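(* Consider the distributed single-stage stochastic MPEC and the exact distributed zeroth-order gradient tracking scheme with constant stepsize $\gamma>0$ described in the context (exact lower-level solutions are available), under the network, lower-boundedness, Lipschitz, lower-level VI and sampling assumptions stated there. **(a) [Non-asymptotic error bound]** Suppose $$\gamma\le\min\Big\{\tfrac{\sqrt{1-\lambda_{\mathbf W}^2}}{6\sqrt3\lambda_{\mathbf W}^2},\tfrac{1-\lambda_{\mathbf W}^2}{12\lambda_{\mathbf W}^3},\tfrac{(1-\lambda_{\mathbf W}^2)^2}{16\lambda_{\mathbf W}^2},\tfrac16,\tfrac{1-\lambda_{\mathbf W}^2}{6\lambda_{\mathbf W}}\Big\}\Big(\tfrac{\eta}{\sqrt nL_0}\Big).$$ Let $K^*$ be uniform on $\{0,\ldots,K-1\}$, independent of the algorithm. Then for any $K\ge1$, $$\begin{aligned} \mathbb E[\mathrm{dist}^2(0,\partial_\eta f(\bar x_{K^*}))]\le{}&\tfrac{2(\mathbb E[f^\eta(\bar x_0)]-\inf_xf^\eta(x))}{\gamma K}+\tfrac{L_0^2n}{\eta^2K}\Big(1+\tfrac{13}{1-\lambda_{\mathbf W}^2}\Big)\mathbb E\big[\tfrac1m\|\mathbf x_0-\mathbf 1\bar x_0\|^2\big]\\ &+\tfrac{52\gamma^2\lambda_{\mathbf W}^4L_0^2n}{\eta^2(1-\lambda_{\mathbf W}^2)^3K}\Big(\tfrac1m\mathbb E[\|\nabla\mathbf f^\eta(\mathbf x_0)\|^2]+16\sqrt{2\pi}L_0^2n\Big)+\tfrac{832\sqrt{2\pi}\gamma^2\lambda_{\mathbf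 W}^2L_0^4n^2(\lambda_{\mathbf W}^2+\|\mathbf W\|^2)}{\eta^2(1-\lambda_{\mathbf W}^2)^3}\\ &+\tfrac{32\sqrt{2\pi}n^{3/2}L_0^3\gamma}{m\eta}+\tfrac{2496\sqrt{2\pi}\lambda_{\mathbf W}^4\gamma^4n^3L_0^6(1+3\lambda_{\mathbf W}^2)}{m\eta^4(1-\lambda_{\mathbf W}^2)^4}+\tfrac{4992\sqrt{2\pi}\gamma^2\lambda_{\mathbf W}^4L_0^4n^2}{\eta^2(1-\lambda_{\mathbf W}^2)^3}. \end{aligned}$$ **(b) [Iteration/sample complexity]** Let $\epsilon>0$ be arbitrary, and let $K_\epsilon$ denote the number of iterations needed to guarantee $\mathbb E[\mathrm{dist}^2(0,\partial_\eta f(\bar x_{K_\epsilon^*}))]\le\epsilon$, where $K_\epsilon^*$ is uniform on $\{0,\ldots,K_\epsilon-1\}$. Suppose $\gamma=\frac{\eta^{1/2}}{\sqrt{n^{3/2}K_\epsilon}L_0^{3/2}}$ with $$K_\epsilon\ge\max\Big\{1,\Big(\max\Big\{\tfrac{6\sqrt3\lambda_{\mathbf W}^2}{\sqrt{1-\lambda_{\mathbf W}^2}},\tfrac{12\lambda_{\mathbf W}^3}{1-\lambda_{\mathbf W}^2},\tfrac{16\lambda_{\mathbf W}^2}{(1-\lambda_{\mathbf W}^2)^2},6,\tfrac{6\lambda_{\mathbf W}}{1-\lambda_{\mathbf W}^2}\Big\}\Big)^2\tfrac1{\eta L_0n^{1/2}}\Big\}.$$ Then $$\begin{aligned} K_\epsilon=\mathcal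 O\Big(&\tfrac{n^{3/2}L_0^3}{\eta}\epsilon^{-2}+\tfrac{L_0^3n^{3/2}}{\eta m^2}\epsilon^{-2}+\tfrac{L_0^2n\,\mathbb E[\frac1m\|\mathbf x_0-\mathbf 1\bar x_0\|^2]}{\eta^2(1-\lambda_{\mathbf W}^2)}\epsilon^{-1}+\tfrac{\lambda_{\mathbf W}^2L_0^{1/2}n^{1/4}}{\eta^{1/2}(1-\lambda_{\mathbf W}^2)^{3/2}}\epsilon^{-1/2}+\tfrac{\lambda_{\mathbf W}^2L_0^{-1/2}n^{-1/4}}{\eta^{1/2}(1-\lambda_{\mathbf W}^2)^{3/2}}\epsilon^{-1/2}\\ &+\tfrac{\lambda_{\mathbf W}^2L_0n^{1/2}(\lambda_{\mathbf W}^2+\|\mathbf W\|^2)}{\eta(1-\lambda_{\mathbf W}^2)^3}\epsilon^{-1}+\tfrac{\lambda_{\mathbf W}^2(1+3\lambda_{\mathbf W}^2)^{1/2}}{\sqrt m\,\eta(1-\lambda_{\mathbf W}^2)^2}\epsilon^{-1/2}+\tfrac{\lambda_{\mathbf W}^4L_0n^{1/2}}{\eta(1-\lambda_{\mathbf W}^2)^3}\epsilon^{-1}\Big). \end{aligned}$$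
   Context: **Problem (single-stage).** $m$ agents minimize $f(x)=\frac1m\sum_{i=1}^m f_i(x)$ over $x\in\mathbb R^n$, with $f_i(x)=\mathbb E[\tilde f_i(x,\boldsymbol\xi_i)]$ and $\tilde f_i(x,\xi_i)=\tilde h_i(x,z_i(x),\xi_i)$, where $\boldsymbol\xi_i$ is an $\mathbb R^d$-valued random vector, $\tilde h_i:\mathbb R^n\times\mathbb R^p\times\mathbb R^d\to\mathbb R$, and $z_i(x)\in\mathbb R^p$ is the unique solution of $\mathrm{VI}(\mathcal Z_i(x),F_i(x,\cdot))$: $z_i(x)\in\mathcal Z_i(x)$ and $F_i(x,z_i(x))^\top(z-z_i(x))\ge0$ for all $z\in\mathcal Z_i(x)$; $F_i(x,z)=\mathbb E[\tilde F_i(x,z,\boldsymbol\xi_i)]$. **Notation.** $\|\cdot\|$ is the Euclidean norm of vectors and the Frobenius norm of matrices. $\mathbf 1\in\mathbb R^m$ is the all-ones vector. $\mathbf x_k=[x_{1,k},\ldots,x_{m,k}]^\top\in\mathbb R^{m\times n}$, $\bar x_k=\frac1m\mathbf 1^\top\mathbf x_k$. For $\eta>0$, $f_i^\eta(x)=\mathbb E_{\mathbf u}[f_i(x+\eta\mathbf u)]$ with $\mathbf u$ uniform on the closed unit ball $\mathbb B$ of $\mathbb R^n$; $f^\eta=\frac1m\sum_if_i^\eta$; $\nabla\mathbf f^\eta(\mathbf x)=[\nabla f_1^\eta(x_1),\ldots,\nabla f_m^\eta(x_m)]^\top$. $\partial f$ is the Clarke generalized gradient and $\partial_\eta f(x)=\mathrm{conv}\big(\bigcup_{y\in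 x+\eta\mathbb B}\partial f(y)\big)$. **Assumptions.** *Network:* undirected connected graph on $\{1,\ldots,m\}$; the mixing matrix $\mathbf W=[w_{ij}]$ (compatible with the graph) is doubly stochastic and $w_{ii}>0$ for some $i$. $\lambda_{\mathbf W}$ is the spectral norm of $\mathbf W-\frac1m\mathbf 1\mathbf 1^\top$, and $0\le\lambda_{\mathbf W}<1$. Terms with $\lambda_{\mathbf W}=0$ in a denominator inside a minimum are read as $+\infty$. *Lower-boundedness:* $\min_xf(x)>-\infty$. *Lipschitz:* for each $i,\xi_i$, $\tilde h_i(x,\cdot,\xi_i)$ is $\tilde L_0(\xi_i)$-Lipschitz (every $x$), with $\tilde L_0=\max_i\sqrt{\mathbb E[\tilde L_0^2(\boldsymbol\xi_i)]}<\infty$; $x\mapsto\tilde h_i(x,z_i(x),\xi_i)$ is $L_0(\xi_i)$-Lipschitz with $L_0=\max_i\sqrt{\mathbb E[L_0^2(\boldsymbol\xi_i)]}<\infty$. *Lower-level VI:* $F_i(x,\cdot)$ is $\mu_F$-strongly monotone and $L_F$-Lipschitz uniformly in $x$; $\mathcal Z_i(x)\subseteq\mathbb R^p$ is nonempty, closed, convex; $\sup_x\sup_{z_1,z_2\in\mathcal Z_i(x)}\|z_1-z_2\|^2\le D_i$. *Sampling:* for each agent the samples $\xi_{i,k}$ of $\boldsymbol\xi_i$ are iid over $k$, $v_{i,k}$ are iid uniform on the unit sphere of $\mathbb R^n$, and all $\xi_{i,k},v_{i,k}$ are mutually independent (also across agents). **Exact scheme.** Random $x_{i,0}$; $y_{i,0}=0$,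 $g_{i,-1}^\eta=0$. For $k\ge0$: draw $\xi_{i,k},v_{i,k}$; set $g_{i,k}^\eta=\frac n{2\eta}\big(\tilde h_i(x_{i,k}+\eta v_{i,k},z_i(x_{i,k}+\eta v_{i,k}),\xi_{i,k})-\tilde h_i(x_{i,k}-\eta v_{i,k},z_i(x_{i,k}-\eta v_{i,k}),\xi_{i,k})\big)v_{i,k}$; $y_{i,k+1}=\sum_jw_{ij}(y_{j,k}+g_{j,k}^\eta-g_{j,k-1}^\eta)$; $x_{i,k+1}=\sum_jw_{ij}(x_{j,k}-\gamma y_{j,k+1})$. **Order notation.** $\mathcal O$ hides constants independent of $\epsilon,n,\eta,L_0,m,\lambda_{\mathbf W},\|\mathbf W\|$ (they may depend on the initial gap $\mathbb E[f^\eta(\bar x_0)]-\inf f^\eta$ and on $\frac1m\mathbb E[\|\nabla\mathbf f^\eta(\mathbf x_0)\|^2]$). *)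

theory Defs
  imports "HOL-Probability.Probability"
begin

section \<open>Variational inequalities\<close>

definition solves_VI :: "'a::real_inner set \<Rightarrow> ('a \<Rightarrow> 'a) \<Rightarrow> 'a \<Rightarrow> bool" where
  "solves_VI Z F z \<longleftrightarrow> z \<in> Z \<and> (\<forall>w\<in>Z. 0 \<le> inner (F z) (w - z))"

definition strongly_monotone :: "real \<Rightarrow> ('a::real_inner \<Rightarrow> 'a) \<Rightarrow> bool" where
  "strongly_monotone \<mu> F \<longleftrightarrow>
     0 < \<mu> \<and> (\<forall>z w. \<mu> * (norm (z - w))\<^sup>2 \<le> inner (F z - F w) (z - w))"


section \<open>Clarke gradients and randomized smoothing\<close>

text \<open>The limit superior below ranges over all base points tending to \<open>x\<close>, including \<open>x\<close> itself.\<close>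

definition clarke_dderiv :: "('a::real_inner \<Rightarrow> real) \<Rightarrow> 'a \<Rightarrow> 'a \<Rightarrow> ereal" where
  "clarke_dderiv f x d =
     Limsup (nhds x \<times>\<^sub>F at_right 0) (\<lambda>(y, t). ereal ((f (y + t *\<^sub>R d) - f y) / t))"

definition clarke_gradient :: "('a::real_inner \<Rightarrow> real) \<Rightarrow> 'a \<Rightarrow> 'a set" where
  "clarke_gradient f x = {g. \<forall>d. ereal (inner g d) \<le> clarke_dderiv f x d}"

definition clarke_gradient_eta :: "real \<Rightarrow> ('a::real_inner \<Rightarrow> real) \<Rightarrow> 'a \<Rightarrow> 'a set" where
  "clarke_gradient_eta \<eta> f x = convex hull (\<Union>y\<in>cball x \<eta>. clarke_gradient f y)"

definition uniform_ball :: "'a::euclidean_space measure" where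
  "uniform_ball = uniform_measure lborel (cball 0 1)"

text \<open>
  Normalized surface measure of the unit sphere, in its cone-measure form: a set \<open>A\<close> of unit
  vectors has the relative volume in the unit ball of the cone over \<open>A\<close>.
\<close>

definition uniform_sphere :: "'a::euclidean_space measure" where
  "uniform_sphere = distr uniform_ball borel (\<lambda>u. u /\<^sub>R norm u)"

definition ball_smoothing :: "real \<Rightarrow> ('a::euclidean_space \<Rightarrow> real) \<Rightarrow> 'a \<Rightarrow> real" where
  "ball_smoothing \<eta> f x = (\<integral>u. f (x + \<eta> *\<^sub>R u) \<partial>uniform_ball)"

definition gradient :: "('a::real_inner \<Rightarrow> real) \<Rightarrow> 'a \<Rightarrow> 'a" where
  "gradient f x = (THE g. GDERIV f x :> g)"


section \<open>Networks of agents\<close>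

text \<open>
  The local copies of the agents are the rows of a matrix of type \<^typ>\<open>real^'n^'m\<close>. The library
  norm of this type is the Frobenius norm.
\<close>

definition row_mean :: "real^'n^'m \<Rightarrow> real^'n" where
  "row_mean X = (1 / real CARD('m)) *\<^sub>R (\<Sum>i\<in>UNIV. X $ i)"

definition consensus_error :: "real^'n^'m \<Rightarrow> real^'n^'m" where
  "consensus_error X = X - (\<chi> i. row_mean X)"

definition agent_mean :: "('m::finite \<Rightarrow> 'a \<Rightarrow> real) \<Rightarrow> 'a \<Rightarrow> real" where
  "agent_mean f x = (1 / real CARD('m)) * (\<Sum>i\<in>UNIV. f i x)"

text \<open>Row \<open>i\<close> is the gradient of the smoothed objective of agent \<open>i\<close> at row \<open>i\<close> of \<open>X\<close>.\<close>

definition stacked_smoothed_gradient ::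
    "real \<Rightarrow> ('m \<Rightarrow> real^'n \<Rightarrow> real) \<Rightarrow> real^'n^'m \<Rightarrow> real^'n^'m" where
  "stacked_smoothed_gradient \<eta> f X = (\<chi> i. gradient (ball_smoothing \<eta> (f i)) (X $ i))"

definition undirected_connected :: "('m \<times> 'm) set \<Rightarrow> bool" where
  "undirected_connected E \<longleftrightarrow> sym E \<and> (\<forall>i j. (i, j) \<in> E\<^sup>*)"

definition mixing_matrix :: "('m \<times> 'm) set \<Rightarrow> real^'m^'m \<Rightarrow> bool" where
  "mixing_matrix E W \<longleftrightarrow>
     (\<forall>i j. 0 \<le> W $ i $ j) \<and>
     (\<forall>i. (\<Sum>j\<in>UNIV. W $ i $ j) = 1) \<and>
     (\<forall>j. (\<Sum>i\<in>UNIV. W $ i $ j) = 1) \<and>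
     (\<forall>i j. i \<noteq> j \<longrightarrow> (i, j) \<notin> E \<longrightarrow> W $ i $ j = 0) \<and>
     (\<exists>i. 0 < W $ i $ i)"

definition spectral_norm :: "real^'n^'m \<Rightarrow> real" where
  "spectral_norm A = onorm ((*v) A)"

definition mixing_rate :: "real^'m^'m \<Rightarrow> real" where
  "mixing_rate W = spectral_norm (W - (\<chi> i j. 1 / real CARD('m)))"


section \<open>Zeroth-order gradient tracking\<close>

definition zo_gradient :: "real \<Rightarrow> (real^'n \<Rightarrow> real) \<Rightarrow> real^'n \<Rightarrow> real^'n \<Rightarrow> real^'n" where
  "zo_gradient \<eta> \<phi> v x =
     (real CARD('n) / (2 * \<eta>) * (\<phi> (x + \<eta> *\<^sub>R v) - \<phi> (x - \<eta> *\<^sub>R v))) *\<^sub>R v"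

text \<open>
  The state after \<open>k\<close> iterations consists of the iterates \<open>x\<^sub>k\<close>, the trackers \<open>y\<^sub>k\<close> and the previous
  gradient estimates \<open>g\<^bsub>k-1\<^esub>\<close>. The argument \<open>G k X\<close> is the matrix of estimates drawn in iteration
  \<open>k\<close> at the rows of \<open>X\<close>; row \<open>i\<close> of \<open>W ** Y\<close> is the weighted sum of the rows \<open>Y $ j\<close> with weights
  \<open>W $ i $ j\<close>.
\<close>

primrec tracking_state ::
    "real^'m^'m \<Rightarrow> real \<Rightarrow> (nat \<Rightarrow> real^'n^'m \<Rightarrow> real^'n^'m) \<Rightarrow> real^'n^'m \<Rightarrow> nat
       \<Rightarrow> (real^'n^'m) \<times> (real^'n^'m) \<times> (real^'n^'m)" where
  "tracking_state W \<gamma> G X0 0 = (X0, 0, 0)"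
| "tracking_state W \<gamma> G X0 (Suc k) =
     (case tracking_state W \<gamma> G X0 k of (X, Y, Gprev) \<Rightarrow>
        let Y' = W ** (Y + G k X - Gprev) in
        (W ** (X - \<gamma> *\<^sub>R Y'), Y', G k X))"

text \<open>
  Here \<open>\<phi> i x s\<close> is the sampled objective of agent \<open>i\<close> at \<open>x\<close> for the realization \<open>s\<close> of the
  random vector of the agent.
\<close>

definition tracking_iterate ::
    "real^'m^'m \<Rightarrow> real \<Rightarrow> real \<Rightarrow> ('m \<Rightarrow> real^'n \<Rightarrow> real^'d \<Rightarrow> real)
       \<Rightarrow> ('m \<Rightarrow> nat \<Rightarrow> 'w \<Rightarrow> real^'d) \<Rightarrow> ('m \<Rightarrow> nat \<Rightarrow> 'w \<Rightarrow> real^'n)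
       \<Rightarrow> ('w \<Rightarrow> real^'n^'m) \<Rightarrow> nat \<Rightarrow> 'w \<Rightarrow> real^'n^'m" where
  "tracking_iterate W \<gamma> \<eta> \<phi> \<xi> v x0 k \<omega> =
     fst (tracking_state W \<gamma>
            (\<lambda>k X. \<chi> i. zo_gradient \<eta> (\<lambda>x. \<phi> i x (\<xi> i k \<omega>)) (v i k \<omega>) (X $ i))
            (x0 \<omega>) k)"


section \<open>Sources of randomness\<close>

definition events_of :: "'w measure \<Rightarrow> 'a measure \<Rightarrow> ('w \<Rightarrow> 'a) \<Rightarrow> 'w set set" where
  "events_of M N X = {X -` A \<inter> space M | A. A \<in> sets N}"

text \<open>
  The library notion of independence of a family of random variables requires a common type of
  values, so independence is stated for the generated families of events.
\<close>

datatype 'm source = Initial | Sample 'm nat | Direction 'm nat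

primrec source_events ::
    "'w measure \<Rightarrow> ('m \<Rightarrow> nat \<Rightarrow> 'w \<Rightarrow> real^'d) \<Rightarrow> ('m \<Rightarrow> nat \<Rightarrow> 'w \<Rightarrow> real^'n)
       \<Rightarrow> ('w \<Rightarrow> real^'n^'m) \<Rightarrow> 'm source \<Rightarrow> 'w set set" where
  "source_events M \<xi> v x0 Initial = events_of M borel x0"
| "source_events M \<xi> v x0 (Sample i k) = events_of M borel (\<xi> i k)"
| "source_events M \<xi> v x0 (Direction i k) = events_of M borel (v i k)"

definition sampling ::
    "'w measure \<Rightarrow> ('m::finite \<Rightarrow> (real^'d) measure) \<Rightarrow> ('m \<Rightarrow> nat \<Rightarrow> 'w \<Rightarrow> real^'d)
       \<Rightarrow> ('m \<Rightarrow> nat \<Rightarrow> 'w \<Rightarrow> real^'n) \<Rightarrow> ('w \<Rightarrow> real^'n^'m) \<Rightarrow> bool" where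
  "sampling M P \<xi> v x0 \<longleftrightarrow>
     x0 \<in> borel_measurable M \<and>
     (\<forall>i k. \<xi> i k \<in> borel_measurable M \<and> distr M borel (\<xi> i k) = P i) \<and>
     (\<forall>i k. v i k \<in> borel_measurable M \<and> distr M borel (v i k) = uniform_sphere) \<and>
     prob_space.indep_sets M (source_events M \<xi> v x0) UNIV"

definition uniform_independent_index ::
    "'w measure \<Rightarrow> ('m::finite \<Rightarrow> nat \<Rightarrow> 'w \<Rightarrow> real^'d) \<Rightarrow> ('m \<Rightarrow> nat \<Rightarrow> 'w \<Rightarrow> real^'n)
       \<Rightarrow> ('w \<Rightarrow> real^'n^'m) \<Rightarrow> nat \<Rightarrow> ('w \<Rightarrow> nat) \<Rightarrow> bool" where
  "uniform_independent_index M \<xi> v x0 K \<kappa> \<longleftrightarrow>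
     \<kappa> \<in> measurable M (count_space UNIV) \<and>
     distr M (count_space UNIV) \<kappa> = measure_pmf (pmf_of_set {..<K}) \<and>
     prob_space.indep_set M (events_of M (count_space UNIV) \<kappa>)
       (sigma_sets (space M) (\<Union>s. source_events M \<xi> v x0 s))"


section \<open>Stepsizes and complexity\<close>

text \<open>Fractions whose denominator contains the mixing rate are infinite if the rate vanishes.\<close>

definition stepsize_cap :: "real \<Rightarrow> real" where
  "stepsize_cap l =
     (if l = 0 then 1 / 6
      else Min {sqrt (1 - l\<^sup>2) / (6 * sqrt 3 * l\<^sup>2), (1 - l\<^sup>2) / (12 * l ^ 3),
                (1 - l\<^sup>2)\<^sup>2 / (16 * l\<^sup>2), 1 / 6, (1 - l\<^sup>2) / (6 * l)})"

definition iteration_threshold :: "real \<Rightarrow> real \<Rightarrow> real \<Rightarrow> real \<Rightarrow> real" where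
  "iteration_threshold n \<eta> L0 l =
     max 1 ((Max {6 * sqrt 3 * l\<^sup>2 / sqrt (1 - l\<^sup>2), 12 * l ^ 3 / (1 - l\<^sup>2),
                  16 * l\<^sup>2 / (1 - l\<^sup>2)\<^sup>2, 6, 6 * l / (1 - l\<^sup>2)})\<^sup>2
            * (1 / (\<eta> * L0 * n powr (1/2))))"

definition complexity_stepsize :: "real \<Rightarrow> real \<Rightarrow> real \<Rightarrow> nat \<Rightarrow> real" where
  "complexity_stepsize n \<eta> L0 K =
     \<eta> powr (1/2) / (sqrt (n powr (3/2) * real K) * L0 powr (3/2))"

text \<open>The expected squared distance of 0 to the set of generalized gradients at \<open>xbar\<^bsub>K*\<^esub>\<close>.\<close>

definition expected_stationarity ::
    "'w measure \<Rightarrow> real \<Rightarrow> (real^'n \<Rightarrow> real) \<Rightarrow> (nat \<Rightarrow> 'w \<Rightarrow> real^'n^'m) \<Rightarrow> ('w \<Rightarrow> nat) \<Rightarrow> ennreal" where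
  "expected_stationarity M \<eta> f X \<kappa> =
     (\<integral>\<^sup>+ \<omega>. ennreal ((infdist 0 (clarke_gradient_eta \<eta> f (row_mean (X (\<kappa> \<omega>) \<omega>))))\<^sup>2) \<partial>M)"

text \<open>
  The stepsize may depend on the total number \<open>K\<close> of iterations, so the error \<open>err K\<close> after \<open>K\<close>
  iterations need not decrease with \<open>K\<close>. A number \<open>N\<close> of iterations guarantees the accuracy
  \<open>\<epsilon>\<close> if every run with at least \<open>N\<close> iterations achieves it, where only runs of a length \<open>K\<close>
  above the threshold \<open>T\<close> for which the stepsize is admissible are considered.
\<close>

definition guarantees_accuracy :: "real \<Rightarrow> (nat \<Rightarrow> ennreal) \<Rightarrow> real \<Rightarrow> nat \<Rightarrow> bool" where
  "guarantees_accuracy T err \<epsilon> N \<longleftrightarrow> (\<forall>K\<ge>N. T \<le> real K \<longrightarrow> err K \<le> ennreal \<epsilon>)"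

definition iterations_needed :: "real \<Rightarrow> (nat \<Rightarrow> ennreal) \<Rightarrow> real \<Rightarrow> nat" where
  "iterations_needed T err \<epsilon> = (LEAST N. guarantees_accuracy T err \<epsilon> N)"

text \<open>
  The constant behind the order notation, as a function of the initial gap \<open>\<Delta>\<close> and of the initial
  mean squared gradient norm \<open>\<Gamma>\<close>. The order notation is uniform in the dimension and in the number
  of agents. Both are cardinalities of types here, over which no existential constant can be
  uniform, hence a concrete constant, free of these types. The number \<open>10 ^ 6\<close> is not optimized.
\<close>

definition complexity_constant :: "real \<Rightarrow> real \<Rightarrow> real" where
  "complexity_constant \<Delta> \<Gamma> = 10 ^ 6 * (1 + \<Delta>\<^sup>2 + sqrt \<Gamma>)"

end

theory Submission
  imports Defs
begin

text \<open>
  The smoothed objectives have the gradients \<open>n / \<eta> \<integral> f (x + \<eta> v) v dv\<close>, averaged over the unit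
  sphere, which are Lipschitz with constant \<open>L\<^sub>0 \<surd>n / \<eta>\<close> and lie in the closure of \<open>\<partial>\<^sub>\<eta> f\<close>. Hence the squared
  distance is at most the squared norm of the gradient of \<open>f\<^sup>\<eta>\<close>. The estimates are unbiased, and a
  Poincare inequality on the sphere bounds their second moments by \<open>16 \<surd>(2 \<pi>) L\<^sub>0\<^sup>2 n\<close>. The descent of
  \<open>f\<^sup>\<eta>\<close> along the means of the iterates, summed over the iterations, leaves the consensus errors,
  which obey a linear recursion coupled with the disagreement of the trackers. The noise of the newest
  estimate is split off the trackers, since it is orthogonal to everything drawn before it. For the
  complexity, each term of the error bound is compared with one term of the claimed order.
\<close>

section \<open>Integration over balls and spheres\<close>

text \<open>The objectives are only Lipschitz and the sphere carries a cone measure, so the gradient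
  formula comes neither from differentiating under the integral nor from a boundary integral. It is
  read off from volumes: the ball is shifted, and the shifted ball is, up to second order, the
  star-shaped region with radius \<open>1 + v \<bullet> h\<close> in the direction \<open>v\<close>.
  The Poincare inequality may be far from sharp: its constant \<open>9 / 4 * pi^2\<close> is about
  22, while \<open>16 * sqrt (2 * pi)\<close> is about 40. This leaves room for an argument on the
  unit ball of pairs of points that uses only invariance under shears, reflections and coordinate
  swaps. The two-point difference is odd in the direction, hence has mean zero, and the inequality
  bounds the second moment of the estimates by order \<open>n\<close> instead of \<open>n^2\<close>.
  The 16 in this bound explains the constants of the result: \<open>832 = 52 * 16\<close>,
  \<open>2496 = 156 * 16\<close>, \<open>4992 = 312 * 16\<close>. In the complexity,
  \<open>10 ^ 6\<close> is twice 500000, the factor 2 paying for the rounding to a whole number of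
  iterations.\<close>

lemma nn_integral_lborel_translate:
  fixes f :: "'a::euclidean_space \<Rightarrow> ennreal"
  assumes [measurable]: "f \<in> borel_measurable borel"
  shows "(\<integral>\<^sup>+x. f (a + x) \<partial>lborel) = (\<integral>\<^sup>+x. f x \<partial>lborel)"
proof -
  have "(\<integral>\<^sup>+x. f x \<partial>lborel) = (\<integral>\<^sup>+x. f x \<partial>distr lborel borel ((+) a))"
    by (simp add: lborel_distr_plus)
  also have "\<dots> = (\<integral>\<^sup>+x. f (a + x) \<partial>lborel)"
    by (subst nn_integral_distr) auto
  finally show ?thesis by simp
qed

lemma nn_integral_lborel_scale:
  fixes f :: "'a::euclidean_space \<Rightarrow> ennreal"
  assumes [measurable]: "f \<in> borel_measurable borel" and s: "0 < s"
  shows "(\<integral>\<^sup>+x. f x \<partial>lborel) = ennreal (s ^ DIM('a)) * (\<integral>\<^sup>+x. f (s *\<^sub>R x) \<partial>lborel)"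
proof -
  have "(\<integral>\<^sup>+x. f x \<partial>lborel)
      = (\<integral>\<^sup>+x. f x \<partial>density (distr lborel borel (\<lambda>x. 0 + s *\<^sub>R x)) (\<lambda>_. \<bar>s\<bar> ^ DIM('a)))"
    using s by (subst lborel_affine[of s 0]) auto
  also have "\<dots> = (\<integral>\<^sup>+x. ennreal (s ^ DIM('a)) * f (s *\<^sub>R x) \<partial>lborel)"
    using s by (subst nn_integral_density, simp, simp, subst nn_integral_distr) auto
  also have "\<dots> = ennreal (s ^ DIM('a)) * (\<integral>\<^sup>+x. f (s *\<^sub>R x) \<partial>lborel)"
    by (rule nn_integral_cmult) auto
  finally show ?thesis .
qed

lemma emeasure_cball_unit_finite: "emeasure lborel (cball 0 1 :: 'a::euclidean_space set) < \<infinity>"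
  by (rule emeasure_lborel_cball_finite)

lemma emeasure_cball_unit_pos: "0 < emeasure lborel (cball 0 1 :: 'a::euclidean_space set)"
proof -
  have "emeasure lborel (ball 0 1 :: 'a set) \<noteq> 0"
  proof
    assume "emeasure lborel (ball 0 1 :: 'a set) = 0"
    then have "ball 0 1 \<in> null_sets (lborel :: 'a measure)" by auto
    then have "negligible (ball 0 1 :: 'a set)"
      by (simp add: negligible_iff_null_sets null_sets_completionI)
    then show False using open_not_negligible[of "ball 0 1 :: 'a set"] by auto
  qed
  then have "0 < emeasure lborel (ball 0 1 :: 'a set)" by (simp add: zero_less_iff_neq_zero)
  also have "\<dots> \<le> emeasure lborel (cball 0 1 :: 'a set)" by (rule emeasure_mono) auto
  finally show ?thesis .
qed

lemma prob_space_uniform_ball: "prob_space (uniform_ball :: 'a::euclidean_space measure)"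
  unfolding uniform_ball_def
  using emeasure_cball_unit_pos[where 'a='a] emeasure_cball_unit_finite[where 'a='a]
  by (intro prob_space_uniform_measure) auto

lemma space_uniform_ball[simp]: "space uniform_ball = UNIV"
  by (simp add: uniform_ball_def)

lemma sets_uniform_ball[measurable_cong, simp]: "sets uniform_ball = sets borel"
  by (simp add: uniform_ball_def)

lemma AE_uniform_ball: "AE u in (uniform_ball :: 'a::euclidean_space measure). norm u \<le> 1 \<and> u \<noteq> 0"
  unfolding uniform_ball_def
proof (rule AE_uniform_measureI)
  show "AE x in lborel. x \<in> cball (0::'a) 1 \<longrightarrow> norm x \<le> 1 \<and> x \<noteq> 0"
    using AE_lborel_singleton[of "0::'a"] by eventually_elim auto
qed simp

lemma prob_space_uniform_sphere: "prob_space (uniform_sphere :: 'a::euclidean_space measure)"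
  unfolding uniform_sphere_def
  by (rule prob_space.prob_space_distr[OF prob_space_uniform_ball]) simp

lemma space_uniform_sphere[simp]: "space uniform_sphere = UNIV"
  by (simp add: uniform_sphere_def)

lemma sets_uniform_sphere[measurable_cong, simp]: "sets uniform_sphere = sets borel"
  by (simp add: uniform_sphere_def)

lemma AE_uniform_sphere: "AE u in (uniform_sphere :: 'a::euclidean_space measure). norm u = 1"
  unfolding uniform_sphere_def
proof (subst AE_distr_iff)
  show "AE u in (uniform_ball :: 'a measure). norm (u /\<^sub>R norm u) = 1"
    using AE_uniform_ball[where 'a='a] by eventually_elim simp
qed auto

lemma nn_integral_uniform_ball:
  fixes f :: "'a::euclidean_space \<Rightarrow> ennreal"
  assumes "f \<in> borel_measurable borel"
  shows "(\<integral>\<^sup>+u. f u \<partial>uniform_ball)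
    = (\<integral>\<^sup>+u. f u * indicator (cball 0 1) u \<partial>lborel) / emeasure lborel (cball 0 1 :: 'a set)"
  unfolding uniform_ball_def using assms by (intro nn_integral_uniform_measure) auto

lemma nn_integral_uniform_sphere:
  fixes f :: "'a::euclidean_space \<Rightarrow> ennreal"
  assumes [measurable]: "f \<in> borel_measurable borel"
  shows "(\<integral>\<^sup>+v. f v \<partial>uniform_sphere) = (\<integral>\<^sup>+u. f (u /\<^sub>R norm u) \<partial>uniform_ball)"
  unfolding uniform_sphere_def by (subst nn_integral_distr) auto

lemma integral_uniform_sphere:
  fixes f :: "'a::euclidean_space \<Rightarrow> 'b::euclidean_space"
  assumes [measurable]: "f \<in> borel_measurable borel"
  shows "(\<integral>v. f v \<partial>uniform_sphere) = (\<integral>u. f (u /\<^sub>R norm u) \<partial>uniform_ball)"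
  unfolding uniform_sphere_def by (subst integral_distr) auto

section \<open>Polar coordinates\<close>

lemma nn_integral_tail:
  assumes "0 < (a::real)" "0 < n"
  shows "(\<integral>\<^sup>+s. ennreal (real n / s ^ Suc n) * indicator {a..} s \<partial>lborel) = ennreal (1 / a ^ n)"
proof -
  have lim: "((\<lambda>s::real. - (1 / s ^ n)) \<longlongrightarrow> 0) at_top"
  proof -
    have "((\<lambda>s::real. 1 / s ^ n) \<longlongrightarrow> 0) at_top"
      using assms(2) by (intro tendsto_divide_0[OF tendsto_const] filterlim_at_top_imp_at_infinity
        filterlim_pow_at_top filterlim_ident)
    from tendsto_minus[OF this] show ?thesis by simp
  qed
  have "(\<integral>\<^sup>+s. ennreal (real n / s ^ Suc n) * indicator {a..} s \<partial>lborel) = ennreal (0 - (- (1 / a ^ n)))"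
  proof (rule nn_integral_FTC_atLeast[OF _ _ _ lim])
    fix x :: real assume x: "a \<le> x"
    \<comment> \<open>Brings the derivative of \<open>1 / s ^ n\<close>, whose quotient-rule
      denominator is a square, into the form of the integrand.\<close>
    have nx: "x ^ n * x ^ n = x ^ (n - 1) * x ^ Suc n"
      using assms(2) by (simp add: power_add[symmetric] del: power_Suc)
    have "((\<lambda>s. - (1 / s ^ n)) has_real_derivative - (- (n * x ^ (n - 1)) / (x ^ n * x ^ n))) (at x)"
      using x assms by (auto intro!: derivative_eq_intros)
    moreover have "- (- (n * x ^ (n - 1)) / (x ^ n * x ^ n)) = real n / x ^ Suc n"
      unfolding nx using x assms by simp
    ultimately show "((\<lambda>s. - (1 / s ^ n)) has_real_derivative real n / x ^ Suc n) (at x)"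
      by simp
  qed (use assms in \<open>auto\<close>)
  then show ?thesis by simp
qed

text \<open>Substituting \<open>\<rho> = s |u|\<close> and exchanging the integrals leaves
  \<open>|w|\<^sup>n \<integral> n s\<^sup>-\<^sup>n\<^sup>-\<^sup>1 ds = 1\<close> over \<open>s \<ge> |w|\<close> as the weight of \<open>F w\<close>.\<close>

lemma nn_integral_polar:
  fixes F :: "'a::euclidean_space \<Rightarrow> ennreal"
  assumes [measurable]: "F \<in> borel_measurable borel"
  shows "(\<integral>\<^sup>+w. F w \<partial>lborel)
    = (\<integral>\<^sup>+u. indicator (cball 0 1) u *
        (\<integral>\<^sup>+\<rho>. ennreal (DIM('a) * \<rho> ^ (DIM('a) - 1)) * F (\<rho> *\<^sub>R (u /\<^sub>R norm u)) * indicator {0<..} \<rho> \<partial>lborel) \<partial>lborel)"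
    (is "_ = ?R")
proof -
  define n where "n = DIM('a)"
  have n: "0 < n" by (simp add: n_def)
  \<comment> \<open>The substitution divides by \<open>norm u\<close>; the point
    \<open>u = 0\<close> is a null set and is dropped when the integrals are compared.\<close>
  have inner: "(\<integral>\<^sup>+\<rho>. ennreal (n * \<rho> ^ (n - 1)) * F (\<rho> *\<^sub>R (u /\<^sub>R norm u)) * indicator {0<..} \<rho> \<partial>lborel)
      = (\<integral>\<^sup>+s. ennreal (norm u ^ n * (n * s ^ (n - 1))) * F (s *\<^sub>R u) * indicator {0<..} s \<partial>lborel)"
    if u: "u \<noteq> 0" for u :: 'a
  proof -
    have "(\<integral>\<^sup>+\<rho>. ennreal (n * \<rho> ^ (n - 1)) * F (\<rho> *\<^sub>R (u /\<^sub>R norm u)) * indicator {0<..} \<rho> \<partial>lborel)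
      = ennreal (norm u ^ 1) * (\<integral>\<^sup>+s. ennreal (n * (norm u *\<^sub>R s) ^ (n - 1)) * F ((norm u *\<^sub>R s) *\<^sub>R (u /\<^sub>R norm u)) * indicator {0<..} (norm u *\<^sub>R s) \<partial>lborel)"
      using u by (subst nn_integral_lborel_scale[where s="norm u"]) auto
    also have "\<dots> = (\<integral>\<^sup>+s. ennreal (norm u ^ 1) * (ennreal (n * (norm u *\<^sub>R s) ^ (n - 1)) * F ((norm u *\<^sub>R s) *\<^sub>R (u /\<^sub>R norm u)) * indicator {0<..} (norm u *\<^sub>R s)) \<partial>lborel)"
      by (rule nn_integral_cmult[symmetric]) measurable
    also have "\<dots> = (\<integral>\<^sup>+s. ennreal (norm u ^ n * (n * s ^ (n - 1))) * F (s *\<^sub>R u) * indicator {0<..} s \<partial>lborel)"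
    proof (rule nn_integral_cong)
      fix s :: real
      show "ennreal (norm u ^ 1) * (ennreal (n * (norm u *\<^sub>R s) ^ (n - 1)) * F ((norm u *\<^sub>R s) *\<^sub>R (u /\<^sub>R norm u)) * indicator {0<..} (norm u *\<^sub>R s))
         = ennreal (norm u ^ n * (n * s ^ (n - 1))) * F (s *\<^sub>R u) * indicator {0<..} s"
      proof (cases "0 < s")
        case True
        have "norm u ^ n = norm u * norm u ^ (n - 1)" using n by (cases n) auto
        then have 1: "norm u * (n * (norm u * s) ^ (n - 1)) = norm u ^ n * (n * s ^ (n - 1))"
          by (simp add: power_mult_distrib)
        have 2: "ennreal (norm u) * (ennreal (n * (norm u * s) ^ (n - 1)) * F (s *\<^sub>R u))
            = ennreal (norm u * (n * (norm u * s) ^ (n - 1))) * F (s *\<^sub>R u)"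
          using True by (subst ennreal_mult) (auto simp: mult.assoc)
        have 3: "(norm u *\<^sub>R s) *\<^sub>R (u /\<^sub>R norm u) = s *\<^sub>R u" using u by simp
        have 4: "0 < norm u *\<^sub>R s" using True u by simp
        show ?thesis unfolding 3 1[symmetric] using True 4 2 by simp
      next
        case False
        then have "\<not> 0 < norm u *\<^sub>R s" by (simp add: zero_less_mult_iff)
        with False show ?thesis by simp
      qed
    qed
    finally show ?thesis .
  qed
  have "?R = (\<integral>\<^sup>+u. (\<integral>\<^sup>+s. indicator (cball 0 1) u * (ennreal (norm u ^ n * (n * s ^ (n - 1))) * F (s *\<^sub>R u) * indicator {0<..} s) \<partial>lborel) \<partial>lborel)"
    unfolding n_def[symmetric]
  proof (rule nn_integral_cong_AE)
    show "AE u in lborel. indicator (cball 0 1) u *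
            (\<integral>\<^sup>+\<rho>. ennreal (n * \<rho> ^ (n - 1)) * F (\<rho> *\<^sub>R (u /\<^sub>R norm u)) * indicator {0<..} \<rho> \<partial>lborel)
          = (\<integral>\<^sup>+s. indicator (cball 0 1) u * (ennreal (norm u ^ n * (n * s ^ (n - 1))) * F (s *\<^sub>R u) * indicator {0<..} s) \<partial>lborel)"
      using AE_lborel_singleton[of "0::'a"]
    proof eventually_elim
      case (elim u)
      show ?case unfolding inner[OF elim]
        by (rule nn_integral_cmult[symmetric]) measurable
    qed
  qed
  also have "\<dots> = (\<integral>\<^sup>+s. (\<integral>\<^sup>+u. indicator (cball 0 1) u * (ennreal (norm u ^ n * (n * s ^ (n - 1))) * F (s *\<^sub>R u) * indicator {0<..} s) \<partial>lborel) \<partial>lborel)"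
    by (rule lborel_pair.Fubini') (simp add: indicator_def)
  \<comment> \<open>For fixed \<open>s\<close> the variable becomes
    \<open>w = s *\<^sub>R u\<close>. The condition \<open>norm u \<le> 1\<close> turns into
    \<open>norm w \<le> s\<close>, which the second exchange of integrals reads as a lower limit for
    \<open>s\<close>.\<close>
  also have "\<dots> = (\<integral>\<^sup>+s. (\<integral>\<^sup>+w. ennreal (norm w ^ n) * F w * (ennreal (n / s ^ Suc n) * indicator {0<..} s * indicator {norm w..} s) \<partial>lborel) \<partial>lborel)"
  proof (rule nn_integral_cong)
    fix s :: real
    show "(\<integral>\<^sup>+u. indicator (cball 0 1) u * (ennreal (norm u ^ n * (n * s ^ (n - 1))) * F (s *\<^sub>R u) * indicator {0<..} s) \<partial>lborel)
      = (\<integral>\<^sup>+w. ennreal (norm w ^ n) * F w * (ennreal (n / s ^ Suc n) * indicator {0<..} s * indicator {norm w..} s) \<partial>lborel)"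
    proof (cases "0 < s")
      case True
      have "(\<integral>\<^sup>+w. ennreal (norm w ^ n) * F w * (ennreal (n / s ^ Suc n) * indicator {0<..} s * indicator {norm w..} s) \<partial>lborel)
        = ennreal (s ^ n) * (\<integral>\<^sup>+u. ennreal (norm (s *\<^sub>R u) ^ n) * F (s *\<^sub>R u) * (ennreal (n / s ^ Suc n) * indicator {0<..} s * indicator {norm (s *\<^sub>R u)..} s) \<partial>lborel)"
        unfolding n_def using True by (subst nn_integral_lborel_scale[where s=s]) (auto simp: indicator_def)
      also have "\<dots> = (\<integral>\<^sup>+u. ennreal (s ^ n) * (ennreal (norm (s *\<^sub>R u) ^ n) * F (s *\<^sub>R u) * (ennreal (n / s ^ Suc n) * indicator {0<..} s * indicator {norm (s *\<^sub>R u)..} s)) \<partial>lborel)"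
        by (rule nn_integral_cmult[symmetric]) (auto simp: indicator_def)
      also have "\<dots> = (\<integral>\<^sup>+u. indicator (cball 0 1) u * (ennreal (norm u ^ n * (n * s ^ (n - 1))) * F (s *\<^sub>R u) * indicator {0<..} s) \<partial>lborel)"
      proof (rule nn_integral_cong)
        fix u :: 'a
        have 1: "s * norm u \<le> s \<longleftrightarrow> norm u \<le> 1" using True by (simp add: mult_le_cancel_left1)
        have 2: "s ^ n * ((s * norm u) ^ n * (real n / s ^ Suc n)) = norm u ^ n * (n * s ^ (n - 1))"
        proof -
          have "s ^ n = s * s ^ (n - 1)" using n by (cases n) auto
          then show ?thesis using True by (simp add: power_mult_distrib field_simps)
        qed
        have "ennreal (s ^ n) * (ennreal ((s * norm u) ^ n) * F (s *\<^sub>R u) * ennreal (real n / s ^ Suc n))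
           = ennreal (s ^ n * ((s * norm u) ^ n * (real n / s ^ Suc n))) * F (s *\<^sub>R u)"
        proof -
          have "0 \<le> s ^ n" "0 \<le> (s * norm u) ^ n" using True by auto
          then show ?thesis unfolding ennreal_mult'[OF \<open>0 \<le> s ^ n\<close>] ennreal_mult'[OF \<open>0 \<le> (s * norm u) ^ n\<close>]
            by (simp only: ac_simps)
        qed
        then show "ennreal (s ^ n) * (ennreal (norm (s *\<^sub>R u) ^ n) * F (s *\<^sub>R u) * (ennreal (n / s ^ Suc n) * indicator {0<..} s * indicator {norm (s *\<^sub>R u)..} s))
         = indicator (cball 0 1) u * (ennreal (norm u ^ n * (n * s ^ (n - 1))) * F (s *\<^sub>R u) * indicator {0<..} s)"
          using True 1 unfolding 2 by (auto simp: indicator_def simp del: power_Suc)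
      qed
      finally show ?thesis by simp
    qed simp
  qed
  also have "\<dots> = (\<integral>\<^sup>+w. (\<integral>\<^sup>+s. ennreal (norm w ^ n) * F w * (ennreal (n / s ^ Suc n) * indicator {0<..} s * indicator {norm w..} s) \<partial>lborel) \<partial>lborel)"
    by (rule lborel_pair.Fubini') (auto simp: indicator_def)
  also have "\<dots> = (\<integral>\<^sup>+w. F w \<partial>lborel)"
  proof (rule nn_integral_cong_AE)
    show "AE w in lborel. (\<integral>\<^sup>+s. ennreal (norm w ^ n) * F w * (ennreal (n / s ^ Suc n) * indicator {0<..} s * indicator {norm w..} s) \<partial>lborel) = F w"
      using AE_lborel_singleton[of "0::'a"]
    proof eventually_elim
      case (elim w)
      have "(\<integral>\<^sup>+s. ennreal (norm w ^ n) * F w * (ennreal (n / s ^ Suc n) * indicator {0<..} s * indicator {norm w..} s) \<partial>lborel)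
        = ennreal (norm w ^ n) * F w * (\<integral>\<^sup>+s. ennreal (n / s ^ Suc n) * indicator {0<..} s * indicator {norm w..} s \<partial>lborel)"
        by (rule nn_integral_cmult) (auto simp: indicator_def)
      also have "(\<integral>\<^sup>+s. ennreal (n / s ^ Suc n) * indicator {0<..} s * indicator {norm w..} s \<partial>lborel)
         = (\<integral>\<^sup>+s. ennreal (n / s ^ Suc n) * indicator {norm w..} s \<partial>lborel)"
      proof (rule nn_integral_cong)
        fix s :: real
        have "0 < norm w" using elim by simp
        then show "ennreal (n / s ^ Suc n) * indicator {0<..} s * indicator {norm w..} s = ennreal (n / s ^ Suc n) * indicator {norm w..} s"
          by (auto simp: indicator_def simp del: power_Suc zero_less_norm_iff)
      qed
      also have "\<dots> = ennreal (1 / norm w ^ n)" using elim n by (intro nn_integral_tail) auto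
      finally show ?case using elim
        by (simp add: mult.commute[of _ "F w"] mult.assoc ennreal_mult[symmetric])
    qed
  qed
  finally show ?thesis by simp
qed

lemma measure_cball_unit_pos: "0 < measure lborel (cball 0 1 :: 'a::euclidean_space set)"
  using emeasure_cball_unit_pos[where 'a='a] emeasure_cball_unit_finite[where 'a='a]
  by (simp add: measure_def enn2real_positive_iff)

lemma emeasure_cball_unit: "emeasure lborel (cball 0 1 :: 'a::euclidean_space set) = ennreal (measure lborel (cball 0 1 :: 'a set))"
  using emeasure_cball_unit_finite[where 'a='a] by (simp add: emeasure_eq_ennreal_measure)

lemma integral_uniform_ball:
  fixes f :: "'a::euclidean_space \<Rightarrow> 'b::euclidean_space"
  assumes [measurable]: "f \<in> borel_measurable borel"
  shows "(\<integral>u. f u \<partial>uniform_ball)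
    = (\<integral>u. indicator (cball 0 1) u *\<^sub>R f u \<partial>lborel) /\<^sub>R measure lborel (cball 0 1 :: 'a set)"
proof -
  let ?V = "measure lborel (cball 0 1 :: 'a set)"
  have [measurable]: "(cball 0 1 :: 'a set) \<in> sets borel" by simp
  have dens: "uniform_ball = density lborel (\<lambda>u::'a. ennreal (indicator (cball 0 1) u / ?V))"
    unfolding uniform_ball_def uniform_measure_def emeasure_cball_unit
    using measure_cball_unit_pos[where 'a='a]
    by (intro density_cong AE_I2) (auto simp: indicator_def divide_ennreal[symmetric] ennreal_1[symmetric] simp del: ennreal_1)
  have "(\<integral>u. f u \<partial>uniform_ball) = (\<integral>u. (indicator (cball 0 1) u / ?V) *\<^sub>R f u \<partial>lborel)"
    unfolding dens by (subst integral_density) auto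
  also have "\<dots> = (\<integral>u. (1 / ?V) *\<^sub>R (indicator (cball 0 1) u *\<^sub>R f u) \<partial>lborel)"
    by simp
  also have "\<dots> = (\<integral>u. indicator (cball 0 1) u *\<^sub>R f u \<partial>lborel) /\<^sub>R ?V"
    by (subst integral_scaleR_right) (simp add: inverse_eq_divide)
  finally show ?thesis .
qed

lemma nn_integral_power_Ioc:
  assumes "0 \<le> r" "0 < n"
  shows "(\<integral>\<^sup>+\<rho>. ennreal (real n * \<rho> ^ (n - 1)) * indicator {0<..r} \<rho> \<partial>lborel) = ennreal (r ^ n)"
proof -
  have "(\<integral>\<^sup>+\<rho>. ennreal (real n * \<rho> ^ (n - 1)) * indicator {0<..r} \<rho> \<partial>lborel)
     = (\<integral>\<^sup>+\<rho>. ennreal (real n * \<rho> ^ (n - 1)) * indicator {0..r} \<rho> \<partial>lborel)"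
  proof (rule nn_integral_cong_AE)
    show "AE \<rho> in lborel. ennreal (real n * \<rho> ^ (n - 1)) * indicator {0<..r} \<rho>
        = ennreal (real n * \<rho> ^ (n - 1)) * indicator {0..r} \<rho>"
      using AE_lborel_singleton[of "0::real"] by eventually_elim (auto simp: indicator_def)
  qed
  also have "\<dots> = ennreal (r ^ n - 0 ^ n)"
    using assms by (intro nn_integral_FTC_Icc) (auto intro!: derivative_eq_intros)
  finally show ?thesis using assms by (simp add: power_0_left)
qed

text \<open>Each ray meets the region in a segment of length \<open>r\<close>, over which the radial
  density \<open>n * \<rho> ^ (n - 1)\<close> integrates to \<open>r ^ n\<close>. The weight
  \<open>k\<close> sees only the direction and is constant along the ray.\<close>

lemma nn_integral_star_shaped:
  fixes k :: "'a::euclidean_space \<Rightarrow> ennreal" and r :: "'a \<Rightarrow> real"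
  assumes [measurable]: "k \<in> borel_measurable borel" "r \<in> borel_measurable borel"
    and r: "\<And>v. norm v = 1 \<Longrightarrow> 0 \<le> r v"
  shows "(\<integral>\<^sup>+w. k (w /\<^sub>R norm w) * indicator {w. norm w \<le> r (w /\<^sub>R norm w)} w \<partial>lborel)
    = (\<integral>\<^sup>+u. indicator (cball 0 1) u * (k (u /\<^sub>R norm u) * ennreal (r (u /\<^sub>R norm u) ^ DIM('a))) \<partial>lborel)"
proof (subst nn_integral_polar, simp add: indicator_def, rule nn_integral_cong_AE)
  have *: "(\<integral>\<^sup>+\<rho>. ennreal (DIM('a) * \<rho> ^ (DIM('a) - 1)) * (k ((\<rho> *\<^sub>R (u /\<^sub>R norm u)) /\<^sub>R norm (\<rho> *\<^sub>R (u /\<^sub>R norm u))) *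
           indicator {w. norm w \<le> r (w /\<^sub>R norm w)} (\<rho> *\<^sub>R (u /\<^sub>R norm u))) * indicator {0<..} \<rho> \<partial>lborel)
      = k (u /\<^sub>R norm u) * ennreal (r (u /\<^sub>R norm u) ^ DIM('a))" (is "?l = _") if u: "u \<noteq> 0" for u :: 'a
  proof -
    have "?l = (\<integral>\<^sup>+\<rho>. k (u /\<^sub>R norm u) * (ennreal (DIM('a) * \<rho> ^ (DIM('a) - 1)) * indicator {0<..r (u /\<^sub>R norm u)} \<rho>) \<partial>lborel)"
    proof (rule nn_integral_cong)
      fix \<rho> :: real
      have 1: "norm (\<rho> *\<^sub>R (u /\<^sub>R norm u)) = \<rho>" if "0 < \<rho>" using u that by simp
      have 2: "(\<rho> *\<^sub>R (u /\<^sub>R norm u)) /\<^sub>R \<rho> = u /\<^sub>R norm u" if "0 < \<rho>" using that by simp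
      show "ennreal (DIM('a) * \<rho> ^ (DIM('a) - 1)) * (k ((\<rho> *\<^sub>R (u /\<^sub>R norm u)) /\<^sub>R norm (\<rho> *\<^sub>R (u /\<^sub>R norm u))) *
           indicator {w. norm w \<le> r (w /\<^sub>R norm w)} (\<rho> *\<^sub>R (u /\<^sub>R norm u))) * indicator {0<..} \<rho>
         = k (u /\<^sub>R norm u) * (ennreal (DIM('a) * \<rho> ^ (DIM('a) - 1)) * indicator {0<..r (u /\<^sub>R norm u)} \<rho>)"
      proof (cases "0 < \<rho>")
        case True
        then show ?thesis
          unfolding 1[OF True] 2[OF True] indicator_def mem_Collect_eq
          by (simp add: mult.commute)
      qed simp
    qed
    also have "\<dots> = k (u /\<^sub>R norm u) * (\<integral>\<^sup>+\<rho>. ennreal (DIM('a) * \<rho> ^ (DIM('a) - 1)) * indicator {0<..r (u /\<^sub>R norm u)} \<rho> \<partial>lborel)"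
      by (rule nn_integral_cmult) auto
    also have "\<dots> = k (u /\<^sub>R norm u) * ennreal (r (u /\<^sub>R norm u) ^ DIM('a))"
      using r[of "u /\<^sub>R norm u"] u by (subst nn_integral_power_Ioc) auto
    finally show ?thesis .
  qed
  show "AE u in lborel. indicator (cball 0 1) u * (\<integral>\<^sup>+\<rho>. ennreal (DIM('a) * \<rho> ^ (DIM('a) - 1)) * (k ((\<rho> *\<^sub>R (u /\<^sub>R norm u)) /\<^sub>R norm (\<rho> *\<^sub>R (u /\<^sub>R norm u))) *
           indicator {w. norm w \<le> r (w /\<^sub>R norm w)} (\<rho> *\<^sub>R (u /\<^sub>R norm u))) * indicator {0<..} \<rho> \<partial>lborel)
      = indicator (cball 0 1) u * (k (u /\<^sub>R norm u) * ennreal (r (u /\<^sub>R norm u) ^ DIM('a)))"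
    using AE_lborel_singleton[of "0::'a"]
  proof eventually_elim
    case (elim u)
    show ?case unfolding *[OF elim] ..
  qed
qed

text \<open>Norm and direction are independent under a rotation-invariant weight. The identity
  \<open>gen\<close> is used twice, for \<open>k\<close> and for the constant 1, so that the radial
  integral is identified without being evaluated.\<close>

lemma nn_integral_radial_times_angular:
  fixes k :: "'a::euclidean_space \<Rightarrow> ennreal" and W :: "real \<Rightarrow> ennreal"
  assumes [measurable]: "k \<in> borel_measurable borel" "W \<in> borel_measurable borel"
  shows "(\<integral>\<^sup>+w. W (norm w) * k (w /\<^sub>R norm w) \<partial>lborel)
    = (\<integral>\<^sup>+(w::'a). W (norm w) \<partial>lborel) * (\<integral>\<^sup>+v. k v \<partial>uniform_sphere)"
proof -
  let ?V = "emeasure lborel (cball 0 1 :: 'a set)"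
  let ?R = "\<integral>\<^sup>+\<rho>. ennreal (DIM('a) * \<rho> ^ (DIM('a) - 1)) * W \<rho> * indicator {0<..} \<rho> \<partial>lborel"
  have gen: "(\<integral>\<^sup>+w. W (norm w) * k (w /\<^sub>R norm w) \<partial>lborel)
      = (\<integral>\<^sup>+u. indicator (cball 0 1) u * k (u /\<^sub>R norm u) \<partial>lborel) * ?R"
    if [measurable]: "k \<in> borel_measurable borel" for k :: "'a \<Rightarrow> ennreal"
  proof -
    have *: "(\<integral>\<^sup>+\<rho>. ennreal (DIM('a) * \<rho> ^ (DIM('a) - 1)) * (W (norm (\<rho> *\<^sub>R (u /\<^sub>R norm u))) *
            k ((\<rho> *\<^sub>R (u /\<^sub>R norm u)) /\<^sub>R norm (\<rho> *\<^sub>R (u /\<^sub>R norm u)))) * indicator {0<..} \<rho> \<partial>lborel)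
        = k (u /\<^sub>R norm u) * ?R" (is "?l = _") if u: "u \<noteq> 0" for u :: 'a
    proof -
      have "?l = (\<integral>\<^sup>+\<rho>. k (u /\<^sub>R norm u) * (ennreal (DIM('a) * \<rho> ^ (DIM('a) - 1)) * W \<rho> * indicator {0<..} \<rho>) \<partial>lborel)"
      proof (rule nn_integral_cong)
        fix \<rho> :: real
        have 1: "norm (\<rho> *\<^sub>R (u /\<^sub>R norm u)) = \<rho>" if "0 < \<rho>" using u that by simp
        have 2: "(\<rho> *\<^sub>R (u /\<^sub>R norm u)) /\<^sub>R \<rho> = u /\<^sub>R norm u" if "0 < \<rho>" using that by simp
        show "ennreal (DIM('a) * \<rho> ^ (DIM('a) - 1)) * (W (norm (\<rho> *\<^sub>R (u /\<^sub>R norm u))) *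
            k ((\<rho> *\<^sub>R (u /\<^sub>R norm u)) /\<^sub>R norm (\<rho> *\<^sub>R (u /\<^sub>R norm u)))) * indicator {0<..} \<rho>
          = k (u /\<^sub>R norm u) * (ennreal (DIM('a) * \<rho> ^ (DIM('a) - 1)) * W \<rho> * indicator {0<..} \<rho>)"
        proof (cases "0 < \<rho>")
          case True
          then show ?thesis unfolding 1[OF True] 2[OF True] by (simp add: ac_simps)
        qed simp
      qed
      also have "\<dots> = k (u /\<^sub>R norm u) * ?R" by (rule nn_integral_cmult) measurable
      finally show ?thesis .
    qed
    have "(\<integral>\<^sup>+w. W (norm w) * k (w /\<^sub>R norm w) \<partial>lborel)
       = (\<integral>\<^sup>+u. indicator (cball 0 1) u * k (u /\<^sub>R norm u) * ?R \<partial>lborel)"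
    proof (subst nn_integral_polar, simp, rule nn_integral_cong_AE)
      show "AE u in lborel. indicator (cball 0 1) u * (\<integral>\<^sup>+\<rho>. ennreal (DIM('a) * \<rho> ^ (DIM('a) - 1)) * (W (norm (\<rho> *\<^sub>R (u /\<^sub>R norm u))) *
            k ((\<rho> *\<^sub>R (u /\<^sub>R norm u)) /\<^sub>R norm (\<rho> *\<^sub>R (u /\<^sub>R norm u)))) * indicator {0<..} \<rho> \<partial>lborel)
         = indicator (cball 0 1) u * k (u /\<^sub>R norm u) * ?R"
        using AE_lborel_singleton[of "0::'a"]
      proof eventually_elim
        case (elim u)
        show ?case unfolding *[OF elim] by (simp add: mult.assoc)
      qed
    qed
    also have "\<dots> = (\<integral>\<^sup>+u. indicator (cball 0 1) u * k (u /\<^sub>R norm u) \<partial>lborel) * ?R"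
      by (rule nn_integral_multc) (simp add: indicator_def)
    finally show ?thesis .
  qed
  have sph: "(\<integral>\<^sup>+u. indicator (cball 0 1) u * k (u /\<^sub>R norm u) \<partial>lborel) = ?V * (\<integral>\<^sup>+v. k v \<partial>uniform_sphere)"
    using emeasure_cball_unit_pos[where 'a='a] emeasure_cball_unit_finite[where 'a='a]
    by (simp add: nn_integral_uniform_sphere nn_integral_uniform_ball ennreal_times_divide mult.commute[of ?V] mult.commute[of _ "indicator _ _"]
      ennreal_mult_divide_eq)
  have one: "(\<integral>\<^sup>+(w::'a). W (norm w) \<partial>lborel) = ?V * ?R"
    using gen[of "\<lambda>_. 1"] by simp
  show ?thesis unfolding gen[OF assms(1)] sph one by (simp add: ac_simps)
qed

section \<open>Symmetries of the uniform distributions\<close>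

lemma distr_uniform_ball_isometry:
  fixes T :: "'a::euclidean_space \<Rightarrow> 'a"
  assumes [measurable]: "T \<in> borel_measurable borel"
    and T: "distr lborel borel T = lborel" and norm_T: "\<And>x. norm (T x) = norm x"
  shows "distr uniform_ball borel T = uniform_ball"
proof (rule measure_eqI)
  fix A assume "A \<in> sets (distr uniform_ball borel T)"
  then have A[measurable]: "A \<in> sets borel" by simp
  have vT: "cball 0 1 \<inter> T -` A = T -` (cball 0 1 \<inter> A)" using norm_T by auto
  have mA: "T -` A \<in> sets borel" using measurable_sets_borel[OF assms(1) A] by simp
  have "emeasure lborel (cball 0 1 \<inter> T -` A) = emeasure (distr lborel borel T) (cball 0 1 \<inter> A)"
    unfolding vT by (subst emeasure_distr) auto
  then show "emeasure (distr uniform_ball borel T) A = emeasure uniform_ball A"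
    using mA unfolding T by (subst emeasure_distr) (auto simp: uniform_ball_def)
qed simp

lemma distr_uniform_sphere_isometry:
  fixes T :: "'a::euclidean_space \<Rightarrow> 'a"
  assumes [measurable]: "T \<in> borel_measurable borel"
    and T: "distr lborel borel T = lborel" and norm_T: "\<And>x. norm (T x) = norm x"
    and hom: "\<And>c x. T (c *\<^sub>R x) = c *\<^sub>R T x"
  shows "distr uniform_sphere borel T = uniform_sphere"
proof -
  have "distr uniform_sphere borel T = distr uniform_ball borel (\<lambda>u. T u /\<^sub>R norm (T u))"
    unfolding uniform_sphere_def by (subst distr_distr) (auto simp: comp_def hom norm_T)
  also have "\<dots> = distr (distr uniform_ball borel T) borel (\<lambda>u. u /\<^sub>R norm u)"
    by (subst distr_distr) (auto simp: comp_def)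
  also have "\<dots> = uniform_sphere"
    using distr_uniform_ball_isometry[OF assms(1-3)] by (simp add: uniform_sphere_def)
  finally show ?thesis .
qed

section \<open>Coordinate reflections and swaps\<close>

lemma distr_lborel_uminus: "distr lborel borel uminus = (lborel :: 'a::euclidean_space measure)"
proof -
  have "(lborel :: 'a measure) = density (distr lborel borel (\<lambda>x. 0 + (-1) *\<^sub>R x)) (\<lambda>_. \<bar>-1::real\<bar> ^ DIM('a))"
    by (rule lborel_affine) simp
  also have "\<dots> = distr lborel borel uminus"
    by (simp add: density_1)
  finally show ?thesis by simp
qed

text \<open>Two kinds of symmetry determine the second moments of an isotropic vector: reflections
  make the mixed moments vanish, and swaps make the diagonal ones equal.\<close>

definition reflect_coord :: "'a::euclidean_space \<Rightarrow> 'a \<Rightarrow> 'a" where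
  "reflect_coord b x = (\<Sum>j\<in>Basis. ((if j = b then -1 else 1) * (x \<bullet> j)) *\<^sub>R j)"

definition swap_coords :: "'a::euclidean_space \<Rightarrow> 'a \<Rightarrow> 'a \<Rightarrow> 'a" where
  "swap_coords b c x = (\<Sum>j\<in>Basis. (x \<bullet> Transposition.transpose b c j) *\<^sub>R j)"

lemma reflect_coord_inner: "j \<in> Basis \<Longrightarrow> reflect_coord b x \<bullet> j = (if j = b then - (x \<bullet> j) else x \<bullet> j)"
  unfolding reflect_coord_def by (subst inner_sum_left_Basis) auto

lemma swap_coords_inner: "j \<in> Basis \<Longrightarrow> swap_coords b c x \<bullet> j = x \<bullet> Transposition.transpose b c j"
  unfolding swap_coords_def by (subst inner_sum_left_Basis) auto

lemma transpose_in_Basis: "b \<in> Basis \<Longrightarrow> c \<in> Basis \<Longrightarrow> j \<in> Basis \<Longrightarrow> Transposition.transpose b c j \<in> Basis"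
  by (simp add: Transposition.transpose_def)

lemma bij_transpose_Basis:
  "b \<in> Basis \<Longrightarrow> c \<in> Basis \<Longrightarrow> bij_betw (Transposition.transpose b c) Basis (Basis :: 'a::euclidean_space set)"
  by (rule bij_betw_byWitness[where f'="Transposition.transpose b c"]) (auto intro: transpose_in_Basis)

lemma norm_reflect_coord: "norm (reflect_coord b x) = norm x"
proof -
  have "reflect_coord b x \<bullet> reflect_coord b x = x \<bullet> x"
    by (subst (1 2) euclidean_inner) (rule sum.cong, auto simp: reflect_coord_inner)
  then show ?thesis by (simp add: norm_eq)
qed

lemma norm_swap_coords: "b \<in> Basis \<Longrightarrow> c \<in> Basis \<Longrightarrow> norm (swap_coords b c x) = norm x"
proof -
  assume bc: "b \<in> Basis" "c \<in> Basis"
  have "swap_coords b c x \<bullet> swap_coords b c x = (\<Sum>j\<in>Basis. (x \<bullet> Transposition.transpose b c j) * (x \<bullet> Transposition.transpose b c j))"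
    by (subst euclidean_inner) (rule sum.cong, auto simp: swap_coords_inner)
  also have "\<dots> = (\<Sum>j\<in>Basis. (x \<bullet> j) * (x \<bullet> j))"
    by (rule sum.reindex_bij_betw[OF bij_transpose_Basis[OF bc]])
  also have "\<dots> = x \<bullet> x" by (rule euclidean_inner[symmetric])
  finally show ?thesis by (simp add: norm_eq)
qed

lemma measurable_reflect_coord[measurable]: "reflect_coord b \<in> borel_measurable borel"
  unfolding reflect_coord_def[abs_def] by measurable

lemma measurable_swap_coords[measurable]: "swap_coords b c \<in> borel_measurable borel"
  unfolding swap_coords_def[abs_def] by measurable

lemma distr_lborel_reflect_coord: "distr lborel borel (reflect_coord b) = (lborel :: 'a::euclidean_space measure)"
proof -
  have "(lborel :: 'a measure) = density (distr lborel borel (\<lambda>x. 0 + (\<Sum>j\<in>Basis. ((if j = b then -1 else 1) * (x \<bullet> j)) *\<^sub>R j)))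
      (\<lambda>_. (\<Prod>j\<in>Basis. \<bar>if j = b then -1 else 1 :: real\<bar>))"
    by (rule lborel_affine_euclidean) auto
  also have "\<dots> = distr lborel borel (reflect_coord b)"
  proof -
    have "(\<Prod>j\<in>(Basis::'a set). \<bar>if j = b then -1 else 1 :: real\<bar>) = 1"
      by (rule prod.neutral) auto
    then show ?thesis by (simp only:) (simp add: density_1 reflect_coord_def[abs_def])
  qed
  finally show ?thesis by simp
qed

text \<open>The preimage of a box is the box with permuted corners, whose volume has the same
  factors in another order.\<close>

lemma distr_lborel_swap_coords:
  assumes bc: "b \<in> Basis" "c \<in> Basis"
  shows "distr lborel borel (swap_coords b c) = (lborel :: 'a::euclidean_space measure)"
proof (rule lborel_eqI[symmetric])
  fix l u :: 'a assume lu: "\<And>b. b \<in> Basis \<Longrightarrow> l \<bullet> b \<le> u \<bullet> b"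
  let ?\<pi> = "Transposition.transpose b c" and ?s = "swap_coords b c"
  have "?s -` box l u = box (?s l) (?s u)"
  proof (intro set_eqI)
    fix x
    have "x \<in> ?s -` box l u \<longleftrightarrow> (\<forall>j\<in>Basis. l \<bullet> j < x \<bullet> ?\<pi> j \<and> x \<bullet> ?\<pi> j < u \<bullet> j)"
      by (auto simp: mem_box swap_coords_inner)
    also have "\<dots> \<longleftrightarrow> (\<forall>j\<in>?\<pi> ` Basis. l \<bullet> ?\<pi> j < x \<bullet> j \<and> x \<bullet> j < u \<bullet> ?\<pi> j)"
      by auto
    also have "?\<pi> ` Basis = (Basis :: 'a set)"
      using bij_transpose_Basis[OF bc] by (simp add: bij_betw_def)
    finally show "x \<in> ?s -` box l u \<longleftrightarrow> x \<in> box (?s l) (?s u)"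
      by (auto simp: mem_box swap_coords_inner)
  qed
  then have "emeasure (distr lborel borel ?s) (box l u) = emeasure lborel (box (?s l) (?s u))"
    by (subst emeasure_distr) auto
  also have "\<dots> = (\<Prod>j\<in>Basis. (?s u - ?s l) \<bullet> j)"
    using lu transpose_in_Basis[OF bc] by (subst emeasure_lborel_box) (auto simp: swap_coords_inner)
  also have "(\<Prod>j\<in>Basis. (?s u - ?s l) \<bullet> j) = (\<Prod>j\<in>Basis. (u - l) \<bullet> ?\<pi> j)"
    by (rule prod.cong) (auto simp: swap_coords_inner inner_diff_left)
  also have "\<dots> = (\<Prod>j\<in>Basis. (u - l) \<bullet> j)"
    by (rule prod.reindex_bij_betw[OF bij_transpose_Basis[OF bc]])
  finally show "emeasure (distr lborel borel ?s) (box l u) = (\<Prod>j\<in>Basis. (u - l) \<bullet> j)" .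
qed simp

lemma uniform_ball_invariant:
  "distr uniform_ball borel uminus = (uniform_ball :: 'a::euclidean_space measure)"
  "distr uniform_ball borel (reflect_coord b) = (uniform_ball :: 'a measure)"
  "b \<in> Basis \<Longrightarrow> c \<in> Basis \<Longrightarrow> distr uniform_ball borel (swap_coords b c) = (uniform_ball :: 'a measure)"
  by (intro distr_uniform_ball_isometry distr_lborel_uminus distr_lborel_reflect_coord distr_lborel_swap_coords;
      simp add: norm_reflect_coord norm_swap_coords)+

lemma reflect_coord_scaleR: "reflect_coord b (r *\<^sub>R x) = r *\<^sub>R reflect_coord b x"
  by (rule euclidean_eqI) (auto simp: reflect_coord_inner)

lemma swap_coords_scaleR: "b \<in> Basis \<Longrightarrow> c \<in> Basis \<Longrightarrow> swap_coords b c (r *\<^sub>R x) = r *\<^sub>R swap_coords b c x"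
  by (rule euclidean_eqI) (auto simp: swap_coords_inner)

lemma uniform_sphere_invariant:
  "distr uniform_sphere borel uminus = (uniform_sphere :: 'a::euclidean_space measure)"
  "distr uniform_sphere borel (reflect_coord b) = (uniform_sphere :: 'a measure)"
  "b \<in> Basis \<Longrightarrow> c \<in> Basis \<Longrightarrow> distr uniform_sphere borel (swap_coords b c) = (uniform_sphere :: 'a measure)"
  by (intro distr_uniform_sphere_isometry distr_lborel_uminus distr_lborel_reflect_coord distr_lborel_swap_coords;
      simp add: norm_reflect_coord norm_swap_coords reflect_coord_scaleR swap_coords_scaleR)+

lemma integral_invariant:
  fixes f :: "'a::euclidean_space \<Rightarrow> 'b::euclidean_space"
  assumes "distr N borel T = N" "T \<in> measurable N borel" "f \<in> borel_measurable borel"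
  shows "(\<integral>x. f (T x) \<partial>N) = (\<integral>x. f x \<partial>N)"
proof -
  have "(\<integral>x. f x \<partial>N) = (\<integral>x. f x \<partial>distr N borel T)" using assms(1) by simp
  also have "\<dots> = (\<integral>x. f (T x) \<partial>N)" using assms(2,3) by (rule integral_distr)
  finally show ?thesis by simp
qed

text \<open>Stated for two random vectors because it serves twice: with a constant \<open>A\<close>
  on the sphere, and with \<open>A\<close> a function of the first and \<open>Y\<close> the second
  component of a random pair. Of the expanded square, \<open>orth\<close> leaves the diagonal, and
  \<open>sym\<close> allows each diagonal term to be averaged over all coordinates of
  \<open>Y\<close>, which restores \<open>norm Y\<close>.\<close>

lemma second_moment_symmetric:
  fixes A Y :: "'w \<Rightarrow> 'a::euclidean_space"
  assumes [measurable]: "A \<in> borel_measurable N" "Y \<in> borel_measurable N"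
    and int: "integrable N (\<lambda>w. (norm (A w))\<^sup>2 * (norm (Y w))\<^sup>2)"
    and orth: "\<And>b c. b \<in> Basis \<Longrightarrow> c \<in> Basis \<Longrightarrow> b \<noteq> c \<Longrightarrow> (\<integral>w. (A w \<bullet> b) * (A w \<bullet> c) * ((Y w \<bullet> b) * (Y w \<bullet> c)) \<partial>N) = 0"
    and sym: "\<And>b c. b \<in> Basis \<Longrightarrow> c \<in> Basis \<Longrightarrow> (\<integral>w. (A w \<bullet> b)\<^sup>2 * (Y w \<bullet> b)\<^sup>2 \<partial>N) = (\<integral>w. (A w \<bullet> b)\<^sup>2 * (Y w \<bullet> c)\<^sup>2 \<partial>N)"
  shows "(\<integral>w. (A w \<bullet> Y w)\<^sup>2 \<partial>N) = (\<integral>w. (norm (A w))\<^sup>2 * (norm (Y w))\<^sup>2 \<partial>N) / DIM('a)"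
proof -
  have I: "integrable N (\<lambda>w. (A w \<bullet> b) * (A w \<bullet> c) * ((Y w \<bullet> b') * (Y w \<bullet> c')))"
    if "b \<in> Basis" "c \<in> Basis" "b' \<in> Basis" "c' \<in> Basis" for b c b' c'
  proof (rule Bochner_Integration.integrable_bound[OF int])
    show "AE w in N. norm ((A w \<bullet> b) * (A w \<bullet> c) * ((Y w \<bullet> b') * (Y w \<bullet> c'))) \<le> norm ((norm (A w))\<^sup>2 * (norm (Y w))\<^sup>2)"
      unfolding real_norm_def abs_mult power2_eq_square abs_norm_cancel
      using that by (intro AE_I2 mult_mono) (auto simp: Basis_le_norm)
  qed measurable
  have I2: "integrable N (\<lambda>w. (A w \<bullet> b)\<^sup>2 * (Y w \<bullet> c)\<^sup>2)" if "b \<in> Basis" "c \<in> Basis" for b c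
    using I[of b b c c] that by (simp add: power2_eq_square)
  have "(\<integral>w. (A w \<bullet> Y w)\<^sup>2 \<partial>N) = (\<integral>w. (\<Sum>b\<in>Basis. \<Sum>c\<in>Basis. (A w \<bullet> b) * (A w \<bullet> c) * ((Y w \<bullet> b) * (Y w \<bullet> c))) \<partial>N)"
    unfolding euclidean_inner[of "A _" "Y _"] power2_eq_square sum_product by (simp only: ac_simps)
  also have "\<dots> = (\<Sum>b\<in>Basis. \<Sum>c\<in>Basis. (\<integral>w. (A w \<bullet> b) * (A w \<bullet> c) * ((Y w \<bullet> b) * (Y w \<bullet> c)) \<partial>N))"
    by (subst Bochner_Integration.integral_sum, (intro Bochner_Integration.integrable_sum I; assumption))
       (intro sum.cong refl Bochner_Integration.integral_sum I; assumption)
  also have "\<dots> = (\<Sum>b\<in>Basis. \<Sum>c\<in>Basis. if c = b then (\<integral>w. (A w \<bullet> b)\<^sup>2 * (Y w \<bullet> b)\<^sup>2 \<partial>N) else 0)"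
    using orth by (intro sum.cong refl) (auto simp: power2_eq_square)
  also have "\<dots> = (\<Sum>b\<in>Basis. (\<integral>w. (A w \<bullet> b)\<^sup>2 * (Y w \<bullet> b)\<^sup>2 \<partial>N))"
    by simp
  also have "\<dots> = (\<Sum>b\<in>Basis. (\<Sum>c\<in>Basis. (\<integral>w. (A w \<bullet> b)\<^sup>2 * (Y w \<bullet> c)\<^sup>2 \<partial>N)) / DIM('a))"
  proof (rule sum.cong[OF refl])
    fix b :: 'a assume b: "b \<in> Basis"
    have "(\<Sum>c\<in>Basis. (\<integral>w. (A w \<bullet> b)\<^sup>2 * (Y w \<bullet> c)\<^sup>2 \<partial>N)) = (\<Sum>c\<in>(Basis::'a set). (\<integral>w. (A w \<bullet> b)\<^sup>2 * (Y w \<bullet> b)\<^sup>2 \<partial>N))"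
      using sym[OF b] by (intro sum.cong) auto
    then show "(\<integral>w. (A w \<bullet> b)\<^sup>2 * (Y w \<bullet> b)\<^sup>2 \<partial>N) = (\<Sum>c\<in>Basis. (\<integral>w. (A w \<bullet> b)\<^sup>2 * (Y w \<bullet> c)\<^sup>2 \<partial>N)) / DIM('a)"
      by simp
  qed
  also have "\<dots> = (\<integral>w. (\<Sum>b\<in>Basis. \<Sum>c\<in>Basis. (A w \<bullet> b)\<^sup>2 * (Y w \<bullet> c)\<^sup>2) \<partial>N) / DIM('a)"
    by (subst Bochner_Integration.integral_sum, (intro Bochner_Integration.integrable_sum I2; assumption))
       (simp add: sum_divide_distrib Bochner_Integration.integral_sum I2)
  also have "(\<lambda>w. \<Sum>b\<in>Basis. \<Sum>c\<in>Basis. (A w \<bullet> b)\<^sup>2 * (Y w \<bullet> c)\<^sup>2) = (\<lambda>w. (norm (A w))\<^sup>2 * (norm (Y w))\<^sup>2)"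
    by (simp add: sum_product[symmetric] norm_eq_sqrt_inner euclidean_inner[of "A _" "A _"] euclidean_inner[of "Y _" "Y _"]
        power2_eq_square[symmetric] sum_nonneg)
  finally show ?thesis .
qed

lemma integrable_uniform_sphere_bounded:
  fixes f :: "'a::euclidean_space \<Rightarrow> 'b::euclidean_space"
  assumes [measurable]: "f \<in> borel_measurable borel" and "\<And>v. norm v = 1 \<Longrightarrow> norm (f v) \<le> B"
  shows "integrable uniform_sphere f"
proof -
  interpret prob_space "uniform_sphere :: 'a measure" by (rule prob_space_uniform_sphere)
  show ?thesis
    by (rule integrable_const_bound[of _ B]) (use AE_uniform_sphere assms in \<open>auto elim!: eventually_mono\<close>)
qed

lemma integrable_uniform_ball_bounded:
  fixes f :: "'a::euclidean_space \<Rightarrow> 'b::euclidean_space"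
  assumes [measurable]: "f \<in> borel_measurable borel" and "\<And>v. norm v \<le> 1 \<Longrightarrow> norm (f v) \<le> B"
  shows "integrable uniform_ball f"
proof -
  interpret prob_space "uniform_ball :: 'a measure" by (rule prob_space_uniform_ball)
  show ?thesis
    by (rule integrable_const_bound[of _ B]) (use AE_uniform_ball assms in \<open>auto elim!: eventually_mono\<close>)
qed

lemma uniform_sphere_second_moment:
  fixes e :: "'a::euclidean_space"
  shows "(\<integral>v. (e \<bullet> v)\<^sup>2 \<partial>uniform_sphere) = (norm e)\<^sup>2 / DIM('a)"
proof -
  interpret prob_space "uniform_sphere :: 'a measure" by (rule prob_space_uniform_sphere)
  have "(\<integral>v. (e \<bullet> v)\<^sup>2 \<partial>uniform_sphere) = (\<integral>v. (norm e)\<^sup>2 * (norm v)\<^sup>2 \<partial>(uniform_sphere::'a measure)) / DIM('a)"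
  proof (rule second_moment_symmetric)
    show "integrable uniform_sphere (\<lambda>v::'a. (norm e)\<^sup>2 * (norm v)\<^sup>2)"
      by (rule integrable_uniform_sphere_bounded[of _ "(norm e)\<^sup>2"]) auto
  next
    fix b c :: 'a assume bc: "b \<in> Basis" "c \<in> Basis" "b \<noteq> c"
    have "(\<integral>v. (e \<bullet> b) * (e \<bullet> c) * ((v \<bullet> b) * (v \<bullet> c)) \<partial>uniform_sphere)
       = (\<integral>v. (e \<bullet> b) * (e \<bullet> c) * ((reflect_coord b v \<bullet> b) * (reflect_coord b v \<bullet> c)) \<partial>uniform_sphere)"
      by (rule integral_invariant[OF uniform_sphere_invariant(2), symmetric]) auto
    also have "\<dots> = (\<integral>v. - ((e \<bullet> b) * (e \<bullet> c) * ((v \<bullet> b) * (v \<bullet> c))) \<partial>uniform_sphere)"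
      using bc by (simp add: reflect_coord_inner)
    finally show "(\<integral>v. (e \<bullet> b) * (e \<bullet> c) * ((v \<bullet> b) * (v \<bullet> c)) \<partial>uniform_sphere) = 0" by simp
  next
    fix b c :: 'a assume bc: "b \<in> Basis" "c \<in> Basis"
    have "(\<integral>v. (e \<bullet> b)\<^sup>2 * (v \<bullet> b)\<^sup>2 \<partial>uniform_sphere)
       = (\<integral>v. (e \<bullet> b)\<^sup>2 * (swap_coords b c v \<bullet> b)\<^sup>2 \<partial>uniform_sphere)"
      by (rule integral_invariant[OF uniform_sphere_invariant(3)[OF bc], symmetric]) auto
    then show "(\<integral>v. (e \<bullet> b)\<^sup>2 * (v \<bullet> b)\<^sup>2 \<partial>uniform_sphere) = (\<integral>v. (e \<bullet> b)\<^sup>2 * (v \<bullet> c)\<^sup>2 \<partial>uniform_sphere)"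
      using bc by (simp add: swap_coords_inner)
  qed auto
  also have "(\<integral>v. (norm e)\<^sup>2 * (norm v)\<^sup>2 \<partial>(uniform_sphere::'a measure)) = (\<integral>v. (norm e)\<^sup>2 \<partial>(uniform_sphere::'a measure))"
  proof (rule integral_cong_AE)
    show "AE v in (uniform_sphere :: 'a measure). (norm e)\<^sup>2 * (norm v)\<^sup>2 = (norm e)\<^sup>2"
      using AE_uniform_sphere[where 'a='a] by eventually_elim simp
  qed auto
  finally show ?thesis by (simp add: prob_space[simplified])
qed

section \<open>Randomized smoothing\<close>

lemma real_le_four_power: "real n \<le> 4 ^ n"
proof -
  have "real n \<le> 2 ^ n" using of_nat_less_two_power[of n, where 'a=real] by simp
  also have "\<dots> \<le> 4 ^ n" by (intro power_mono) auto
  finally show ?thesis .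
qed

lemma measurable_cball[measurable]: "cball c r \<in> sets borel" for c :: "'a::metric_space"
  by simp

lemma norm_normalize_le: "norm (w /\<^sub>R norm w) \<le> 1" for w :: "'a::real_normed_vector"
  by (cases "w = 0") auto

text \<open>The upper companion of Bernoulli's inequality. Only the quadratic order of the remainder
  matters, so the crude coefficient \<open>4 ^ n\<close> is chosen for its easy induction.\<close>

lemma power_one_plus_le:
  fixes s :: real
  assumes "\<bar>s\<bar> \<le> 1"
  shows "(1 + s) ^ n \<le> 1 + real n * s + 4 ^ n * s\<^sup>2"
proof (induction n)
  case (Suc n)
  have n4: "real n \<le> 4 ^ n" by (rule real_le_four_power)
  have "(1 + s) ^ Suc n \<le> (1 + s) * (1 + real n * s + 4 ^ n * s\<^sup>2)"
    using Suc assms by (simp add: mult_left_mono)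
  also have "\<dots> = 1 + real (Suc n) * s + real n * s\<^sup>2 + 4 ^ n * s\<^sup>2 * (1 + s)"
    by (simp add: algebra_simps power2_eq_square)
  also have "\<dots> \<le> 1 + real (Suc n) * s + 4 ^ n * s\<^sup>2 + 4 ^ n * s\<^sup>2 * 2"
  proof -
    have "real n * s\<^sup>2 \<le> 4 ^ n * s\<^sup>2" by (rule mult_right_mono[OF n4]) auto
    moreover have "4 ^ n * s\<^sup>2 * (1 + s) \<le> 4 ^ n * s\<^sup>2 * 2"
      using assms by (intro mult_left_mono) auto
    ultimately show ?thesis by linarith
  qed
  also have "\<dots> \<le> 1 + real (Suc n) * s + 4 ^ Suc n * s\<^sup>2"
    by simp
  finally show ?case .
qed simp

section \<open>Volume integrals over star-shaped regions and shifted balls\<close>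

lemma integrable_lborel_bounded_support:
  fixes f :: "'a::euclidean_space \<Rightarrow> real"
  assumes [measurable]: "f \<in> borel_measurable borel"
    and bound: "\<And>w. norm w \<le> r \<Longrightarrow> \<bar>f w\<bar> \<le> B" and supp: "\<And>w. r < norm w \<Longrightarrow> f w = 0"
  shows "integrable lborel f"
proof (rule Bochner_Integration.integrable_bound)
  show "integrable lborel (\<lambda>w::'a. B * indicator (cball 0 r) w)"
    using emeasure_lborel_cball_finite[of "0::'a" r] by (intro integrable_mult_right integrable_real_indicator) auto
  show "AE w in lborel. norm (f w) \<le> norm (B * indicator (cball 0 r) w)"
  proof (rule AE_I2)
    fix w
    show "norm (f w) \<le> norm (B * indicator (cball 0 r) w)"
      using bound[of w] supp[of w] by (cases "norm w \<le> r") auto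
  qed
qed simp

lemma integral_lborel_translate:
  fixes f :: "'a::euclidean_space \<Rightarrow> real"
  assumes [measurable]: "f \<in> borel_measurable borel"
  shows "(\<integral>x. f (a + x) \<partial>lborel) = (\<integral>x. f x \<partial>lborel)"
proof -
  have "(\<integral>x. f x \<partial>lborel) = (\<integral>x. f x \<partial>distr lborel borel ((+) a))"
    by (simp add: lborel_distr_plus)
  also have "\<dots> = (\<integral>x. f (a + x) \<partial>lborel)"
    by (subst integral_distr) auto
  finally show ?thesis by simp
qed

lemma integral_uniform_ball_real:
  fixes f :: "'a::euclidean_space \<Rightarrow> real"
  assumes "f \<in> borel_measurable borel"
  shows "(\<integral>u. indicator (cball 0 1) u * f u \<partial>lborel) = measure lborel (cball 0 1 :: 'a set) * (\<integral>u. f u \<partial>uniform_ball)"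
  using measure_cball_unit_pos[where 'a='a] by (subst integral_uniform_ball[OF assms]) simp

lemma integral_star_shaped:
  fixes k r :: "'a::euclidean_space \<Rightarrow> real"
  assumes [measurable]: "k \<in> borel_measurable borel" "r \<in> borel_measurable borel"
    and k: "\<And>v. norm v \<le> 1 \<Longrightarrow> 0 \<le> k v \<and> k v \<le> B"
    and r: "\<And>v. norm v \<le> 1 \<Longrightarrow> 0 \<le> r v \<and> r v \<le> R"
  shows "(\<integral>w. k (w /\<^sub>R norm w) * indicator {w. norm w \<le> r (w /\<^sub>R norm w)} w \<partial>lborel)
    = measure lborel (cball 0 1 :: 'a set) * (\<integral>u. k (u /\<^sub>R norm u) * r (u /\<^sub>R norm u) ^ DIM('a) \<partial>uniform_ball)"
    (is "?l = ?r")
proof -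
  have n1: "norm (w /\<^sub>R norm w) \<le> 1" for w :: 'a by (rule norm_normalize_le)
  have kn: "0 \<le> k (w /\<^sub>R norm w)" "k (w /\<^sub>R norm w) \<le> B" "0 \<le> r (w /\<^sub>R norm w)" "r (w /\<^sub>R norm w) \<le> R" for w :: 'a
    using k[OF n1[of w]] r[OF n1[of w]] by auto
  have B: "0 \<le> B" and R: "0 \<le> R" using k[of 0] r[of 0] by auto
  have meas[measurable]: "{w. norm w \<le> r (w /\<^sub>R norm w)} \<in> sets borel" by measurable
  have i1: "integrable lborel (\<lambda>w. k (w /\<^sub>R norm w) * indicator {w. norm w \<le> r (w /\<^sub>R norm w)} w)"
  proof (rule integrable_lborel_bounded_support[of _ R B])
    fix w :: 'a assume "R < norm w"
    then have "\<not> norm w \<le> r (w /\<^sub>R norm w)" using kn(4)[of w] by linarith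
    then show "k (w /\<^sub>R norm w) * indicator {w. norm w \<le> r (w /\<^sub>R norm w)} w = 0" by simp
  qed (use kn B in \<open>auto simp: indicator_def\<close>)
  have i2: "integrable lborel (\<lambda>u. indicator (cball 0 1) u * (k (u /\<^sub>R norm u) * r (u /\<^sub>R norm u) ^ DIM('a)))"
  proof (rule integrable_lborel_bounded_support[of _ 1 "B * R ^ DIM('a)"])
    fix w :: 'a
    show "\<bar>indicator (cball 0 1) w * (k (w /\<^sub>R norm w) * r (w /\<^sub>R norm w) ^ DIM('a))\<bar> \<le> B * R ^ DIM('a)"
      using kn[of w] B R by (auto simp: indicator_def abs_mult intro!: mult_mono power_mono)
  qed (auto simp: indicator_def)
  have "ennreal ?l = (\<integral>\<^sup>+w. ennreal (k (w /\<^sub>R norm w) * indicator {w. norm w \<le> r (w /\<^sub>R norm w)} w) \<partial>lborel)"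
    using kn by (intro nn_integral_eq_integral[symmetric] i1) auto
  also have "\<dots> = (\<integral>\<^sup>+w. ennreal (k (w /\<^sub>R norm w)) * indicator {w. norm w \<le> r (w /\<^sub>R norm w)} w \<partial>lborel)"
    by (intro nn_integral_cong) (auto simp: indicator_def)
  also have "\<dots> = (\<integral>\<^sup>+u. indicator (cball 0 1) u * (ennreal (k (u /\<^sub>R norm u)) * ennreal (r (u /\<^sub>R norm u) ^ DIM('a))) \<partial>lborel)"
    using r by (intro nn_integral_star_shaped) auto
  also have "\<dots> = (\<integral>\<^sup>+u. ennreal (indicator (cball 0 1) u * (k (u /\<^sub>R norm u) * r (u /\<^sub>R norm u) ^ DIM('a))) \<partial>lborel)"
    using kn by (intro nn_integral_cong) (auto simp: indicator_def ennreal_mult)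
  also have "\<dots> = ennreal (\<integral>u. indicator (cball 0 1) u * (k (u /\<^sub>R norm u) * r (u /\<^sub>R norm u) ^ DIM('a)) \<partial>lborel)"
    using kn by (intro nn_integral_eq_integral i2) auto
  also have "\<dots> = ennreal ?r"
    by (subst integral_uniform_ball_real) auto
  finally show ?thesis
    using kn by (subst (asm) ennreal_inj) (auto intro!: integral_nonneg_AE mult_nonneg_nonneg)
qed

text \<open>In the direction \<open>v\<close> the boundary of the shifted ball has the distance
  \<open>v \<bullet> h + sqrt (1 - (norm h)^2 + (v \<bullet> h)^2)\<close> from 0, and the root lies
  between \<open>1 - (norm h)^2\<close> and 1. The smallness of \<open>h\<close> keeps 0 inside the
  ball and the lower radius positive.\<close>

lemma shifted_ball_bounds:
  fixes h w :: "'a::euclidean_space"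
  assumes "norm h \<le> 1 / 2" "w \<noteq> 0"
  shows "w \<in> cball h 1 \<Longrightarrow> norm w \<le> 1 + (w /\<^sub>R norm w) \<bullet> h"
    and "norm w \<le> 1 + (w /\<^sub>R norm w) \<bullet> h - (norm h)\<^sup>2 \<Longrightarrow> w \<in> cball h 1"
proof -
  define v where "v = w /\<^sub>R norm w"
  define \<rho> where "\<rho> = norm w"
  have v1: "norm v = 1" using assms by (simp add: v_def)
  have w: "w = \<rho> *\<^sub>R v" using assms by (simp add: v_def \<rho>_def)
  have \<rho>: "0 \<le> \<rho>" by (simp add: \<rho>_def)
  have vv: "v \<bullet> v = 1" using v1 by (simp add: norm_eq_1)
  have vh: "\<bar>v \<bullet> h\<bar> \<le> norm h" using Cauchy_Schwarz_ineq2[of v h] v1 by simp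
  have d: "(norm (w - h))\<^sup>2 = (\<rho> - v \<bullet> h)\<^sup>2 + (norm h)\<^sup>2 - (v \<bullet> h)\<^sup>2"
    unfolding w dot_square_norm[symmetric] by (simp add: inner_diff algebra_simps vv inner_commute power2_eq_square)
  { assume "w \<in> cball h 1"
    then have "norm (w - h) \<le> 1" by (simp add: dist_norm norm_minus_commute)
    then have "(norm (w - h))\<^sup>2 \<le> 1" by (simp add: power_le_one)
    moreover have "(v \<bullet> h)\<^sup>2 \<le> (norm h)\<^sup>2" using vh by (metis abs_le_square_iff abs_norm_cancel)
    ultimately have "(\<rho> - v \<bullet> h)\<^sup>2 \<le> 1" using d by linarith
    then have "\<rho> - v \<bullet> h \<le> 1" by (metis abs_le_square_iff abs_one abs_le_D1 one_power2)
    then show "norm w \<le> 1 + (w /\<^sub>R norm w) \<bullet> h" by (simp add: v_def \<rho>_def) }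
  { assume "norm w \<le> 1 + (w /\<^sub>R norm w) \<bullet> h - (norm h)\<^sup>2"
    then have up: "\<rho> - v \<bullet> h \<le> 1 - (norm h)\<^sup>2" by (simp add: v_def \<rho>_def)
    have "norm h * norm h \<le> (1/2) * (1/2)" using assms by (intro mult_mono) auto
    then have hs: "(norm h)\<^sup>2 \<le> 1 / 4" by (simp add: power2_eq_square)
    have "- (1 - (norm h)\<^sup>2) \<le> \<rho> - v \<bullet> h" using \<rho> vh assms hs by linarith
    with up have "\<bar>\<rho> - v \<bullet> h\<bar> \<le> \<bar>1 - (norm h)\<^sup>2\<bar>" by linarith
    then have "(\<rho> - v \<bullet> h)\<^sup>2 \<le> (1 - (norm h)\<^sup>2)\<^sup>2" by (simp only: abs_le_square_iff)
    also have "\<dots> = 1 - (norm h)\<^sup>2 - (norm h)\<^sup>2 * (1 - (norm h)\<^sup>2)" by (simp add: power2_eq_square algebra_simps)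
    also have "\<dots> \<le> 1 - (norm h)\<^sup>2" using hs by (simp add: mult_nonneg_nonneg)
    finally have "(norm (w - h))\<^sup>2 \<le> 1" using d by (smt (verit) zero_le_power2)
    then have "norm (w - h) \<le> 1" by (simp add: power2_le_imp_le abs_square_le_1)
    then show "w \<in> cball h 1" by (simp add: dist_norm norm_minus_commute) }
qed

text \<open>The shifted ball lies between the star-shaped regions with the radii \<open>lo\<close>
  and \<open>up\<close>. Both radii have the \<open>n\<close>-th power
  \<open>1 + n * (v \<bullet> h)\<close> up to a quadratic error, from below by Bernoulli's
  inequality and from above by \<open>power_one_plus_le\<close>. Nonnegativity of \<open>k\<close>
  turns the inclusions into inequalities.\<close>

lemma shifted_ball_angular_expansion:
  fixes k :: "'a::euclidean_space \<Rightarrow> real" and h :: 'a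
  defines "V \<equiv> measure lborel (cball 0 1 :: 'a set)"
  assumes [measurable]: "k \<in> borel_measurable borel"
    and k: "\<And>v. norm v \<le> 1 \<Longrightarrow> 0 \<le> k v \<and> k v \<le> B"
    and h: "norm h \<le> 1 / 2"
  shows "\<bar>(\<integral>w. indicator (cball h 1) w * k (w /\<^sub>R norm w) \<partial>lborel)
      - V * (\<integral>v. k v \<partial>uniform_sphere) - V * (DIM('a) * (\<integral>v. k v * (v \<bullet> h) \<partial>uniform_sphere))\<bar> \<le> V * (4 ^ DIM('a) * B * (norm h)\<^sup>2)"
proof -
  interpret U: prob_space "uniform_ball :: 'a measure" by (rule prob_space_uniform_ball)
  let ?n = "DIM('a)"
  let ?A = "\<integral>w. indicator (cball h 1) w * k (w /\<^sub>R norm w) \<partial>lborel"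
  have B: "0 \<le> B" using k[of 0] by auto
  have V: "0 < V" unfolding V_def by (rule measure_cball_unit_pos)
  have n1: "norm (w /\<^sub>R norm w) \<le> 1" for w :: 'a by (rule norm_normalize_le)
  have kn: "0 \<le> k (w /\<^sub>R norm w)" "k (w /\<^sub>R norm w) \<le> B" for w :: 'a
    using k[OF n1[of w]] by auto
  have vh: "\<bar>v \<bullet> h\<bar> \<le> norm h" if "norm v \<le> 1" for v :: 'a
    using Cauchy_Schwarz_ineq2[of v h] that mult_right_mono[OF that norm_ge_zero[of h]] by linarith
  have "norm h * norm h \<le> (1/2) * (1/2)" using h by (intro mult_mono) auto
  then have hs: "(norm h)\<^sup>2 \<le> 1 / 4" by (simp add: power2_eq_square)
  have intA: "integrable lborel (\<lambda>w. indicator (cball h 1) w * k (w /\<^sub>R norm w))"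
  proof (rule integrable_lborel_bounded_support[of _ "3/2" B])
    fix w :: 'a assume "3 / 2 < norm w"
    then have "1 < norm (w - h)" using h norm_triangle_ineq2[of w h] by linarith
    then show "indicator (cball h 1) w * k (w /\<^sub>R norm w) = 0" by (simp add: dist_norm norm_minus_commute)
  qed (use kn B in \<open>auto simp: indicator_def\<close>)
  define up where "up v = 1 + v \<bullet> h" for v :: 'a
  define lo where "lo v = 1 + v \<bullet> h - (norm h)\<^sup>2" for v :: 'a
  have up: "0 \<le> up v \<and> up v \<le> 2" if "norm v \<le> 1" for v using vh[OF that] h unfolding up_def by linarith
  have lo: "0 \<le> lo v \<and> lo v \<le> 2" if "norm v \<le> 1" for v
    using vh[OF that] h hs zero_le_power2[of "norm h"] unfolding lo_def by linarith
  have [measurable]: "up \<in> borel_measurable borel" "lo \<in> borel_measurable borel"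
    unfolding up_def[abs_def] lo_def[abs_def] by measurable
  have star_int: "integrable lborel (\<lambda>w. k (w /\<^sub>R norm w) * indicator {w. norm w \<le> r (w /\<^sub>R norm w)} w)"
    if [measurable]: "r \<in> borel_measurable borel" and r: "\<And>v. norm v \<le> 1 \<Longrightarrow> 0 \<le> r v \<and> r v \<le> 2" for r :: "'a \<Rightarrow> real"
  proof (rule integrable_lborel_bounded_support[of _ 2 B])
    fix w :: 'a assume "2 < norm w"
    then have "\<not> norm w \<le> r (w /\<^sub>R norm w)" using r[OF n1[of w]] by linarith
    then show "k (w /\<^sub>R norm w) * indicator {w. norm w \<le> r (w /\<^sub>R norm w)} w = 0" by simp
  qed (use kn B in \<open>auto simp: indicator_def\<close>)
  have "?A \<le> (\<integral>w. k (w /\<^sub>R norm w) * indicator {w. norm w \<le> up (w /\<^sub>R norm w)} w \<partial>lborel)"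
  proof (rule integral_mono_AE[OF intA star_int[OF _ up]])
    show "AE w in lborel. indicator (cball h 1) w * k (w /\<^sub>R norm w) \<le> k (w /\<^sub>R norm w) * indicator {w. norm w \<le> up (w /\<^sub>R norm w)} w"
      using AE_lborel_singleton[of "0::'a"]
      by eventually_elim (use shifted_ball_bounds(1)[OF h] kn in \<open>auto simp: indicator_def up_def\<close>)
  qed auto
  also have "\<dots> = V * (\<integral>u. k (u /\<^sub>R norm u) * up (u /\<^sub>R norm u) ^ ?n \<partial>uniform_ball)"
    unfolding V_def by (rule integral_star_shaped[OF _ _ k up]) auto
  finally have A1: "?A \<le> V * (\<integral>u. k (u /\<^sub>R norm u) * up (u /\<^sub>R norm u) ^ ?n \<partial>uniform_ball)" .
  have "(\<integral>w. k (w /\<^sub>R norm w) * indicator {w. norm w \<le> lo (w /\<^sub>R norm w)} w \<partial>lborel) \<le> ?A"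
  proof (rule integral_mono_AE[OF star_int[OF _ lo] intA])
    show "AE w in lborel. k (w /\<^sub>R norm w) * indicator {w. norm w \<le> lo (w /\<^sub>R norm w)} w \<le> indicator (cball h 1) w * k (w /\<^sub>R norm w)"
      using AE_lborel_singleton[of "0::'a"]
      by eventually_elim (use shifted_ball_bounds(2)[OF h] kn in \<open>auto simp: indicator_def lo_def\<close>)
  qed auto
  also have "(\<integral>w. k (w /\<^sub>R norm w) * indicator {w. norm w \<le> lo (w /\<^sub>R norm w)} w \<partial>lborel)
      = V * (\<integral>u. k (u /\<^sub>R norm u) * lo (u /\<^sub>R norm u) ^ ?n \<partial>uniform_ball)"
    unfolding V_def by (rule integral_star_shaped[OF _ _ k lo]) auto
  finally have A2: "V * (\<integral>u. k (u /\<^sub>R norm u) * lo (u /\<^sub>R norm u) ^ ?n \<partial>uniform_ball) \<le> ?A" .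
  have i1: "integrable uniform_ball (\<lambda>u::'a. k (u /\<^sub>R norm u))"
    by (rule integrable_uniform_ball_bounded[of _ B]) (use kn in auto)
  have i2: "integrable uniform_ball (\<lambda>u::'a. k (u /\<^sub>R norm u) * ((u /\<^sub>R norm u) \<bullet> h))"
  proof (rule integrable_uniform_ball_bounded[of _ "B * norm h"])
    fix u :: 'a
    show "norm (k (u /\<^sub>R norm u) * ((u /\<^sub>R norm u) \<bullet> h)) \<le> B * norm h"
      unfolding real_norm_def abs_mult using kn[of u] vh[OF n1[of u]] by (intro mult_mono) auto
  qed measurable
  have ip: "integrable uniform_ball (\<lambda>u. k (u /\<^sub>R norm u) * r (u /\<^sub>R norm u) ^ ?n)"
    if [measurable]: "r \<in> borel_measurable borel" and r: "\<And>v. norm v \<le> 1 \<Longrightarrow> 0 \<le> r v \<and> r v \<le> 2" for r :: "'a \<Rightarrow> real"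
  proof (rule integrable_uniform_ball_bounded[of _ "B * 2 ^ ?n"])
    fix u :: 'a
    show "norm (k (u /\<^sub>R norm u) * r (u /\<^sub>R norm u) ^ ?n) \<le> B * 2 ^ ?n"
      unfolding real_norm_def abs_mult using kn[of u] r[OF n1[of u]] by (intro mult_mono) (auto simp: power_abs intro: power_mono)
  qed measurable
  \<comment> \<open>The common first-order integrand; \<open>c\<close> is \<open>4 ^ n\<close> in
    the upper and \<open>- (4 ^ n)\<close> in the lower comparison, with \<open>n\<close> the
    dimension.\<close>
  let ?q = "\<lambda>c u. k (u /\<^sub>R norm u) + ?n * (k (u /\<^sub>R norm u) * ((u /\<^sub>R norm u) \<bullet> h)) + c * B * (norm h)\<^sup>2"
  have q_val: "(\<integral>u. ?q c u \<partial>uniform_ball) = (\<integral>v. k v \<partial>uniform_sphere) + ?n * (\<integral>v. k v * (v \<bullet> h) \<partial>uniform_sphere) + c * B * (norm h)\<^sup>2" for c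
    using i1 i2 U.prob_space by (simp add: integral_uniform_sphere)
  have iq: "integrable uniform_ball (?q c)" for c using i1 i2 by auto
  have "(\<integral>u. k (u /\<^sub>R norm u) * up (u /\<^sub>R norm u) ^ ?n \<partial>uniform_ball) \<le> (\<integral>u. ?q (4 ^ ?n) u \<partial>uniform_ball)"
  proof (rule integral_mono[OF ip[OF _ up] iq])
    fix u :: 'a
    let ?s = "(u /\<^sub>R norm u) \<bullet> h"
    have s: "\<bar>?s\<bar> \<le> norm h" by (rule vh[OF n1])
    have "up (u /\<^sub>R norm u) ^ ?n \<le> 1 + ?n * ?s + 4 ^ ?n * ?s\<^sup>2"
      unfolding up_def using s h by (intro power_one_plus_le) auto
    also have "\<dots> \<le> 1 + ?n * ?s + 4 ^ ?n * (norm h)\<^sup>2"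
      using s by (intro add_left_mono mult_left_mono) (auto simp: abs_le_square_iff[symmetric])
    finally have "k (u /\<^sub>R norm u) * up (u /\<^sub>R norm u) ^ ?n \<le> k (u /\<^sub>R norm u) * (1 + ?n * ?s + 4 ^ ?n * (norm h)\<^sup>2)"
      using kn by (intro mult_left_mono) auto
    also have "\<dots> = k (u /\<^sub>R norm u) + ?n * (k (u /\<^sub>R norm u) * ?s) + 4 ^ ?n * k (u /\<^sub>R norm u) * (norm h)\<^sup>2"
      by (simp add: algebra_simps)
    also have "\<dots> \<le> ?q (4 ^ ?n) u"
      using kn by (intro add_left_mono mult_right_mono mult_left_mono) auto
    finally show "k (u /\<^sub>R norm u) * up (u /\<^sub>R norm u) ^ ?n \<le> ?q (4 ^ ?n) u" .
  qed auto
  then have B1: "?A \<le> V * ((\<integral>v. k v \<partial>uniform_sphere) + ?n * (\<integral>v. k v * (v \<bullet> h) \<partial>uniform_sphere) + 4 ^ ?n * B * (norm h)\<^sup>2)"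
    using A1 V unfolding q_val by (meson mult_left_mono order_trans less_imp_le)
  have n4: "real ?n \<le> 4 ^ ?n" by (rule real_le_four_power)
  have "(\<integral>u. ?q (- (4 ^ ?n)) u \<partial>uniform_ball) \<le> (\<integral>u. k (u /\<^sub>R norm u) * lo (u /\<^sub>R norm u) ^ ?n \<partial>uniform_ball)"
  proof (rule integral_mono[OF iq ip[OF _ lo]])
    fix u :: 'a
    let ?s = "(u /\<^sub>R norm u) \<bullet> h"
    have s: "\<bar>?s\<bar> \<le> norm h" by (rule vh[OF n1])
    have "?q (- (4 ^ ?n)) u \<le> k (u /\<^sub>R norm u) + ?n * (k (u /\<^sub>R norm u) * ?s) - ?n * k (u /\<^sub>R norm u) * (norm h)\<^sup>2"
      using mult_mono[OF mult_mono[OF n4 kn(2)[of u] _ kn(1)] order_refl[of "(norm h)\<^sup>2"]] kn B by simp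
    also have "\<dots> = k (u /\<^sub>R norm u) * (1 + ?n * (?s - (norm h)\<^sup>2))"
      by (simp add: algebra_simps)
    also have "\<dots> \<le> k (u /\<^sub>R norm u) * lo (u /\<^sub>R norm u) ^ ?n"
    proof (rule mult_left_mono[OF _ kn(1)])
      have "-1 \<le> ?s - (norm h)\<^sup>2" using s h hs by linarith
      from Bernoulli_inequality[OF this, of ?n]
      show "1 + ?n * (?s - (norm h)\<^sup>2) \<le> lo (u /\<^sub>R norm u) ^ ?n" by (simp add: lo_def add_diff_eq)
    qed
    finally show "?q (- (4 ^ ?n)) u \<le> k (u /\<^sub>R norm u) * lo (u /\<^sub>R norm u) ^ ?n" .
  qed auto
  then have B2: "V * ((\<integral>v. k v \<partial>uniform_sphere) + ?n * (\<integral>v. k v * (v \<bullet> h) \<partial>uniform_sphere) + - (4 ^ ?n) * B * (norm h)\<^sup>2) \<le> ?A"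
    using A2 V unfolding q_val by (meson mult_left_mono order_trans less_imp_le)
  show ?thesis using B1 B2 by (simp add: algebra_simps abs_le_iff)
qed

text \<open>A second-order effect: the two balls differ only where \<open>norm w\<close> is within
  \<open>norm h\<close> of 1, so moving \<open>w\<close> to the sphere changes \<open>f\<close> by
  at most \<open>\<Lambda> * norm h\<close>, and this shell has a volume of order
  \<open>norm h\<close>.\<close>

lemma shifted_ball_radial_error:
  fixes f :: "'a::euclidean_space \<Rightarrow> real" and h :: 'a
  defines "V \<equiv> measure lborel (cball 0 1 :: 'a set)"
  assumes f: "\<Lambda>-lipschitz_on UNIV f" and h: "norm h \<le> 1 / 2"
  shows "\<bar>\<integral>w. (indicator (cball h 1) w - indicator (cball 0 1) w) * (f w - f (w /\<^sub>R norm w)) \<partial>lborel\<bar>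
    \<le> V * (\<Lambda> * (2 * DIM('a) + 4 ^ DIM('a)) * (norm h)\<^sup>2)"
proof -
  let ?n = "DIM('a)" and ?t = "norm h"
  have \<Lambda>: "0 \<le> \<Lambda>" using f by (rule lipschitz_on_nonneg)
  have [measurable]: "f \<in> borel_measurable borel"
    using f by (intro borel_measurable_continuous_onI lipschitz_on_continuous_on)
  let ?g = "\<lambda>w. (indicator (cball h 1) w - indicator (cball 0 1) w) * (f w - f (w /\<^sub>R norm w))"
  let ?b = "\<lambda>w::'a. \<Lambda> * ?t * (indicator (cball 0 (1 + ?t)) w - indicator (ball 0 (1 - ?t)) w)"
  have pw: "\<bar>?g w\<bar> \<le> ?b w" if w: "w \<noteq> 0" for w
  proof (cases "indicator (cball h 1) w = (indicator (cball 0 1) w :: real)")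
    case True
    have "indicator (ball 0 (1 - ?t)) w \<le> (indicator (cball 0 (1 + ?t)) w :: real)"
      using norm_ge_zero[of h] by (auto simp: indicator_def simp del: norm_ge_zero)
    with True \<Lambda> show ?thesis by simp
  next
    case False
    have tri: "\<bar>norm (w - h) - norm w\<bar> \<le> ?t" using norm_triangle_ineq3[of "w - h" w] by simp
    from False have "norm (w - h) \<le> 1 \<and> 1 < norm w \<or> norm w \<le> 1 \<and> 1 < norm (w - h)"
      by (auto simp: indicator_def dist_norm norm_minus_commute split: if_splits)
    then have nw: "1 - ?t < norm w \<and> norm w \<le> 1 + ?t \<or> norm w = 1 - ?t" "\<bar>norm w - 1\<bar> \<le> ?t" using tri by linarith+
    then have ind: "indicator (cball 0 (1 + ?t)) w - indicator (ball 0 (1 - ?t)) w = (1 :: real)"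
      by (auto simp: indicator_def)
    have "\<bar>f w - f (w /\<^sub>R norm w)\<bar> \<le> \<Lambda> * norm (w - w /\<^sub>R norm w)"
      using lipschitz_on_normD[OF f, of w "w /\<^sub>R norm w"] by simp
    also have "w - w /\<^sub>R norm w = (norm w - 1) *\<^sub>R (w /\<^sub>R norm w)"
      using w by (simp add: scaleR_diff_left left_diff_distrib)
    also have "norm \<dots> = \<bar>norm w - 1\<bar>" using w by (simp add: abs_mult)
    also have "\<Lambda> * \<dots> \<le> \<Lambda> * ?t" using nw \<Lambda> by (intro mult_left_mono) auto
    finally have 1: "\<bar>f w - f (w /\<^sub>R norm w)\<bar> \<le> \<Lambda> * ?t" .
    have 2: "\<bar>indicator (cball h 1) w - indicator (cball 0 1) w\<bar> = (1 :: real)"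
      using False by (auto simp: indicator_def split: if_splits)
    show ?thesis unfolding abs_mult ind 2 using 1 by simp
  qed
  have fin: "emeasure lborel (cball c r :: 'a set) < \<infinity>" "emeasure lborel (ball c r :: 'a set) < \<infinity>" for c r
    using emeasure_lborel_cball_finite emeasure_lborel_ball_finite by auto
  have ib: "integrable lborel ?b"
    using fin by (intro integrable_mult_right Bochner_Integration.integrable_diff integrable_real_indicator) auto
  have "\<bar>\<integral>w. ?g w \<partial>lborel\<bar> \<le> (\<integral>w. \<bar>?g w\<bar> \<partial>lborel)"
    using integral_norm_bound[of lborel ?g] by simp
  also have "\<dots> \<le> (\<integral>w. ?b w \<partial>lborel)"
  proof (rule integral_mono_AE')
    show "AE w in lborel. \<bar>?g w\<bar> \<le> ?b w"
      using AE_lborel_singleton[of "0::'a"] by eventually_elim (rule pw)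
    show "AE w in lborel. 0 \<le> ?b w"
      using AE_lborel_singleton[of "0::'a"] by eventually_elim (use pw abs_ge_zero order_trans in blast)
  qed (use ib in auto)
  also have "\<dots> = \<Lambda> * ?t * (measure lborel (cball 0 (1 + ?t) :: 'a set) - measure lborel (ball 0 (1 - ?t) :: 'a set))"
    using fin by (simp add: Bochner_Integration.integral_diff integrable_real_indicator)
  also have "measure lborel (cball 0 (1 + ?t) :: 'a set) - measure lborel (ball 0 (1 - ?t) :: 'a set)
     = V * ((1 + ?t) ^ ?n - (1 - ?t) ^ ?n)"
    using h by (simp add: V_def content_cball content_ball algebra_simps)
  also have "\<Lambda> * ?t * (V * ((1 + ?t) ^ ?n - (1 - ?t) ^ ?n)) \<le> \<Lambda> * ?t * (V * ((2 * ?n + 4 ^ ?n) * ?t))"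
  proof (intro mult_left_mono)
    have 1: "(1 + ?t) ^ ?n \<le> 1 + ?n * ?t + 4 ^ ?n * ?t\<^sup>2" using h by (intro power_one_plus_le) auto
    have 2: "1 - ?n * ?t \<le> (1 - ?t) ^ ?n" using h Bernoulli_inequality[of "- ?t" ?n] by simp
    have 3: "4 ^ ?n * ?t\<^sup>2 \<le> 4 ^ ?n * ?t"
      using h by (intro mult_left_mono) (auto simp: power2_eq_square mult_left_le)
    have "(2 * ?n + 4 ^ ?n) * ?t = 2 * (?n * ?t) + 4 ^ ?n * ?t" by (simp add: algebra_simps)
    then show "(1 + ?t) ^ ?n - (1 - ?t) ^ ?n \<le> (2 * ?n + 4 ^ ?n) * ?t"
      using 1 2 3 by linarith
  qed (use \<Lambda> in \<open>auto simp: V_def\<close>)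
  also have "\<dots> = V * (\<Lambda> * (2 * ?n + 4 ^ ?n) * ?t\<^sup>2)" by (simp add: power2_eq_square)
  finally show ?thesis .
qed

lemma integral_uniform_sphere_odd:
  fixes f :: "'a::euclidean_space \<Rightarrow> 'b::euclidean_space"
  assumes [measurable]: "f \<in> borel_measurable borel" and "\<And>v. f (- v) = - f v"
  shows "(\<integral>v. f v \<partial>uniform_sphere) = 0"
proof -
  have "(\<integral>v. f v \<partial>uniform_sphere) = (\<integral>v. f (- v) \<partial>uniform_sphere)"
    by (rule integral_invariant[OF uniform_sphere_invariant(1), symmetric]) auto
  also have "\<dots> = - (\<integral>v. f v \<partial>uniform_sphere)"
    by (simp add: assms(2))
  finally have "2 *\<^sub>R (\<integral>v. f v \<partial>uniform_sphere) = 0"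
    by (simp add: scaleR_2 eq_neg_iff_add_eq_0)
  then show ?thesis by simp
qed

text \<open>Translating the domain moves the derivative from \<open>f\<close> to the ball, so
  \<open>f\<close> may be merely Lipschitz. On the difference of the shifted and the unit ball,
  \<open>f\<close> is split into its value on the sphere, handled by the angular expansion, and the
  radial error.\<close>

lemma uniform_ball_smoothing_expansion:
  fixes f :: "'a::euclidean_space \<Rightarrow> real"
  assumes f: "\<Lambda>-lipschitz_on UNIV f"
  shows "\<exists>C. \<forall>h. norm h \<le> 1 / 2 \<longrightarrow>
    \<bar>(\<integral>u. f (h + u) \<partial>uniform_ball) - (\<integral>u. f u \<partial>uniform_ball) - DIM('a) * ((\<integral>v. f v *\<^sub>R v \<partial>uniform_sphere) \<bullet> h)\<bar> \<le> C * (norm h)\<^sup>2"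
proof -
  let ?n = "DIM('a)" and ?V = "measure lborel (cball 0 1 :: 'a set)"
  interpret U: prob_space "uniform_ball :: 'a measure" by (rule prob_space_uniform_ball)
  interpret S: prob_space "uniform_sphere :: 'a measure" by (rule prob_space_uniform_sphere)
  have V: "0 < ?V" by (rule measure_cball_unit_pos)
  have \<Lambda>: "0 \<le> \<Lambda>" using f by (rule lipschitz_on_nonneg)
  have [measurable]: "f \<in> borel_measurable borel"
    using f by (intro borel_measurable_continuous_onI lipschitz_on_continuous_on)
  have fb: "\<bar>f v\<bar> \<le> \<bar>f 0\<bar> + \<Lambda> * norm v" for v
    using lipschitz_on_normD[OF f, of v 0] by simp
  define M where "M = \<bar>f 0\<bar> + \<Lambda>"
  have fM: "\<bar>f v\<bar> \<le> M" if "norm v \<le> 1" for v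
    using fb[of v] mult_left_mono[OF that \<Lambda>] by (simp add: M_def)
  \<comment> \<open>The angular expansion asks for a nonnegative weight. The added constant drops
    out again: both balls have the same volume, and \<open>v\<close> has mean zero on the
    sphere.\<close>
  define k where "k v = f v + M" for v
  have [measurable]: "k \<in> borel_measurable borel" unfolding k_def[abs_def] by measurable
  have kb: "0 \<le> k v \<and> k v \<le> 2 * M" if "norm v \<le> 1" for v using fM[OF that] by (auto simp: k_def abs_le_iff)
  define C where "C = 2 * (4 ^ ?n * (2 * M)) + \<Lambda> * (2 * ?n + 4 ^ ?n)"
  have "\<bar>(\<integral>u. f (h + u) \<partial>uniform_ball) - (\<integral>u. f u \<partial>uniform_ball) - ?n * ((\<integral>v. f v *\<^sub>R v \<partial>uniform_sphere) \<bullet> h)\<bar> \<le> C * (norm h)\<^sup>2"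
    if h: "norm h \<le> 1 / 2" for h
  proof -
    let ?I = "\<lambda>(c::'a) w. indicator (cball c 1) w :: real"
    have n1: "norm (w /\<^sub>R norm w) \<le> 1" for w :: 'a by (rule norm_normalize_le)
    have c2: "norm w \<le> 3 / 2" if "?I h w \<noteq> 0 \<or> ?I 0 w \<noteq> 0" for w
      using that h norm_triangle_ineq2[of w h] by (auto simp: indicator_def dist_norm norm_minus_commute split: if_splits)
    have int1: "integrable lborel (\<lambda>w. ?I c w * g w)"
      if [measurable]: "g \<in> borel_measurable borel" and g: "\<And>w. norm w \<le> 3 / 2 \<Longrightarrow> \<bar>g w\<bar> \<le> B" and c: "c = h \<or> c = 0" for c B and g :: "'a \<Rightarrow> real"
    proof (rule integrable_lborel_bounded_support[of _ "3/2" B])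
      fix w :: 'a assume "norm w \<le> 3 / 2"
      then show "\<bar>?I c w * g w\<bar> \<le> B" using g[of w] abs_ge_zero[of "g w"] by (auto simp: indicator_def simp del: abs_ge_zero)
    next
      fix w :: 'a assume "3 / 2 < norm w"
      then show "?I c w * g w = 0" using c2[of w] c by (auto simp del: indicator_eq_0_iff)
    next
      show "(\<lambda>w. ?I c w * g w) \<in> borel_measurable borel"
        by (intro borel_measurable_times borel_measurable_indicator that(1)) auto
    qed
    have f2: "\<bar>f w\<bar> \<le> \<bar>f 0\<bar> + \<Lambda> * (3/2)" if "norm w \<le> 3/2" for w
      using fb[of w] mult_left_mono[OF that \<Lambda>] by linarith
    have intf: "integrable lborel (\<lambda>w. ?I c w * f w)" if "c = h \<or> c = 0" for c
      by (rule int1[OF _ f2 that]) auto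
    have intk: "integrable lborel (\<lambda>w. ?I c w * k (w /\<^sub>R norm w))" if "c = h \<or> c = 0" for c
      by (rule int1[OF _ _ that, of _ "2 * M"]) (use kb[OF n1] in auto)
    have int1': "integrable lborel (?I c)" for c :: 'a
      using emeasure_lborel_cball_finite[of c 1] by (intro integrable_real_indicator) auto
    have shift: "?V * (\<integral>u. f (c + u) \<partial>uniform_ball) = (\<integral>w. ?I c w * f w \<partial>lborel)" for c
    proof -
      have "?V * (\<integral>u. f (c + u) \<partial>uniform_ball) = (\<integral>u. ?I 0 u * f (c + u) \<partial>lborel)"
        by (rule integral_uniform_ball_real[symmetric]) auto
      also have "\<dots> = (\<integral>u. ?I c (c + u) * f (c + u) \<partial>lborel)"
        by (intro Bochner_Integration.integral_cong) (auto simp: indicator_def dist_norm)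
      also have "\<dots> = (\<integral>w. ?I c w * f w \<partial>lborel)"
        by (rule integral_lborel_translate[of "\<lambda>w. ?I c w * f w"]) auto
      finally show ?thesis .
    qed
    have vol: "(\<integral>w. ?I h w \<partial>lborel) = (\<integral>w. ?I 0 w \<partial>lborel)"
      by (simp add: content_cball)
    let ?D = "\<integral>w. (?I h w - ?I 0 w) * (f w - f (w /\<^sub>R norm w)) \<partial>lborel"
    let ?A = "\<lambda>c. \<integral>w. ?I c w * k (w /\<^sub>R norm w) \<partial>lborel"
    have "(\<lambda>w. (?I h w - ?I 0 w) * (f w - f (w /\<^sub>R norm w)))
       = (\<lambda>w. (?I h w * f w - ?I 0 w * f w) - (?I h w * k (w /\<^sub>R norm w) - ?I 0 w * k (w /\<^sub>R norm w)) + M * (?I h w - ?I 0 w))"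
      by (auto simp: k_def fun_eq_iff algebra_simps)
    then have "?D = ((\<integral>w. ?I h w * f w \<partial>lborel) - (\<integral>w. ?I 0 w * f w \<partial>lborel)) - (?A h - ?A 0) + M * ((\<integral>w. ?I h w \<partial>lborel) - (\<integral>w. ?I 0 w \<partial>lborel))"
      using intf intk int1' by simp
    then have D: "?V * (\<integral>u. f (h + u) \<partial>uniform_ball) - ?V * (\<integral>u. f u \<partial>uniform_ball) = ?D + (?A h - ?A 0)"
      using vol shift[of h] shift[of 0] by simp
    have Dle: "\<bar>?D\<bar> \<le> ?V * (\<Lambda> * (2 * ?n + 4 ^ ?n) * (norm h)\<^sup>2)"
      by (rule shifted_ball_radial_error[OF f h])
    let ?S0 = "\<integral>v. k v \<partial>uniform_sphere" and ?S1 = "\<lambda>c. \<integral>v. k v * (v \<bullet> c) \<partial>uniform_sphere"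
    have Ah: "\<bar>?A h - ?V * ?S0 - ?V * (?n * ?S1 h)\<bar> \<le> ?V * (4 ^ ?n * (2 * M) * (norm h)\<^sup>2)"
      by (rule shifted_ball_angular_expansion[OF _ kb h]) auto
    have A0: "\<bar>?A 0 - ?V * ?S0 - ?V * (?n * ?S1 0)\<bar> \<le> ?V * (4 ^ ?n * (2 * M) * (norm (0::'a))\<^sup>2)"
      by (rule shifted_ball_angular_expansion[OF _ kb]) auto
    have isf: "integrable uniform_sphere (\<lambda>v. f v *\<^sub>R v)"
      by (rule integrable_uniform_sphere_bounded[of _ M]) (use fM in auto)
    have isv: "integrable uniform_sphere (\<lambda>v::'a. v)"
      by (rule integrable_uniform_sphere_bounded[of _ 1]) auto
    have "?S1 h = (\<integral>v. (f v *\<^sub>R v) \<bullet> h + M * (v \<bullet> h) \<partial>uniform_sphere)"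
      by (simp add: k_def algebra_simps)
    also have "\<dots> = (\<integral>v. f v *\<^sub>R v \<partial>uniform_sphere) \<bullet> h + M * ((\<integral>v. v \<partial>uniform_sphere) \<bullet> h)"
    proof -
      have j: "integrable uniform_sphere (\<lambda>v. (f v *\<^sub>R v) \<bullet> h)" "integrable uniform_sphere (\<lambda>v. M * (v \<bullet> h))"
        by (rule integrable_inner_left, rule isf) (rule integrable_mult_right, rule integrable_inner_left, rule isv)
      show ?thesis
        unfolding Bochner_Integration.integral_add[OF j] integral_mult_right_zero
          integral_inner_left[OF isf] integral_inner_left[OF isv] ..
    qed
    also have "(\<integral>v. v \<partial>(uniform_sphere :: 'a measure)) = 0"
      by (rule integral_uniform_sphere_odd) auto
    finally have S1: "?S1 h = (\<integral>v. f v *\<^sub>R v \<partial>uniform_sphere) \<bullet> h" by simp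
    let ?E = "(\<integral>u. f (h + u) \<partial>uniform_ball) - (\<integral>u. f u \<partial>uniform_ball) - ?n * ((\<integral>v. f v *\<^sub>R v \<partial>uniform_sphere) \<bullet> h)"
    have "\<bar>?V * ?E\<bar> \<le> ?V * (\<Lambda> * (2 * ?n + 4 ^ ?n) * (norm h)\<^sup>2) + ?V * (4 ^ ?n * (2 * M) * (norm h)\<^sup>2)"
    proof -
      have "?V * ?E = ?D + (?A h - ?V * ?S0 - ?V * (?n * ?S1 h)) - (?A 0 - ?V * ?S0 - ?V * (?n * ?S1 0))"
        using D S1 by (simp add: algebra_simps)
      then show ?thesis using Dle Ah A0 by simp
    qed
    also have "\<dots> \<le> ?V * (C * (norm h)\<^sup>2)"
    proof -
      have "0 \<le> M" using fM[of 0] by simp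
      then have "0 \<le> ?V * (4 ^ ?n * (2 * M) * (norm h)\<^sup>2)" using V by (intro mult_nonneg_nonneg) auto
      then show ?thesis by (simp add: C_def algebra_simps)
    qed
    finally show ?thesis using V by (simp add: abs_mult)
  qed
  then show ?thesis by blast
qed

section \<open>The gradient of the ball smoothing and its Lipschitz constant\<close>

definition sphere_gradient :: "real \<Rightarrow> ('a::euclidean_space \<Rightarrow> real) \<Rightarrow> 'a \<Rightarrow> 'a" where
  "sphere_gradient \<eta> f x = (DIM('a) / \<eta>) *\<^sub>R (\<integral>v. f (x + \<eta> *\<^sub>R v) *\<^sub>R v \<partial>uniform_sphere)"

lemma has_derivative_quadratic_error:
  fixes f :: "'a::real_inner \<Rightarrow> real"
  assumes "0 < r" and bound: "\<And>d. norm d \<le> r \<Longrightarrow> \<bar>f (x + d) - f x - g \<bullet> d\<bar> \<le> C * (norm d)\<^sup>2"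
  shows "GDERIV f x :> g"
  unfolding gderiv_def has_derivative_at
proof
  show "bounded_linear (\<lambda>h. h \<bullet> g)" by (rule bounded_linear_inner_left)
  have "((\<lambda>h. norm (f (x + h) - f x - h \<bullet> g) / norm h) \<longlongrightarrow> 0) (at 0)"
  proof (rule Lim_null_comparison)
    show "\<forall>\<^sub>F h in at 0. norm (norm (f (x + h) - f x - h \<bullet> g) / norm h) \<le> \<bar>C\<bar> * norm h"
      unfolding eventually_at
    proof (intro exI[of _ r] conjI ballI impI assms(1))
      fix h :: 'a assume h: "h \<noteq> 0 \<and> dist h 0 < r"
      have "\<bar>f (x + h) - f x - g \<bullet> h\<bar> \<le> C * (norm h)\<^sup>2" using h by (intro bound) auto
      also have "\<dots> \<le> \<bar>C\<bar> * (norm h)\<^sup>2" by (intro mult_right_mono) auto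
      finally show "norm (norm (f (x + h) - f x - h \<bullet> g) / norm h) \<le> \<bar>C\<bar> * norm h"
        using h by (simp add: inner_commute divide_le_eq power2_eq_square)
    qed
    have "((\<lambda>h::'a. \<bar>C\<bar> * norm h) \<longlongrightarrow> \<bar>C\<bar> * norm (0::'a)) (at 0)" by (intro tendsto_intros)
    then show "((\<lambda>h::'a. \<bar>C\<bar> * norm h) \<longlongrightarrow> 0) (at 0)" by simp
  qed
  then show "(\<lambda>h. norm (f (x + h) - f x - h \<bullet> g) / norm h) \<midarrow>0\<rightarrow> 0" .
qed

lemma lipschitz_on_borel_measurable:
  fixes f :: "'a::euclidean_space \<Rightarrow> 'b::real_normed_vector"
  assumes "L-lipschitz_on UNIV f"
  shows "f \<in> borel_measurable borel"
  using assms by (intro borel_measurable_continuous_onI lipschitz_on_continuous_on)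

lemma lipschitz_on_affine:
  fixes f :: "'a::real_normed_vector \<Rightarrow> 'b::metric_space"
  assumes "L-lipschitz_on UNIV f"
  shows "(L * \<bar>\<eta>\<bar>)-lipschitz_on UNIV (\<lambda>u. f (x + \<eta> *\<^sub>R u))"
proof (rule lipschitz_onI)
  fix u w :: 'a
  have "dist (f (x + \<eta> *\<^sub>R u)) (f (x + \<eta> *\<^sub>R w)) \<le> L * dist (x + \<eta> *\<^sub>R u) (x + \<eta> *\<^sub>R w)"
    by (rule lipschitz_onD[OF assms]) auto
  then show "dist (f (x + \<eta> *\<^sub>R u)) (f (x + \<eta> *\<^sub>R w)) \<le> L * \<bar>\<eta>\<bar> * dist u w"
    by (simp add: dist_norm scaleR_diff_right[symmetric] mult.assoc)
qed (use lipschitz_on_nonneg[OF assms] in auto)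

text \<open>\<open>C\<close> may depend on \<open>x\<close>. The quadratic remainder, stronger than
  differentiability, also controls the finite step taken in
  \<open>sphere_gradient_in_closure_clarke\<close>.\<close>

lemma ball_smoothing_expansion:
  fixes f :: "'a::euclidean_space \<Rightarrow> real"
  assumes f: "\<Lambda>-lipschitz_on UNIV f" and \<eta>: "0 < \<eta>"
  shows "\<exists>C. \<forall>d. norm d \<le> \<eta> / 2 \<longrightarrow>
    \<bar>ball_smoothing \<eta> f (x + d) - ball_smoothing \<eta> f x - sphere_gradient \<eta> f x \<bullet> d\<bar> \<le> C * (norm d)\<^sup>2"
proof -
  obtain C where C: "\<And>h. norm h \<le> 1 / 2 \<Longrightarrow>
    \<bar>(\<integral>u. f (x + \<eta> *\<^sub>R (h + u)) \<partial>uniform_ball) - (\<integral>u. f (x + \<eta> *\<^sub>R u) \<partial>uniform_ball)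
      - DIM('a) * ((\<integral>v. f (x + \<eta> *\<^sub>R v) *\<^sub>R v \<partial>uniform_sphere) \<bullet> h)\<bar> \<le> C * (norm h)\<^sup>2"
    using uniform_ball_smoothing_expansion[OF lipschitz_on_affine[OF f, of \<eta> x]] by blast
  show ?thesis
  proof (intro exI[of _ "C / \<eta>\<^sup>2"] allI impI)
    fix d :: 'a assume "norm d \<le> \<eta> / 2"
    then have "norm (d /\<^sub>R \<eta>) \<le> 1 / 2" using \<eta> by (simp add: field_simps)
    note C' = C[OF this]
    have 1: "x + \<eta> *\<^sub>R (d /\<^sub>R \<eta> + u) = x + d + \<eta> *\<^sub>R u" for u
      using \<eta> by (simp add: scaleR_add_right)
    have 2: "real DIM('a) * (G \<bullet> (d /\<^sub>R \<eta>)) = ((DIM('a) / \<eta>) *\<^sub>R G) \<bullet> d" for G :: 'a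
      by (simp add: divide_inverse)
    have 3: "C * (norm (d /\<^sub>R \<eta>))\<^sup>2 = C / \<eta>\<^sup>2 * (norm d)\<^sup>2"
      using \<eta> by (simp add: power_mult_distrib divide_inverse power_inverse)
    show "\<bar>ball_smoothing \<eta> f (x + d) - ball_smoothing \<eta> f x - sphere_gradient \<eta> f x \<bullet> d\<bar> \<le> C / \<eta>\<^sup>2 * (norm d)\<^sup>2"
      using C' unfolding 1 2 3 ball_smoothing_def sphere_gradient_def .
  qed
qed

lemma GDERIV_ball_smoothing:
  assumes f: "\<Lambda>-lipschitz_on UNIV f" and \<eta>: "0 < \<eta>"
  shows "GDERIV (ball_smoothing \<eta> f) x :> sphere_gradient \<eta> f x"
proof -
  obtain C where "\<And>d. norm d \<le> \<eta> / 2 \<Longrightarrow>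
    \<bar>ball_smoothing \<eta> f (x + d) - ball_smoothing \<eta> f x - sphere_gradient \<eta> f x \<bullet> d\<bar> \<le> C * (norm d)\<^sup>2"
    using ball_smoothing_expansion[OF f \<eta>, of x] by blast
  then show ?thesis using \<eta> by (intro has_derivative_quadratic_error[of "\<eta> / 2"]) auto
qed

lemma GDERIV_unique:
  assumes "GDERIV f x :> g" "GDERIV f x :> g'"
  shows "g = g'"
proof -
  have "(\<lambda>h. h \<bullet> g) = (\<lambda>h. h \<bullet> g')"
    using assms unfolding gderiv_def by (rule has_derivative_unique)
  then have "(g - g') \<bullet> g = (g - g') \<bullet> g'" by metis
  then have "(g - g') \<bullet> (g - g') = 0" by (simp add: inner_diff_right)
  then show ?thesis by simp
qed

lemma gradient_eqI: "GDERIV f x :> g \<Longrightarrow> gradient f x = g"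
  unfolding gradient_def by (rule the_equality) (auto intro: GDERIV_unique)

lemma gradient_ball_smoothing:
  "\<Lambda>-lipschitz_on UNIV f \<Longrightarrow> 0 < \<eta> \<Longrightarrow> gradient (ball_smoothing \<eta> f) = sphere_gradient \<eta> f"
  by (intro ext gradient_eqI GDERIV_ball_smoothing)

lemma lipschitz_on_ball_smoothing:
  fixes f :: "'a::euclidean_space \<Rightarrow> real"
  assumes f: "\<Lambda>-lipschitz_on UNIV f"
  shows "\<Lambda>-lipschitz_on UNIV (ball_smoothing \<eta> f)"
    and "\<bar>ball_smoothing \<eta> f x - f x\<bar> \<le> \<Lambda> * \<bar>\<eta>\<bar>"
    and "integrable uniform_ball (\<lambda>u. f (x + \<eta> *\<^sub>R u))"
proof -
  interpret U: prob_space "uniform_ball :: 'a measure" by (rule prob_space_uniform_ball)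
  have [measurable]: "f \<in> borel_measurable borel" by (rule lipschitz_on_borel_measurable[OF f])
  have \<Lambda>: "0 \<le> \<Lambda>" using f by (rule lipschitz_on_nonneg)
  have b: "\<bar>f (x + \<eta> *\<^sub>R u) - f x\<bar> \<le> \<Lambda> * \<bar>\<eta>\<bar>" if "norm u \<le> 1" for u x
  proof -
    have "\<bar>f (x + \<eta> *\<^sub>R u) - f x\<bar> \<le> \<Lambda> * norm (x + \<eta> *\<^sub>R u - x)"
      using lipschitz_on_normD[OF f, of "x + \<eta> *\<^sub>R u" x] by simp
    also have "\<dots> \<le> \<Lambda> * \<bar>\<eta>\<bar>" using that \<Lambda> by (intro mult_left_mono) (auto simp: mult_left_le)
    finally show ?thesis .
  qed
  have int: "integrable uniform_ball (\<lambda>u. f (x + \<eta> *\<^sub>R u))" for x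
  proof (rule integrable_uniform_ball_bounded[of _ "\<bar>f x\<bar> + \<Lambda> * \<bar>\<eta>\<bar>"])
    fix u :: 'a assume "norm u \<le> 1"
    from b[OF this, of x] show "norm (f (x + \<eta> *\<^sub>R u)) \<le> \<bar>f x\<bar> + \<Lambda> * \<bar>\<eta>\<bar>" by simp
  qed measurable
  then show "integrable uniform_ball (\<lambda>u. f (x + \<eta> *\<^sub>R u))" .
  have "\<bar>ball_smoothing \<eta> f x - f x\<bar> = \<bar>\<integral>u. f (x + \<eta> *\<^sub>R u) - f x \<partial>uniform_ball\<bar>"
    using int[of x] U.prob_space by (simp add: ball_smoothing_def)
  also have "\<dots> \<le> (\<integral>u. \<bar>f (x + \<eta> *\<^sub>R u) - f x\<bar> \<partial>uniform_ball)"
    using integral_norm_bound[of uniform_ball "\<lambda>u. f (x + \<eta> *\<^sub>R u) - f x"] by simp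
  also have "\<dots> \<le> (\<integral>u. \<Lambda> * \<bar>\<eta>\<bar> \<partial>(uniform_ball :: 'a measure))"
  proof (rule integral_mono_AE)
    show "AE u in uniform_ball. \<bar>f (x + \<eta> *\<^sub>R u) - f x\<bar> \<le> \<Lambda> * \<bar>\<eta>\<bar>"
      using AE_uniform_ball[where 'a='a] by eventually_elim (rule b, simp)
  qed (use int[of x] in auto)
  finally show "\<bar>ball_smoothing \<eta> f x - f x\<bar> \<le> \<Lambda> * \<bar>\<eta>\<bar>" using U.prob_space by simp
  show "\<Lambda>-lipschitz_on UNIV (ball_smoothing \<eta> f)"
  proof (rule lipschitz_onI[OF _ \<Lambda>])
    fix x y :: 'a
    have "\<bar>ball_smoothing \<eta> f x - ball_smoothing \<eta> f y\<bar> = \<bar>\<integral>u. f (x + \<eta> *\<^sub>R u) - f (y + \<eta> *\<^sub>R u) \<partial>uniform_ball\<bar>"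
      using int[of x] int[of y] by (simp add: ball_smoothing_def)
    also have "\<dots> \<le> (\<integral>u. \<bar>f (x + \<eta> *\<^sub>R u) - f (y + \<eta> *\<^sub>R u)\<bar> \<partial>uniform_ball)"
      using integral_norm_bound[of uniform_ball "\<lambda>u. f (x + \<eta> *\<^sub>R u) - f (y + \<eta> *\<^sub>R u)"] by simp
    also have "\<dots> \<le> (\<integral>u. \<Lambda> * dist x y \<partial>(uniform_ball :: 'a measure))"
    proof (rule integral_mono)
      fix u :: 'a
      show "\<bar>f (x + \<eta> *\<^sub>R u) - f (y + \<eta> *\<^sub>R u)\<bar> \<le> \<Lambda> * dist x y"
        using lipschitz_onD[OF f, of "x + \<eta> *\<^sub>R u" "y + \<eta> *\<^sub>R u"] by (simp add: dist_real_def)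
    qed (use int[of x] int[of y] in auto)
    finally show "dist (ball_smoothing \<eta> f x) (ball_smoothing \<eta> f y) \<le> \<Lambda> * dist x y"
      using U.prob_space by (simp add: dist_real_def)
  qed
qed

text \<open>Jensen's inequality for the square, \<open>(norm e)^2 / n\<close> being the mean of
  \<open>(e \<bullet> v)^2\<close>. The gain of \<open>sqrt n\<close> over Cauchy-Schwarz is what
  makes the Lipschitz constant of the smoothed gradients of order \<open>sqrt n\<close> rather than
  \<open>n\<close>.\<close>

lemma uniform_sphere_abs_inner:
  fixes e :: "'a::euclidean_space"
  shows "(\<integral>v. \<bar>v \<bullet> e\<bar> \<partial>uniform_sphere) \<le> norm e / sqrt DIM('a)"
proof (cases "e = 0")
  case False
  interpret S: prob_space "uniform_sphere :: 'a measure" by (rule prob_space_uniform_sphere)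
  \<comment> \<open>The weight for which both summands of the arithmetic-geometric mean bound have
    the mean \<open>s / 2\<close>.\<close>
  define s where "s = norm e / sqrt DIM('a)"
  have s: "0 < s" using False by (simp add: s_def)
  have vb: "\<bar>v \<bullet> e\<bar> \<le> norm e" if "norm v = 1" for v using Cauchy_Schwarz_ineq2[of v e] that by simp
  have i1: "integrable uniform_sphere (\<lambda>v::'a. \<bar>v \<bullet> e\<bar>)"
    by (rule integrable_uniform_sphere_bounded[of _ "norm e"]) (use vb in auto)
  have i2: "integrable uniform_sphere (\<lambda>v::'a. (e \<bullet> v)\<^sup>2)"
  proof (rule integrable_uniform_sphere_bounded[of _ "(norm e)\<^sup>2"])
    fix v :: 'a assume "norm v = 1"
    from vb[OF this] show "norm ((e \<bullet> v)\<^sup>2) \<le> (norm e)\<^sup>2"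
      by (simp add: inner_commute abs_le_square_iff[symmetric])
  qed measurable
  have "(\<integral>v. \<bar>v \<bullet> e\<bar> \<partial>uniform_sphere) \<le> (\<integral>v. (1 / (2 * s)) * (e \<bullet> v)\<^sup>2 + s / 2 \<partial>uniform_sphere)"
  proof (rule integral_mono[OF i1])
    fix v :: 'a
    have "2 * s * \<bar>v \<bullet> e\<bar> \<le> (v \<bullet> e)\<^sup>2 + s\<^sup>2"
      using sum_squares_bound[of "\<bar>v \<bullet> e\<bar>" s] by (simp add: mult.commute mult.left_commute)
    then show "\<bar>v \<bullet> e\<bar> \<le> (1 / (2 * s)) * (e \<bullet> v)\<^sup>2 + s / 2"
      using s by (simp add: inner_commute field_simps power2_eq_square)
  qed (use i2 in auto)
  also have "\<dots> = (1 / (2 * s)) * (\<integral>v. (e \<bullet> v)\<^sup>2 \<partial>uniform_sphere) + s / 2"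
    using i2 S.prob_space by simp
  also have "\<dots> = (1 / (2 * s)) * s\<^sup>2 + s / 2"
    by (simp add: uniform_sphere_second_moment s_def power_divide)
  also have "\<dots> = s" using s by (simp add: power2_eq_square)
  finally show ?thesis by (simp add: s_def)
qed simp

lemma sphere_gradient_integrable:
  fixes f :: "'a::euclidean_space \<Rightarrow> real"
  assumes f: "\<Lambda>-lipschitz_on UNIV f"
  shows "integrable uniform_sphere (\<lambda>v. f (x + \<eta> *\<^sub>R v) *\<^sub>R v)"
proof (rule integrable_uniform_sphere_bounded[of _ "\<bar>f x\<bar> + \<Lambda> * \<bar>\<eta>\<bar>"])
  have [measurable]: "f \<in> borel_measurable borel" by (rule lipschitz_on_borel_measurable[OF f])
  show "(\<lambda>v. f (x + \<eta> *\<^sub>R v) *\<^sub>R v) \<in> borel_measurable borel" by measurable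
  fix v :: 'a assume "norm v = 1"
  then show "norm (f (x + \<eta> *\<^sub>R v) *\<^sub>R v) \<le> \<bar>f x\<bar> + \<Lambda> * \<bar>\<eta>\<bar>"
    using lipschitz_on_normD[OF f, of "x + \<eta> *\<^sub>R v" x] by simp
qed

text \<open>The difference of the two sphere integrals is tested against itself, which leaves the
  mean of \<open>\<bar>v \<bullet> D\<bar>\<close>. The factor \<open>n / \<eta>\<close> of the
  definition and the \<open>1 / sqrt n\<close> of \<open>uniform_sphere_abs_inner\<close> combine to
  \<open>sqrt n / \<eta>\<close>.\<close>

lemma lipschitz_on_sphere_gradient:
  fixes f :: "'a::euclidean_space \<Rightarrow> real"
  assumes f: "\<Lambda>-lipschitz_on UNIV f" and \<eta>: "0 < \<eta>"
  shows "(\<Lambda> * sqrt DIM('a) / \<eta>)-lipschitz_on UNIV (sphere_gradient \<eta> f)"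
proof (rule lipschitz_onI)
  have \<Lambda>: "0 \<le> \<Lambda>" using f by (rule lipschitz_on_nonneg)
  then show "0 \<le> \<Lambda> * sqrt DIM('a) / \<eta>" using \<eta> by simp
  interpret S: prob_space "uniform_sphere :: 'a measure" by (rule prob_space_uniform_sphere)
  have [measurable]: "f \<in> borel_measurable borel" by (rule lipschitz_on_borel_measurable[OF f])
  fix x y :: 'a
  note int = sphere_gradient_integrable[OF f, of _ \<eta>]
  define D where "D = (\<integral>v. (f (x + \<eta> *\<^sub>R v) *\<^sub>R v - f (y + \<eta> *\<^sub>R v) *\<^sub>R v) \<partial>uniform_sphere)"
  have iD: "integrable uniform_sphere (\<lambda>v. f (x + \<eta> *\<^sub>R v) *\<^sub>R v - f (y + \<eta> *\<^sub>R v) *\<^sub>R v)"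
    using int by (rule Bochner_Integration.integrable_diff) (rule int)
  have sg: "sphere_gradient \<eta> f x - sphere_gradient \<eta> f y = (DIM('a) / \<eta>) *\<^sub>R D"
    unfolding sphere_gradient_def D_def Bochner_Integration.integral_diff[OF int int] by (simp add: scaleR_diff_right)
  have "D \<bullet> D = (\<integral>v. (f (x + \<eta> *\<^sub>R v) *\<^sub>R v - f (y + \<eta> *\<^sub>R v) *\<^sub>R v) \<bullet> D \<partial>uniform_sphere)"
    unfolding D_def by (rule integral_inner_left[symmetric]) (rule iD)
  also have "\<dots> \<le> (\<integral>v. \<Lambda> * dist x y * \<bar>v \<bullet> D\<bar> \<partial>uniform_sphere)"
  proof (rule integral_mono)
    show "integrable uniform_sphere (\<lambda>v. (f (x + \<eta> *\<^sub>R v) *\<^sub>R v - f (y + \<eta> *\<^sub>R v) *\<^sub>R v) \<bullet> D)"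
      by (rule integrable_inner_left) (rule iD)
    show "integrable uniform_sphere (\<lambda>v. \<Lambda> * dist x y * \<bar>v \<bullet> D\<bar>)"
    proof (intro integrable_mult_right integrable_uniform_sphere_bounded[of _ "norm D"])
      fix v :: 'a assume "norm v = 1"
      then show "norm \<bar>v \<bullet> D\<bar> \<le> norm D" using Cauchy_Schwarz_ineq2[of v D] by simp
    qed measurable
    fix v :: 'a
    have "(f (x + \<eta> *\<^sub>R v) *\<^sub>R v - f (y + \<eta> *\<^sub>R v) *\<^sub>R v) \<bullet> D = (f (x + \<eta> *\<^sub>R v) - f (y + \<eta> *\<^sub>R v)) * (v \<bullet> D)"
      by (simp add: inner_diff_left algebra_simps)
    also have "\<dots> \<le> \<bar>f (x + \<eta> *\<^sub>R v) - f (y + \<eta> *\<^sub>R v)\<bar> * \<bar>v \<bullet> D\<bar>"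
      by (metis abs_ge_self abs_mult)
    also have "\<dots> \<le> \<Lambda> * dist x y * \<bar>v \<bullet> D\<bar>"
      using lipschitz_onD[OF f, of "x + \<eta> *\<^sub>R v" "y + \<eta> *\<^sub>R v"] by (intro mult_right_mono) (auto simp: dist_real_def)
    finally show "(f (x + \<eta> *\<^sub>R v) *\<^sub>R v - f (y + \<eta> *\<^sub>R v) *\<^sub>R v) \<bullet> D \<le> \<Lambda> * dist x y * \<bar>v \<bullet> D\<bar>" .
  qed
  also have "\<dots> = \<Lambda> * dist x y * (\<integral>v. \<bar>v \<bullet> D\<bar> \<partial>uniform_sphere)" by simp
  also have "\<dots> \<le> \<Lambda> * dist x y * (norm D / sqrt DIM('a))"
    using \<Lambda> by (intro mult_left_mono uniform_sphere_abs_inner) auto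
  finally have "norm D * norm D \<le> (\<Lambda> * dist x y / sqrt DIM('a)) * norm D"
    by (simp add: dot_square_norm power2_eq_square)
  then have D: "norm D \<le> \<Lambda> * dist x y / sqrt DIM('a)"
    using \<Lambda> by (cases "D = 0") (auto simp del: times_divide_eq_left simp: mult_le_cancel_right)
  have "dist (sphere_gradient \<eta> f x) (sphere_gradient \<eta> f y) = DIM('a) / \<eta> * norm D"
    using \<eta> by (simp add: dist_norm sg)
  also have "\<dots> \<le> DIM('a) / \<eta> * (\<Lambda> * dist x y / sqrt DIM('a))"
    using \<eta> D by (intro mult_left_mono) auto
  also have "\<dots> = \<Lambda> * sqrt DIM('a) / \<eta> * dist x y"
    using \<eta> real_sqrt_mult_self[of "DIM('a)"] by (simp add: field_simps)
  finally show "dist (sphere_gradient \<eta> f x) (sphere_gradient \<eta> f y) \<le> \<Lambda> * sqrt DIM('a) / \<eta> * dist x y" .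
qed

text \<open>The difference quotients in the direction \<open>g\<close> itself tend to
  \<open>(norm g)^2\<close> and are bounded by \<open>\<Lambda> * norm g\<close>.\<close>

lemma norm_GDERIV_le:
  fixes f :: "'a::real_inner \<Rightarrow> real"
  assumes g: "GDERIV f x :> g" and f: "\<Lambda>-lipschitz_on UNIV f"
  shows "norm g \<le> \<Lambda>"
proof (rule ccontr)
  assume "\<not> norm g \<le> \<Lambda>"
  then have gt: "\<Lambda> < norm g" by simp
  have \<Lambda>: "0 \<le> \<Lambda>" using f by (rule lipschitz_on_nonneg)
  then have g0: "0 < norm g" using gt by linarith
  have "((\<lambda>t. f (x + t *\<^sub>R g)) has_real_derivative (g \<bullet> g)) (at 0)"
  proof -
    have "((\<lambda>t. x + t *\<^sub>R g) has_derivative (\<lambda>t. t *\<^sub>R g)) (at (0::real))"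
      by (auto intro!: derivative_eq_intros)
    moreover have "(f has_derivative (\<lambda>h. h \<bullet> g)) (at (x + 0 *\<^sub>R g))"
      using g by (simp add: gderiv_def)
    ultimately have "((\<lambda>t. f (x + t *\<^sub>R g)) has_derivative (\<lambda>t. (t *\<^sub>R g) \<bullet> g)) (at 0)"
      by (rule has_derivative_compose)
    then show ?thesis by (simp add: has_field_derivative_def mult_commute_abs)
  qed
  then have lim: "((\<lambda>t. (f (x + t *\<^sub>R g) - f x) / t) \<longlongrightarrow> g \<bullet> g) (at 0)"
    by (simp add: DERIV_def)
  have "\<forall>\<^sub>F t in at (0::real). (f (x + t *\<^sub>R g) - f x) / t \<le> \<Lambda> * norm g"
  proof (rule eventually_at_topological[THEN iffD2], intro exI[of _ UNIV] conjI ballI impI)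
    fix t :: real assume t: "t \<noteq> 0"
    have "\<bar>f (x + t *\<^sub>R g) - f x\<bar> \<le> \<Lambda> * (\<bar>t\<bar> * norm g)"
      using lipschitz_on_normD[OF f, of "x + t *\<^sub>R g" x] by simp
    then have "\<bar>(f (x + t *\<^sub>R g) - f x) / t\<bar> \<le> \<Lambda> * norm g"
      using t by (simp add: abs_divide field_simps)
    then show "(f (x + t *\<^sub>R g) - f x) / t \<le> \<Lambda> * norm g" by linarith
  qed auto
  then have "g \<bullet> g \<le> \<Lambda> * norm g"
    by (rule tendsto_upperbound[OF lim]) auto
  then have "norm g * norm g \<le> \<Lambda> * norm g" by (simp add: dot_square_norm power2_eq_square)
  then show False using gt g0 by simp
qed

text \<open>The mean value theorem only gives the factor \<open>L\<close> instead of \<open>L / 2\<close>, which suffices here.\<close>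

lemma smooth_expansion:
  fixes f :: "'a::real_inner \<Rightarrow> real"
  assumes g: "\<And>x. GDERIV f x :> g x" and L: "L-lipschitz_on UNIV g"
  shows "\<bar>f y - f x - g x \<bullet> (y - x)\<bar> \<le> L * (norm (y - x))\<^sup>2"
proof -
  let ?\<psi> = "\<lambda>t. f (x + t *\<^sub>R (y - x))"
  have der: "(?\<psi> has_real_derivative (y - x) \<bullet> g (x + t *\<^sub>R (y - x))) (at t)" for t
  proof -
    have "((\<lambda>t. x + t *\<^sub>R (y - x)) has_derivative (\<lambda>t. t *\<^sub>R (y - x))) (at t)"
      by (auto intro!: derivative_eq_intros)
    moreover have "(f has_derivative (\<lambda>h. h \<bullet> g (x + t *\<^sub>R (y - x)))) (at (x + t *\<^sub>R (y - x)))"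
      using g by (simp add: gderiv_def)
    ultimately have "(?\<psi> has_derivative (\<lambda>s. (s *\<^sub>R (y - x)) \<bullet> g (x + t *\<^sub>R (y - x)))) (at t)"
      by (rule has_derivative_compose)
    then show ?thesis by (simp add: has_field_derivative_def mult_commute_abs)
  qed
  obtain t where t: "0 < t" "t < 1" "?\<psi> 1 - ?\<psi> 0 = (1 - 0) * ((y - x) \<bullet> g (x + t *\<^sub>R (y - x)))"
    using MVT2[of 0 1 ?\<psi>, OF _ der] by auto
  have "\<bar>f y - f x - g x \<bullet> (y - x)\<bar> = \<bar>(g (x + t *\<^sub>R (y - x)) - g x) \<bullet> (y - x)\<bar>"
    using t(3) by (simp add: inner_diff_left inner_diff_right inner_commute)
  also have "\<dots> \<le> norm (g (x + t *\<^sub>R (y - x)) - g x) * norm (y - x)"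
    by (rule Cauchy_Schwarz_ineq2)
  also have "\<dots> \<le> (L * norm (y - x)) * norm (y - x)"
  proof (rule mult_right_mono)
    have "norm (g (x + t *\<^sub>R (y - x)) - g x) \<le> L * (t * norm (y - x))"
      using lipschitz_on_normD[OF L, of "x + t *\<^sub>R (y - x)" x] t by simp
    also have "\<dots> \<le> L * norm (y - x)"
      using t lipschitz_on_nonneg[OF L] by (intro mult_left_mono) (auto simp: mult_left_le_one_le)
    finally show "norm (g (x + t *\<^sub>R (y - x)) - g x) \<le> L * norm (y - x)" .
  qed auto
  finally show ?thesis by (simp add: power2_eq_square)
qed

section \<open>Gradients of smoothed functions as generalized gradients\<close>

text \<open>The epigraph of the directional derivative in elementary form, see
  \<open>clarke_dderiv_le_iff\<close>: inequalities of this form can be added and scaled without a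
  limit superior of extended reals.\<close>

definition clarke_le :: "('a::real_inner \<Rightarrow> real) \<Rightarrow> 'a \<Rightarrow> 'a \<Rightarrow> real \<Rightarrow> bool" where
  "clarke_le f x d b \<longleftrightarrow>
     (\<forall>\<epsilon>>0. \<exists>\<delta>>0. \<forall>y\<in>ball x \<delta>. \<forall>t. 0 < t \<longrightarrow> t < \<delta> \<longrightarrow> f (y + t *\<^sub>R d) - f y \<le> t * (b + \<epsilon>))"

lemma clarke_dderiv_le_iff: "clarke_dderiv f x d \<le> ereal b \<longleftrightarrow> clarke_le f x d b"
proof -
  have ev: "(\<forall>\<^sub>F p in nhds x \<times>\<^sub>F at_right 0. case p of (y, t) \<Rightarrow> (f (y + t *\<^sub>R d) - f y) / t < c)
     \<longleftrightarrow> (\<exists>\<delta>>0. \<forall>y\<in>ball x \<delta>. \<forall>t. 0 < t \<longrightarrow> t < \<delta> \<longrightarrow> (f (y + t *\<^sub>R d) - f y) / t < c)" for c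
  proof
    assume "\<forall>\<^sub>F p in nhds x \<times>\<^sub>F at_right 0. case p of (y, t) \<Rightarrow> (f (y + t *\<^sub>R d) - f y) / t < c"
    then obtain P Q where PQ: "eventually P (nhds x)" "eventually Q (at_right (0::real))"
      "\<And>y t. P y \<Longrightarrow> Q t \<Longrightarrow> (f (y + t *\<^sub>R d) - f y) / t < c"
      unfolding eventually_prod_filter by auto
    obtain d1 where d1: "0 < d1" "\<And>y. dist y x < d1 \<Longrightarrow> P y"
      using PQ(1) unfolding eventually_nhds_metric by auto
    obtain d2 where d2: "0 < d2" "\<And>t. 0 < t \<Longrightarrow> t < d2 \<Longrightarrow> Q t"
      using PQ(2) unfolding eventually_at_right_field by auto
    show "\<exists>\<delta>>0. \<forall>y\<in>ball x \<delta>. \<forall>t. 0 < t \<longrightarrow> t < \<delta> \<longrightarrow> (f (y + t *\<^sub>R d) - f y) / t < c"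
      using d1 d2 PQ(3) by (intro exI[of _ "min d1 d2"]) (auto simp: dist_commute)
  next
    assume "\<exists>\<delta>>0. \<forall>y\<in>ball x \<delta>. \<forall>t. 0 < t \<longrightarrow> t < \<delta> \<longrightarrow> (f (y + t *\<^sub>R d) - f y) / t < c"
    then obtain \<delta> where \<delta>: "0 < \<delta>" "\<And>y t. y \<in> ball x \<delta> \<Longrightarrow> 0 < t \<Longrightarrow> t < \<delta> \<Longrightarrow> (f (y + t *\<^sub>R d) - f y) / t < c"
      by auto
    show "\<forall>\<^sub>F p in nhds x \<times>\<^sub>F at_right 0. case p of (y, t) \<Rightarrow> (f (y + t *\<^sub>R d) - f y) / t < c"
      unfolding eventually_prod_filter
    proof (intro exI[of _ "\<lambda>y. y \<in> ball x \<delta>"] exI[of _ "\<lambda>t. 0 < t \<and> t < \<delta>"] conjI allI impI)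
      show "\<forall>\<^sub>F y in nhds x. y \<in> ball x \<delta>" using \<delta>(1) by (intro eventually_nhds_in_open) auto
      show "\<forall>\<^sub>F t in at_right 0. 0 < t \<and> t < \<delta>" using \<delta>(1) by (auto simp: eventually_at_right_field)
    qed (use \<delta>(2) in auto)
  qed
  have "clarke_dderiv f x d \<le> ereal b \<longleftrightarrow>
      (\<forall>c>ereal b. \<forall>\<^sub>F p in nhds x \<times>\<^sub>F at_right 0. (case p of (y, t) \<Rightarrow> ereal ((f (y + t *\<^sub>R d) - f y) / t)) < c)"
    unfolding clarke_dderiv_def by (subst Limsup_le_iff) auto
  also have "\<dots> \<longleftrightarrow> (\<forall>c>b. \<forall>\<^sub>F p in nhds x \<times>\<^sub>F at_right 0. case p of (y, t) \<Rightarrow> (f (y + t *\<^sub>R d) - f y) / t < c)"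
    (is "?A \<longleftrightarrow> ?B")
  proof
    assume A: ?A
    show ?B
    proof (intro allI impI)
      fix c assume "b < c"
      then have "ereal b < ereal c" by simp
      with A have "\<forall>\<^sub>F p in nhds x \<times>\<^sub>F at_right 0. (case p of (y, t) \<Rightarrow> ereal ((f (y + t *\<^sub>R d) - f y) / t)) < ereal c"
        by blast
      then show "\<forall>\<^sub>F p in nhds x \<times>\<^sub>F at_right 0. case p of (y, t) \<Rightarrow> (f (y + t *\<^sub>R d) - f y) / t < c"
        by (rule eventually_mono) auto
    qed
  next
    assume B: ?B
    show ?A
    proof (intro allI impI)
      fix c assume "ereal b < c"
      then obtain c' where c': "b < c'" "ereal c' \<le> c"
        by (metis ereal_dense2 ereal_less(2) less_ereal.simps(1) less_imp_le)
      from B c'(1) have "\<forall>\<^sub>F p in nhds x \<times>\<^sub>F at_right 0. case p of (y, t) \<Rightarrow> (f (y + t *\<^sub>R d) - f y) / t < c'" by blast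
      then show "\<forall>\<^sub>F p in nhds x \<times>\<^sub>F at_right 0. (case p of (y, t) \<Rightarrow> ereal ((f (y + t *\<^sub>R d) - f y) / t)) < c"
      proof (rule eventually_mono)
        fix p assume "case p of (y, t) \<Rightarrow> (f (y + t *\<^sub>R d) - f y) / t < c'"
        then have "(case p of (y, t) \<Rightarrow> ereal ((f (y + t *\<^sub>R d) - f y) / t)) < ereal c'" by (auto split: prod.splits)
        then show "(case p of (y, t) \<Rightarrow> ereal ((f (y + t *\<^sub>R d) - f y) / t)) < c" using c'(2) by order
      qed
    qed
  qed
  also have "\<dots> \<longleftrightarrow> (\<forall>c>b. \<exists>\<delta>>0. \<forall>y\<in>ball x \<delta>. \<forall>t. 0 < t \<longrightarrow> t < \<delta> \<longrightarrow> (f (y + t *\<^sub>R d) - f y) / t < c)"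
    by (simp only: ev)
  also have "\<dots> \<longleftrightarrow> clarke_le f x d b" (is "?A \<longleftrightarrow> _")
  proof
    assume A: ?A
    show "clarke_le f x d b"
      unfolding clarke_le_def
    proof (intro allI impI)
      fix \<epsilon> :: real assume "0 < \<epsilon>"
      then obtain \<delta> where \<delta>: "0 < \<delta>" "\<And>y t. y \<in> ball x \<delta> \<Longrightarrow> 0 < t \<Longrightarrow> t < \<delta> \<Longrightarrow> (f (y + t *\<^sub>R d) - f y) / t < b + \<epsilon>"
        using A[rule_format, of "b + \<epsilon>"] by auto
      have "f (y + t *\<^sub>R d) - f y \<le> t * (b + \<epsilon>)" if "y \<in> ball x \<delta>" "0 < t" "t < \<delta>" for y t
        using \<delta>(2)[OF that] that(2) by (simp add: divide_less_eq mult.commute)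
      with \<delta>(1) show "\<exists>\<delta>>0. \<forall>y\<in>ball x \<delta>. \<forall>t. 0 < t \<longrightarrow> t < \<delta> \<longrightarrow> f (y + t *\<^sub>R d) - f y \<le> t * (b + \<epsilon>)" by blast
    qed
  next
    assume A: "clarke_le f x d b"
    show ?A
    proof (intro allI impI)
      fix c assume "b < c"
      then obtain \<delta> where \<delta>: "0 < \<delta>" "\<And>y t. y \<in> ball x \<delta> \<Longrightarrow> 0 < t \<Longrightarrow> t < \<delta> \<Longrightarrow> f (y + t *\<^sub>R d) - f y \<le> t * (b + (c - b) / 2)"
        using A unfolding clarke_le_def by (metis diff_gt_0_iff_gt half_gt_zero)
      have "(f (y + t *\<^sub>R d) - f y) / t < c" if "y \<in> ball x \<delta>" "0 < t" "t < \<delta>" for y t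
      proof -
        have "(f (y + t *\<^sub>R d) - f y) / t \<le> b + (c - b) / 2"
          using \<delta>(2)[OF that] that(2) by (simp add: divide_le_eq mult.commute)
        also have "\<dots> < c" using \<open>b < c\<close> by (simp add: field_simps)
        finally show ?thesis .
      qed
      with \<delta>(1) show "\<exists>\<delta>>0. \<forall>y\<in>ball x \<delta>. \<forall>t. 0 < t \<longrightarrow> t < \<delta> \<longrightarrow> (f (y + t *\<^sub>R d) - f y) / t < c" by blast
    qed
  qed
  finally show ?thesis .
qed

lemma clarke_leD:
  "clarke_le f x d b \<Longrightarrow> 0 < \<epsilon> \<Longrightarrow>
    \<exists>\<delta>>0. \<forall>y\<in>ball x \<delta>. \<forall>t. 0 < t \<longrightarrow> t < \<delta> \<longrightarrow> f (y + t *\<^sub>R d) - f y \<le> t * (b + \<epsilon>)"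
  unfolding clarke_le_def by (elim allE impE)

lemma clarke_le_lipschitz:
  assumes "\<Lambda>-lipschitz_on UNIV f"
  shows "clarke_le f x d (\<Lambda> * norm d)"
  unfolding clarke_le_def
proof (intro allI impI exI[of _ "1::real"] conjI ballI)
  fix \<epsilon> t :: real and y assume *: "0 < \<epsilon>" "0 < t"
  have "f (y + t *\<^sub>R d) - f y \<le> \<Lambda> * (t * norm d)"
    using lipschitz_on_normD[OF assms, of "y + t *\<^sub>R d" y] * by simp
  also have "\<dots> \<le> t * (\<Lambda> * norm d + \<epsilon>)" using * by (simp add: algebra_simps)
  finally show "f (y + t *\<^sub>R d) - f y \<le> t * (\<Lambda> * norm d + \<epsilon>)" .
qed simp

text \<open>The step along \<open>d + d'\<close> is made in two legs, the second starting at
  \<open>y + t *\<^sub>R d\<close>. The bound for \<open>d'\<close> holds there because the base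
  points of the limit superior range over a neighbourhood of \<open>x\<close>; this is the source of
  subadditivity.\<close>

lemma clarke_le_add:
  assumes "clarke_le f x d b" "clarke_le f x d' b'"
  shows "clarke_le f x (d + d') (b + b')"
  unfolding clarke_le_def
proof (intro allI impI)
  fix \<epsilon> :: real assume "0 < \<epsilon>"
  then have e: "0 < \<epsilon> / 2" by simp
  obtain \<delta>1 where 1: "0 < \<delta>1" "\<forall>y\<in>ball x \<delta>1. \<forall>t. 0 < t \<longrightarrow> t < \<delta>1 \<longrightarrow> f (y + t *\<^sub>R d) - f y \<le> t * (b + \<epsilon> / 2)"
    using clarke_leD[OF assms(1) e] by auto
  note r1r = 1(2)[rule_format]
  obtain \<delta>2 where 2: "0 < \<delta>2" "\<forall>y\<in>ball x \<delta>2. \<forall>t. 0 < t \<longrightarrow> t < \<delta>2 \<longrightarrow> f (y + t *\<^sub>R d') - f y \<le> t * (b' + \<epsilon> / 2)"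
    using clarke_leD[OF assms(2) e] by auto
  note r2r = 2(2)[rule_format]
  \<comment> \<open>The second radius is shrunk so that the intermediate point
    \<open>y + t *\<^sub>R d\<close>, at a distance below \<open>\<delta> * (1 + norm d)\<close>
    from \<open>x\<close>, stays in the ball of radius \<open>\<delta>2\<close>.\<close>
  define \<delta> where "\<delta> = min \<delta>1 (\<delta>2 / (1 + norm d))"
  have nd: "0 < 1 + norm d" by (smt (verit) norm_ge_zero)
  have \<delta>: "0 < \<delta>" using 1 2 nd by (simp add: \<delta>_def)
  have \<delta>2: "\<delta> * (1 + norm d) \<le> \<delta>2"
  proof -
    have "\<delta> * (1 + norm d) \<le> (\<delta>2 / (1 + norm d)) * (1 + norm d)" using nd by (intro mult_right_mono) (auto simp: \<delta>_def)
    also have "\<dots> = \<delta>2" using nd by simp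
    finally show ?thesis .
  qed
  show "\<exists>\<delta>>0. \<forall>y\<in>ball x \<delta>. \<forall>t. 0 < t \<longrightarrow> t < \<delta> \<longrightarrow> f (y + t *\<^sub>R (d + d')) - f y \<le> t * (b + b' + \<epsilon>)"
  proof (intro exI[of _ \<delta>] conjI \<delta> ballI allI impI)
    fix y t assume y: "y \<in> ball x \<delta>" and t: "0 < t" "t < \<delta>"
    have tn: "t * norm d \<le> \<delta> * norm d" using t by (intro mult_right_mono) auto
    have "0 \<le> \<delta> * norm d" using \<delta> by simp
    then have d2: "\<delta> \<le> \<delta>2" using \<delta>2 by (simp add: algebra_simps)
    have "dist x (y + t *\<^sub>R d) \<le> dist x y + t * norm d"
      using t dist_triangle[of x "y + t *\<^sub>R d" y] by (simp add: dist_norm)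
    also have "\<dots> < \<delta>2" using y tn \<delta>2 by (simp add: algebra_simps)
    finally have m: "y + t *\<^sub>R d \<in> ball x \<delta>2" by simp
    have "f (y + t *\<^sub>R d + t *\<^sub>R d') - f (y + t *\<^sub>R d) \<le> t * (b' + \<epsilon> / 2)"
      using d2 t by (intro r2r[OF m]) auto
    moreover have "f (y + t *\<^sub>R d) - f y \<le> t * (b + \<epsilon> / 2)"
      using y t by (intro r1r) (auto simp: \<delta>_def)
    moreover have e3: "y + t *\<^sub>R (d + d') = y + t *\<^sub>R d + t *\<^sub>R d'" by (simp add: scaleR_add_right)
    moreover have "t * (b + b' + \<epsilon>) = t * (b + \<epsilon> / 2) + t * (b' + \<epsilon> / 2)" by (simp add: field_simps)
    ultimately show "f (y + t *\<^sub>R (d + d')) - f y \<le> t * (b + b' + \<epsilon>)" unfolding e3 by linarith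
  qed
qed

lemma clarke_le_scale:
  assumes "clarke_le f x d b" "0 \<le> s"
  shows "clarke_le f x (s *\<^sub>R d) (s * b)"
proof (cases "s = 0")
  case True
  then show ?thesis by (auto simp: clarke_le_def intro!: exI[of _ "1::real"])
next
  case False
  with assms have s: "0 < s" by simp
  show ?thesis
    unfolding clarke_le_def
  proof (intro allI impI)
    fix \<epsilon> :: real assume "0 < \<epsilon>"
    then have e: "0 < \<epsilon> / s" using s by simp
    obtain \<delta> where 1: "0 < \<delta>" "\<forall>y\<in>ball x \<delta>. \<forall>t. 0 < t \<longrightarrow> t < \<delta> \<longrightarrow> f (y + t *\<^sub>R d) - f y \<le> t * (b + \<epsilon> / s)"
    using clarke_leD[OF assms(1) e] by auto
  note r1r = 1(2)[rule_format]
    show "\<exists>\<delta>>0. \<forall>y\<in>ball x \<delta>. \<forall>t. 0 < t \<longrightarrow> t < \<delta> \<longrightarrow> f (y + t *\<^sub>R s *\<^sub>R d) - f y \<le> t * (s * b + \<epsilon>)"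
    proof (intro exI[of _ "min \<delta> (\<delta> / s)"] conjI ballI allI impI)
      show "0 < min \<delta> (\<delta> / s)" using 1 s by simp
      fix y t assume y: "y \<in> ball x (min \<delta> (\<delta> / s))" and t: "0 < t" "t < min \<delta> (\<delta> / s)"
      have "f (y + (t * s) *\<^sub>R d) - f y \<le> (t * s) * (b + \<epsilon> / s)"
        using y t s by (intro r1r) (auto simp: field_simps)
      also have "\<dots> = t * (s * b + \<epsilon>)" using s by (simp add: field_simps)
      finally show "f (y + t *\<^sub>R s *\<^sub>R d) - f y \<le> t * (s * b + \<epsilon>)" by simp
    qed
  qed
qed

lemma clarke_le_mono: "clarke_le f x d b \<Longrightarrow> b \<le> b' \<Longrightarrow> clarke_le f x d b'"
  unfolding clarke_dderiv_le_iff[symmetric] by (meson ereal_less_eq(3) order_trans)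

text \<open>For Lipschitz \<open>f\<close>, replacing \<open>d'\<close> by \<open>d\<close> changes
  the increment by at most \<open>t * (\<Lambda> * e)\<close>, which is linear in \<open>t\<close>.
  The choice \<open>e = \<epsilon> / (2 + \<Lambda>)\<close> pays for this, for the error of
  \<open>b'\<close> and for the slack in the bound along \<open>d'\<close>.\<close>

lemma clarke_le_closure:
  assumes f: "\<Lambda>-lipschitz_on UNIV f"
    and approx: "\<And>e. 0 < e \<Longrightarrow> \<exists>d' b'. norm (d' - d) \<le> e \<and> \<bar>b' - b\<bar> \<le> e \<and> clarke_le f x d' b'"
  shows "clarke_le f x d b"
  unfolding clarke_le_def
proof (intro allI impI)
  fix \<epsilon> :: real assume \<epsilon>: "0 < \<epsilon>"
  have \<Lambda>: "0 \<le> \<Lambda>" using f by (rule lipschitz_on_nonneg)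
  define e where "e = \<epsilon> / (2 + \<Lambda>)"
  have e: "0 < e" "(2 + \<Lambda>) * e = \<epsilon>" using \<epsilon> \<Lambda> by (auto simp: e_def)
  obtain d' b' where d': "norm (d' - d) \<le> e" "\<bar>b' - b\<bar> \<le> e" "clarke_le f x d' b'"
    using approx[OF e(1)] by blast
  obtain \<delta> where 1: "0 < \<delta>" "\<forall>y\<in>ball x \<delta>. \<forall>t. 0 < t \<longrightarrow> t < \<delta> \<longrightarrow> f (y + t *\<^sub>R d') - f y \<le> t * (b' + e)"
    using clarke_leD[OF d'(3) e(1)] by auto
  note r1r = 1(2)[rule_format]
  show "\<exists>\<delta>>0. \<forall>y\<in>ball x \<delta>. \<forall>t. 0 < t \<longrightarrow> t < \<delta> \<longrightarrow> f (y + t *\<^sub>R d) - f y \<le> t * (b + \<epsilon>)"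
  proof (intro exI[of _ \<delta>] conjI 1(1) ballI allI impI)
    fix y t assume y: "y \<in> ball x \<delta>" and t: "0 < t" "t < \<delta>"
    have "\<bar>f (y + t *\<^sub>R d) - f (y + t *\<^sub>R d')\<bar> \<le> \<Lambda> * norm ((y + t *\<^sub>R d) - (y + t *\<^sub>R d'))"
      using lipschitz_on_normD[OF f, of "y + t *\<^sub>R d" "y + t *\<^sub>R d'"] by simp
    also have "(y + t *\<^sub>R d) - (y + t *\<^sub>R d') = t *\<^sub>R (d - d')" by (simp add: scaleR_diff_right)
    also have "\<Lambda> * norm (t *\<^sub>R (d - d')) \<le> \<Lambda> * (t * e)"
      using t d'(1) \<Lambda> by (intro mult_left_mono) (auto simp: norm_minus_commute)
    finally have "f (y + t *\<^sub>R d) - f (y + t *\<^sub>R d') \<le> t * (\<Lambda> * e)" by (simp add: mult.left_commute)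
    moreover have "f (y + t *\<^sub>R d') - f y \<le> t * (b' + e)" by (rule r1r[OF y t])
    moreover have "t * (b' + e) \<le> t * (b + 2 * e)" using t d'(2) by (intro mult_left_mono) auto
    moreover have "t * (b + \<epsilon>) = t * (b + 2 * e) + t * (\<Lambda> * e)" unfolding e(2)[symmetric] by (simp add: algebra_simps)
    ultimately show "f (y + t *\<^sub>R d) - f y \<le> t * (b + \<epsilon>)" by linarith
  qed
qed

text \<open>The pairs \<open>(d, b)\<close> with \<open>clarke_le f x d b\<close> form a closed convex cone. A hyperplane separating
  \<open>(d, \<beta>)\<close> from it is, after normalization, the graph of a generalized gradient \<open>c\<close> with
  \<open>c \<bullet> d > \<beta>\<close>.\<close>

lemma clarke_le_dual:
  fixes f :: "'a::euclidean_space \<Rightarrow> real"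
  assumes f: "\<Lambda>-lipschitz_on UNIV f" and \<beta>: "\<And>c. c \<in> clarke_gradient f x \<Longrightarrow> c \<bullet> d \<le> \<beta>"
  shows "clarke_le f x d \<beta>"
proof (rule ccontr)
  assume neg: "\<not> clarke_le f x d \<beta>"
  define A where "A = {p :: 'a \<times> real. clarke_le f x (fst p) (snd p)}"
  have "convex A"
  proof (rule convexI)
    fix p q :: "'a \<times> real" and u v :: real
    assume "p \<in> A" "q \<in> A" "0 \<le> u" "0 \<le> v"
    then show "u *\<^sub>R p + v *\<^sub>R q \<in> A"
      by (auto simp: A_def intro: clarke_le_add clarke_le_scale)
  qed
  moreover have "closed A"
    unfolding closure_subset_eq[symmetric]
  proof
    fix p :: "'a \<times> real" assume "p \<in> closure A"
    then have p: "\<forall>e>0. \<exists>q\<in>A. dist q p < e" by (simp add: closure_approachable)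
    have "clarke_le f x (fst p) (snd p)"
    proof (rule clarke_le_closure[OF f])
      fix e :: real assume "0 < e"
      then obtain q where q: "q \<in> A" "dist q p < e" using p by blast
      have "norm (fst q - fst p) \<le> e" "\<bar>snd q - snd p\<bar> \<le> e"
        using q(2) dist_fst_le[of q p] dist_snd_le[of q p] by (auto simp: dist_norm)
      with q(1) show "\<exists>d' b'. norm (d' - fst p) \<le> e \<and> \<bar>b' - snd p\<bar> \<le> e \<and> clarke_le f x d' b'"
        by (auto simp: A_def)
    qed
    then show "p \<in> A" by (simp add: A_def)
  qed
  moreover have "(d, \<beta>) \<notin> A" using neg by (simp add: A_def)
  ultimately obtain h k where hk: "h \<bullet> (d, \<beta>) < k" "\<forall>p\<in>A. k < h \<bullet> p"
    using separating_hyperplane_closed_point[of A "(d, \<beta>)"] by blast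
  obtain a \<alpha> where h: "h = (a, \<alpha>)" by (cases h)
  have sep: "k < a \<bullet> d' + \<alpha> * b'" if "clarke_le f x d' b'" for d' b'
    using hk(2) that by (auto simp: A_def h)
  have top: "clarke_le f x d' (\<Lambda> * norm d')" for d' by (rule clarke_le_lipschitz[OF f])
  have k: "k < 0" using sep[OF top[of 0]] by simp
  \<comment> \<open>The functional cannot be negative on a cone that it keeps above
    \<open>k < 0\<close>: a suitable multiple of a negative value would equal
    \<open>k\<close>.\<close>
  have nonneg: "0 \<le> a \<bullet> d' + \<alpha> * b'" if c: "clarke_le f x d' b'" for d' b'
  proof (rule ccontr)
    assume "\<not> 0 \<le> a \<bullet> d' + \<alpha> * b'"
    then have n: "a \<bullet> d' + \<alpha> * b' < 0" by simp
    define s where "s = k / (a \<bullet> d' + \<alpha> * b')"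
    have "0 \<le> s" using n k by (simp add: s_def divide_nonpos_neg)
    from sep[OF clarke_le_scale[OF c this]] have "k < s * (a \<bullet> d' + \<alpha> * b')" by (simp add: algebra_simps)
    also have "\<dots> = k" using n by (simp add: s_def)
    finally show False by simp
  qed
  have "0 \<le> \<alpha>"
    using nonneg[OF clarke_le_mono[OF top[of 0], of 1]] by simp
  \<comment> \<open>A vertical hyperplane is impossible, since every direction \<open>d'\<close>
    carries a finite bound, here \<open>\<Lambda> * norm d'\<close>.\<close>
  moreover have "\<alpha> \<noteq> 0"
  proof
    assume "\<alpha> = 0"
    then have "0 \<le> a \<bullet> (- a)" using nonneg[OF top[of "- a"]] by simp
    then have "a = 0" by (metis antisym inner_ge_zero inner_minus_right inner_eq_zero_iff neg_0_le_iff_le)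
    then show False using hk(1) k \<open>\<alpha> = 0\<close> by (simp add: h)
  qed
  ultimately have \<alpha>: "0 < \<alpha>" by simp
  define c where "c = - (a /\<^sub>R \<alpha>)"
  have cd: "c \<bullet> d' \<le> b'" if "clarke_le f x d' b'" for d' b'
  proof -
    have "- (a \<bullet> d') \<le> \<alpha> * b'" using nonneg[OF that] by simp
    then show ?thesis using \<alpha> by (simp add: c_def field_simps)
  qed
  have "c \<in> clarke_gradient f x"
    unfolding clarke_gradient_def
  proof (intro CollectI allI)
    fix d'
    show "ereal (c \<bullet> d') \<le> clarke_dderiv f x d'"
    proof (rule ccontr)
      assume "\<not> ereal (c \<bullet> d') \<le> clarke_dderiv f x d'"
      then obtain b where b: "clarke_dderiv f x d' < ereal b" "ereal b < ereal (c \<bullet> d')"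
        using ereal_dense2[of "clarke_dderiv f x d'" "ereal (c \<bullet> d')"] by (auto simp: not_le)
      from b(1) have "clarke_le f x d' b" unfolding clarke_dderiv_le_iff[symmetric] by simp
      from cd[OF this] b(2) show False by simp
    qed
  qed
  from \<beta>[OF this] have "c \<bullet> d \<le> \<beta>" .
  then have "- (a \<bullet> d) \<le> \<alpha> * \<beta>" using \<alpha> by (simp add: c_def field_simps)
  then show False using hk(1) k by (simp add: h)
qed

text \<open>At a single point the bound holds up to a step size that depends on the point. A finite
  subcover gives one step size for all points, as is required to integrate the increments over the
  ball.\<close>

lemma clarke_le_uniform:
  fixes f :: "'a::euclidean_space \<Rightarrow> real"
  assumes S: "compact S" and c: "\<And>y. y \<in> S \<Longrightarrow> clarke_le f y d b" and \<epsilon>: "0 < \<epsilon>"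
  shows "\<exists>\<tau>>0. \<forall>t. 0 < t \<longrightarrow> t < \<tau> \<longrightarrow> (\<forall>y\<in>S. f (y + t *\<^sub>R d) - f y \<le> t * (b + \<epsilon>))"
proof -
  have "\<exists>\<delta>. \<forall>y\<in>S. 0 < \<delta> y \<and> (\<forall>w\<in>ball y (\<delta> y). \<forall>t. 0 < t \<longrightarrow> t < \<delta> y \<longrightarrow> f (w + t *\<^sub>R d) - f w \<le> t * (b + \<epsilon>))"
    using c \<epsilon> unfolding clarke_le_def by (intro bchoice) blast
  then obtain \<delta> where \<delta>: "\<And>y. y \<in> S \<Longrightarrow> 0 < \<delta> y"
    "\<And>y w t. y \<in> S \<Longrightarrow> w \<in> ball y (\<delta> y) \<Longrightarrow> 0 < t \<Longrightarrow> t < \<delta> y \<Longrightarrow> f (w + t *\<^sub>R d) - f w \<le> t * (b + \<epsilon>)"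
    by blast
  obtain C where C: "C \<subseteq> S" "finite C" "S \<subseteq> (\<Union>y\<in>C. ball y (\<delta> y))"
  proof (rule compactE_image[OF S, of S "\<lambda>y. ball y (\<delta> y)"])
    show "S \<subseteq> (\<Union>y\<in>S. ball y (\<delta> y))" using \<delta>(1) by force
  qed auto
  define \<tau> where "\<tau> = Min (insert 1 (\<delta> ` C))"
  have "0 < \<tau>" unfolding \<tau>_def using C \<delta>(1) by (subst Min_gr_iff) auto
  moreover have "f (y + t *\<^sub>R d) - f y \<le> t * (b + \<epsilon>)" if t: "0 < t" "t < \<tau>" and y: "y \<in> S" for t y
  proof -
    obtain w where w: "w \<in> C" "y \<in> ball w (\<delta> w)" using C(3) y by blast
    have "\<tau> \<le> \<delta> w" unfolding \<tau>_def using C(2) w(1) by (intro Min_le) auto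
    then show ?thesis using \<delta>(2)[of w y t] w C(1) t by auto
  qed
  ultimately show ?thesis by blast
qed

text \<open>If a hyperplane separated the gradient from the set, then along \<open>d = - a\<close>
  every generalized gradient on \<open>cball x \<eta>\<close> would have slope below
  \<open>- k\<close>. Duality and compactness turn this into a bound for the increments of
  \<open>f\<close> on the whole ball, and averaging bounds the slope of the smoothed function by
  \<open>- k\<close> as well, against the separation.\<close>

lemma sphere_gradient_in_closure_clarke:
  fixes f :: "'a::euclidean_space \<Rightarrow> real"
  assumes f: "\<Lambda>-lipschitz_on UNIV f" and \<eta>: "0 < \<eta>"
  shows "sphere_gradient \<eta> f x \<in> closure (clarke_gradient_eta \<eta> f x)"
proof (rule ccontr)
  let ?g = "sphere_gradient \<eta> f x" and ?C = "clarke_gradient_eta \<eta> f x"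
  interpret U: prob_space "uniform_ball :: 'a measure" by (rule prob_space_uniform_ball)
  assume "?g \<notin> closure ?C"
  moreover have "convex (closure ?C)"
    unfolding clarke_gradient_eta_def by (intro convex_closure convex_convex_hull)
  ultimately obtain a k where ak: "a \<bullet> ?g < k" "\<forall>c\<in>closure ?C. k < a \<bullet> c"
    using separating_hyperplane_closed_point[of "closure ?C" ?g] by auto
  define d where "d = - a"
  have cl: "clarke_le f y d (- k)" if y: "y \<in> cball x \<eta>" for y
  proof (rule clarke_le_dual[OF f])
    fix c assume "c \<in> clarke_gradient f y"
    then have "c \<in> ?C" using y unfolding clarke_gradient_eta_def by (intro hull_inc) auto
    then have "k < a \<bullet> c" using ak(2) closure_subset by blast
    then show "c \<bullet> d \<le> - k" by (simp add: d_def inner_commute)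
  qed
  obtain C where C: "\<And>h. norm h \<le> \<eta> / 2 \<Longrightarrow> \<bar>ball_smoothing \<eta> f (x + h) - ball_smoothing \<eta> f x - ?g \<bullet> h\<bar> \<le> C * (norm h)\<^sup>2"
    using ball_smoothing_expansion[OF f \<eta>, of x] by blast
  have bound: "?g \<bullet> d \<le> - k + \<epsilon>" if \<epsilon>: "0 < \<epsilon>" for \<epsilon>
  proof -
    obtain \<tau> where \<tau>: "0 < \<tau>" "\<And>t y. 0 < t \<Longrightarrow> t < \<tau> \<Longrightarrow> y \<in> cball x \<eta> \<Longrightarrow> f (y + t *\<^sub>R d) - f y \<le> t * (- k + \<epsilon> / 2)"
      using clarke_le_uniform[OF compact_cball[of x \<eta>] cl, of "\<epsilon> / 2"] \<epsilon> by auto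
    \<comment> \<open>The three bounds serve the uniform step size, the range of the expansion, and
      a quadratic remainder of at most \<open>r * (\<epsilon> / 2)\<close>.\<close>
    define r where "r = Min {\<tau> / 2, \<eta> / (2 * (1 + norm d)), \<epsilon> / (2 * (1 + \<bar>C\<bar> * (norm d)\<^sup>2))}"
    have nd: "0 < 1 + norm d" by (smt (verit) norm_ge_zero)
    have nC: "0 < 1 + \<bar>C\<bar> * (norm d)\<^sup>2" by (smt (verit) mult_nonneg_nonneg abs_ge_zero zero_le_power2)
    have r: "0 < r" using \<tau>(1) \<eta> \<epsilon> nd nC by (simp add: r_def)
    have r\<tau>: "r < \<tau>" using \<tau>(1) by (simp add: r_def min_less_iff_disj)
    have "r \<le> \<eta> / (2 * (1 + norm d))" by (simp add: r_def)
    then have "r * (1 + norm d) \<le> \<eta> / 2" using nd by (simp add: field_simps)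
    then have rn: "norm (r *\<^sub>R d) \<le> \<eta> / 2" using r by (simp add: algebra_simps)
    have "r \<le> \<epsilon> / (2 * (1 + \<bar>C\<bar> * (norm d)\<^sup>2))" by (simp add: r_def)
    then have "r * (1 + \<bar>C\<bar> * (norm d)\<^sup>2) \<le> \<epsilon> / 2" using nC by (simp add: field_simps)
    then have rC: "r * (\<bar>C\<bar> * (norm d)\<^sup>2) \<le> \<epsilon> / 2" using r by (simp add: algebra_simps)
    have int: "integrable uniform_ball (\<lambda>u. f (z + \<eta> *\<^sub>R u))" for z by (rule lipschitz_on_ball_smoothing(3)[OF f])
    have "ball_smoothing \<eta> f (x + r *\<^sub>R d) - ball_smoothing \<eta> f x = (\<integral>u. f (x + r *\<^sub>R d + \<eta> *\<^sub>R u) - f (x + \<eta> *\<^sub>R u) \<partial>uniform_ball)"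
      by (simp add: ball_smoothing_def int)
    also have "\<dots> \<le> (\<integral>u. r * (- k + \<epsilon> / 2) \<partial>(uniform_ball :: 'a measure))"
    proof (rule integral_mono_AE)
      show "AE u in uniform_ball. f (x + r *\<^sub>R d + \<eta> *\<^sub>R u) - f (x + \<eta> *\<^sub>R u) \<le> r * (- k + \<epsilon> / 2)"
        using AE_uniform_ball[where 'a='a]
      proof eventually_elim
        case (elim u)
        have "x + \<eta> *\<^sub>R u \<in> cball x \<eta>" using elim \<eta> by (simp add: dist_norm mult_left_le)
        from \<tau>(2)[OF r r\<tau> this] show ?case by (simp add: add.assoc add.left_commute add.commute)
      qed
    qed (use int in auto)
    finally have 1: "ball_smoothing \<eta> f (x + r *\<^sub>R d) - ball_smoothing \<eta> f x \<le> r * (- k + \<epsilon> / 2)"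
      using U.prob_space by simp
    have "r * (?g \<bullet> d) \<le> ball_smoothing \<eta> f (x + r *\<^sub>R d) - ball_smoothing \<eta> f x + C * (norm (r *\<^sub>R d))\<^sup>2"
      using C[OF rn] by (simp add: abs_le_iff)
    also have "\<dots> \<le> r * (- k + \<epsilon> / 2) + \<bar>C\<bar> * (norm (r *\<^sub>R d))\<^sup>2"
      using 1 by (intro add_mono mult_right_mono) auto
    also have "\<dots> = r * (- k + \<epsilon> / 2) + r * (r * (\<bar>C\<bar> * (norm d)\<^sup>2))"
      using r by (simp add: power_mult_distrib power2_eq_square)
    also have "\<dots> \<le> r * (- k + \<epsilon> / 2) + r * (\<epsilon> / 2)"
      using r rC by (intro add_left_mono mult_left_mono) auto
    also have "\<dots> = r * (- k + \<epsilon>)" by (simp add: field_simps)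
    finally show ?thesis using r by simp
  qed
  have "?g \<bullet> d \<le> - k" by (rule field_le_epsilon) (use bound in auto)
  then show False using ak(1) by (simp add: d_def inner_commute)
qed

lemma infdist_clarke_gradient_eta_le:
  fixes f :: "'a::euclidean_space \<Rightarrow> real"
  assumes f: "\<Lambda>-lipschitz_on UNIV f" and \<eta>: "0 < \<eta>"
  shows "infdist 0 (clarke_gradient_eta \<eta> f x) \<le> norm (sphere_gradient \<eta> f x)"
proof -
  let ?g = "sphere_gradient \<eta> f x" and ?C = "clarke_gradient_eta \<eta> f x"
  have g: "?g \<in> closure ?C" by (rule sphere_gradient_in_closure_clarke[OF f \<eta>])
  \<comment> \<open>The distance to the empty set is 0 by convention, so the passage between closure
    and vanishing distance is made for a nonempty set.\<close>
  then have "?C \<noteq> {}" by auto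
  with g have "infdist ?g ?C = 0" by (simp add: in_closure_iff_infdist_zero)
  then show ?thesis using infdist_triangle[of 0 ?C ?g] by simp
qed

section \<open>A Poincare inequality on the sphere\<close>

text \<open>For a fixed second component the shear is a translation of the first, so Fubini reduces
  the claim to translation invariance.\<close>

lemma distr_lborel_shear_fst:
  "distr lborel borel (\<lambda>p. (fst p + t *\<^sub>R snd p, snd p)) = (lborel :: ('a::euclidean_space \<times> 'a) measure)"
proof (rule measure_eqI)
  fix A assume "A \<in> sets (distr lborel borel (\<lambda>p. (fst p + t *\<^sub>R snd p, snd p)) :: ('a \<times> 'a) measure)"
  then have A: "A \<in> sets borel" by simp
  have m: "(\<lambda>p. (fst p + t *\<^sub>R snd p, snd p)) \<in> borel \<rightarrow>\<^sub>M (borel :: ('a \<times> 'a) measure)"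
    by (intro borel_measurable_continuous_onI continuous_intros)
  have A': "A \<in> sets (borel \<Otimes>\<^sub>M borel)" using A unfolding borel_prod .
  have mi: "(\<lambda>p. indicator A (fst p + t *\<^sub>R snd p, snd p) :: ennreal) \<in> borel_measurable borel"
    using m A by (intro measurable_compose[OF m]) auto
  have "emeasure (distr lborel borel (\<lambda>p. (fst p + t *\<^sub>R snd p, snd p))) A
     = (\<integral>\<^sup>+p. indicator A p \<partial>distr lborel borel (\<lambda>p. (fst p + t *\<^sub>R snd p, snd p)))"
    using A by simp
  also have "\<dots> = (\<integral>\<^sup>+p. indicator A (fst p + t *\<^sub>R snd p, snd p) \<partial>lborel)"
    using m A by (subst nn_integral_distr) auto
  also have "\<dots> = (\<integral>\<^sup>+y. \<integral>\<^sup>+x. indicator A (x + t *\<^sub>R y, y) \<partial>lborel \<partial>lborel)"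
    using mi unfolding lborel_prod[symmetric]
    by (subst lborel_pair.nn_integral_snd[symmetric]) (auto simp: lborel_prod)
  also have "\<dots> = (\<integral>\<^sup>+y. \<integral>\<^sup>+x. indicator A (x, y) \<partial>lborel \<partial>lborel)"
  proof (rule nn_integral_cong)
    fix y :: 'a
    have "(\<lambda>x. indicator A (x, y) :: ennreal) \<in> borel_measurable borel"
      using A' by (intro borel_measurable_indicator' ) auto
    from nn_integral_lborel_translate[OF this, of "t *\<^sub>R y"]
    show "(\<integral>\<^sup>+x. indicator A (x + t *\<^sub>R y, y) \<partial>lborel) = (\<integral>\<^sup>+x. indicator A (x, y) \<partial>lborel)"
      by (simp add: add.commute)
  qed
  also have "\<dots> = (\<integral>\<^sup>+p. indicator A p \<partial>lborel)"
    using A unfolding lborel_prod[symmetric]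
    by (subst lborel_pair.nn_integral_snd[symmetric]) (auto simp: lborel_prod)
  finally show "emeasure (distr lborel borel (\<lambda>p. (fst p + t *\<^sub>R snd p, snd p))) A = emeasure lborel A"
    using A by simp
qed simp

lemma distr_lborel_shear_snd:
  "distr lborel borel (\<lambda>p. (fst p, snd p + t *\<^sub>R fst p)) = (lborel :: ('a::euclidean_space \<times> 'a) measure)"
proof (rule measure_eqI)
  fix A assume "A \<in> sets (distr lborel borel (\<lambda>p. (fst p, snd p + t *\<^sub>R fst p)) :: ('a \<times> 'a) measure)"
  then have A: "A \<in> sets borel" by simp
  have m: "(\<lambda>p. (fst p, snd p + t *\<^sub>R fst p)) \<in> borel \<rightarrow>\<^sub>M (borel :: ('a \<times> 'a) measure)"
    by (intro borel_measurable_continuous_onI continuous_intros)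
  have A': "A \<in> sets (borel \<Otimes>\<^sub>M borel)" using A unfolding borel_prod .
  have mi: "(\<lambda>p. indicator A (fst p, snd p + t *\<^sub>R fst p) :: ennreal) \<in> borel_measurable borel"
    using m A by (intro measurable_compose[OF m]) auto
  have "emeasure (distr lborel borel (\<lambda>p. (fst p, snd p + t *\<^sub>R fst p))) A
     = (\<integral>\<^sup>+p. indicator A p \<partial>distr lborel borel (\<lambda>p. (fst p, snd p + t *\<^sub>R fst p)))"
    using A by simp
  also have "\<dots> = (\<integral>\<^sup>+p. indicator A (fst p, snd p + t *\<^sub>R fst p) \<partial>lborel)"
    using m A by (subst nn_integral_distr) auto
  also have "\<dots> = (\<integral>\<^sup>+x. \<integral>\<^sup>+y. indicator A (x, y + t *\<^sub>R x) \<partial>lborel \<partial>lborel)"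
    using mi unfolding lborel_prod[symmetric]
    by (subst lborel.nn_integral_fst[symmetric]) (auto simp: lborel_prod)
  also have "\<dots> = (\<integral>\<^sup>+x. \<integral>\<^sup>+y. indicator A (x, y) \<partial>lborel \<partial>lborel)"
  proof (rule nn_integral_cong)
    fix x :: 'a
    have "(\<lambda>y. indicator A (x, y) :: ennreal) \<in> borel_measurable borel"
      using A' by (intro borel_measurable_indicator') auto
    from nn_integral_lborel_translate[OF this, of "t *\<^sub>R x"]
    show "(\<integral>\<^sup>+y. indicator A (x, y + t *\<^sub>R x) \<partial>lborel) = (\<integral>\<^sup>+y. indicator A (x, y) \<partial>lborel)"
      by (simp add: add.commute)
  qed
  also have "\<dots> = (\<integral>\<^sup>+p. indicator A p \<partial>lborel)"
    using A unfolding lborel_prod[symmetric]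
    by (subst lborel.nn_integral_fst[symmetric]) (auto simp: lborel_prod)
  finally show "emeasure (distr lborel borel (\<lambda>p. (fst p, snd p + t *\<^sub>R fst p))) A = emeasure lborel A"
    using A by simp
qed simp

section \<open>Rotations of pairs of points\<close>

definition plane_rotation :: "real \<Rightarrow> real \<Rightarrow> 'a::euclidean_space \<times> 'a \<Rightarrow> 'a \<times> 'a" where
  "plane_rotation c s p = (c *\<^sub>R fst p + s *\<^sub>R snd p, c *\<^sub>R snd p - s *\<^sub>R fst p)"

lemma measurable_plane_rotation[measurable]: "plane_rotation c s \<in> borel \<rightarrow>\<^sub>M borel"
  unfolding plane_rotation_def[abs_def] by (intro borel_measurable_continuous_onI continuous_intros)

text \<open>A rotation by an angle that is not a multiple of \<open>\<pi>\<close> is a product of three shears.\<close>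

lemma distr_lborel_plane_rotation:
  assumes cs: "c\<^sup>2 + s\<^sup>2 = 1" and s: "s \<noteq> 0"
  shows "distr lborel borel (plane_rotation c s) = (lborel :: ('a::euclidean_space \<times> 'a) measure)"
proof -
  \<comment> \<open>For \<open>c = cos \<theta>\<close> and \<open>s = sin \<theta>\<close> this is
    the tangent of \<open>\<theta> / 2\<close>; the shears by \<open>t\<close>, \<open>- s\<close>
    and \<open>t\<close> then compose to the rotation.\<close>
  define t where "t = (1 - c) / s"
  let ?T = "\<lambda>t p :: 'a \<times> 'a. (fst p + t *\<^sub>R snd p, snd p)"
  let ?S = "\<lambda>t p :: 'a \<times> 'a. (fst p, snd p + t *\<^sub>R fst p)"
  have mT[measurable]: "?T t \<in> borel \<rightarrow>\<^sub>M borel" and mS[measurable]: "?S t \<in> borel \<rightarrow>\<^sub>M borel" for t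
    by (intro borel_measurable_continuous_onI continuous_intros)+
  have ts: "t * s = 1 - c" using s by (simp add: t_def)
  have tc: "t * (1 + c) = s" using s cs by (simp add: t_def field_simps power2_eq_square)
  have eq: "plane_rotation c s = ?T t \<circ> (?S (- s) \<circ> ?T t)"
  proof
    fix p :: "'a \<times> 'a"
    obtain x y where p: "p = (x, y)" by (cases p)
    have y1: "y - s *\<^sub>R (x + t *\<^sub>R y) = c *\<^sub>R y - s *\<^sub>R x"
    proof -
      have "y - s *\<^sub>R (x + t *\<^sub>R y) = (1 - t * s) *\<^sub>R y - s *\<^sub>R x" by (simp add: algebra_simps)
      then show ?thesis by (simp add: ts)
    qed
    have "x + t *\<^sub>R y + t *\<^sub>R (c *\<^sub>R y - s *\<^sub>R x) = (1 - t * s) *\<^sub>R x + (t * (1 + c)) *\<^sub>R y"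
      by (simp add: algebra_simps)
    also have "\<dots> = c *\<^sub>R x + s *\<^sub>R y" by (simp add: ts tc)
    finally show "plane_rotation c s p = (?T t \<circ> (?S (- s) \<circ> ?T t)) p"
      using y1 by (simp add: p plane_rotation_def)
  qed
  have "distr lborel borel (plane_rotation c s) = distr (distr (distr lborel borel (?T t)) borel (?S (- s))) borel (?T t)"
  proof -
    have "distr lborel borel (?T t \<circ> (?S (- s) \<circ> ?T t)) = distr (distr lborel borel (?S (- s) \<circ> ?T t)) borel (?T t)"
      by (rule distr_distr[symmetric]) (unfold measurable_lborel2, rule mT, rule measurable_comp[OF mT mS])
    also have "distr lborel borel (?S (- s) \<circ> ?T t) = distr (distr lborel borel (?T t)) borel (?S (- s))"
      by (rule distr_distr[symmetric]) (unfold measurable_lborel2, rule mS, rule mT)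
    finally show ?thesis unfolding eq .
  qed
  also have "\<dots> = lborel"
    by (simp only: distr_lborel_shear_fst distr_lborel_shear_snd)
  finally show ?thesis .
qed

lemma norm_plane_rotation:
  assumes "c\<^sup>2 + s\<^sup>2 = 1"
  shows "norm (plane_rotation c s p) = norm p"
proof -
  obtain x y where p: "p = (x, y)" by (cases p)
  have "(norm (c *\<^sub>R x + s *\<^sub>R y))\<^sup>2 + (norm (c *\<^sub>R y - s *\<^sub>R x))\<^sup>2 = (c\<^sup>2 + s\<^sup>2) * ((norm x)\<^sup>2 + (norm y)\<^sup>2)"
    unfolding dot_square_norm[symmetric] by (simp add: inner_add inner_diff algebra_simps inner_commute power2_eq_square)
  then show ?thesis using assms by (simp add: p plane_rotation_def norm_Pair)
qed

text \<open>The excluded case is the half turn \<open>c = -1\<close>. The angles in the application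
  are at least 0 and below \<pi>, where the sine vanishes only for the identity.\<close>

lemma distr_uniform_ball_plane_rotation:
  assumes "c\<^sup>2 + s\<^sup>2 = 1" "s \<noteq> 0 \<or> c = 1"
  shows "distr uniform_ball borel (plane_rotation c s) = (uniform_ball :: ('a::euclidean_space \<times> 'a) measure)"
proof (cases "s = 0")
  case True
  with assms have "plane_rotation c s = (\<lambda>p :: 'a \<times> 'a. p)" by (auto simp: plane_rotation_def)
  then show ?thesis by (simp add: distr_id2[unfolded id_def])
next
  case False
  with assms show ?thesis
    by (intro distr_uniform_ball_isometry distr_lborel_plane_rotation norm_plane_rotation) auto
qed

lemma integrable_uniform_ball_pair:
  fixes f :: "'a::euclidean_space \<times> 'a \<Rightarrow> real"
  assumes "f \<in> borel_measurable borel" and "\<And>x y. norm x \<le> 1 \<Longrightarrow> norm y \<le> 1 \<Longrightarrow> \<bar>f (x, y)\<bar> \<le> B"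
  shows "integrable uniform_ball f"
proof (rule integrable_uniform_ball_bounded[of _ B])
  fix p :: "'a \<times> 'a" assume "norm p \<le> 1"
  then have "norm (fst p) \<le> 1" "norm (snd p) \<le> 1"
    using norm_fst_le[of "fst p" "snd p"] norm_snd_le[of "snd p" "fst p"] by auto
  then show "norm (f p) \<le> B" using assms(2)[of "fst p" "snd p"] by simp
qed fact

text \<open>Embedding the basis as \<open>(0, b)\<close> lets the symmetries act on the second
  component alone, with the first one held fixed.\<close>

lemma reflect_coord_pair:
  fixes p :: "'a::euclidean_space \<times> 'a"
  assumes "b \<in> Basis"
  shows "reflect_coord (0, b) p = (fst p, reflect_coord b (snd p))"
proof (rule euclidean_eqI)
  fix j :: "'a \<times> 'a" assume j: "j \<in> Basis"
  then show "reflect_coord (0, b) p \<bullet> j = (fst p, reflect_coord b (snd p)) \<bullet> j"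
    using assms by (subst reflect_coord_inner[OF j]) (auto simp: Basis_prod_def reflect_coord_inner inner_prod_def nonzero_Basis split: if_splits)
qed

lemma swap_coords_pair:
  fixes p :: "'a::euclidean_space \<times> 'a"
  assumes "b \<in> Basis" "c \<in> Basis"
  shows "swap_coords (0, b) (0, c) p = (fst p, swap_coords b c (snd p))"
proof (rule euclidean_eqI)
  fix j :: "'a \<times> 'a" assume j: "j \<in> Basis"
  then show "swap_coords (0, b) (0, c) p \<bullet> j = (fst p, swap_coords b c (snd p)) \<bullet> j"
    using assms by (subst swap_coords_inner[OF j])
      (auto simp: Basis_prod_def swap_coords_inner inner_prod_def nonzero_Basis Transposition.transpose_def split: if_splits)
qed

text \<open>The radius of the second component depends on the first, but its direction does not:
  reflections and swaps of the second component preserve the law of the pair and fix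
  \<open>G (fst p)\<close>. So the square of the inner product averages to the product of the
  squared norms divided by the dimension.\<close>

lemma uniform_ball_pair_second_moment:
  fixes G :: "'a::euclidean_space \<Rightarrow> 'a"
  assumes [measurable]: "G \<in> borel_measurable borel" and G: "\<And>x. norm (G x) \<le> \<Lambda>"
  shows "(\<integral>p. (G (fst p) \<bullet> snd p)\<^sup>2 \<partial>uniform_ball) \<le> \<Lambda>\<^sup>2 / DIM('a) * (\<integral>p. (norm (snd p))\<^sup>2 \<partial>(uniform_ball :: ('a \<times> 'a) measure))"
proof -
  have \<Lambda>: "0 \<le> \<Lambda>" using G[of 0] norm_ge_zero order_trans by blast
  have [measurable]: "(fst :: 'a \<times> 'a \<Rightarrow> 'a) \<in> borel \<rightarrow>\<^sub>M borel" "(snd :: 'a \<times> 'a \<Rightarrow> 'a) \<in> borel \<rightarrow>\<^sub>M borel"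
    by (intro borel_measurable_continuous_onI continuous_intros)+
  have i1: "integrable uniform_ball (\<lambda>p :: 'a \<times> 'a. (norm (G (fst p)))\<^sup>2 * (norm (snd p))\<^sup>2)"
  proof (rule integrable_uniform_ball_pair[of _ "\<Lambda>\<^sup>2"])
    fix x y :: 'a assume "norm y \<le> 1"
    then have "(norm (G x))\<^sup>2 * (norm y)\<^sup>2 \<le> \<Lambda>\<^sup>2 * 1"
      using G by (intro mult_mono power_mono power_le_one) auto
    then show "\<bar>(norm (G (fst (x, y))))\<^sup>2 * (norm (snd (x, y)))\<^sup>2\<bar> \<le> \<Lambda>\<^sup>2" by (simp add: abs_mult)
  qed measurable
  have i2: "integrable uniform_ball (\<lambda>p :: 'a \<times> 'a. (norm (snd p))\<^sup>2)"
    by (rule integrable_uniform_ball_pair[of _ 1]) (auto simp: power_le_one)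
  have inB: "(0, b) \<in> Basis" if "b \<in> Basis" for b :: 'a using that by (auto simp: Basis_prod_def)
  have "(\<integral>p. (G (fst p) \<bullet> snd p)\<^sup>2 \<partial>uniform_ball)
      = (\<integral>p. (norm (G (fst p)))\<^sup>2 * (norm (snd p))\<^sup>2 \<partial>(uniform_ball :: ('a \<times> 'a) measure)) / DIM('a)"
  proof (rule second_moment_symmetric)
    fix b c :: 'a assume bc: "b \<in> Basis" "c \<in> Basis" "b \<noteq> c"
    let ?f = "\<lambda>p. (G (fst p) \<bullet> b) * (G (fst p) \<bullet> c) * ((snd p \<bullet> b) * (snd p \<bullet> c))"
    have "(\<integral>p. ?f p \<partial>uniform_ball) = (\<integral>p. ?f (reflect_coord (0, b) p) \<partial>uniform_ball)"
      by (rule integral_invariant[OF uniform_ball_invariant(2), symmetric]) auto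
    also have "\<dots> = (\<integral>p. - ?f p \<partial>uniform_ball)"
      using bc by (simp add: reflect_coord_pair reflect_coord_inner)
    finally show "(\<integral>p. ?f p \<partial>uniform_ball) = 0" by simp
  next
    fix b c :: 'a assume bc: "b \<in> Basis" "c \<in> Basis"
    let ?f = "\<lambda>p. (G (fst p) \<bullet> b)\<^sup>2 * (snd p \<bullet> b)\<^sup>2"
    have "(\<integral>p. ?f p \<partial>uniform_ball) = (\<integral>p. ?f (swap_coords (0, b) (0, c) p) \<partial>uniform_ball)"
      by (rule integral_invariant[OF uniform_ball_invariant(3)[OF inB[OF bc(1)] inB[OF bc(2)]], symmetric]) auto
    then show "(\<integral>p. ?f p \<partial>uniform_ball) = (\<integral>p. (G (fst p) \<bullet> b)\<^sup>2 * (snd p \<bullet> c)\<^sup>2 \<partial>uniform_ball)"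
      using bc by (simp add: swap_coords_pair swap_coords_inner)
  qed (use i1 in auto)
  also have "\<dots> \<le> (\<integral>p. \<Lambda>\<^sup>2 * (norm (snd p))\<^sup>2 \<partial>(uniform_ball :: ('a \<times> 'a) measure)) / DIM('a)"
    by (intro divide_right_mono integral_mono i1 integrable_mult_right i2 mult_right_mono power_mono G) auto
  finally show ?thesis by simp
qed

text \<open>A quarter turn maps \<open>(x, y)\<close> to \<open>(y, - x)\<close>.\<close>

lemma uniform_ball_pair_norm_fst:
  "(\<integral>p. (norm (fst p))\<^sup>2 \<partial>(uniform_ball :: ('a::euclidean_space \<times> 'a) measure)) = (\<integral>p. (norm (snd p))\<^sup>2 \<partial>(uniform_ball :: ('a \<times> 'a) measure))"
proof -
  have [measurable]: "(fst :: 'a \<times> 'a \<Rightarrow> 'a) \<in> borel \<rightarrow>\<^sub>M borel"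
    by (intro borel_measurable_continuous_onI continuous_intros)
  have "(\<integral>p. (norm (fst p))\<^sup>2 \<partial>(uniform_ball :: ('a \<times> 'a) measure)) = (\<integral>p. (norm (fst (plane_rotation 0 1 p)))\<^sup>2 \<partial>(uniform_ball :: ('a \<times> 'a) measure))"
    by (rule integral_invariant[OF distr_uniform_ball_plane_rotation, symmetric]) auto
  then show ?thesis by (simp add: plane_rotation_def)
qed

text \<open>Allows the division by this mean in \<open>odd_poincare_sphere\<close>. If it vanished,
  then by symmetry both components would vanish almost everywhere.\<close>

lemma uniform_ball_pair_norm_pos:
  "0 < (\<integral>p. (norm (fst p))\<^sup>2 \<partial>(uniform_ball :: ('a::euclidean_space \<times> 'a) measure))"
proof (rule ccontr)
  interpret U: prob_space "uniform_ball :: ('a \<times> 'a) measure" by (rule prob_space_uniform_ball)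
  have [measurable]: "(fst :: 'a \<times> 'a \<Rightarrow> 'a) \<in> borel \<rightarrow>\<^sub>M borel" "(snd :: 'a \<times> 'a \<Rightarrow> 'a) \<in> borel \<rightarrow>\<^sub>M borel"
    by (intro borel_measurable_continuous_onI continuous_intros)+
  have i: "integrable uniform_ball (\<lambda>p :: 'a \<times> 'a. (norm (fst p))\<^sup>2)" "integrable uniform_ball (\<lambda>p :: 'a \<times> 'a. (norm (snd p))\<^sup>2)"
    by (rule integrable_uniform_ball_pair[of _ 1]; auto simp: power_le_one)+
  assume "\<not> 0 < (\<integral>p. (norm (fst p))\<^sup>2 \<partial>(uniform_ball :: ('a \<times> 'a) measure))"
  moreover have "0 \<le> (\<integral>p. (norm (fst p))\<^sup>2 \<partial>(uniform_ball :: ('a \<times> 'a) measure))" by (intro Bochner_Integration.integral_nonneg) auto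
  ultimately have z: "(\<integral>p. (norm (fst p))\<^sup>2 \<partial>(uniform_ball :: ('a \<times> 'a) measure)) = 0" by linarith
  from z z[unfolded uniform_ball_pair_norm_fst] have "AE p in (uniform_ball :: ('a \<times> 'a) measure). (norm (fst p))\<^sup>2 = 0" "AE p in (uniform_ball :: ('a \<times> 'a) measure). (norm (snd p))\<^sup>2 = 0"
    using i by (auto simp: integral_nonneg_eq_0_iff_AE)
  with AE_uniform_ball[where 'a="'a \<times> 'a"] have "AE p in (uniform_ball :: ('a \<times> 'a) measure). False"
    by eventually_elim (auto simp: prod_eq_iff)
  then show False using U.AE_False by simp
qed

lemma plane_rotation_Suc:
  "fst (plane_rotation (cos (real (Suc j) * \<delta>)) (sin (real (Suc j) * \<delta>)) p)
    = cos \<delta> *\<^sub>R fst (plane_rotation (cos (real j * \<delta>)) (sin (real j * \<delta>)) p)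
      + sin \<delta> *\<^sub>R snd (plane_rotation (cos (real j * \<delta>)) (sin (real j * \<delta>)) p)"
proof -
  have "real (Suc j) * \<delta> = \<delta> + real j * \<delta>" by (simp add: algebra_simps)
  then show ?thesis
    by (simp only:) (simp add: plane_rotation_def cos_add sin_add algebra_simps)
qed

text \<open>Maurey's path argument: the segment from \<open>x\<close> to \<open>- x\<close> is replaced by a half turn in the plane
  of \<open>x\<close> and \<open>y\<close>. All steps of the half turn have the same law, and their first-order terms are
  directional derivatives in the independent isotropic direction \<open>y\<close>.\<close>

lemma odd_poincare_step:
  fixes g :: "'a::euclidean_space \<Rightarrow> real" and G :: "'a \<Rightarrow> 'a" and N :: nat
  assumes gG: "\<And>x. GDERIV g x :> G x" and L: "L-lipschitz_on UNIV G" and G: "\<And>x. norm (G x) \<le> \<Lambda>"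
    and odd: "\<And>x. g (- x) = - g x" and N: "2 \<le> N"
  defines "C \<equiv> 4 * L + 2 * \<Lambda>"
  shows "4 * (\<integral>p. (g (fst p))\<^sup>2 \<partial>(uniform_ball :: ('a \<times> 'a) measure))
    \<le> pi\<^sup>2 * ((\<integral>p. (G (fst p) \<bullet> snd p)\<^sup>2 \<partial>(uniform_ball :: ('a \<times> 'a) measure)) + 2 * C * \<Lambda> * (pi / N) + C\<^sup>2 * (pi / N)\<^sup>2)"
proof -
  interpret U: prob_space "uniform_ball :: ('a \<times> 'a) measure" by (rule prob_space_uniform_ball)
  define \<delta> where "\<delta> = pi / N"
  have N0: "0 < real N" using N by simp
  have \<delta>: "0 < \<delta>" "\<delta> \<le> 2" "N * \<delta> = pi"
  proof -
    show "0 < \<delta>" "N * \<delta> = pi" using N0 by (auto simp: \<delta>_def)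
    have "pi / N \<le> pi / 2" using N by (intro divide_left_mono) auto
    moreover have "pi / 2 < 2" using pi_less_4 by simp
    ultimately show "\<delta> \<le> 2" unfolding \<delta>_def by linarith
  qed
  have L0: "0 \<le> L" using L by (rule lipschitz_on_nonneg)
  have \<Lambda>: "0 \<le> \<Lambda>" using G[of 0] norm_ge_zero order_trans by blast
  have C: "0 \<le> C" using L0 \<Lambda> by (simp add: C_def)
  have [measurable]: "(fst :: 'a \<times> 'a \<Rightarrow> 'a) \<in> borel \<rightarrow>\<^sub>M borel" "(snd :: 'a \<times> 'a \<Rightarrow> 'a) \<in> borel \<rightarrow>\<^sub>M borel"
    by (intro borel_measurable_continuous_onI continuous_intros)+
  have [measurable]: "G \<in> borel_measurable borel" by (rule lipschitz_on_borel_measurable[OF L])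
  have "continuous_on UNIV g"
    using gG unfolding gderiv_def by (intro continuous_at_imp_continuous_on ballI) (blast intro: has_derivative_continuous)
  then have [measurable]: "g \<in> borel_measurable borel" by (rule borel_measurable_continuous_onI)
  let ?R = "\<lambda>j. plane_rotation (cos (real j * \<delta>)) (sin (real j * \<delta>)) :: 'a \<times> 'a \<Rightarrow> 'a \<times> 'a"
  define D where "D p = g (fst p) - g (cos \<delta> *\<^sub>R fst p + sin \<delta> *\<^sub>R snd p)" for p :: "'a \<times> 'a"
  have [measurable]: "D \<in> borel_measurable borel" unfolding D_def[abs_def] by measurable
  have g0: "g 0 = 0" using odd[of 0] by simp
  have cosd: "\<bar>cos \<delta> - 1\<bar> \<le> \<delta>\<^sup>2 / 2"
  proof -
    have "cos \<delta> - 1 = - 2 * (sin (\<delta> / 2))\<^sup>2" using cos_double_sin[of "\<delta> / 2"] by simp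
    moreover have "(sin (\<delta> / 2))\<^sup>2 \<le> (\<delta> / 2)\<^sup>2"
      using abs_sin_x_le_abs_x[of "\<delta> / 2"] by (simp only: abs_le_square_iff)
    ultimately show ?thesis by (simp add: power_divide)
  qed
  have sind: "\<bar>sin \<delta> - \<delta>\<bar> \<le> \<delta>\<^sup>2 / 2"
    using Maclaurin_sin_bound[of \<delta> 2] by (simp add: numeral_2_eq_2 sin_coeff_def)
  \<comment> \<open>One step of the half turn moves \<open>x\<close> by
    \<open>\<delta> *\<^sub>R y\<close> up to second order. In \<open>C\<close>, the summand
    \<open>4 * L\<close> comes from a displacement of at most \<open>2 * \<delta>\<close>, and
    \<open>2 * \<Lambda>\<close> covers the replacement of \<open>cos \<delta>\<close> by 1 and of
    \<open>sin \<delta>\<close> by \<open>\<delta>\<close>.\<close>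
  have Dexp: "\<bar>D (x, y) + \<delta> * (G x \<bullet> y)\<bar> \<le> C * \<delta>\<^sup>2" if xy: "norm x \<le> 1" "norm y \<le> 1" for x y :: 'a
  proof -
    let ?x' = "cos \<delta> *\<^sub>R x + sin \<delta> *\<^sub>R y"
    have diff: "?x' - x = (cos \<delta> - 1) *\<^sub>R x + sin \<delta> *\<^sub>R y" by (simp add: algebra_simps)
    have "norm (?x' - x) \<le> \<bar>cos \<delta> - 1\<bar> * norm x + \<bar>sin \<delta>\<bar> * norm y"
      unfolding diff by (rule order_trans[OF norm_triangle_ineq]) simp
    also have "\<dots> \<le> \<delta>\<^sup>2 / 2 * 1 + \<delta> * 1"
      using cosd abs_sin_x_le_abs_x[of \<delta>] \<delta> xy by (intro add_mono mult_mono) auto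
    also have "\<dots> \<le> 2 * \<delta>"
      using \<delta> by (simp add: power2_eq_square mult_left_le)
    finally have nd: "norm (?x' - x) \<le> 2 * \<delta>" .
    have 1: "\<bar>g ?x' - g x - G x \<bullet> (?x' - x)\<bar> \<le> 4 * L * \<delta>\<^sup>2"
    proof -
      have "\<bar>g ?x' - g x - G x \<bullet> (?x' - x)\<bar> \<le> L * (norm (?x' - x))\<^sup>2" by (rule smooth_expansion[OF gG L])
      also have "\<dots> \<le> L * (2 * \<delta>)\<^sup>2" using nd L0 by (intro mult_left_mono power_mono) auto
      finally show ?thesis by (simp add: power_mult_distrib)
    qed
    have e: "G x \<bullet> (?x' - x) - \<delta> * (G x \<bullet> y) = G x \<bullet> ((cos \<delta> - 1) *\<^sub>R x + (sin \<delta> - \<delta>) *\<^sub>R y)"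
      unfolding diff by (simp add: inner_add_right inner_diff_right algebra_simps)
    have "\<bar>G x \<bullet> ((cos \<delta> - 1) *\<^sub>R x + (sin \<delta> - \<delta>) *\<^sub>R y)\<bar> \<le> norm (G x) * norm ((cos \<delta> - 1) *\<^sub>R x + (sin \<delta> - \<delta>) *\<^sub>R y)"
      by (rule Cauchy_Schwarz_ineq2)
    also have "norm ((cos \<delta> - 1) *\<^sub>R x + (sin \<delta> - \<delta>) *\<^sub>R y) \<le> \<bar>cos \<delta> - 1\<bar> * norm x + \<bar>sin \<delta> - \<delta>\<bar> * norm y"
      by (rule order_trans[OF norm_triangle_ineq]) simp
    also have "\<dots> \<le> \<delta>\<^sup>2 / 2 * 1 + \<delta>\<^sup>2 / 2 * 1"
      using cosd sind xy by (intro add_mono mult_mono) auto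
    finally have 2: "\<bar>G x \<bullet> (?x' - x) - \<delta> * (G x \<bullet> y)\<bar> \<le> norm (G x) * \<delta>\<^sup>2"
      unfolding e by (simp add: mult_left_mono)
    have 3: "norm (G x) * \<delta>\<^sup>2 \<le> \<Lambda> * \<delta>\<^sup>2" using G by (intro mult_right_mono) auto
    have 4: "0 \<le> \<Lambda> * \<delta>\<^sup>2" using \<Lambda> by simp
    have "D (x, y) + \<delta> * (G x \<bullet> y) = - (g ?x' - g x - G x \<bullet> (?x' - x)) - (G x \<bullet> (?x' - x) - \<delta> * (G x \<bullet> y))"
      by (simp add: D_def)
    moreover have "C * \<delta>\<^sup>2 = 4 * L * \<delta>\<^sup>2 + 2 * (\<Lambda> * \<delta>\<^sup>2)" by (simp add: C_def algebra_simps)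
    ultimately show ?thesis using 1 2 3 4 by linarith
  qed
  have Gy: "\<bar>G x \<bullet> y\<bar> \<le> \<Lambda>" if "norm y \<le> 1" for x y
  proof -
    have "\<bar>G x \<bullet> y\<bar> \<le> norm (G x) * norm y" by (rule Cauchy_Schwarz_ineq2)
    also have "\<dots> \<le> \<Lambda> * 1" using G that \<Lambda> by (intro mult_mono) auto
    finally show ?thesis by simp
  qed
  have Dsq: "(D (x, y))\<^sup>2 \<le> \<delta>\<^sup>2 * ((G x \<bullet> y)\<^sup>2 + 2 * C * \<Lambda> * \<delta> + C\<^sup>2 * \<delta>\<^sup>2)" if xy: "norm x \<le> 1" "norm y \<le> 1" for x y :: 'a
  proof -
    have "\<bar>D (x, y)\<bar> \<le> \<delta> * \<bar>G x \<bullet> y\<bar> + C * \<delta>\<^sup>2"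
      using Dexp[OF xy] \<delta> abs_triangle_ineq4[of "D (x, y) + \<delta> * (G x \<bullet> y)" "\<delta> * (G x \<bullet> y)"] by (simp add: abs_mult)
    then have "\<bar>D (x, y)\<bar>\<^sup>2 \<le> (\<delta> * \<bar>G x \<bullet> y\<bar> + C * \<delta>\<^sup>2)\<^sup>2" by (intro power_mono) auto
    also have "\<dots> = \<delta>\<^sup>2 * ((G x \<bullet> y)\<^sup>2 + 2 * C * \<bar>G x \<bullet> y\<bar> * \<delta> + C\<^sup>2 * \<delta>\<^sup>2)"
      by (simp add: power2_sum power_mult_distrib power2_eq_square algebra_simps abs_mult_self_eq)
    also have "\<dots> \<le> \<delta>\<^sup>2 * ((G x \<bullet> y)\<^sup>2 + 2 * C * \<Lambda> * \<delta> + C\<^sup>2 * \<delta>\<^sup>2)"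
      using Gy[OF xy(2)] C \<delta> by (intro mult_left_mono add_mono mult_right_mono order_refl) auto
    finally show ?thesis by simp
  qed
  have iG: "integrable uniform_ball (\<lambda>p :: 'a \<times> 'a. (G (fst p) \<bullet> snd p)\<^sup>2)"
  proof (rule integrable_uniform_ball_pair[of _ "\<Lambda>\<^sup>2"])
    fix x y :: 'a assume "norm y \<le> 1"
    from power_mono[OF Gy[OF this, of x], of 2] show "\<bar>(G (fst (x, y)) \<bullet> snd (x, y))\<^sup>2\<bar> \<le> \<Lambda>\<^sup>2" by simp
  qed measurable
  have iD: "integrable uniform_ball (\<lambda>p. (D p)\<^sup>2)"
  proof (rule integrable_uniform_ball_pair[of _ "\<delta>\<^sup>2 * (\<Lambda>\<^sup>2 + 2 * C * \<Lambda> * \<delta> + C\<^sup>2 * \<delta>\<^sup>2)"])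
    fix x y :: 'a assume xy: "norm x \<le> 1" "norm y \<le> 1"
    have "(G x \<bullet> y)\<^sup>2 \<le> \<Lambda>\<^sup>2" using power_mono[OF Gy[OF xy(2), of x], of 2] by simp
    then have "\<delta>\<^sup>2 * ((G x \<bullet> y)\<^sup>2 + 2 * C * \<Lambda> * \<delta> + C\<^sup>2 * \<delta>\<^sup>2) \<le> \<delta>\<^sup>2 * (\<Lambda>\<^sup>2 + 2 * C * \<Lambda> * \<delta> + C\<^sup>2 * \<delta>\<^sup>2)"
      by (intro mult_left_mono add_right_mono) auto
    with Dsq[OF xy] show "\<bar>(D (x, y))\<^sup>2\<bar> \<le> \<delta>\<^sup>2 * (\<Lambda>\<^sup>2 + 2 * C * \<Lambda> * \<delta> + C\<^sup>2 * \<delta>\<^sup>2)" by simp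
  qed measurable
  have rot: "distr uniform_ball borel (?R j) = uniform_ball" if "j < N" for j
  proof (rule distr_uniform_ball_plane_rotation)
    show "sin (real j * \<delta>) \<noteq> 0 \<or> cos (real j * \<delta>) = 1"
    proof (cases "j = 0")
      case False
      have "real j * \<delta> < N * \<delta>" using that \<delta>(1) by (intro mult_strict_right_mono) auto
      then have "0 < sin (real j * \<delta>)" using False \<delta> by (intro sin_gt_zero) auto
      then show ?thesis by simp
    qed simp
  qed simp
  \<comment> \<open>The half turn ends at \<open>- x\<close>, where oddness turns the telescoping
    sum into \<open>2 * g x\<close>. Cauchy-Schwarz costs a factor \<open>N\<close>, so
    \<open>N\<close> steps of squared size about \<open>\<delta>^2\<close> add up to the factor
    \<open>(N * \<delta>)^2 = pi^2\<close>.\<close>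
  have tele: "(2 * g (fst p))\<^sup>2 \<le> N * (\<Sum>j<N. (D (?R j p))\<^sup>2)" for p
  proof -
    have "(\<Sum>j<N. D (?R j p)) = (\<Sum>j<N. g (fst (?R j p)) - g (fst (?R (Suc j) p)))"
      unfolding D_def plane_rotation_Suc ..
    also have "\<dots> = g (fst (?R 0 p)) - g (fst (?R N p))"
      by (rule sum_lessThan_telescope')
    also have "fst (?R 0 p) = fst p" by (simp add: plane_rotation_def)
    also have "fst (?R N p) = - fst p" unfolding \<delta>(3) by (simp add: plane_rotation_def)
    finally have "2 * g (fst p) = (\<Sum>j<N. D (?R j p))" by (simp add: odd)
    then show ?thesis
      using sum_squared_le_sum_of_squares[of "\<lambda>j. D (?R j p)" "{..<N}"] by (simp add: mult.commute)
  qed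
  have iDR: "integrable uniform_ball (\<lambda>p. (D (?R j p))\<^sup>2)" if "j < N" for j
  proof -
    have "integrable (distr uniform_ball borel (?R j)) (\<lambda>p. (D p)\<^sup>2)" using iD rot[OF that] by simp
    then show ?thesis by (subst (asm) integrable_distr_eq) auto
  qed
  have DR: "(\<integral>p. (D (?R j p))\<^sup>2 \<partial>uniform_ball) = (\<integral>p. (D p)\<^sup>2 \<partial>uniform_ball)" if "j < N" for j
    by (rule integral_invariant[OF rot[OF that]]) auto
  have "4 * (\<integral>p. (g (fst p))\<^sup>2 \<partial>(uniform_ball :: ('a \<times> 'a) measure)) = (\<integral>p. (2 * g (fst p))\<^sup>2 \<partial>(uniform_ball :: ('a \<times> 'a) measure))"
    by (simp add: power_mult_distrib)
  also have "\<dots> \<le> (\<integral>p. N * (\<Sum>j<N. (D (?R j p))\<^sup>2) \<partial>uniform_ball)"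
    by (rule integral_mono') (use iDR tele in \<open>auto intro!: mult_nonneg_nonneg sum_nonneg\<close>)
  also have "\<dots> = N * (\<Sum>j<N. (\<integral>p. (D (?R j p))\<^sup>2 \<partial>uniform_ball))"
    using iDR by (subst integral_mult_right_zero, subst Bochner_Integration.integral_sum) auto
  also have "\<dots> = (real N)\<^sup>2 * (\<integral>p. (D p)\<^sup>2 \<partial>uniform_ball)"
    using DR by (simp add: power2_eq_square)
  also have "\<dots> \<le> (real N)\<^sup>2 * (\<integral>p. \<delta>\<^sup>2 * ((G (fst p) \<bullet> snd p)\<^sup>2 + 2 * C * \<Lambda> * \<delta> + C\<^sup>2 * \<delta>\<^sup>2) \<partial>(uniform_ball :: ('a \<times> 'a) measure))"
  proof (intro mult_left_mono integral_mono_AE)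
    show "AE p in uniform_ball. (D p)\<^sup>2 \<le> \<delta>\<^sup>2 * ((G (fst p) \<bullet> snd p)\<^sup>2 + 2 * C * \<Lambda> * \<delta> + C\<^sup>2 * \<delta>\<^sup>2)"
      using AE_uniform_ball[where 'a="'a \<times> 'a"]
    proof eventually_elim
      case (elim p)
      then have "norm (fst p) \<le> 1" "norm (snd p) \<le> 1"
        using norm_fst_le[of "fst p" "snd p"] norm_snd_le[of "snd p" "fst p"] by auto
      from Dsq[OF this] show ?case by simp
    qed
  qed (use iD iG in auto)
  also have "\<dots> = (N * \<delta>)\<^sup>2 * ((\<integral>p. (G (fst p) \<bullet> snd p)\<^sup>2 \<partial>(uniform_ball :: ('a \<times> 'a) measure)) + 2 * C * \<Lambda> * \<delta> + C\<^sup>2 * \<delta>\<^sup>2)"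
    using iG U.prob_space[simplified] by (simp add: power_mult_distrib)
  finally show ?thesis unfolding \<delta>(3) by (simp add: \<delta>_def)
qed

text \<open>As \<open>N\<close> grows the discretization errors of the half turn vanish, and the
  isotropy of the second component supplies the factor \<open>1 / n\<close>.\<close>

lemma odd_poincare_smooth:
  fixes g :: "'a::euclidean_space \<Rightarrow> real" and G :: "'a \<Rightarrow> 'a"
  assumes gG: "\<And>x. GDERIV g x :> G x" and L: "L-lipschitz_on UNIV G" and G: "\<And>x. norm (G x) \<le> \<Lambda>"
    and odd: "\<And>x. g (- x) = - g x"
  shows "4 * (\<integral>p. (g (fst p))\<^sup>2 \<partial>(uniform_ball :: ('a \<times> 'a) measure))
    \<le> pi\<^sup>2 * \<Lambda>\<^sup>2 / DIM('a) * (\<integral>p. (norm (fst p))\<^sup>2 \<partial>(uniform_ball :: ('a \<times> 'a) measure))"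
proof -
  let ?I = "\<integral>p. (G (fst p) \<bullet> snd p)\<^sup>2 \<partial>(uniform_ball :: ('a \<times> 'a) measure)"
  let ?C = "4 * L + 2 * \<Lambda>"
  have lim: "(\<lambda>N. pi / real N) \<longlonglongrightarrow> 0" by (rule lim_const_over_n)
  have "(\<lambda>N. pi\<^sup>2 * (?I + 2 * ?C * \<Lambda> * (pi / real N) + ?C\<^sup>2 * (pi / real N)\<^sup>2)) \<longlonglongrightarrow> pi\<^sup>2 * (?I + 2 * ?C * \<Lambda> * 0 + ?C\<^sup>2 * 0\<^sup>2)"
    by (intro tendsto_intros lim)
  then have "4 * (\<integral>p. (g (fst p))\<^sup>2 \<partial>(uniform_ball :: ('a \<times> 'a) measure)) \<le> pi\<^sup>2 * (?I + 2 * ?C * \<Lambda> * 0 + ?C\<^sup>2 * 0\<^sup>2)"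
    by (rule LIMSEQ_le_const) (use odd_poincare_step[OF gG L G odd] in blast)
  also have "\<dots> = pi\<^sup>2 * ?I" by simp
  also have "\<dots> \<le> pi\<^sup>2 * (\<Lambda>\<^sup>2 / DIM('a) * (\<integral>p. (norm (snd p))\<^sup>2 \<partial>(uniform_ball :: ('a \<times> 'a) measure)))"
    by (intro mult_left_mono uniform_ball_pair_second_moment lipschitz_on_borel_measurable[OF L] G) auto
  finally show ?thesis by (simp add: uniform_ball_pair_norm_fst)
qed

section \<open>From smooth odd functions to Lipschitz functions on the sphere\<close>

lemma ball_smoothing_odd:
  fixes f :: "'a::euclidean_space \<Rightarrow> real"
  assumes [measurable]: "f \<in> borel_measurable borel" and odd: "\<And>x. f (- x) = - f x"
  shows "ball_smoothing s f (- x) = - ball_smoothing s f x"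
proof -
  have "ball_smoothing s f (- x) = (\<integral>u. f (- x + s *\<^sub>R (- u)) \<partial>uniform_ball)"
    unfolding ball_smoothing_def by (rule integral_invariant[OF uniform_ball_invariant(1), symmetric]) auto
  also have "\<dots> = (\<integral>u. - f (x + s *\<^sub>R u) \<partial>uniform_ball)"
  proof (rule Bochner_Integration.integral_cong[OF refl])
    fix u :: 'a
    have "- x + s *\<^sub>R (- u) = - (x + s *\<^sub>R u)" by simp
    then show "f (- x + s *\<^sub>R (- u)) = - f (x + s *\<^sub>R u)" by (simp only: odd)
  qed
  finally show ?thesis by (simp add: ball_smoothing_def)
qed

text \<open>Smoothing over a small ball keeps oddness and the Lipschitz constant and makes the
  gradient Lipschitz. The Lipschitz constant of the gradient blows up as \<open>s\<close> tends to
  0, but it does not occur in the bound of \<open>odd_poincare_smooth\<close>.\<close>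

lemma odd_poincare_lipschitz:
  fixes h :: "'a::euclidean_space \<Rightarrow> real"
  assumes h: "\<Lambda>-lipschitz_on UNIV h" and odd: "\<And>x. h (- x) = - h x"
  shows "4 * (\<integral>p. (h (fst p))\<^sup>2 \<partial>(uniform_ball :: ('a \<times> 'a) measure))
    \<le> pi\<^sup>2 * \<Lambda>\<^sup>2 / DIM('a) * (\<integral>p. (norm (fst p))\<^sup>2 \<partial>(uniform_ball :: ('a \<times> 'a) measure))" (is "?l \<le> ?r")
proof -
  interpret U: prob_space "uniform_ball :: ('a \<times> 'a) measure" by (rule prob_space_uniform_ball)
  have [measurable]: "(fst :: 'a \<times> 'a \<Rightarrow> 'a) \<in> borel \<rightarrow>\<^sub>M borel"
    by (intro borel_measurable_continuous_onI continuous_intros)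
  have [measurable]: "h \<in> borel_measurable borel" by (rule lipschitz_on_borel_measurable[OF h])
  have \<Lambda>: "0 \<le> \<Lambda>" using h by (rule lipschitz_on_nonneg)
  have h0: "h 0 = 0" using odd[of 0] by simp
  have hb: "\<bar>h x\<bar> \<le> \<Lambda>" if "norm x \<le> 1" for x
    using lipschitz_on_normD[OF h, of x 0] h0 mult_left_mono[OF that \<Lambda>] by simp
  have step: "?l \<le> ?r + 4 * (s * \<Lambda> * (2 * \<Lambda> + s * \<Lambda>))" if s: "0 < s" for s
  proof -
    let ?g = "ball_smoothing s h"
    note gL = lipschitz_on_ball_smoothing[OF h, where \<eta>=s]
    have [measurable]: "?g \<in> borel_measurable borel" by (rule lipschitz_on_borel_measurable[OF gL(1)])
    have gh: "\<bar>?g x - h x\<bar> \<le> s * \<Lambda>" for x using gL(2)[of x] s by (simp add: mult.commute)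
    have gb: "\<bar>?g x\<bar> \<le> \<Lambda> + s * \<Lambda>" if "norm x \<le> 1" for x using gh[of x] hb[OF that] by linarith
    have ih: "integrable uniform_ball (\<lambda>p :: 'a \<times> 'a. (h (fst p))\<^sup>2)"
    proof (rule integrable_uniform_ball_pair[of _ "\<Lambda>\<^sup>2"])
      fix x y :: 'a assume "norm x \<le> 1"
      from power_mono[OF hb[OF this], of 2] show "\<bar>(h (fst (x, y)))\<^sup>2\<bar> \<le> \<Lambda>\<^sup>2" by simp
    qed measurable
    have ig: "integrable uniform_ball (\<lambda>p :: 'a \<times> 'a. (?g (fst p))\<^sup>2)"
    proof (rule integrable_uniform_ball_pair[of _ "(\<Lambda> + s * \<Lambda>)\<^sup>2"])
      fix x y :: 'a assume "norm x \<le> 1"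
      from power_mono[OF gb[OF this], of 2] show "\<bar>(?g (fst (x, y)))\<^sup>2\<bar> \<le> (\<Lambda> + s * \<Lambda>)\<^sup>2" by simp
    qed measurable
    have "(\<integral>p. (h (fst p))\<^sup>2 \<partial>(uniform_ball :: ('a \<times> 'a) measure))
       \<le> (\<integral>p. (?g (fst p))\<^sup>2 + s * \<Lambda> * (2 * \<Lambda> + s * \<Lambda>) \<partial>(uniform_ball :: ('a \<times> 'a) measure))"
    proof (rule integral_mono_AE[OF ih])
      show "AE p in (uniform_ball :: ('a \<times> 'a) measure). (h (fst p))\<^sup>2 \<le> (?g (fst p))\<^sup>2 + s * \<Lambda> * (2 * \<Lambda> + s * \<Lambda>)"
        using AE_uniform_ball[where 'a="'a \<times> 'a"]
      proof eventually_elim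
        case (elim p)
        then have x: "norm (fst p) \<le> 1" using norm_fst_le[of "fst p" "snd p"] by auto
        have "(h (fst p))\<^sup>2 - (?g (fst p))\<^sup>2 = (h (fst p) - ?g (fst p)) * (h (fst p) + ?g (fst p))"
          by (simp add: power2_eq_square algebra_simps)
        also have "\<dots> \<le> \<bar>h (fst p) - ?g (fst p)\<bar> * \<bar>h (fst p) + ?g (fst p)\<bar>"
          by (metis abs_ge_self abs_mult)
        also have "\<dots> \<le> (s * \<Lambda>) * (2 * \<Lambda> + s * \<Lambda>)"
        proof (rule mult_mono)
          show "\<bar>h (fst p) - ?g (fst p)\<bar> \<le> s * \<Lambda>" using gh[of "fst p"] by linarith
          show "\<bar>h (fst p) + ?g (fst p)\<bar> \<le> 2 * \<Lambda> + s * \<Lambda>" using hb[OF x] gb[OF x] by linarith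
        qed (use \<Lambda> s in auto)
        finally show ?case by simp
      qed
    qed (use ig in auto)
    also have "\<dots> = (\<integral>p. (?g (fst p))\<^sup>2 \<partial>(uniform_ball :: ('a \<times> 'a) measure)) + s * \<Lambda> * (2 * \<Lambda> + s * \<Lambda>)"
      using ig U.prob_space[simplified] by simp
    finally have "?l \<le> 4 * (\<integral>p. (?g (fst p))\<^sup>2 \<partial>(uniform_ball :: ('a \<times> 'a) measure)) + 4 * (s * \<Lambda> * (2 * \<Lambda> + s * \<Lambda>))" by simp
    also have "4 * (\<integral>p. (?g (fst p))\<^sup>2 \<partial>(uniform_ball :: ('a \<times> 'a) measure)) \<le> ?r"
    proof (rule odd_poincare_smooth)
      show "GDERIV ?g x :> sphere_gradient s h x" for x by (rule GDERIV_ball_smoothing[OF h s])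
      show "(\<Lambda> * sqrt DIM('a) / s)-lipschitz_on UNIV (sphere_gradient s h)" by (rule lipschitz_on_sphere_gradient[OF h s])
      show "norm (sphere_gradient s h x) \<le> \<Lambda>" for x by (rule norm_GDERIV_le[OF GDERIV_ball_smoothing[OF h s] gL(1)])
      show "?g (- x) = - ?g x" for x by (rule ball_smoothing_odd) (use odd in auto)
    qed
    finally show ?thesis by simp
  qed
  have "((\<lambda>s. ?r + 4 * (s * \<Lambda> * (2 * \<Lambda> + s * \<Lambda>))) \<longlongrightarrow> ?r + 4 * (0 * \<Lambda> * (2 * \<Lambda> + 0 * \<Lambda>))) (at_right 0)"
    by (intro tendsto_intros)
  then have "?l \<le> ?r + 4 * (0 * \<Lambda> * (2 * \<Lambda> + 0 * \<Lambda>))"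
  proof (rule tendsto_lowerbound)
    show "\<forall>\<^sub>F s in at_right 0. ?l \<le> ?r + 4 * (s * \<Lambda> * (2 * \<Lambda> + s * \<Lambda>))"
      using eventually_at_right_less[of "0::real"] by eventually_elim (rule step)
  qed simp
  then show ?thesis by simp
qed

text \<open>Under the uniform law of pairs the first component has independent norm and direction,
  and its direction is uniform on the sphere. Taking \<open>c = 1\<close> in \<open>gen\<close>
  again identifies the radial factor.\<close>

lemma uniform_ball_pair_radial_angular:
  fixes k :: "'a::euclidean_space \<Rightarrow> real"
  assumes [measurable]: "k \<in> borel_measurable borel"
  shows "(\<integral>\<^sup>+p. ennreal ((norm (fst p))\<^sup>2) * ennreal ((k (fst p /\<^sub>R norm (fst p)))\<^sup>2) \<partial>(uniform_ball :: ('a \<times> 'a) measure))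
    = (\<integral>\<^sup>+p. ennreal ((norm (fst p))\<^sup>2) \<partial>(uniform_ball :: ('a \<times> 'a) measure)) * (\<integral>\<^sup>+v. ennreal ((k v)\<^sup>2) \<partial>uniform_sphere)"
proof -
  have gen: "(\<integral>\<^sup>+p. ennreal ((norm (fst p))\<^sup>2) * c (fst p /\<^sub>R norm (fst p)) \<partial>(uniform_ball :: ('a \<times> 'a) measure))
     = (\<integral>\<^sup>+y. (\<integral>\<^sup>+x. ennreal ((norm x)\<^sup>2) * indicator {x. norm (x, y) \<le> 1} x \<partial>(lborel :: 'a measure)) \<partial>(lborel :: 'a measure)) * (\<integral>\<^sup>+v. c v \<partial>uniform_sphere)
        / emeasure lborel (cball 0 1 :: ('a \<times> 'a) set)" if [measurable]: "c \<in> borel_measurable borel" for c :: "'a \<Rightarrow> ennreal"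
  proof -
    have [measurable]: "(fst :: 'a \<times> 'a \<Rightarrow> 'a) \<in> borel \<rightarrow>\<^sub>M borel"
      by (intro borel_measurable_continuous_onI continuous_intros)
    let ?f = "\<lambda>p :: 'a \<times> 'a. ennreal ((norm (fst p))\<^sup>2) * c (fst p /\<^sub>R norm (fst p)) * indicator (cball 0 1) p"
    have mf: "?f \<in> borel_measurable (lborel \<Otimes>\<^sub>M lborel)"
      unfolding lborel_prod by measurable
    have ind: "indicator (cball 0 1) (x, y) = indicator {..1 - (norm y)\<^sup>2} ((norm x)\<^sup>2)" for x y :: 'a
      by (auto simp: indicator_def norm_Pair)
    have ind': "indicator {x. norm (x, y) \<le> 1} x = indicator {..1 - (norm y)\<^sup>2} ((norm x)\<^sup>2)" for x y :: 'a
      by (auto simp: indicator_def norm_Pair)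
    have "(\<integral>\<^sup>+p. ?f p \<partial>lborel) = (\<integral>\<^sup>+y. \<integral>\<^sup>+x. ?f (x, y) \<partial>lborel \<partial>lborel)"
      by (subst lborel_prod[symmetric], subst lborel_pair.nn_integral_snd[symmetric, OF mf]) simp
    also have "\<dots> = (\<integral>\<^sup>+y. (\<integral>\<^sup>+x. (ennreal ((norm x)\<^sup>2) * indicator {..1 - (norm y)\<^sup>2} ((norm x)\<^sup>2)) * c (x /\<^sub>R norm x) \<partial>lborel) \<partial>(lborel :: 'a measure))"
      unfolding ind by (intro nn_integral_cong) (simp add: ac_simps)
    also have "\<dots> = (\<integral>\<^sup>+y. (\<integral>\<^sup>+(x::'a). ennreal ((norm x)\<^sup>2) * indicator {..1 - (norm y)\<^sup>2} ((norm x)\<^sup>2) \<partial>lborel) * (\<integral>\<^sup>+v. c v \<partial>uniform_sphere) \<partial>(lborel :: 'a measure))"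
    proof (rule nn_integral_cong)
      fix y :: 'a
      show "(\<integral>\<^sup>+x. (ennreal ((norm x)\<^sup>2) * indicator {..1 - (norm y)\<^sup>2} ((norm x)\<^sup>2)) * c (x /\<^sub>R norm x) \<partial>lborel)
         = (\<integral>\<^sup>+(x::'a). ennreal ((norm x)\<^sup>2) * indicator {..1 - (norm y)\<^sup>2} ((norm x)\<^sup>2) \<partial>lborel) * (\<integral>\<^sup>+v. c v \<partial>uniform_sphere)"
        by (rule nn_integral_radial_times_angular[of c "\<lambda>r. ennreal (r\<^sup>2) * indicator {..1 - (norm y)\<^sup>2} (r\<^sup>2)"]) auto
    qed
    also have "\<dots> = (\<integral>\<^sup>+y. (\<integral>\<^sup>+(x::'a). ennreal ((norm x)\<^sup>2) * indicator {..1 - (norm y)\<^sup>2} ((norm x)\<^sup>2) \<partial>lborel) \<partial>(lborel :: 'a measure)) * (\<integral>\<^sup>+v. c v \<partial>uniform_sphere)"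
      by (rule nn_integral_multc) (auto simp: indicator_def)
    finally show ?thesis unfolding ind' by (subst nn_integral_uniform_ball) auto
  qed
  have S: "emeasure (uniform_sphere :: 'a measure) UNIV = 1"
    using prob_space.emeasure_space_1[OF prob_space_uniform_sphere[where 'a='a]] by simp
  have one: "(\<integral>\<^sup>+p. ennreal ((norm (fst p))\<^sup>2) \<partial>(uniform_ball :: ('a \<times> 'a) measure))
     = (\<integral>\<^sup>+y. (\<integral>\<^sup>+x. ennreal ((norm x)\<^sup>2) * indicator {x. norm (x, y) \<le> 1} x \<partial>(lborel :: 'a measure)) \<partial>(lborel :: 'a measure))
        / emeasure lborel (cball 0 1 :: ('a \<times> 'a) set)"
    using gen[of "\<lambda>_. 1"] by (simp add: S)
  show ?thesis
    unfolding one by (subst gen) (auto simp: ennreal_times_divide mult.commute)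
qed

text \<open>Positive homogeneity carries a function on the sphere to the ball inequality. Of the
  factor 3, the change of direction contributes 2, because the directions of \<open>a\<close> and
  \<open>b\<close> differ by at most \<open>2 * norm (a - b) / norm a\<close>, and the change of
  norm contributes 1.\<close>

lemma lipschitz_on_homogeneous_extension:
  fixes k :: "'a::euclidean_space \<Rightarrow> real"
  assumes k: "K-lipschitz_on UNIV k" and k0: "k 0 = 0"
  shows "(3 * K)-lipschitz_on UNIV (\<lambda>x. norm x * k (x /\<^sub>R norm x))"
proof (rule lipschitz_onI)
  have K: "0 \<le> K" using k by (rule lipschitz_on_nonneg)
  then show "0 \<le> 3 * K" by simp
  have kb: "\<bar>k (x /\<^sub>R norm x)\<bar> \<le> K" for x
    using lipschitz_on_normD[OF k, of "x /\<^sub>R norm x" 0] k0 mult_left_mono[OF norm_normalize_le[of x] K] by simp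
  fix a b :: 'a
  have "norm a * norm (a /\<^sub>R norm a - b /\<^sub>R norm b) \<le> 2 * norm (a - b)"
  proof (cases "a = 0 \<or> b = 0")
    case True
    then show ?thesis by (cases "a = 0") auto
  next
    case False
    have "norm a * norm (a /\<^sub>R norm a - b /\<^sub>R norm b) = norm (norm a *\<^sub>R (a /\<^sub>R norm a - b /\<^sub>R norm b))" by simp
    also have "norm a *\<^sub>R (a /\<^sub>R norm a - b /\<^sub>R norm b) = (a - b) + (norm b - norm a) *\<^sub>R (b /\<^sub>R norm b)"
      using False by (simp add: scaleR_diff_right scaleR_diff_left left_diff_distrib)
    also have "norm \<dots> \<le> norm (a - b) + \<bar>norm b - norm a\<bar> * norm (b /\<^sub>R norm b)"
      by (rule order_trans[OF norm_triangle_ineq]) (simp only: norm_scaleR order_refl)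
    also have "\<dots> \<le> norm (a - b) + norm (a - b)"
      using False norm_triangle_ineq3[of b a] by (simp add: norm_minus_commute)
    finally show ?thesis by simp
  qed
  then have 1: "K * (norm a * norm (a /\<^sub>R norm a - b /\<^sub>R norm b)) \<le> K * (2 * norm (a - b))"
    using K by (rule mult_left_mono)
  have "norm a * k (a /\<^sub>R norm a) - norm b * k (b /\<^sub>R norm b)
     = norm a * (k (a /\<^sub>R norm a) - k (b /\<^sub>R norm b)) + (norm a - norm b) * k (b /\<^sub>R norm b)"
    by (simp add: algebra_simps)
  then have "\<bar>norm a * k (a /\<^sub>R norm a) - norm b * k (b /\<^sub>R norm b)\<bar>
     \<le> norm a * \<bar>k (a /\<^sub>R norm a) - k (b /\<^sub>R norm b)\<bar> + \<bar>norm a - norm b\<bar> * \<bar>k (b /\<^sub>R norm b)\<bar>"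
    using abs_triangle_ineq[of "norm a * (k (a /\<^sub>R norm a) - k (b /\<^sub>R norm b))" "(norm a - norm b) * k (b /\<^sub>R norm b)"]
    by (simp add: abs_mult)
  also have "\<dots> \<le> norm a * (K * norm (a /\<^sub>R norm a - b /\<^sub>R norm b)) + norm (a - b) * K"
    using lipschitz_on_normD[OF k, of "a /\<^sub>R norm a" "b /\<^sub>R norm b"] kb[of b] norm_triangle_ineq3[of a b]
    by (intro add_mono mult_left_mono mult_mono) auto
  also have "\<dots> \<le> 3 * K * norm (a - b)" using 1 by (simp add: algebra_simps)
  finally show "dist (norm a * k (a /\<^sub>R norm a)) (norm b * k (b /\<^sub>R norm b)) \<le> 3 * K * dist a b"
    by (simp add: dist_norm)
qed

text \<open>For the homogeneous extension \<open>h\<close> the radial factor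
  \<open>(norm x)^2\<close> has the same mean on both sides of \<open>odd_poincare_lipschitz\<close>
  and cancels. The 9 is the square of the Lipschitz factor 3 of the extension.\<close>

lemma odd_poincare_sphere:
  fixes k :: "'a::euclidean_space \<Rightarrow> real"
  assumes k: "K-lipschitz_on UNIV k" and odd: "\<And>x. k (- x) = - k x"
  shows "(\<integral>\<^sup>+v. ennreal ((k v)\<^sup>2) \<partial>uniform_sphere) \<le> ennreal (9 * pi\<^sup>2 * K\<^sup>2 / (4 * DIM('a)))"
proof -
  let ?U = "uniform_ball :: ('a \<times> 'a) measure"
  have k0: "k 0 = 0" using odd[of 0] by simp
  have K: "0 \<le> K" using k by (rule lipschitz_on_nonneg)
  have [measurable]: "k \<in> borel_measurable borel" by (rule lipschitz_on_borel_measurable[OF k])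
  have [measurable]: "(fst :: 'a \<times> 'a \<Rightarrow> 'a) \<in> borel \<rightarrow>\<^sub>M borel"
    by (intro borel_measurable_continuous_onI continuous_intros)
  define h where "h x = norm x * k (x /\<^sub>R norm x)" for x
  have hL: "(3 * K)-lipschitz_on UNIV h" unfolding h_def[abs_def] by (rule lipschitz_on_homogeneous_extension[OF k k0])
  have hodd: "h (- x) = - h x" for x using odd[of "x /\<^sub>R norm x"] by (simp add: h_def)
  have kb: "\<bar>k x\<bar> \<le> K" if "norm x \<le> 1" for x
    using lipschitz_on_normD[OF k, of x 0] k0 mult_left_mono[OF that K] by simp
  let ?m = "\<integral>p. (norm (fst p))\<^sup>2 \<partial>?U"
  have m: "0 < ?m" by (rule uniform_ball_pair_norm_pos)
  have im: "integrable ?U (\<lambda>p. (norm (fst p))\<^sup>2)"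
    by (rule integrable_uniform_ball_pair[of _ 1]) (auto simp: power_le_one)
  have [measurable]: "h \<in> borel_measurable borel" by (rule lipschitz_on_borel_measurable[OF hL])
  have ih: "integrable ?U (\<lambda>p. (h (fst p))\<^sup>2)"
  proof (rule integrable_uniform_ball_pair[of _ "K\<^sup>2"])
    fix x y :: 'a assume x: "norm x \<le> 1"
    have "\<bar>h x\<bar> \<le> 1 * K" unfolding h_def abs_mult using x kb[OF norm_normalize_le[of x]] by (intro mult_mono) auto
    from power_mono[OF this, of 2] show "\<bar>(h (fst (x, y)))\<^sup>2\<bar> \<le> K\<^sup>2" by simp
  qed measurable
  have "ennreal ?m * (\<integral>\<^sup>+v. ennreal ((k v)\<^sup>2) \<partial>uniform_sphere) = (\<integral>\<^sup>+p. ennreal ((h (fst p))\<^sup>2) \<partial>?U)"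
    using uniform_ball_pair_radial_angular[of k] im
    by (simp add: nn_integral_eq_integral h_def power_mult_distrib ennreal_mult)
  also have "\<dots> = ennreal (\<integral>p. (h (fst p))\<^sup>2 \<partial>?U)"
    using ih by (intro nn_integral_eq_integral) auto
  also have "\<dots> \<le> ennreal (9 * pi\<^sup>2 * K\<^sup>2 / (4 * DIM('a)) * ?m)"
    using odd_poincare_lipschitz[OF hL hodd] by (intro ennreal_leI) (simp add: power_mult_distrib field_simps)
  also have "\<dots> = ennreal ?m * ennreal (9 * pi\<^sup>2 * K\<^sup>2 / (4 * DIM('a)))"
    using m by (subst ennreal_mult[symmetric]) (auto simp: mult.commute)
  finally show ?thesis using m by (subst (asm) ennreal_mult_le_mult_iff) auto
qed

text \<open>The two-point difference \<open>k\<close> is odd in the direction and Lipschitz with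
  constant \<open>2 * \<eta> * \<Lambda>\<close>. The prefactor \<open>(n / (2 * \<eta>))^2\<close>
  meets a second moment of order \<open>\<eta>^2 * \<Lambda>^2 / n\<close>, which leaves one factor
  \<open>n\<close>.\<close>

lemma zo_gradient_second_moment:
  fixes f :: "real^'n \<Rightarrow> real"
  assumes f: "\<Lambda>-lipschitz_on UNIV f" and \<eta>: "0 < \<eta>"
  shows "(\<integral>\<^sup>+v. ennreal ((norm (zo_gradient \<eta> f v x))\<^sup>2) \<partial>uniform_sphere) \<le> ennreal (16 * sqrt (2 * pi) * CARD('n) * \<Lambda>\<^sup>2)"
proof -
  let ?n = "real CARD('n)"
  define k where "k v = f (x + \<eta> *\<^sub>R v) - f (x - \<eta> *\<^sub>R v)" for v
  have [measurable]: "f \<in> borel_measurable borel" by (rule lipschitz_on_borel_measurable[OF f])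
  have \<Lambda>: "0 \<le> \<Lambda>" using f by (rule lipschitz_on_nonneg)
  have kL: "(2 * \<eta> * \<Lambda>)-lipschitz_on UNIV k"
  proof (rule lipschitz_onI)
    fix a b :: "real^'n"
    have 1: "\<bar>f (x + \<eta> *\<^sub>R a) - f (x + \<eta> *\<^sub>R b)\<bar> \<le> \<Lambda> * \<eta> * norm (a - b)"
      using lipschitz_onD[OF lipschitz_on_affine[OF f, of \<eta> x], of a b] \<eta> by (simp add: dist_norm)
    have 2: "\<bar>f (x - \<eta> *\<^sub>R a) - f (x - \<eta> *\<^sub>R b)\<bar> \<le> \<Lambda> * \<eta> * norm (a - b)"
      using lipschitz_onD[OF lipschitz_on_affine[OF f, of "- \<eta>" x], of a b] \<eta> by (simp add: dist_norm)
    have "2 * \<eta> * \<Lambda> * norm (a - b) = 2 * (\<Lambda> * \<eta> * norm (a - b))" by simp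
    then show "dist (k a) (k b) \<le> 2 * \<eta> * \<Lambda> * dist a b"
      unfolding k_def dist_real_def dist_norm[of a b] using 1 2 by linarith
  qed (use \<Lambda> \<eta> in auto)
  have kodd: "k (- v) = - k v" for v by (simp add: k_def)
  have [measurable]: "k \<in> borel_measurable borel" by (rule lipschitz_on_borel_measurable[OF kL])
  have "(\<integral>\<^sup>+v. ennreal ((norm (zo_gradient \<eta> f v x))\<^sup>2) \<partial>uniform_sphere)
     = (\<integral>\<^sup>+v. ennreal ((?n / (2 * \<eta>))\<^sup>2) * ennreal ((k v)\<^sup>2) \<partial>(uniform_sphere :: (real^'n) measure))"
  proof (rule nn_integral_cong_AE)
    show "AE v in (uniform_sphere :: (real^'n) measure). ennreal ((norm (zo_gradient \<eta> f v x))\<^sup>2) = ennreal ((?n / (2 * \<eta>))\<^sup>2) * ennreal ((k v)\<^sup>2)"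
      using AE_uniform_sphere[where 'a="real^'n"]
    proof eventually_elim
      case (elim v)
      have "(norm (zo_gradient \<eta> f v x))\<^sup>2 = (?n / (2 * \<eta>) * k v)\<^sup>2"
        unfolding zo_gradient_def norm_scaleR elim k_def mult_1_right power2_abs ..
      then show ?case by (simp only: power_mult_distrib) (rule ennreal_mult; simp)
    qed
  qed
  also have "\<dots> = ennreal ((?n / (2 * \<eta>))\<^sup>2) * (\<integral>\<^sup>+v. ennreal ((k v)\<^sup>2) \<partial>(uniform_sphere :: (real^'n) measure))"
    by (rule nn_integral_cmult) simp
  also have "\<dots> \<le> ennreal ((?n / (2 * \<eta>))\<^sup>2) * ennreal (9 * pi\<^sup>2 * (2 * \<eta> * \<Lambda>)\<^sup>2 / (4 * DIM(real^'n)))"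
    by (intro mult_left_mono odd_poincare_sphere kL kodd) auto
  also have "\<dots> = ennreal ((9 / 4) * pi\<^sup>2 * (?n * \<Lambda>\<^sup>2))"
    by (subst ennreal_mult[symmetric], simp, simp) (use \<eta> in \<open>simp add: power2_eq_square field_simps\<close>)
  also have "\<dots> \<le> ennreal (16 * sqrt (2 * pi) * ?n * \<Lambda>\<^sup>2)"
  proof (rule ennreal_leI)
    have "9 / 4 \<le> sqrt (2 * pi)" using pi_gt3 by (intro real_le_rsqrt) (simp add: power2_eq_square)
    moreover have "pi\<^sup>2 \<le> 4\<^sup>2" using pi_less_4 pi_gt_zero by (intro power_mono) auto
    ultimately have "(9 / 4) * pi\<^sup>2 \<le> 16 * sqrt (2 * pi)" by simp
    then have "(9 / 4) * pi\<^sup>2 * (?n * \<Lambda>\<^sup>2) \<le> 16 * sqrt (2 * pi) * (?n * \<Lambda>\<^sup>2)"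
      by (rule mult_right_mono) auto
    then show "(9 / 4) * pi\<^sup>2 * (?n * \<Lambda>\<^sup>2) \<le> 16 * sqrt (2 * pi) * ?n * \<Lambda>\<^sup>2" by (simp add: mult.assoc)
  qed
  finally show ?thesis .
qed

text \<open>By the symmetry of the sphere both halves of the difference contribute equally, which
  cancels the 2 in \<open>n / (2 * \<eta>)\<close>.\<close>

lemma zo_gradient_expectation:
  fixes f :: "real^'n \<Rightarrow> real"
  assumes f: "\<Lambda>-lipschitz_on UNIV f" and \<eta>: "0 < \<eta>"
  shows "(\<integral>v. zo_gradient \<eta> f v x \<partial>uniform_sphere) = sphere_gradient \<eta> f x"
proof -
  have [measurable]: "f \<in> borel_measurable borel" by (rule lipschitz_on_borel_measurable[OF f])
  let ?I = "\<lambda>s. \<integral>v. f (x + (s * \<eta>) *\<^sub>R v) *\<^sub>R v \<partial>uniform_sphere"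
  have int: "integrable uniform_sphere (\<lambda>v. f (x + (s * \<eta>) *\<^sub>R v) *\<^sub>R v)" for s by (rule sphere_gradient_integrable[OF f])
  have neg: "?I (-1) = - ?I 1"
  proof -
    have "?I (-1) = (\<integral>v. f (x + ((-1) * \<eta>) *\<^sub>R (- v)) *\<^sub>R (- v) \<partial>uniform_sphere)"
      by (rule integral_invariant[OF uniform_sphere_invariant(1), symmetric]) auto
    then show ?thesis by simp
  qed
  have "(\<integral>v. zo_gradient \<eta> f v x \<partial>uniform_sphere)
     = (\<integral>v. (CARD('n) / (2 * \<eta>)) *\<^sub>R (f (x + (1 * \<eta>) *\<^sub>R v) *\<^sub>R v - f (x + ((-1) * \<eta>) *\<^sub>R v) *\<^sub>R v) \<partial>uniform_sphere)"
    by (intro Bochner_Integration.integral_cong) (auto simp: zo_gradient_def scaleR_diff_left algebra_simps)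
  also have "\<dots> = (CARD('n) / (2 * \<eta>)) *\<^sub>R (?I 1 - ?I (-1))"
    by (subst integral_scaleR_right, subst Bochner_Integration.integral_diff[OF int int]) simp
  also have "\<dots> = (CARD('n) / \<eta>) *\<^sub>R ?I 1"
    unfolding neg by (simp add: scaleR_2[symmetric])
  finally show ?thesis by (simp add: sphere_gradient_def)
qed

section \<open>The consensus dynamics\<close>

lemma matrix_mul_row: "(A ** X) $ i = (\<Sum>j\<in>UNIV. A $ i $ j *\<^sub>R X $ j)"
  for A :: "real^'k^'m" and X :: "real^'n^'k"
  by (simp add: vec_eq_iff matrix_matrix_mult_def)

lemma norm_matrix_squared: "(norm X)\<^sup>2 = (\<Sum>i\<in>UNIV. (norm (X $ i))\<^sup>2)" for X :: "('a::real_normed_vector)^'m"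
  by (simp add: norm_vec_def L2_set_def sum_nonneg)

lemma linear_matrix_mul: "bounded_linear ((**) A :: real^'n^'k \<Rightarrow> real^'n^'m)" for A :: "real^'k^'m"
  by (rule linear_conv_bounded_linear[THEN iffD1], rule linearI)
     (simp_all add: vec_eq_iff matrix_mul_row scaleR_add_right sum.distrib scaleR_sum_right mult.commute sum_distrib_left algebra_simps)

lemma matrix_mul_linear_simps:
  fixes A :: "real^'k^'m" and X Y :: "real^'n^'k"
  shows "A ** (X + Y) = A ** X + A ** Y" "A ** (X - Y) = A ** X - A ** Y" "A ** (r *\<^sub>R X) = r *\<^sub>R (A ** X)"
    "A ** - X = - (A ** X)" "A ** (0 :: real^'n^'k) = 0"
proof -
  have lin: "linear ((**) A :: real^'n^'k \<Rightarrow> real^'n^'m)" by (rule bounded_linear.linear[OF linear_matrix_mul])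
  show "A ** (X + Y) = A ** X + A ** Y" by (rule linear_add[OF lin])
  show "A ** (X - Y) = A ** X - A ** Y" by (rule linear_diff[OF lin])
  show "A ** (r *\<^sub>R X) = r *\<^sub>R (A ** X)" by (rule linear_scale[OF lin])
  show "A ** - X = - (A ** X)" by (rule linear_neg[OF lin])
  show "A ** (0 :: real^'n^'k) = 0" by (rule linear_0[OF lin])
qed

text \<open>The squared Frobenius norm is the sum over the columns, on each of which
  \<open>A\<close> acts as on a vector.\<close>

lemma norm_matrix_mul_le:
  fixes A :: "real^'k^'m" and X :: "real^'n^'k"
  shows "norm (A ** X) \<le> spectral_norm A * norm X"
proof -
  have bl: "bounded_linear ((*v) A)" by (rule matrix_vector_mul_bounded_linear)
  have s0: "0 \<le> spectral_norm A" unfolding spectral_norm_def by (rule onorm_pos_le[OF bl])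
  have "(norm (A ** X))\<^sup>2 = (\<Sum>i\<in>UNIV. \<Sum>l\<in>UNIV. ((A *v (\<chi> k. X $ k $ l)) $ i)\<^sup>2)"
    unfolding norm_matrix_squared[of "A ** X"] norm_matrix_squared[of "(A ** X) $ _"]
    by (simp add: matrix_matrix_mult_def matrix_vector_mult_def)
  also have "\<dots> = (\<Sum>l\<in>UNIV. (norm (A *v (\<chi> k. X $ k $ l)))\<^sup>2)"
    unfolding norm_matrix_squared[of "A *v _"] by (subst sum.swap) (simp only: real_norm_def power2_abs)
  also have "\<dots> \<le> (\<Sum>l\<in>UNIV. (spectral_norm A * norm (\<chi> k. X $ k $ l))\<^sup>2)"
    unfolding spectral_norm_def by (intro sum_mono power_mono onorm[OF bl]) auto
  also have "\<dots> = (spectral_norm A)\<^sup>2 * (\<Sum>l\<in>UNIV. \<Sum>k\<in>UNIV. (X $ k $ l)\<^sup>2)"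
    unfolding power_mult_distrib norm_matrix_squared[of "\<chi> k. X $ k $ _"] by (simp add: sum_distrib_left)
  also have "\<dots> = (spectral_norm A * norm X)\<^sup>2"
    unfolding power_mult_distrib norm_matrix_squared[of X] norm_matrix_squared[of "X $ _"]
    by (subst sum.swap) (simp only: real_norm_def power2_abs)
  finally show ?thesis by (rule power2_le_imp_le) (use s0 in simp)
qed

lemma row_mean_linear: "bounded_linear (row_mean :: real^'n^'m \<Rightarrow> real^'n)"
  by (rule linear_conv_bounded_linear[THEN iffD1], rule linearI)
     (simp_all add: row_mean_def scaleR_add_right sum.distrib scaleR_sum_right mult.commute)

lemma row_mean_simps:
  fixes X Y :: "real^'n^'m"
  shows "row_mean (X + Y) = row_mean X + row_mean Y" "row_mean (X - Y) = row_mean X - row_mean Y"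
    "row_mean (r *\<^sub>R X) = r *\<^sub>R row_mean X" "row_mean (0 :: real^'n^'m) = 0"
proof -
  have lin: "linear (row_mean :: real^'n^'m \<Rightarrow> real^'n)" by (rule bounded_linear.linear[OF row_mean_linear])
  show "row_mean (X + Y) = row_mean X + row_mean Y" by (rule linear_add[OF lin])
  show "row_mean (X - Y) = row_mean X - row_mean Y" by (rule linear_diff[OF lin])
  show "row_mean (r *\<^sub>R X) = r *\<^sub>R row_mean X" by (rule linear_scale[OF lin])
  show "row_mean (0 :: real^'n^'m) = 0" by (rule linear_0[OF lin])
qed

lemma consensus_error_simps:
  fixes X Y :: "real^'n^'m"
  shows "consensus_error (X + Y) = consensus_error X + consensus_error Y"
    "consensus_error (X - Y) = consensus_error X - consensus_error Y"
    "consensus_error (r *\<^sub>R X) = r *\<^sub>R consensus_error X" "consensus_error (0 :: real^'n^'m) = 0"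
  by (simp_all add: consensus_error_def row_mean_simps vec_eq_iff algebra_simps)

lemma consensus_error_linear: "bounded_linear (consensus_error :: real^'n^'m \<Rightarrow> real^'n^'m)"
  by (rule linear_conv_bounded_linear[THEN iffD1], rule linearI) (simp_all add: consensus_error_simps)

lemma sum_rows: "(\<Sum>i\<in>UNIV. X $ i) = real CARD('m) *\<^sub>R row_mean X" for X :: "real^'n^'m"
  by (simp add: row_mean_def)

text \<open>Pythagoras: matrices with equal rows are orthogonal to matrices with row mean 0.\<close>

lemma norm_matrix_decomposition:
  fixes X :: "real^'n^'m"
  shows "(norm X)\<^sup>2 = (norm (consensus_error X))\<^sup>2 + real CARD('m) * (norm (row_mean X))\<^sup>2"
proof -
  have "(norm (consensus_error X))\<^sup>2 = (\<Sum>i\<in>UNIV. (norm (X $ i))\<^sup>2 - 2 * (X $ i \<bullet> row_mean X) + (norm (row_mean X))\<^sup>2)"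
  proof -
    have "(norm (a - b))\<^sup>2 = (norm a)\<^sup>2 - 2 * (a \<bullet> b) + (norm b)\<^sup>2" for a b :: "real^'n"
      unfolding dot_square_norm[symmetric] by (simp add: inner_diff inner_commute)
    then show ?thesis unfolding norm_matrix_squared[of "consensus_error X"] by (simp add: consensus_error_def)
  qed
  also have "\<dots> = (norm X)\<^sup>2 - 2 * ((\<Sum>i\<in>UNIV. X $ i) \<bullet> row_mean X) + real CARD('m) * (norm (row_mean X))\<^sup>2"
    unfolding norm_matrix_squared[of X] by (simp add: sum.distrib sum_subtractf sum_distrib_left inner_sum_left)
  also have "\<dots> = (norm X)\<^sup>2 - real CARD('m) * (norm (row_mean X))\<^sup>2"
    by (simp add: sum_rows dot_square_norm)
  finally show ?thesis by simp
qed

lemma norm_row_mean_le: "real CARD('m) * (norm (row_mean X))\<^sup>2 \<le> (norm X)\<^sup>2" for X :: "real^'n^'m"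
  by (simp add: norm_matrix_decomposition[of X])

section \<open>Mixing and the contraction of the disagreement\<close>

definition doubly_stochastic :: "real^'m^'m \<Rightarrow> bool" where
  "doubly_stochastic W \<longleftrightarrow> (\<forall>i. (\<Sum>j\<in>UNIV. W $ i $ j) = 1) \<and> (\<forall>j. (\<Sum>i\<in>UNIV. W $ i $ j) = 1)"

definition mixing_deviation :: "real^'m^'m \<Rightarrow> real^'m^'m" where
  "mixing_deviation W = W - (\<chi> i j. 1 / real CARD('m))"

lemma mixing_rate_deviation: "mixing_rate W = spectral_norm (mixing_deviation W)"
  by (simp add: mixing_rate_def mixing_deviation_def)

lemma mixing_rate_nonneg: "0 \<le> mixing_rate W"
  unfolding mixing_rate_def spectral_norm_def by (rule onorm_pos_le[OF matrix_vector_mul_bounded_linear])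

lemma row_mean_mixing:
  fixes X :: "real^'n^'m"
  assumes "doubly_stochastic W"
  shows "row_mean (W ** X) = row_mean X"
proof -
  have "(\<Sum>i\<in>UNIV. \<Sum>j\<in>UNIV. W $ i $ j *\<^sub>R X $ j) = (\<Sum>j\<in>UNIV. (\<Sum>i\<in>UNIV. W $ i $ j) *\<^sub>R X $ j)"
    by (subst sum.swap) (simp add: scaleR_sum_left)
  then show ?thesis using assms by (simp add: row_mean_def matrix_mul_row doubly_stochastic_def)
qed

lemma mixing_deviation_mul: "mixing_deviation W ** X = W ** X - (\<chi> i. row_mean X)" for X :: "real^'n^'m"
  by (rule vec_eq_iff[THEN iffD2], rule allI)
     (simp add: matrix_mul_row mixing_deviation_def scaleR_diff_left sum_subtractf row_mean_def scaleR_sum_right)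

text \<open>\<open>mixing_deviation W\<close> annihilates matrices with equal rows because the rows
  of \<open>W\<close> sum to 1, so it acts on the disagreement alone. Its spectral norm is
  \<open>mixing_rate W\<close>, which makes mixing a contraction.\<close>

lemma consensus_error_mixing:
  fixes X :: "real^'n^'m"
  assumes W: "doubly_stochastic W"
  shows "consensus_error (W ** X) = mixing_deviation W ** consensus_error X"
proof -
  have "mixing_deviation W ** (\<chi> i. r) = (0 :: real^'n^'m)" for r :: "real^'n"
  proof -
    have "row_mean ((\<chi> i. r) :: real^'n^'m) = r" by (simp add: row_mean_def sum_constant_scaleR del: sum_constant)
    then show ?thesis using W
      by (simp add: mixing_deviation_mul vec_eq_iff[of _ 0] matrix_mul_row scaleR_sum_left[symmetric] doubly_stochastic_def)
  qed
  then have "mixing_deviation W ** consensus_error X = mixing_deviation W ** X"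
    by (simp add: consensus_error_def matrix_mul_linear_simps)
  then show ?thesis by (simp add: mixing_deviation_mul consensus_error_def row_mean_mixing[OF W])
qed

lemma consensus_error_mixing':
  fixes X :: "real^'n^'m"
  assumes W: "doubly_stochastic W"
  shows "consensus_error (W ** X) = mixing_deviation W ** X"
  by (simp add: mixing_deviation_mul consensus_error_def row_mean_mixing[OF W])

text \<open>Young's inequality with the weight for which the contraction factor \<open>\<lambda>\<^sup>2\<close> becomes
  \<open>(1 + \<lambda>\<^sup>2) / 2\<close>.\<close>

lemma contraction_young:
  fixes A B :: "'a::real_inner" and l :: real
  assumes "l\<^sup>2 < 1" and N: "N \<le> l * norm (A + B)" "0 \<le> N"
  shows "N\<^sup>2 \<le> (1 + l\<^sup>2) / 2 * (norm A)\<^sup>2 + l\<^sup>2 * (1 + l\<^sup>2) / (1 - l\<^sup>2) * (norm B)\<^sup>2"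
proof -
  define q where "q = 1 - l\<^sup>2"
  have q: "0 < q" "l\<^sup>2 = 1 - q" using assms by (auto simp: q_def)
  have "N\<^sup>2 \<le> (l * norm (A + B))\<^sup>2" using N by (intro power_mono) auto
  also have "\<dots> = l\<^sup>2 * (norm (A + B))\<^sup>2" by (simp add: power_mult_distrib)
  also have "\<dots> \<le> l\<^sup>2 * (norm A + norm B)\<^sup>2"
    by (intro mult_left_mono power_mono norm_triangle_ineq) auto
  also have "\<dots> \<le> (1 + l\<^sup>2) / 2 * (norm A)\<^sup>2 + l\<^sup>2 * (1 + l\<^sup>2) / q * (norm B)\<^sup>2"
  proof -
    \<comment> \<open>The difference of the two sides, written as a completed square.\<close>
    have "0 \<le> q / 2 * (norm A - 2 * l\<^sup>2 * norm B / q)\<^sup>2" using q by (intro mult_nonneg_nonneg) auto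
    also have "\<dots> = (1 + l\<^sup>2) / 2 * (norm A)\<^sup>2 + l\<^sup>2 * (1 + l\<^sup>2) / q * (norm B)\<^sup>2 - l\<^sup>2 * (norm A + norm B)\<^sup>2"
      unfolding q(2) using q(1) by (simp add: field_simps power2_eq_square)
    finally show ?thesis by simp
  qed
  finally show ?thesis by (simp add: q_def)
qed

text \<open>The recursion is summed, and \<open>1 - q / 2\<close> times the sum is absorbed on the
  left. The \<open>Suc J\<close> states involve only \<open>J\<close> transitions.\<close>

lemma sum_contraction:
  fixes x y :: "nat \<Rightarrow> real"
  assumes q: "0 < q" and x: "\<And>k. 0 \<le> x k" and rec: "\<And>k. x (Suc k) \<le> (1 - q / 2) * x k + y k"
    and q1: "q \<le> 1"
  shows "(\<Sum>k<Suc J. x k) \<le> 2 / q * (x 0 + (\<Sum>k<J. y k))"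
proof -
  have "(\<Sum>k<Suc J. x k) = x 0 + (\<Sum>k<J. x (Suc k))" by (rule sum.lessThan_Suc_shift)
  also have "\<dots> \<le> x 0 + (\<Sum>k<J. (1 - q / 2) * x k + y k)" by (intro add_left_mono sum_mono rec)
  also have "\<dots> = x 0 + (1 - q / 2) * (\<Sum>k<J. x k) + (\<Sum>k<J. y k)" by (simp add: sum.distrib sum_distrib_left)
  also have "\<dots> \<le> x 0 + (1 - q / 2) * (\<Sum>k<Suc J. x k) + (\<Sum>k<J. y k)"
    using x q1 by (intro add_mono mult_left_mono) auto
  finally have "q / 2 * (\<Sum>k<Suc J. x k) \<le> x 0 + (\<Sum>k<J. y k)" by (simp only: algebra_simps)
  then show ?thesis using q by (simp add: field_simps)
qed

text \<open>The disagreement of the trackers drives the consensus error \<open>c\<close>, the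
  movement \<open>\<delta>\<close> of the iterates drives the disagreement \<open>a\<close>, and
  \<open>c\<close> drives \<open>\<delta>\<close>. Summation turns this loop into one inequality for
  \<open>Z\<close>, in which \<open>Z\<close> returns with the factor \<open>64 * w^2\<close>. The
  stepsize makes this at most 1/4, so solving for \<open>Z\<close> multiplies the other terms by
  4/3.\<close>

lemma consensus_sum_bound:
  fixes c a d \<delta> \<beta> :: "nat \<Rightarrow> real" and m L \<gamma> l \<sigma> \<Gamma> :: real
  defines "q \<equiv> 1 - l\<^sup>2" and "\<rho> \<equiv> \<gamma> * L"
  assumes nonneg: "\<And>k. 0 \<le> c k" "\<And>k. 0 \<le> a k" "\<And>k. 0 \<le> \<beta> k" "0 \<le> \<sigma>" "0 \<le> \<Gamma>" "0 \<le> \<gamma>" "0 \<le> L" "1 \<le> m" "l\<^sup>2 < 1"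
    and c: "\<And>k. c (Suc k) \<le> (1 + l\<^sup>2) / 2 * c k + 2 * \<gamma>\<^sup>2 * l\<^sup>2 / q * d k"
    and a0: "a 0 \<le> l\<^sup>2 * m * \<Gamma>"
    and a: "\<And>k. a (Suc k) \<le> (1 + l\<^sup>2) / 2 * a k + (2 * l\<^sup>2 / q * L\<^sup>2 * \<delta> k + 8 * l\<^sup>2 * m * \<sigma>)"
    and d: "\<And>k. d k \<le> a k + l\<^sup>2 * m * \<sigma>"
    and \<delta>: "\<And>k. \<delta> k \<le> 2 * c (Suc k) + 2 * c k + m * \<gamma>\<^sup>2 * \<beta> k + \<gamma>\<^sup>2 * \<sigma>"
    and step: "16 * \<rho> * l\<^sup>2 \<le> q\<^sup>2" and K: "1 \<le> K"
  shows "L\<^sup>2 / m * (\<Sum>k<K. c k) \<le> 8 / (3 * q) * (L\<^sup>2 * c 0 / m) + 32 / 3 * (\<rho>\<^sup>2 * l ^ 4 / q ^ 3) * \<Gamma>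
    + \<rho>\<^sup>2 / 12 * (\<Sum>k<K. \<beta> k) + 64 / 3 * (\<rho> ^ 4 * l ^ 4 / q ^ 4) * (K * \<sigma> / m) + 272 / 3 * (\<rho>\<^sup>2 * l ^ 4 / q ^ 3) * (K * \<sigma>)"
proof -
  obtain J where J: "K = Suc J" using K by (cases K) auto
  define u where "u = l\<^sup>2"
  have q: "0 < q" "q \<le> 1" using nonneg by (auto simp: q_def)
  have u: "0 \<le> u" "u \<le> 1" using nonneg by (auto simp: u_def)
  have u4: "l ^ 4 = u\<^sup>2" by (simp add: u_def power_mult[symmetric])
  have half: "(1 + l\<^sup>2) / 2 = 1 - q / 2" by (simp add: q_def field_simps)
  have m: "0 < m" using nonneg by simp
  have \<rho>: "0 \<le> \<rho>" using nonneg by (simp add: \<rho>_def)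
  define SC SA SB where "SC = (\<Sum>k<K. c k)" and "SA = (\<Sum>k<K. a k)" and "SB = (\<Sum>k<K. \<beta> k)"
  define SD S\<delta> where "SD = (\<Sum>k<J. d k)" and "S\<delta> = (\<Sum>k<J. \<delta> k)"
  have SB0: "0 \<le> SB" unfolding SB_def by (intro sum_nonneg nonneg)
  have JK: "real J \<le> real K" using J by simp
  have "(\<Sum>k<J. 2 * \<gamma>\<^sup>2 * l\<^sup>2 / q * d k) = 2 * \<gamma>\<^sup>2 * u / q * SD"
    unfolding SD_def u_def by (rule sum_distrib_left[symmetric])
  then have SC: "SC \<le> 2 / q * (c 0 + 2 * \<gamma>\<^sup>2 * u / q * SD)"
    using sum_contraction[where x=c and y="\<lambda>k. 2 * \<gamma>\<^sup>2 * l\<^sup>2 / q * d k", OF q(1) nonneg(1) c[unfolded half] q(2), of J]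
    unfolding SC_def J by simp
  have "SA \<le> 2 / q * (a 0 + (\<Sum>k<J. 2 * l\<^sup>2 / q * L\<^sup>2 * \<delta> k + 8 * l\<^sup>2 * m * \<sigma>))"
    using sum_contraction[where x=a and y="\<lambda>k. 2 * l\<^sup>2 / q * L\<^sup>2 * \<delta> k + 8 * l\<^sup>2 * m * \<sigma>", OF q(1) nonneg(2) a[unfolded half] q(2), of J] by (simp add: SA_def J)
  also have "(\<Sum>k<J. 2 * l\<^sup>2 / q * L\<^sup>2 * \<delta> k + 8 * l\<^sup>2 * m * \<sigma>) = 2 * u / q * L\<^sup>2 * S\<delta> + real J * (8 * u * m * \<sigma>)"
    by (simp add: sum.distrib S\<delta>_def sum_distrib_left u_def)
  also have "2 / q * (a 0 + (2 * u / q * L\<^sup>2 * S\<delta> + real J * (8 * u * m * \<sigma>))) \<le> 2 / q * (u * m * \<Gamma> + (2 * u / q * L\<^sup>2 * S\<delta> + real K * (8 * u * m * \<sigma>)))"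
    using a0 q JK u m nonneg by (intro mult_left_mono add_mono mult_right_mono order_refl) (auto simp: u_def)
  finally have SA: "SA \<le> 2 / q * (u * m * \<Gamma> + (2 * u / q * L\<^sup>2 * S\<delta> + real K * (8 * u * m * \<sigma>)))" .
  have "SD \<le> (\<Sum>k<J. a k + l\<^sup>2 * m * \<sigma>)" unfolding SD_def by (intro sum_mono d)
  also have "\<dots> = (\<Sum>k<J. a k) + real J * (u * m * \<sigma>)" by (simp add: sum.distrib u_def)
  also have "\<dots> \<le> SA + real K * (u * m * \<sigma>)"
    using JK nonneg u m by (intro add_mono mult_right_mono) (auto simp: SA_def J)
  finally have SD: "SD \<le> SA + real K * (u * m * \<sigma>)" .
  have "S\<delta> \<le> (\<Sum>k<J. 2 * c (Suc k) + 2 * c k + m * \<gamma>\<^sup>2 * \<beta> k + \<gamma>\<^sup>2 * \<sigma>)" unfolding S\<delta>_def by (intro sum_mono \<delta>)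
  also have "\<dots> = 2 * (\<Sum>k<J. c (Suc k)) + 2 * (\<Sum>k<J. c k) + m * \<gamma>\<^sup>2 * (\<Sum>k<J. \<beta> k) + real J * (\<gamma>\<^sup>2 * \<sigma>)"
    by (simp add: sum.distrib sum_distrib_left)
  also have "\<dots> \<le> 2 * SC + 2 * SC + m * \<gamma>\<^sup>2 * SB + real K * (\<gamma>\<^sup>2 * \<sigma>)"
  proof (intro add_mono mult_left_mono mult_right_mono)
    show "(\<Sum>k<J. c (Suc k)) \<le> SC" using nonneg(1)[of 0] unfolding SC_def J by (subst sum.lessThan_Suc_shift) simp
    show "(\<Sum>k<J. c k) \<le> SC" using nonneg(1)[of J] by (simp add: SC_def J)
    show "(\<Sum>k<J. \<beta> k) \<le> SB" using nonneg(3)[of J] by (simp add: SB_def J)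
  qed (use JK nonneg m in auto)
  finally have S\<delta>: "S\<delta> \<le> 4 * SC + m * \<gamma>\<^sup>2 * SB + real K * (\<gamma>\<^sup>2 * \<sigma>)" by simp
  define Z where "Z = L\<^sup>2 / m * SC"
  define \<kappa> where "\<kappa> = 4 * \<rho>\<^sup>2 * u / q\<^sup>2"
  have \<kappa>: "0 \<le> \<kappa>" using u q by (simp add: \<kappa>_def)
  have Z1: "Z \<le> 2 / q * (L\<^sup>2 * c 0 / m) + \<kappa> * (SD / m)"
  proof -
    have "Z \<le> L\<^sup>2 / m * (2 / q * (c 0 + 2 * \<gamma>\<^sup>2 * u / q * SD))"
      unfolding Z_def using SC m by (intro mult_left_mono) auto
    also have "\<dots> = 2 / q * (L\<^sup>2 * c 0 / m) + \<kappa> * (SD / m)"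
      using m q by (simp add: \<kappa>_def \<rho>_def field_simps power2_eq_square)
    finally show ?thesis .
  qed
  \<comment> \<open>The 17 is twice the 8 in the recursion for \<open>a\<close> plus 1 for the
    newest noise in \<open>d\<close>.\<close>
  have D1: "SD / m \<le> 2 * u / q * \<Gamma> + 4 * u / q\<^sup>2 * (4 * Z + \<rho>\<^sup>2 * SB + \<rho>\<^sup>2 * (K * \<sigma> / m)) + 17 * u / q * (K * \<sigma>)"
  proof -
    have "SD \<le> 2 / q * (u * m * \<Gamma> + (2 * u / q * L\<^sup>2 * (4 * SC + m * \<gamma>\<^sup>2 * SB + real K * (\<gamma>\<^sup>2 * \<sigma>)) + real K * (8 * u * m * \<sigma>))) + real K * (u * m * \<sigma>)"
    proof -
      have "2 / q * (u * m * \<Gamma> + (2 * u / q * L\<^sup>2 * S\<delta> + real K * (8 * u * m * \<sigma>)))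
          \<le> 2 / q * (u * m * \<Gamma> + (2 * u / q * L\<^sup>2 * (4 * SC + m * \<gamma>\<^sup>2 * SB + real K * (\<gamma>\<^sup>2 * \<sigma>)) + real K * (8 * u * m * \<sigma>)))"
        using S\<delta> q u by (intro mult_left_mono add_mono order_refl) auto
      then show ?thesis using SA SD by linarith
    qed
    then have "SD / m \<le> (2 / q * (u * m * \<Gamma> + (2 * u / q * L\<^sup>2 * (4 * SC + m * \<gamma>\<^sup>2 * SB + real K * (\<gamma>\<^sup>2 * \<sigma>)) + real K * (8 * u * m * \<sigma>))) + real K * (u * m * \<sigma>)) / m"
      using m by (intro divide_right_mono) auto
    also have "\<dots> = 2 * u / q * \<Gamma> + 4 * u / q\<^sup>2 * (4 * Z + \<rho>\<^sup>2 * SB + \<rho>\<^sup>2 * (K * \<sigma> / m)) + (16 * u / q + u) * (K * \<sigma>)"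
      using m q by (simp add: Z_def \<rho>_def field_simps power2_eq_square)
    also have "\<dots> \<le> 2 * u / q * \<Gamma> + 4 * u / q\<^sup>2 * (4 * Z + \<rho>\<^sup>2 * SB + \<rho>\<^sup>2 * (K * \<sigma> / m)) + 17 * u / q * (K * \<sigma>)"
    proof (intro add_left_mono mult_right_mono)
      have "u \<le> u / q" using u q mult_left_le_one_le[of u q] by (simp add: field_simps)
      moreover have "17 * u / q = 16 * u / q + u / q" by (simp add: add_divide_distrib[symmetric])
      ultimately show "16 * u / q + u \<le> 17 * u / q" by linarith
    qed (use nonneg in auto)
    finally show ?thesis .
  qed
  \<comment> \<open>Measures the loop gain: \<open>step\<close> bounds \<open>w\<close> by 1/16,
    hence \<open>64 * w^2\<close> by 1/4 and \<open>16 * w^2\<close> by 1/16.\<close>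
  define w where "w = \<rho> * u / q\<^sup>2"
  have w: "0 \<le> w" "w \<le> 1 / 16" using step \<rho> u q by (auto simp: w_def u_def[symmetric] field_simps)
  have w2: "w\<^sup>2 \<le> 1 / 256" using power_mono[OF w(2,1), of 2] by (simp add: power_divide)
  have "Z \<le> 2 / q * (L\<^sup>2 * c 0 / m) + \<kappa> * (2 * u / q * \<Gamma> + 4 * u / q\<^sup>2 * (4 * Z + \<rho>\<^sup>2 * SB + \<rho>\<^sup>2 * (K * \<sigma> / m)) + 17 * u / q * (K * \<sigma>))"
    using Z1 mult_left_mono[OF D1 \<kappa>] by linarith
  also have "\<dots> = 2 / q * (L\<^sup>2 * c 0 / m) + 8 * (\<rho>\<^sup>2 * u\<^sup>2 / q ^ 3) * \<Gamma> + 64 * w\<^sup>2 * Z + 16 * w\<^sup>2 * (\<rho>\<^sup>2 * SB)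
      + 16 * (\<rho> ^ 4 * u\<^sup>2 / q ^ 4) * (K * \<sigma> / m) + 68 * (\<rho>\<^sup>2 * u\<^sup>2 / q ^ 3) * (K * \<sigma>)"
    using q m by (simp add: \<kappa>_def w_def field_simps power2_eq_square power3_eq_cube power4_eq_xxxx)
  finally have Z2: "Z \<le> 2 / q * (L\<^sup>2 * c 0 / m) + 8 * (\<rho>\<^sup>2 * u\<^sup>2 / q ^ 3) * \<Gamma> + 64 * w\<^sup>2 * Z + 16 * w\<^sup>2 * (\<rho>\<^sup>2 * SB)
      + 16 * (\<rho> ^ 4 * u\<^sup>2 / q ^ 4) * (K * \<sigma> / m) + 68 * (\<rho>\<^sup>2 * u\<^sup>2 / q ^ 3) * (K * \<sigma>)" .
  have Z0: "0 \<le> Z" unfolding Z_def SC_def using m nonneg by (intro mult_nonneg_nonneg sum_nonneg) auto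
  have "64 * w\<^sup>2 * Z \<le> 1 / 4 * Z" using w2 Z0 by (intro mult_right_mono) auto
  moreover have "16 * w\<^sup>2 * (\<rho>\<^sup>2 * SB) \<le> 1 / 16 * (\<rho>\<^sup>2 * SB)" using w2 SB0 by (intro mult_right_mono) auto
  \<comment> \<open>Stated for arbitrary terms, so that the arithmetic deals with variables instead
    of large expressions.\<close>
  moreover have "Z \<le> 4 / 3 * (T1 + T2 + 1 / 16 * T3 + T4 + T5)"
    if "Z \<le> T1 + T2 + 64 * w\<^sup>2 * Z + 16 * w\<^sup>2 * T3 + T4 + T5" "64 * w\<^sup>2 * Z \<le> 1 / 4 * Z" "16 * w\<^sup>2 * T3 \<le> 1 / 16 * T3"
    for T1 T2 T3 T4 T5 :: real
    using that by simp
  ultimately have "Z \<le> 4 / 3 * (2 / q * (L\<^sup>2 * c 0 / m) + 8 * (\<rho>\<^sup>2 * u\<^sup>2 / q ^ 3) * \<Gamma> + 1 / 16 * (\<rho>\<^sup>2 * SB)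
      + 16 * (\<rho> ^ 4 * u\<^sup>2 / q ^ 4) * (K * \<sigma> / m) + 68 * (\<rho>\<^sup>2 * u\<^sup>2 / q ^ 3) * (K * \<sigma>))"
    using Z2 by blast
  also have "\<dots> = 8 / (3 * q) * (L\<^sup>2 * c 0 / m) + 32 / 3 * (\<rho>\<^sup>2 * u\<^sup>2 / q ^ 3) * \<Gamma>
    + \<rho>\<^sup>2 / 12 * SB + 64 / 3 * (\<rho> ^ 4 * u\<^sup>2 / q ^ 4) * (K * \<sigma> / m) + 272 / 3 * (\<rho>\<^sup>2 * u\<^sup>2 / q ^ 3) * (K * \<sigma>)"
    by (simp add: distrib_left ac_simps)
  finally show ?thesis unfolding Z_def SC_def SB_def u4 .
qed

text \<open>The factor \<open>1 / 12\<close> in front of the gradient means is absorbed by the descent, and the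
  remaining constants leave ample room below those of the target bound.\<close>

lemma descent_sum_bound:
  fixes c s \<beta> F :: "nat \<Rightarrow> real" and m L \<gamma> l \<sigma> \<Gamma> w Finf :: real
  defines "q \<equiv> 1 - l\<^sup>2" and "\<rho> \<equiv> \<gamma> * L"
  assumes nonneg: "\<And>k. 0 \<le> \<beta> k" "0 \<le> c 0" "0 \<le> \<sigma>" "0 \<le> \<Gamma>" "0 \<le> w" "0 < \<gamma>" "0 \<le> L" "1 \<le> m" "l\<^sup>2 < 1"
    and F: "\<And>k. F (Suc k) \<le> F k - \<gamma> / 2 * s k - \<gamma> / 2 * (1 - 2 * \<rho>) * \<beta> k + \<gamma> / 2 * (L\<^sup>2 / m * c k) + \<gamma> * \<rho> * (\<sigma> / m)"
    and Finf: "\<And>k. Finf \<le> F k"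
    and C: "L\<^sup>2 / m * (\<Sum>k<K. c k) \<le> 8 / (3 * q) * (L\<^sup>2 * c 0 / m) + 32 / 3 * (\<rho>\<^sup>2 * l ^ 4 / q ^ 3) * \<Gamma>
    + \<rho>\<^sup>2 / 12 * (\<Sum>k<K. \<beta> k) + 64 / 3 * (\<rho> ^ 4 * l ^ 4 / q ^ 4) * (K * \<sigma> / m) + 272 / 3 * (\<rho>\<^sup>2 * l ^ 4 / q ^ 3) * (K * \<sigma>)"
    and step: "\<rho> \<le> 1 / 6" and K: "1 \<le> K"
  shows "(\<Sum>k<K. s k) / K \<le> 2 * (F 0 - Finf) / (\<gamma> * K) + L\<^sup>2 / K * (1 + 13 / q) * (c 0 / m)
    + 52 * (\<rho>\<^sup>2 * l ^ 4 / q ^ 3) / K * (\<Gamma> + \<sigma>)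
    + 52 * (\<rho>\<^sup>2 * l\<^sup>2 / q ^ 3) * \<sigma> * (l\<^sup>2 + w) + 2 * \<rho> * (\<sigma> / m)
    + 156 * (\<rho> ^ 4 * l ^ 4 / q ^ 4) * (\<sigma> / m) * (1 + 3 * l\<^sup>2) + 312 * (\<rho>\<^sup>2 * l ^ 4 / q ^ 3) * \<sigma>"
proof -
  have q: "0 < q" using nonneg by (simp add: q_def)
  have \<rho>: "0 \<le> \<rho>" using nonneg by (simp add: \<rho>_def)
  have m: "0 < m" using nonneg by simp
  have K0: "0 < real K" using K by simp
  define SB where "SB = (\<Sum>k<K. \<beta> k)"
  have SB0: "0 \<le> SB" unfolding SB_def by (intro sum_nonneg nonneg)
  define A1 A2 A3 A4 where "A1 = \<gamma> / 2" and "A2 = \<gamma> / 2 * (1 - 2 * \<rho>)" and "A3 = \<gamma> / 2 * (L\<^sup>2 / m)" and "A4 = \<gamma> * \<rho> * (\<sigma> / m)"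
  have F': "F (Suc k) \<le> F k - A1 * s k - A2 * \<beta> k + A3 * c k + A4" for k
    using F[of k] by (simp add: A1_def A2_def A3_def A4_def mult.assoc)
  have tele': "F j \<le> F 0 - A1 * (\<Sum>k<j. s k) - A2 * (\<Sum>k<j. \<beta> k) + A3 * (\<Sum>k<j. c k) + real j * A4" for j
  proof (induction j)
    case (Suc j)
    then show ?case using F'[of j] by (simp add: algebra_simps)
  qed simp
  have tele: "F j \<le> F 0 - \<gamma> / 2 * (\<Sum>k<j. s k) - \<gamma> / 2 * (1 - 2 * \<rho>) * (\<Sum>k<j. \<beta> k) + \<gamma> / 2 * (L\<^sup>2 / m * (\<Sum>k<j. c k)) + real j * (\<gamma> * \<rho> * (\<sigma> / m))" for j
    using tele'[of j] by (simp add: A1_def A2_def A3_def A4_def mult.assoc)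
  have "\<gamma> / 2 * (\<Sum>k<K. s k) \<le> (F 0 - Finf) - \<gamma> / 2 * (1 - 2 * \<rho>) * SB + \<gamma> / 2 * (L\<^sup>2 / m * (\<Sum>k<K. c k)) + K * (\<gamma> * \<rho> * (\<sigma> / m))"
    using tele[of K] Finf[of K] unfolding SB_def by linarith
  then have "2 / \<gamma> * (\<gamma> / 2 * (\<Sum>k<K. s k)) \<le> 2 / \<gamma> * ((F 0 - Finf) - \<gamma> / 2 * (1 - 2 * \<rho>) * SB + \<gamma> / 2 * (L\<^sup>2 / m * (\<Sum>k<K. c k)) + K * (\<gamma> * \<rho> * (\<sigma> / m)))"
    using nonneg by (intro mult_left_mono) auto
  also have "2 / \<gamma> * (\<gamma> / 2 * (\<Sum>k<K. s k)) = (\<Sum>k<K. s k)" using nonneg by simp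
  also have "2 / \<gamma> * ((F 0 - Finf) - \<gamma> / 2 * (1 - 2 * \<rho>) * SB + \<gamma> / 2 * (L\<^sup>2 / m * (\<Sum>k<K. c k)) + K * (\<gamma> * \<rho> * (\<sigma> / m)))
     = 2 / \<gamma> * (F 0 - Finf) - (1 - 2 * \<rho>) * SB + L\<^sup>2 / m * (\<Sum>k<K. c k) + 2 * K * \<rho> * (\<sigma> / m)"
    using nonneg(6) m by (simp add: field_simps)
  finally have S1: "(\<Sum>k<K. s k) \<le> 2 / \<gamma> * (F 0 - Finf) - (1 - 2 * \<rho>) * SB + L\<^sup>2 / m * (\<Sum>k<K. c k) + 2 * K * \<rho> * (\<sigma> / m)" .
  \<comment> \<open>For \<open>\<rho> \<le> 1 / 6\<close> the descent retains at least 2/3 of the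
    gradient means, far more than the consensus errors return.\<close>
  have "\<rho>\<^sup>2 / 12 * SB \<le> (1 - 2 * \<rho>) * SB"
  proof (rule mult_right_mono[OF _ SB0])
    have "\<rho>\<^sup>2 \<le> (1 / 6)\<^sup>2" using step \<rho> by (intro power_mono) auto
    then have "\<rho>\<^sup>2 \<le> 1 / 36" by (simp add: power2_eq_square)
    then show "\<rho>\<^sup>2 / 12 \<le> 1 - 2 * \<rho>" using step by linarith
  qed
  with S1 C have S2: "(\<Sum>k<K. s k) \<le> 2 / \<gamma> * (F 0 - Finf) + 8 / (3 * q) * (L\<^sup>2 * c 0 / m) + 32 / 3 * (\<rho>\<^sup>2 * l ^ 4 / q ^ 3) * \<Gamma>
      + 64 / 3 * (\<rho> ^ 4 * l ^ 4 / q ^ 4) * (K * \<sigma> / m) + 272 / 3 * (\<rho>\<^sup>2 * l ^ 4 / q ^ 3) * (K * \<sigma>) + 2 * K * \<rho> * (\<sigma> / m)"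
    by (simp add: SB_def)
  define t3 where "t3 = \<rho>\<^sup>2 * l ^ 4 / q ^ 3"
  define t4 where "t4 = \<rho> ^ 4 * l ^ 4 / q ^ 4"
  have t: "0 \<le> t3" "0 \<le> t4" using q by (auto simp: t3_def t4_def)
  have "(\<Sum>k<K. s k) / K \<le> (2 / \<gamma> * (F 0 - Finf) + 8 / (3 * q) * (L\<^sup>2 * c 0 / m) + 32 / 3 * t3 * \<Gamma>
      + 64 / 3 * t4 * (K * \<sigma> / m) + 272 / 3 * t3 * (K * \<sigma>) + 2 * K * \<rho> * (\<sigma> / m)) / K"
    unfolding t3_def t4_def using S2 K0 by (intro divide_right_mono) auto
  also have "\<dots> = 2 * (F 0 - Finf) / (\<gamma> * K) + L\<^sup>2 / K * (8 / (3 * q)) * (c 0 / m) + 32 / 3 * t3 / K * \<Gamma>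
      + 64 / 3 * t4 * (\<sigma> / m) + 272 / 3 * t3 * \<sigma> + 2 * \<rho> * (\<sigma> / m)"
    using K0 by (simp add: add_divide_distrib ac_simps)
  also have "\<dots> \<le> 2 * (F 0 - Finf) / (\<gamma> * K) + L\<^sup>2 / K * (1 + 13 / q) * (c 0 / m) + 52 * t3 / K * (\<Gamma> + \<sigma>)
      + 156 * t4 * (\<sigma> / m) * (1 + 3 * l\<^sup>2) + 312 * t3 * \<sigma> + 2 * \<rho> * (\<sigma> / m)"
  proof (intro add_mono order_refl)
    have "8 / (3 * q) \<le> 1 + 13 / q" using q by (simp add: field_simps)
    then show "L\<^sup>2 / K * (8 / (3 * q)) * (c 0 / m) \<le> L\<^sup>2 / K * (1 + 13 / q) * (c 0 / m)"
      using K0 nonneg m by (intro mult_right_mono mult_left_mono) auto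
    show "32 / 3 * t3 / K * \<Gamma> \<le> 52 * t3 / K * (\<Gamma> + \<sigma>)"
      using t K0 nonneg by (intro mult_mono divide_right_mono mult_right_mono) auto
    have "64 / 3 * t4 * (\<sigma> / m) * 1 \<le> 156 * t4 * (\<sigma> / m) * (1 + 3 * l\<^sup>2)"
      using t nonneg m by (intro mult_mono mult_right_mono) auto
    then show "64 / 3 * t4 * (\<sigma> / m) \<le> 156 * t4 * (\<sigma> / m) * (1 + 3 * l\<^sup>2)" by simp
    show "272 / 3 * t3 * \<sigma> \<le> 312 * t3 * \<sigma>" using t nonneg by (intro mult_right_mono) auto
  qed
  also have "\<dots> \<le> 2 * (F 0 - Finf) / (\<gamma> * K) + L\<^sup>2 / K * (1 + 13 / q) * (c 0 / m)
    + 52 * t3 / K * (\<Gamma> + \<sigma>)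
    + 52 * (\<rho>\<^sup>2 * l\<^sup>2 / q ^ 3) * \<sigma> * (l\<^sup>2 + w) + 2 * \<rho> * (\<sigma> / m)
    + 156 * t4 * (\<sigma> / m) * (1 + 3 * l\<^sup>2) + 312 * t3 * \<sigma>"
  proof -
    have "0 \<le> 52 * (\<rho>\<^sup>2 * l\<^sup>2 / q ^ 3) * \<sigma> * (l\<^sup>2 + w)"
      using q nonneg by (intro mult_nonneg_nonneg divide_nonneg_nonneg) auto
    then show ?thesis by linarith
  qed
  finally show ?thesis unfolding t3_def t4_def .
qed

section \<open>Conditional moments of the gradient estimates\<close>

lemma measurable_vec_lambda:
  fixes f :: "'m::finite \<Rightarrow> 'w \<Rightarrow> 'a::euclidean_space"
  assumes "\<And>i. f i \<in> borel_measurable N"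
  shows "(\<lambda>\<omega>. \<chi> i. f i \<omega>) \<in> borel_measurable N"
  unfolding borel_measurable_euclidean_space[of "\<lambda>\<omega>. \<chi> i. f i \<omega>"]
proof
  fix b :: "'a^'m" assume "b \<in> Basis"
  then obtain i c where b: "b = axis i c" by (auto simp: Basis_vec_def)
  show "(\<lambda>\<omega>. (\<chi> i. f i \<omega>) \<bullet> b) \<in> borel_measurable N"
    using assms[of i] by (simp add: b inner_axis)
qed

lemma measurable_bounded_linear:
  fixes T :: "'a::euclidean_space \<Rightarrow> 'b::euclidean_space"
  assumes "bounded_linear T" "f \<in> borel_measurable N"
  shows "(\<lambda>\<omega>. T (f \<omega>)) \<in> borel_measurable N"
  using assms by (intro measurable_compose[OF assms(2)] borel_measurable_continuous_onI linear_continuous_on)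

definition square_integrable :: "'w measure \<Rightarrow> ('w \<Rightarrow> 'a::euclidean_space) \<Rightarrow> bool" where
  "square_integrable M f \<longleftrightarrow> f \<in> borel_measurable M \<and> integrable M (\<lambda>\<omega>. (norm (f \<omega>))\<^sup>2)"

lemma square_integrableD:
  "square_integrable M f \<Longrightarrow> f \<in> borel_measurable M"
  "square_integrable M f \<Longrightarrow> integrable M (\<lambda>\<omega>. (norm (f \<omega>))\<^sup>2)"
  by (auto simp: square_integrable_def)

lemma square_integrable_bound:
  assumes "integrable M g" "f \<in> borel_measurable M" "\<And>\<omega>. \<omega> \<in> space M \<Longrightarrow> (norm (f \<omega>))\<^sup>2 \<le> g \<omega>"
  shows "square_integrable M f"
  unfolding square_integrable_def
proof
  show "integrable M (\<lambda>\<omega>. (norm (f \<omega>))\<^sup>2)"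
  proof (rule Bochner_Integration.integrable_bound[OF assms(1)])
    show "AE \<omega> in M. norm ((norm (f \<omega>))\<^sup>2) \<le> norm (g \<omega>)"
    proof (rule AE_I2)
      fix \<omega> assume "\<omega> \<in> space M"
      from assms(3)[OF this] show "norm ((norm (f \<omega>))\<^sup>2) \<le> norm (g \<omega>)" by simp
    qed
  qed (use assms(2) in measurable)
qed fact

lemma square_integrable_linear:
  fixes T :: "'a::euclidean_space \<Rightarrow> 'b::euclidean_space"
  assumes T: "bounded_linear T" and f: "square_integrable M f"
  shows "square_integrable M (\<lambda>\<omega>. T (f \<omega>))"
proof (rule square_integrable_bound)
  show "integrable M (\<lambda>\<omega>. (onorm T)\<^sup>2 * (norm (f \<omega>))\<^sup>2)" using square_integrableD(2)[OF f] by simp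
  show "(\<lambda>\<omega>. T (f \<omega>)) \<in> borel_measurable M" by (rule measurable_bounded_linear[OF T square_integrableD(1)[OF f]])
  fix \<omega>
  show "(norm (T (f \<omega>)))\<^sup>2 \<le> (onorm T)\<^sup>2 * (norm (f \<omega>))\<^sup>2"
    using power_mono[OF onorm[OF T, of "f \<omega>"], of 2] by (simp add: power_mult_distrib)
qed

lemma square_integrable_add:
  fixes f g :: "'w \<Rightarrow> 'a::euclidean_space"
  assumes f: "square_integrable M f" and g: "square_integrable M g"
  shows "square_integrable M (\<lambda>\<omega>. f \<omega> + g \<omega>)"
proof (rule square_integrable_bound)
  show "integrable M (\<lambda>\<omega>. 2 * (norm (f \<omega>))\<^sup>2 + 2 * (norm (g \<omega>))\<^sup>2)"
    using square_integrableD(2)[OF f] square_integrableD(2)[OF g] by simp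
  show "(\<lambda>\<omega>. f \<omega> + g \<omega>) \<in> borel_measurable M" using f g by (auto simp: square_integrable_def)
  fix \<omega>
  have "(norm (f \<omega> + g \<omega>))\<^sup>2 \<le> (norm (f \<omega>) + norm (g \<omega>))\<^sup>2" by (intro power_mono norm_triangle_ineq) auto
  also have "\<dots> \<le> 2 * (norm (f \<omega>))\<^sup>2 + 2 * (norm (g \<omega>))\<^sup>2"
    using sum_squares_bound[of "norm (f \<omega>)" "norm (g \<omega>)"] by (simp add: power2_sum)
  finally show "(norm (f \<omega> + g \<omega>))\<^sup>2 \<le> 2 * (norm (f \<omega>))\<^sup>2 + 2 * (norm (g \<omega>))\<^sup>2" .
qed

lemma square_integrable_scaleR: "square_integrable M f \<Longrightarrow> square_integrable M (\<lambda>\<omega>. r *\<^sub>R f \<omega>)"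
  by (rule square_integrable_linear[OF bounded_linear_scaleR_right])

lemma square_integrable_diff:
  fixes f g :: "'w \<Rightarrow> 'a::euclidean_space"
  shows "square_integrable M f \<Longrightarrow> square_integrable M g \<Longrightarrow> square_integrable M (\<lambda>\<omega>. f \<omega> - g \<omega>)"
  using square_integrable_add[of M f "\<lambda>\<omega>. (-1) *\<^sub>R g \<omega>"] square_integrable_scaleR[of M g "-1"] by simp

lemma integrable_inner:
  fixes f g :: "'w \<Rightarrow> 'a::euclidean_space"
  assumes f: "square_integrable M f" and g: "square_integrable M g"
  shows "integrable M (\<lambda>\<omega>. f \<omega> \<bullet> g \<omega>)"
proof (rule Bochner_Integration.integrable_bound)
  show "integrable M (\<lambda>\<omega>. (norm (f \<omega>))\<^sup>2 + (norm (g \<omega>))\<^sup>2)"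
    using square_integrableD(2)[OF f] square_integrableD(2)[OF g] by simp
  show "(\<lambda>\<omega>. f \<omega> \<bullet> g \<omega>) \<in> borel_measurable M"
    using square_integrableD(1)[OF f] square_integrableD(1)[OF g] by measurable
  have "\<bar>f \<omega> \<bullet> g \<omega>\<bar> \<le> (norm (f \<omega>))\<^sup>2 + (norm (g \<omega>))\<^sup>2" for \<omega>
  proof -
    have "\<bar>f \<omega> \<bullet> g \<omega>\<bar> \<le> norm (f \<omega>) * norm (g \<omega>)" by (rule Cauchy_Schwarz_ineq2)
    also have "\<dots> \<le> 2 * norm (f \<omega>) * norm (g \<omega>)" by simp
    also have "\<dots> \<le> (norm (f \<omega>))\<^sup>2 + (norm (g \<omega>))\<^sup>2" by (rule sum_squares_bound)
    finally show ?thesis .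
  qed
  then show "AE \<omega> in M. norm (f \<omega> \<bullet> g \<omega>) \<le> norm ((norm (f \<omega>))\<^sup>2 + (norm (g \<omega>))\<^sup>2)"
    by (intro AE_I2) (auto intro: order_trans)
qed

lemma (in finite_measure) square_integrable_integrable:
  assumes f: "square_integrable M f"
  shows "integrable M f"
proof (rule Bochner_Integration.integrable_bound)
  show "integrable M (\<lambda>\<omega>. 1 + (norm (f \<omega>))\<^sup>2)" using square_integrableD(2)[OF f] by simp
  have "x \<le> 1 + x\<^sup>2" if "0 \<le> x" for x :: real
    using sum_squares_bound[of 1 x] that by (simp add: power2_eq_square)
  then show "AE \<omega> in M. norm (f \<omega>) \<le> norm (1 + (norm (f \<omega>))\<^sup>2)" by (intro AE_I2) simp
qed (rule square_integrableD(1)[OF f])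

lemma (in finite_measure) square_integrable_bounded:
  assumes "f \<in> borel_measurable M" "\<And>\<omega>. norm (f \<omega>) \<le> B"
  shows "square_integrable M f"
  by (rule square_integrable_bound[of M "\<lambda>_. B\<^sup>2"]) (auto intro: power_mono assms)

lemma square_integrableI_nn:
  assumes "f \<in> borel_measurable M" "(\<integral>\<^sup>+\<omega>. ennreal ((norm (f \<omega>))\<^sup>2) \<partial>M) \<le> ennreal B" "0 \<le> B"
  shows "square_integrable M f" "(\<integral>\<omega>. (norm (f \<omega>))\<^sup>2 \<partial>M) \<le> B"
proof -
  have m: "(\<lambda>\<omega>. (norm (f \<omega>))\<^sup>2) \<in> borel_measurable M" using assms(1) by measurable
  have "(\<integral>\<^sup>+\<omega>. ennreal ((norm (f \<omega>))\<^sup>2) \<partial>M) < \<infinity>" using assms(2) ennreal_less_top order_le_less_trans by fastforce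
  then have i: "integrable M (\<lambda>\<omega>. (norm (f \<omega>))\<^sup>2)" using m by (intro integrableI_nonneg) auto
  then show "square_integrable M f" using assms(1) by (simp add: square_integrable_def)
  show "(\<integral>\<omega>. (norm (f \<omega>))\<^sup>2 \<partial>M) \<le> B"
    using assms(2,3) nn_integral_eq_integral[OF i] by simp
qed

text \<open>A function that is Lipschitz in its first and measurable in its second argument is the
  infimum of countably many jointly measurable functions.\<close>

lemma measurable_lipschitz_family:
  fixes \<phi> :: "'a::euclidean_space \<Rightarrow> 'b \<Rightarrow> real"
  assumes lip: "\<And>s. (lc s)-lipschitz_on UNIV (\<lambda>x. \<phi> x s)" and [measurable]: "lc \<in> borel_measurable N"
    and meas[measurable]: "\<And>x. \<phi> x \<in> borel_measurable N"
  shows "(\<lambda>p. \<phi> (fst p) (snd p)) \<in> borel_measurable (borel \<Otimes>\<^sub>M N)"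
proof -
  obtain D :: "'a set" where D: "countable D" "\<And>X. open X \<Longrightarrow> X \<noteq> {} \<Longrightarrow> \<exists>d\<in>D. d \<in> X"
    by (erule countable_dense_setE)
  have "{p \<in> space (borel \<Otimes>\<^sub>M N). \<phi> (fst p) (snd p) < c} \<in> sets (borel \<Otimes>\<^sub>M N)" for c
  proof -
    have "{p \<in> space (borel \<Otimes>\<^sub>M N). \<phi> (fst p) (snd p) < c}
       = (\<Union>d\<in>D. {p \<in> space (borel \<Otimes>\<^sub>M N). \<phi> d (snd p) + lc (snd p) * dist (fst p) d < c})" (is "?L = ?R")
    proof (intro equalityI subsetI)
      fix p assume p: "p \<in> ?L"
      let ?x = "fst p" and ?s = "snd p"
      have l: "0 \<le> lc ?s" using lip by (rule lipschitz_on_nonneg)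
      \<comment> \<open>The passage from \<open>x\<close> to \<open>d\<close> costs
        \<open>lc * dist\<close> in \<open>\<phi>\<close> and once more in the added term, hence the
        2; the 1 guards against a vanishing \<open>lc\<close>.\<close>
      have pos: "0 < (c - \<phi> ?x ?s) / (2 * lc ?s + 1)" using p l by auto
      obtain d where d: "d \<in> D" "dist ?x d < (c - \<phi> ?x ?s) / (2 * lc ?s + 1)"
        using D(2)[of "ball ?x ((c - \<phi> ?x ?s) / (2 * lc ?s + 1))"] pos by auto
      have "\<phi> d ?s \<le> \<phi> ?x ?s + lc ?s * dist ?x d"
        using lipschitz_onD[OF lip, of d ?x ?s] by (simp add: dist_real_def dist_commute)
      moreover have "2 * lc ?s * dist ?x d \<le> (2 * lc ?s + 1) * dist ?x d" by (intro mult_right_mono) auto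
      moreover have "(2 * lc ?s + 1) * dist ?x d < c - \<phi> ?x ?s"
        using d(2) l by (simp add: pos_less_divide_eq mult.commute)
      ultimately have "\<phi> d ?s + lc ?s * dist ?x d < c" by linarith
      then show "p \<in> ?R" using d(1) p by auto
    next
      fix p assume "p \<in> ?R"
      then obtain d where p: "p \<in> space (borel \<Otimes>\<^sub>M N)" "\<phi> d (snd p) + lc (snd p) * dist (fst p) d < c" by auto
      then show "p \<in> ?L" using lipschitz_onD[OF lip, of "fst p" d "snd p"] by (auto simp: dist_real_def)
    qed
    also have "\<dots> \<in> sets (borel \<Otimes>\<^sub>M N)"
      by (rule sets.countable_UN'[OF D(1)], rule image_subsetI) measurable
    finally show ?thesis .
  qed
  then show ?thesis by (simp add: borel_measurable_iff_less)
qed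

text \<open>Independence enters as a product formula for events, so that \<open>X\<close> and
  \<open>Y\<close> may take values in different spaces. It is applied to two blocks of sources and
  to the random index.\<close>

lemma (in prob_space) distr_pair_indep:
  assumes X: "X \<in> M \<rightarrow>\<^sub>M S" and Y: "Y \<in> M \<rightarrow>\<^sub>M T"
    and indep: "\<And>A B. A \<in> sets S \<Longrightarrow> B \<in> sets T \<Longrightarrow>
      prob ((X -` A \<inter> space M) \<inter> (Y -` B \<inter> space M)) = prob (X -` A \<inter> space M) * prob (Y -` B \<inter> space M)"
  shows "distr M (S \<Otimes>\<^sub>M T) (\<lambda>\<omega>. (X \<omega>, Y \<omega>)) = distr M S X \<Otimes>\<^sub>M distr M T Y"
proof (rule pair_measure_eqI[symmetric])
  show "sigma_finite_measure (distr M S X)" "sigma_finite_measure (distr M T Y)"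
    using X Y by (auto intro: prob_space_imp_sigma_finite prob_space_distr)
  fix A B assume "A \<in> sets (distr M S X)" "B \<in> sets (distr M T Y)"
  then have AB: "A \<in> sets S" "B \<in> sets T" by auto
  have XY: "(\<lambda>\<omega>. (X \<omega>, Y \<omega>)) \<in> M \<rightarrow>\<^sub>M S \<Otimes>\<^sub>M T" using X Y by measurable
  have "(\<lambda>\<omega>. (X \<omega>, Y \<omega>)) -` (A \<times> B) \<inter> space M = (X -` A \<inter> space M) \<inter> (Y -` B \<inter> space M)" by auto
  then have "emeasure (distr M (S \<Otimes>\<^sub>M T) (\<lambda>\<omega>. (X \<omega>, Y \<omega>))) (A \<times> B) = ennreal (prob (X -` A \<inter> space M) * prob (Y -` B \<inter> space M))"
    using AB XY indep by (simp add: emeasure_distr emeasure_eq_measure)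
  then show "emeasure (distr M S X) A * emeasure (distr M T Y) B = emeasure (distr M (S \<Otimes>\<^sub>M T) (\<lambda>\<omega>. (X \<omega>, Y \<omega>))) (A \<times> B)"
    using AB X Y by (simp add: emeasure_distr emeasure_eq_measure ennreal_mult)
next
  show "sets (distr M S X \<Otimes>\<^sub>M distr M T Y) = sets (distr M (S \<Otimes>\<^sub>M T) (\<lambda>\<omega>. (X \<omega>, Y \<omega>)))"
    unfolding sets_distr[of M "S \<Otimes>\<^sub>M T"] by (intro sets_pair_measure_cong sets_distr)
qed

lemma Int_stable_events_of: "Int_stable (events_of M N f)"
proof (rule Int_stableI)
  fix a b assume "a \<in> events_of M N f" "b \<in> events_of M N f"
  then obtain a' b' where "a = f -` a' \<inter> space M" "b = f -` b' \<inter> space M" "a' \<in> sets N" "b' \<in> sets N"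
    by (auto simp: events_of_def)
  then show "a \<inter> b \<in> events_of M N f" unfolding events_of_def by (auto intro!: exI[of _ "a' \<inter> b'"])
qed

text \<open>The analysis sees the lower-level problems through the sampled objectives
  \<open>\<phi>\<close>, which already contain the exact solutions. The random Lipschitz constants
  \<open>lc\<close> are controlled in mean square by \<open>L0\<close>.\<close>

locale zo_tracking =
  fixes M :: "'w measure" and P :: "'m::finite \<Rightarrow> (real^'d) measure"
    and \<phi> :: "'m \<Rightarrow> real^'n \<Rightarrow> real^'d \<Rightarrow> real" and fi :: "'m \<Rightarrow> real^'n \<Rightarrow> real"
    and lc :: "'m \<Rightarrow> real^'d \<Rightarrow> real" and L0 \<eta> \<gamma> :: real and W :: "real^'m^'m"
    and \<xi> :: "'m \<Rightarrow> nat \<Rightarrow> 'w \<Rightarrow> real^'d" and v :: "'m \<Rightarrow> nat \<Rightarrow> 'w \<Rightarrow> real^'n"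
    and x0 :: "'w \<Rightarrow> real^'n^'m"
  assumes prob_M: "prob_space M"
    and prob_P: "\<And>i. prob_space (P i)" and sets_P: "\<And>i. sets (P i) = sets borel"
    and integrable_\<phi>: "\<And>i x. integrable (P i) (\<phi> i x)" and fi_def: "\<And>i x. fi i x = (\<integral>s. \<phi> i x s \<partial>P i)"
    and lip: "\<And>i s. (lc i s)-lipschitz_on UNIV (\<lambda>x. \<phi> i x s)"
    and integrable_lc: "\<And>i. integrable (P i) (\<lambda>s. (lc i s)\<^sup>2)"
    and lc_bound: "\<And>i. (\<integral>s. (lc i s)\<^sup>2 \<partial>P i) \<le> L0\<^sup>2"
    and L0_pos: "0 < L0" and \<eta>_pos: "0 < \<eta>" and \<gamma>_pos: "0 < \<gamma>"
    and sampling: "sampling M P \<xi> v x0"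
    and W: "doubly_stochastic W" and W_rate: "mixing_rate W < 1"
    and integrable_cons: "integrable M (\<lambda>\<omega>. (norm (consensus_error (x0 \<omega>)))\<^sup>2)"
    and integrable_gap: "integrable M (\<lambda>\<omega>. agent_mean (\<lambda>i. ball_smoothing \<eta> (fi i)) (row_mean (x0 \<omega>)))"
    and lower_bounded: "bdd_below (range (agent_mean fi))"
begin

sublocale prob_space M by (rule prob_M)

text \<open>Bounds the second moment, hence the variance, of the estimate of one agent.
  \<open>\<Lambda>\<close> below is the Lipschitz constant of the smoothed gradients, as opposed to
  the constant \<open>L0\<close> of the objectives.\<close>

definition \<sigma>2 :: real where "\<sigma>2 = 16 * sqrt (2 * pi) * L0\<^sup>2 * CARD('n)"

definition \<Lambda> :: real where "\<Lambda> = L0 * sqrt CARD('n) / \<eta>"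

lemma \<sigma>2_nonneg: "0 \<le> \<sigma>2" by (simp add: \<sigma>2_def)

lemma \<Lambda>_pos: "0 < \<Lambda>" using L0_pos \<eta>_pos by (simp add: \<Lambda>_def)

lemma lc_nonneg: "0 \<le> lc i s" using lip by (rule lipschitz_on_nonneg)

lemma measurable_\<phi>1[measurable]: "\<phi> i x \<in> borel_measurable borel"
  using borel_measurable_integrable[OF integrable_\<phi>[of i x]] by (simp add: measurable_cong_sets[OF sets_P refl])

lemma measurable_lc[measurable]: "lc i \<in> borel_measurable borel"
proof -
  have "(\<lambda>s. (lc i s)\<^sup>2) \<in> borel_measurable borel"
    using borel_measurable_integrable[OF integrable_lc[of i]] by (simp add: measurable_cong_sets[OF sets_P refl])
  then have "(\<lambda>s. sqrt ((lc i s)\<^sup>2)) \<in> borel_measurable borel" by measurable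
  then show ?thesis by (simp add: lc_nonneg)
qed

lemma measurable_P: "f \<in> borel_measurable borel \<Longrightarrow> f \<in> borel_measurable (P i)"
  by (simp add: measurable_cong_sets[OF sets_P refl])

text \<open>The mean of \<open>lc\<close> is at most its root mean square, here through the
  arithmetic-geometric mean bound with weight \<open>L0\<close>.\<close>

lemma lipschitz_fi: "L0-lipschitz_on UNIV (fi i)"
proof (rule lipschitz_onI)
  interpret P: prob_space "P i" by (rule prob_P)
  have si: "square_integrable (P i) (lc i)"
    using integrable_lc by (auto simp: square_integrable_def intro: measurable_P)
  have i1: "integrable (P i) (lc i)" by (rule P.square_integrable_integrable[OF si])
  have "(\<integral>s. lc i s \<partial>P i) \<le> (\<integral>s. (1 / (2 * L0)) * (lc i s)\<^sup>2 + L0 / 2 \<partial>P i)"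
  proof (rule integral_mono[OF i1])
    fix s
    have "2 * lc i s * L0 \<le> (lc i s)\<^sup>2 + L0\<^sup>2" by (rule sum_squares_bound)
    then show "lc i s \<le> (1 / (2 * L0)) * (lc i s)\<^sup>2 + L0 / 2"
      using L0_pos by (simp add: field_simps power2_eq_square)
  qed (use integrable_lc in auto)
  also have "\<dots> = (1 / (2 * L0)) * (\<integral>s. (lc i s)\<^sup>2 \<partial>P i) + L0 / 2"
    using integrable_lc[of i] P.prob_space by simp
  also have "\<dots> \<le> (1 / (2 * L0)) * L0\<^sup>2 + L0 / 2"
    using L0_pos lc_bound[of i] by (intro add_right_mono mult_left_mono) auto
  also have "\<dots> = L0" using L0_pos by (simp add: power2_eq_square)
  finally have l1: "(\<integral>s. lc i s \<partial>P i) \<le> L0" .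
  fix x y
  have "dist (fi i x) (fi i y) = \<bar>\<integral>s. \<phi> i x s - \<phi> i y s \<partial>P i\<bar>"
    using integrable_\<phi> by (simp add: fi_def dist_real_def)
  also have "\<dots> \<le> (\<integral>s. \<bar>\<phi> i x s - \<phi> i y s\<bar> \<partial>P i)"
    using integral_norm_bound[of "P i" "\<lambda>s. \<phi> i x s - \<phi> i y s"] by simp
  also have "\<dots> \<le> (\<integral>s. lc i s * dist x y \<partial>P i)"
  proof (rule integral_mono)
    fix s
    show "\<bar>\<phi> i x s - \<phi> i y s\<bar> \<le> lc i s * dist x y" using lipschitz_onD[OF lip, of x y i s] by (simp add: dist_real_def)
  qed (use integrable_\<phi> i1 in auto)
  also have "\<dots> = (\<integral>s. lc i s \<partial>P i) * dist x y" by simp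
  also have "\<dots> \<le> L0 * dist x y" by (rule mult_right_mono[OF l1]) auto
  finally show "dist (fi i x) (fi i y) \<le> L0 * dist x y" .
qed (use L0_pos in simp)

lemma measurable_\<phi>[measurable]: "(\<lambda>p. \<phi> i (fst p) (snd p)) \<in> borel_measurable (borel \<Otimes>\<^sub>M borel)"
  by (rule measurable_lipschitz_family[OF lip]) auto

definition estimate :: "'m \<Rightarrow> real^'n \<Rightarrow> (real^'d) \<times> (real^'n) \<Rightarrow> real^'n" where
  "estimate i x p = zo_gradient \<eta> (\<lambda>x. \<phi> i x (fst p)) (snd p) x"

lemma measurable_estimate:
  "(\<lambda>(x, p). estimate i x p) \<in> borel_measurable (borel \<Otimes>\<^sub>M (borel \<Otimes>\<^sub>M borel))"
proof -
  have m: "(\<lambda>q. \<phi> i (fst q + r *\<^sub>R snd (snd q)) (fst (snd q))) \<in> borel_measurable (borel \<Otimes>\<^sub>M (borel \<Otimes>\<^sub>M borel))" for r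
    using measurable_compose[OF _ measurable_\<phi>, of "\<lambda>q. (fst q + r *\<^sub>R snd (snd q), fst (snd q))"] by simp
  have m1: "(\<lambda>q. \<phi> i (fst q + \<eta> *\<^sub>R snd (snd q)) (fst (snd q))) \<in> borel_measurable (borel \<Otimes>\<^sub>M (borel \<Otimes>\<^sub>M borel))"
    by (rule m)
  have m2: "(\<lambda>q. \<phi> i (fst q - \<eta> *\<^sub>R snd (snd q)) (fst (snd q))) \<in> borel_measurable (borel \<Otimes>\<^sub>M (borel \<Otimes>\<^sub>M borel))"
    using m[of "- \<eta>"] by simp
  show ?thesis
    unfolding estimate_def zo_gradient_def split_beta using m1 m2 by measurable
qed

definition source_pair :: "'m \<Rightarrow> ((real^'d) \<times> (real^'n)) measure" where
  "source_pair i = P i \<Otimes>\<^sub>M uniform_sphere"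

lemma sets_source_pair[measurable_cong]: "sets (source_pair i) = sets (borel \<Otimes>\<^sub>M borel)"
  unfolding source_pair_def by (rule sets_pair_measure_cong[OF sets_P]) simp

lemma pair_prob: "pair_prob_space (P i) (uniform_sphere :: (real^'n) measure)"
  unfolding pair_prob_space_def pair_sigma_finite_def
  by (auto intro: prob_space_imp_sigma_finite prob_P prob_space_uniform_sphere)

lemma prob_space_source_pair: "prob_space (source_pair i)"
  unfolding source_pair_def by (intro prob_space_pair prob_P prob_space_uniform_sphere)

lemma measurable_estimate1[measurable]: "estimate i x \<in> borel_measurable (borel \<Otimes>\<^sub>M borel)"
  using measurable_compose[OF _ measurable_estimate[of i], of "\<lambda>p. (x, p)"] by simp

text \<open>For a fixed sample the objective is Lipschitz with its own constant
  \<open>lc i s\<close>, so the spherical bound applies first and the sample is integrated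
  afterwards.\<close>

lemma estimate_second_moment: "(\<integral>\<^sup>+p. ennreal ((norm (estimate i x p))\<^sup>2) \<partial>source_pair i) \<le> ennreal \<sigma>2"
proof -
  interpret U: prob_space "uniform_sphere :: (real^'n) measure" by (rule prob_space_uniform_sphere)
  have me: "(\<lambda>p. ennreal ((norm (estimate i x p))\<^sup>2)) \<in> borel_measurable (P i \<Otimes>\<^sub>M uniform_sphere)"
    unfolding source_pair_def[symmetric] by measurable
  have "(\<integral>\<^sup>+p. ennreal ((norm (estimate i x p))\<^sup>2) \<partial>source_pair i)
     = (\<integral>\<^sup>+s. \<integral>\<^sup>+u. ennreal ((norm (zo_gradient \<eta> (\<lambda>x. \<phi> i x s) u x))\<^sup>2) \<partial>uniform_sphere \<partial>P i)"
    unfolding source_pair_def by (subst U.nn_integral_fst[OF me, symmetric]) (simp add: estimate_def)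
  also have "\<dots> \<le> (\<integral>\<^sup>+s. ennreal (16 * sqrt (2 * pi) * CARD('n)) * ennreal ((lc i s)\<^sup>2) \<partial>P i)"
    using zo_gradient_second_moment[OF lip \<eta>_pos]
    by (intro nn_integral_mono) (simp add: ennreal_mult[symmetric] mult.assoc)
  also have "\<dots> = ennreal (16 * sqrt (2 * pi) * CARD('n)) * (\<integral>\<^sup>+s. ennreal ((lc i s)\<^sup>2) \<partial>P i)"
    by (intro nn_integral_cmult measurable_P) measurable
  also have "(\<integral>\<^sup>+s. ennreal ((lc i s)\<^sup>2) \<partial>P i) = ennreal (\<integral>s. (lc i s)\<^sup>2 \<partial>P i)"
    using integrable_lc by (intro nn_integral_eq_integral) auto
  also have "ennreal (16 * sqrt (2 * pi) * CARD('n)) * ennreal (\<integral>s. (lc i s)\<^sup>2 \<partial>P i) \<le> ennreal (16 * sqrt (2 * pi) * CARD('n)) * ennreal (L0\<^sup>2)"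
    by (intro mult_left_mono ennreal_leI lc_bound) auto
  also have "\<dots> = ennreal \<sigma>2" by (subst ennreal_mult[symmetric]) (auto simp: \<sigma>2_def ac_simps)
  finally show ?thesis .
qed

lemma estimate_square_integrable: "square_integrable (source_pair i) (estimate i x)"
  by (rule square_integrableI_nn[OF _ estimate_second_moment \<sigma>2_nonneg]) measurable

text \<open>The estimate is linear in the objective, so integrating the samples first replaces
  \<open>\<phi> i\<close> by \<open>fi i\<close>; the directions then give the gradient.\<close>

lemma estimate_expectation: "(\<integral>p. estimate i x p \<partial>source_pair i) = sphere_gradient \<eta> (fi i) x"
proof -
  interpret S: prob_space "source_pair i" by (rule prob_space_source_pair)
  interpret PU: pair_prob_space "P i" "uniform_sphere :: (real^'n) measure" by (rule pair_prob)
  have "integrable (source_pair i) (estimate i x)"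
    by (rule S.square_integrable_integrable[OF estimate_square_integrable])
  then have int: "integrable (P i \<Otimes>\<^sub>M uniform_sphere) (case_prod (\<lambda>s u. estimate i x (s, u)))"
    by (simp add: source_pair_def)
  have "(\<integral>p. estimate i x p \<partial>source_pair i) = (\<integral>u. \<integral>s. estimate i x (s, u) \<partial>P i \<partial>uniform_sphere)"
    using PU.integral_snd[OF int] by (simp add: source_pair_def)
  also have "\<dots> = (\<integral>u. zo_gradient \<eta> (fi i) u x \<partial>uniform_sphere)"
  proof (rule Bochner_Integration.integral_cong[OF refl])
    fix u :: "real^'n"
    show "(\<integral>s. estimate i x (s, u) \<partial>P i) = zo_gradient \<eta> (fi i) u x"
      unfolding estimate_def zo_gradient_def fi_def using integrable_\<phi> by (simp del: scaleR_scaleR)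
  qed
  also have "\<dots> = sphere_gradient \<eta> (fi i) x" by (rule zo_gradient_expectation[OF lipschitz_fi \<eta>_pos])
  finally show ?thesis .
qed

section \<open>Independence of the random sources\<close>

definition source_algebra :: "'m source set \<Rightarrow> 'w measure" where
  "source_algebra A = sigma (space M) (\<Union>s\<in>A. source_events M \<xi> v x0 s)"

lemma measurable_sources[measurable]:
  "x0 \<in> borel_measurable M" "\<xi> i k \<in> borel_measurable M" "v i k \<in> borel_measurable M"
  using sampling by (auto simp: sampling_def)

lemma source_events_subset: "source_events M \<xi> v x0 s \<subseteq> events"
  by (cases s) (auto simp: events_of_def intro: measurable_sets)

lemma source_events_Pow: "(\<Union>s\<in>A. source_events M \<xi> v x0 s) \<subseteq> Pow (space M)"
  using source_events_subset sets.space_closed by blast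

lemma space_source_algebra[simp]: "space (source_algebra A) = space M"
  by (simp add: source_algebra_def space_measure_of_conv)

lemma sets_source_algebra: "sets (source_algebra A) = sigma_sets (space M) (\<Union>s\<in>A. source_events M \<xi> v x0 s)"
  using source_events_Pow by (simp add: source_algebra_def)

lemma subalgebra_source_algebra: "subalgebra M (source_algebra A)"
  unfolding subalgebra_def sets_source_algebra
  using source_events_subset by (auto intro!: sets.sigma_sets_subset)

lemma subalgebra_source_algebra_mono: "A \<subseteq> B \<Longrightarrow> subalgebra (source_algebra B) (source_algebra A)"
  unfolding subalgebra_def sets_source_algebra by (auto intro!: sigma_sets_mono')

lemma measurable_source_mono:
  "f \<in> source_algebra A \<rightarrow>\<^sub>M N \<Longrightarrow> A \<subseteq> B \<Longrightarrow> f \<in> source_algebra B \<rightarrow>\<^sub>M N"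
  using measurable_from_subalg[OF subalgebra_source_algebra_mono] by blast

lemma measurable_source_M: "f \<in> source_algebra A \<rightarrow>\<^sub>M N \<Longrightarrow> f \<in> M \<rightarrow>\<^sub>M N"
  using measurable_from_subalg[OF subalgebra_source_algebra] by blast

lemma measurable_source:
  "Initial \<in> A \<Longrightarrow> x0 \<in> borel_measurable (source_algebra A)"
  "Sample i k \<in> A \<Longrightarrow> \<xi> i k \<in> borel_measurable (source_algebra A)"
  "Direction i k \<in> A \<Longrightarrow> v i k \<in> borel_measurable (source_algebra A)"
proof -
  have gen: "f \<in> borel_measurable (source_algebra A)"
    if "events_of M borel f = source_events M \<xi> v x0 s" "s \<in> A" for s and f :: "'w \<Rightarrow> 'b::euclidean_space"
  proof (rule measurableI)
    fix B :: "'b set" assume "B \<in> sets borel"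
    then have "f -` B \<inter> space M \<in> source_events M \<xi> v x0 s" unfolding that(1)[symmetric] events_of_def by auto
    then show "f -` B \<inter> space (source_algebra A) \<in> sets (source_algebra A)"
      unfolding sets_source_algebra space_source_algebra using that(2) by (intro sigma_sets.Basic) auto
  qed simp
  show "Initial \<in> A \<Longrightarrow> x0 \<in> borel_measurable (source_algebra A)" by (rule gen[of _ Initial]) auto
  show "Sample i k \<in> A \<Longrightarrow> \<xi> i k \<in> borel_measurable (source_algebra A)" by (rule gen[of _ "Sample i k"]) auto
  show "Direction i k \<in> A \<Longrightarrow> v i k \<in> borel_measurable (source_algebra A)" by (rule gen[of _ "Direction i k"]) auto
qed

lemma indep_source_algebra:
  assumes "A \<inter> B = {}"
  shows "indep_set (sets (source_algebra A)) (sets (source_algebra B))"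
proof -
  have "indep_sets (\<lambda>j. sigma_sets (space M) (\<Union>i\<in>case_bool A B j. source_events M \<xi> v x0 i)) UNIV"
  proof (rule indep_sets_collect_sigma)
    have "indep_sets (source_events M \<xi> v x0) UNIV" using sampling by (simp add: sampling_def)
    then show "indep_sets (source_events M \<xi> v x0) (\<Union>j\<in>UNIV. case_bool A B j)"
      by (rule indep_sets_mono_index[rotated]) simp
    show "Int_stable (source_events M \<xi> v x0 i)" for i
      by (cases i) (auto intro: Int_stable_events_of)
    show "disjoint_family_on (case_bool A B) UNIV"
      using assms by (auto simp: disjoint_family_on_def split: bool.splits)
  qed
  then show ?thesis
    unfolding indep_set_def sets_source_algebra
    by (rule indep_sets_cong[THEN iffD1, rotated -1]) (auto split: bool.splits)
qed

lemma distr_pair_source: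
  assumes "A \<inter> B = {}" and X: "X \<in> source_algebra A \<rightarrow>\<^sub>M S" and Y: "Y \<in> source_algebra B \<rightarrow>\<^sub>M T"
  shows "distr M (S \<Otimes>\<^sub>M T) (\<lambda>\<omega>. (X \<omega>, Y \<omega>)) = distr M S X \<Otimes>\<^sub>M distr M T Y"
  using measurable_source_M[OF X] measurable_source_M[OF Y]
proof (rule distr_pair_indep)
  fix C D assume "C \<in> sets S" "D \<in> sets T"
  then show "prob ((X -` C \<inter> space M) \<inter> (Y -` D \<inter> space M)) = prob (X -` C \<inter> space M) * prob (Y -` D \<inter> space M)"
    using measurable_sets[OF X, of C] measurable_sets[OF Y, of D]
    by (intro indep_setD[OF indep_source_algebra[OF assms(1)]]) auto
qed

abbreviation fresh :: "'m \<Rightarrow> nat \<Rightarrow> 'm source set" where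
  "fresh i k \<equiv> {Sample i k, Direction i k}"

text \<open>Includes the sources that the other agents draw in the same iteration, so that
  orthogonality between agents is covered as well.\<close>

abbreviation rest :: "'m \<Rightarrow> nat \<Rightarrow> 'w measure" where
  "rest i k \<equiv> source_algebra (- fresh i k)"

lemma measurable_id_rest: "(\<lambda>\<omega>. \<omega>) \<in> M \<rightarrow>\<^sub>M rest i k"
  by (rule measurable_source_M[of _ "- fresh i k"]) simp

lemma distr_source_pair: "distr M (borel \<Otimes>\<^sub>M borel) (\<lambda>\<omega>. (\<xi> i k \<omega>, v i k \<omega>)) = source_pair i"
proof -
  have "distr M (borel \<Otimes>\<^sub>M borel) (\<lambda>\<omega>. (\<xi> i k \<omega>, v i k \<omega>)) = distr M borel (\<xi> i k) \<Otimes>\<^sub>M distr M borel (v i k)"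
    by (rule distr_pair_source[of "{Sample i k}" "{Direction i k}"]) (auto intro: measurable_source)
  then show ?thesis using sampling by (simp add: sampling_def source_pair_def)
qed

text \<open>The identity map, read as a random element of \<open>rest i k\<close>, carries all of
  the remaining randomness at once; the quantities to be frozen are functions of it.\<close>

lemma distr_rest_pair:
  "distr M (rest i k \<Otimes>\<^sub>M (borel \<Otimes>\<^sub>M borel)) (\<lambda>\<omega>. (\<omega>, (\<xi> i k \<omega>, v i k \<omega>)))
    = distr M (rest i k) (\<lambda>\<omega>. \<omega>) \<Otimes>\<^sub>M source_pair i"
proof -
  have m: "(\<lambda>\<omega>. (\<xi> i k \<omega>, v i k \<omega>)) \<in> source_algebra (fresh i k) \<rightarrow>\<^sub>M borel \<Otimes>\<^sub>M borel"
    by (intro measurable_Pair measurable_source) auto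
  show ?thesis
    unfolding distr_source_pair[of i k, symmetric]
    by (rule distr_pair_source[of "- fresh i k" "fresh i k", OF _ _ m]) auto
qed

text \<open>Conditioning on everything except the fresh sources of agent \<open>i\<close> in iteration \<open>k\<close>, these
  sources may be integrated out first.\<close>

lemma nn_integral_freeze:
  assumes \<Psi>: "\<Psi> \<in> borel_measurable (rest i k \<Otimes>\<^sub>M (borel \<Otimes>\<^sub>M borel))"
  shows "(\<integral>\<^sup>+\<omega>. \<Psi> (\<omega>, (\<xi> i k \<omega>, v i k \<omega>)) \<partial>M) = (\<integral>\<^sup>+\<omega>. \<integral>\<^sup>+p. \<Psi> (\<omega>, p) \<partial>source_pair i \<partial>M)"
proof -
  interpret S: prob_space "source_pair i" by (rule prob_space_source_pair)
  let ?R = "rest i k"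
  have mp: "(\<lambda>\<omega>. (\<omega>, (\<xi> i k \<omega>, v i k \<omega>))) \<in> M \<rightarrow>\<^sub>M ?R \<Otimes>\<^sub>M (borel \<Otimes>\<^sub>M borel)"
    by (intro measurable_Pair measurable_id_rest measurable_sources)
  have \<Psi>': "\<Psi> \<in> borel_measurable (?R \<Otimes>\<^sub>M source_pair i)"
    using \<Psi> by (simp add: measurable_cong_sets[OF sets_pair_measure_cong[OF refl sets_source_pair] refl])
  then have \<Psi>'': "\<Psi> \<in> borel_measurable (distr M ?R (\<lambda>\<omega>. \<omega>) \<Otimes>\<^sub>M source_pair i)"
    by (simp add: measurable_cong_sets[OF sets_pair_measure_cong[OF sets_distr refl] refl])
  have "(\<integral>\<^sup>+\<omega>. \<Psi> (\<omega>, (\<xi> i k \<omega>, v i k \<omega>)) \<partial>M) = (\<integral>\<^sup>+q. \<Psi> q \<partial>distr M (?R \<Otimes>\<^sub>M (borel \<Otimes>\<^sub>M borel)) (\<lambda>\<omega>. (\<omega>, (\<xi> i k \<omega>, v i k \<omega>))))"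
    using mp \<Psi> by (subst nn_integral_distr) auto
  also have "\<dots> = (\<integral>\<^sup>+\<omega>. \<integral>\<^sup>+p. \<Psi> (\<omega>, p) \<partial>source_pair i \<partial>distr M ?R (\<lambda>\<omega>. \<omega>))"
    unfolding distr_rest_pair by (rule S.nn_integral_fst[OF \<Psi>'', symmetric])
  also have "\<dots> = (\<integral>\<^sup>+\<omega>. \<integral>\<^sup>+p. \<Psi> (\<omega>, p) \<partial>source_pair i \<partial>M)"
    using S.borel_measurable_nn_integral_fst[OF \<Psi>'] by (subst nn_integral_distr[OF measurable_id_rest]) auto
  finally show ?thesis .
qed

lemma integral_freeze:
  fixes \<Psi> :: "'w \<times> (real^'d) \<times> (real^'n) \<Rightarrow> real"
  assumes \<Psi>: "\<Psi> \<in> borel_measurable (rest i k \<Otimes>\<^sub>M (borel \<Otimes>\<^sub>M borel))"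
    and int: "integrable M (\<lambda>\<omega>. \<Psi> (\<omega>, (\<xi> i k \<omega>, v i k \<omega>)))"
  shows "(\<integral>\<omega>. \<Psi> (\<omega>, (\<xi> i k \<omega>, v i k \<omega>)) \<partial>M) = (\<integral>\<omega>. \<integral>p. \<Psi> (\<omega>, p) \<partial>source_pair i \<partial>M)"
proof -
  interpret S: prob_space "source_pair i" by (rule prob_space_source_pair)
  let ?R = "rest i k"
  let ?D = "distr M ?R (\<lambda>\<omega>. \<omega>)"
  interpret D: prob_space ?D by (rule prob_space_distr[OF measurable_id_rest])
  interpret DS: pair_sigma_finite ?D "source_pair i" ..
  have mp: "(\<lambda>\<omega>. (\<omega>, (\<xi> i k \<omega>, v i k \<omega>))) \<in> M \<rightarrow>\<^sub>M ?R \<Otimes>\<^sub>M (borel \<Otimes>\<^sub>M borel)"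
    by (intro measurable_Pair measurable_id_rest measurable_sources)
  have \<Psi>': "\<Psi> \<in> borel_measurable (?R \<Otimes>\<^sub>M source_pair i)"
    using \<Psi> by (simp add: measurable_cong_sets[OF sets_pair_measure_cong[OF refl sets_source_pair] refl])
  have int': "integrable (?D \<Otimes>\<^sub>M source_pair i) \<Psi>"
    unfolding distr_rest_pair[symmetric] using int integrable_distr_eq[OF mp \<Psi>] by simp
  have "(\<integral>\<omega>. \<Psi> (\<omega>, (\<xi> i k \<omega>, v i k \<omega>)) \<partial>M) = (\<integral>q. \<Psi> q \<partial>distr M (?R \<Otimes>\<^sub>M (borel \<Otimes>\<^sub>M borel)) (\<lambda>\<omega>. (\<omega>, (\<xi> i k \<omega>, v i k \<omega>))))"
    by (rule integral_distr[OF mp \<Psi>, symmetric])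
  also have "\<dots> = (\<integral>\<omega>. \<integral>p. \<Psi> (\<omega>, p) \<partial>source_pair i \<partial>?D)"
    unfolding distr_rest_pair by (rule DS.integral_fst'[OF int', symmetric])
  also have "\<dots> = (\<integral>\<omega>. \<integral>p. \<Psi> (\<omega>, p) \<partial>source_pair i \<partial>M)"
    by (rule integral_distr[OF measurable_id_rest]) (rule S.borel_measurable_lebesgue_integral, simp add: \<Psi>')
  finally show ?thesis .
qed

text \<open>Conditional expectations are expressed by pairings with square integrable
  \<open>Z\<close> that are measurable with respect to \<open>rest i k\<close>; the last part is
  unbiasedness in this form.\<close>

lemma estimate_at:
  assumes X: "X \<in> borel_measurable (rest i k)"
  shows "square_integrable M (\<lambda>\<omega>. estimate i (X \<omega>) (\<xi> i k \<omega>, v i k \<omega>))" (is "square_integrable M ?g")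
    and "(\<integral>\<omega>. (norm (estimate i (X \<omega>) (\<xi> i k \<omega>, v i k \<omega>)))\<^sup>2 \<partial>M) \<le> \<sigma>2"
    and "Z \<in> borel_measurable (rest i k) \<Longrightarrow> square_integrable M Z \<Longrightarrow>
      (\<integral>\<omega>. Z \<omega> \<bullet> estimate i (X \<omega>) (\<xi> i k \<omega>, v i k \<omega>) \<partial>M) = (\<integral>\<omega>. Z \<omega> \<bullet> sphere_gradient \<eta> (fi i) (X \<omega>) \<partial>M)"
proof -
  have mE: "(\<lambda>q. estimate i (X (fst q)) (snd q)) \<in> borel_measurable (rest i k \<Otimes>\<^sub>M (borel \<Otimes>\<^sub>M borel))"
    using measurable_compose[OF _ measurable_estimate[of i], of "\<lambda>q. (X (fst q), snd q)"] X by simp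
  have XM[measurable]: "X \<in> borel_measurable M" by (rule measurable_source_M[OF X])
  have mg[measurable]: "?g \<in> borel_measurable M"
    using measurable_compose[OF _ measurable_estimate[of i], of "\<lambda>\<omega>. (X \<omega>, \<xi> i k \<omega>, v i k \<omega>)"] by simp
  have "(\<integral>\<^sup>+\<omega>. ennreal ((norm (?g \<omega>))\<^sup>2) \<partial>M) = (\<integral>\<^sup>+\<omega>. \<integral>\<^sup>+p. ennreal ((norm (estimate i (X \<omega>) p))\<^sup>2) \<partial>source_pair i \<partial>M)"
    using nn_integral_freeze[of "\<lambda>q. ennreal ((norm (estimate i (X (fst q)) (snd q)))\<^sup>2)" i k] mE by simp
  also have "\<dots> \<le> (\<integral>\<^sup>+\<omega>. ennreal \<sigma>2 \<partial>M)" by (intro nn_integral_mono estimate_second_moment)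
  also have "\<dots> = ennreal \<sigma>2" by (simp add: emeasure_space_1)
  finally have nn: "(\<integral>\<^sup>+\<omega>. ennreal ((norm (?g \<omega>))\<^sup>2) \<partial>M) \<le> ennreal \<sigma>2" .
  show sg: "square_integrable M ?g" "(\<integral>\<omega>. (norm (?g \<omega>))\<^sup>2 \<partial>M) \<le> \<sigma>2"
    using square_integrableI_nn[OF mg nn \<sigma>2_nonneg] by auto
  assume Z: "Z \<in> borel_measurable (rest i k)" and Z2: "square_integrable M Z"
  have int: "integrable M (\<lambda>\<omega>. Z \<omega> \<bullet> ?g \<omega>)" by (rule integrable_inner[OF Z2 sg(1)])
  have mZ: "(\<lambda>q. Z (fst q)) \<in> borel_measurable (rest i k \<Otimes>\<^sub>M (borel \<Otimes>\<^sub>M borel))"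
    by (rule measurable_compose[OF measurable_fst Z])
  have "(\<lambda>q. Z (fst q) \<bullet> estimate i (X (fst q)) (snd q)) \<in> borel_measurable (rest i k \<Otimes>\<^sub>M (borel \<Otimes>\<^sub>M borel))"
    by (rule borel_measurable_inner[OF mZ mE])
  then have "(\<integral>\<omega>. Z \<omega> \<bullet> ?g \<omega> \<partial>M) = (\<integral>\<omega>. \<integral>p. Z \<omega> \<bullet> estimate i (X \<omega>) p \<partial>source_pair i \<partial>M)"
    using integral_freeze[of "\<lambda>q. Z (fst q) \<bullet> estimate i (X (fst q)) (snd q)" i k] int by simp
  also have "\<dots> = (\<integral>\<omega>. Z \<omega> \<bullet> sphere_gradient \<eta> (fi i) (X \<omega>) \<partial>M)"
  proof (rule Bochner_Integration.integral_cong[OF refl])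
    fix \<omega>
    have "integrable (source_pair i) (estimate i (X \<omega>))"
      by (rule finite_measure.square_integrable_integrable[OF prob_space.finite_measure[OF prob_space_source_pair] estimate_square_integrable])
    then show "(\<integral>p. Z \<omega> \<bullet> estimate i (X \<omega>) p \<partial>source_pair i) = Z \<omega> \<bullet> sphere_gradient \<eta> (fi i) (X \<omega>)"
      by (simp add: estimate_expectation)
  qed
  finally show "(\<integral>\<omega>. Z \<omega> \<bullet> ?g \<omega> \<partial>M) = (\<integral>\<omega>. Z \<omega> \<bullet> sphere_gradient \<eta> (fi i) (X \<omega>) \<partial>M)" .
qed

end

section \<open>Moments of the gradient tracking iterates\<close>

lemma agent_mean_lipschitz:
  assumes "\<And>i. L-lipschitz_on UNIV (f i)" "0 \<le> L"
  shows "L-lipschitz_on UNIV (agent_mean f :: 'a::metric_space \<Rightarrow> real)"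
proof (rule lipschitz_onI[OF _ assms(2)])
  fix x y :: 'a
  have "dist (agent_mean f x) (agent_mean f y) = \<bar>(\<Sum>i\<in>UNIV. f i x - f i y)\<bar> / real CARD('b)"
    by (simp add: agent_mean_def dist_real_def sum_subtractf diff_divide_distrib[symmetric])
  also have "\<dots> \<le> (\<Sum>i\<in>(UNIV::'b set). L * dist x y) / real CARD('b)"
    using lipschitz_onD[OF assms(1), of x y] by (intro divide_right_mono order_trans[OF sum_abs] sum_mono) (auto simp: dist_real_def)
  also have "\<dots> = L * dist x y" by simp
  finally show "dist (agent_mean f x) (agent_mean f y) \<le> L * dist x y" .
qed

lemma ball_smoothing_agent_mean:
  fixes f :: "'m::finite \<Rightarrow> 'a::euclidean_space \<Rightarrow> real"
  assumes "\<And>i. L-lipschitz_on UNIV (f i)"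
  shows "ball_smoothing \<eta> (agent_mean f) x = agent_mean (\<lambda>i. ball_smoothing \<eta> (f i)) x"
  using lipschitz_on_ball_smoothing(3)[OF assms] by (simp add: ball_smoothing_def agent_mean_def)

lemma sphere_gradient_agent_mean:
  fixes f :: "'m::finite \<Rightarrow> 'a::euclidean_space \<Rightarrow> real"
  assumes f: "\<And>i. L-lipschitz_on UNIV (f i)"
  shows "sphere_gradient \<eta> (agent_mean f) x = (1 / real CARD('m)) *\<^sub>R (\<Sum>i\<in>UNIV. sphere_gradient \<eta> (f i) x)"
proof -
  have "(\<integral>v. agent_mean f (x + \<eta> *\<^sub>R v) *\<^sub>R v \<partial>uniform_sphere)
      = (\<integral>v. (1 / real CARD('m)) *\<^sub>R (\<Sum>i\<in>UNIV. f i (x + \<eta> *\<^sub>R v) *\<^sub>R v) \<partial>uniform_sphere)"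
    by (intro Bochner_Integration.integral_cong refl) (simp add: agent_mean_def scaleR_sum_left[symmetric])
  also have "\<dots> = (1 / real CARD('m)) *\<^sub>R (\<Sum>i\<in>UNIV. \<integral>v. f i (x + \<eta> *\<^sub>R v) *\<^sub>R v \<partial>uniform_sphere)"
    using sphere_gradient_integrable[OF f] by (subst integral_scaleR_right, subst Bochner_Integration.integral_sum) auto
  finally show ?thesis unfolding sphere_gradient_def by (simp add: scaleR_sum_right mult.commute)
qed

lemma square_integrable_vec:
  fixes F :: "'w \<Rightarrow> 'a::euclidean_space^'m"
  assumes "\<And>i. square_integrable M (\<lambda>\<omega>. F \<omega> $ i)"
  shows "square_integrable M F"
proof (rule square_integrable_bound)
  show "integrable M (\<lambda>\<omega>. \<Sum>i\<in>UNIV. (norm (F \<omega> $ i))\<^sup>2)"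
    using assms by (intro Bochner_Integration.integrable_sum square_integrableD(2))
  have "(\<lambda>\<omega>. \<chi> i. F \<omega> $ i) \<in> borel_measurable M"
    using assms by (intro measurable_vec_lambda square_integrableD(1))
  then show "F \<in> borel_measurable M" by simp
qed (simp add: norm_matrix_squared)

context zo_tracking
begin

abbreviation (input) f where "f \<equiv> agent_mean fi"
abbreviation lam where "lam \<equiv> mixing_rate W"
abbreviation V where "V \<equiv> mixing_deviation W"

lemma lipschitz_f: "L0-lipschitz_on UNIV f"
  using lipschitz_fi L0_pos by (intro agent_mean_lipschitz) auto

lemma lipschitz_gradient: "\<Lambda>-lipschitz_on UNIV (sphere_gradient \<eta> (fi i))" "\<Lambda>-lipschitz_on UNIV (sphere_gradient \<eta> f)"
  using lipschitz_on_sphere_gradient[OF lipschitz_fi \<eta>_pos] lipschitz_on_sphere_gradient[OF lipschitz_f \<eta>_pos]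
  by (auto simp: \<Lambda>_def)

lemma gradient_bound: "norm (sphere_gradient \<eta> (fi i) x) \<le> L0" "norm (sphere_gradient \<eta> f x) \<le> L0"
  using norm_GDERIV_le[OF GDERIV_ball_smoothing[OF lipschitz_fi \<eta>_pos] lipschitz_on_ball_smoothing(1)[OF lipschitz_fi]]
    norm_GDERIV_le[OF GDERIV_ball_smoothing[OF lipschitz_f \<eta>_pos] lipschitz_on_ball_smoothing(1)[OF lipschitz_f]]
  by auto

section \<open>The scheme in matrix form\<close>

definition state :: "nat \<Rightarrow> 'w \<Rightarrow> (real^'n^'m) \<times> (real^'n^'m) \<times> (real^'n^'m)" where
  "state k \<omega> = tracking_state W \<gamma> (\<lambda>k X. \<chi> i. zo_gradient \<eta> (\<lambda>x. \<phi> i x (\<xi> i k \<omega>)) (v i k \<omega>) (X $ i)) (x0 \<omega>) k"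

definition iter where "iter k \<omega> = fst (state k \<omega>)"
definition track where "track k \<omega> = fst (snd (state k \<omega>))"
definition prev where "prev k \<omega> = snd (snd (state k \<omega>))"
definition est :: "nat \<Rightarrow> 'w \<Rightarrow> real^'n^'m" where
  "est k \<omega> = (\<chi> i. estimate i (iter k \<omega> $ i) (\<xi> i k \<omega>, v i k \<omega>))"
definition grads :: "nat \<Rightarrow> 'w \<Rightarrow> real^'n^'m" where
  "grads k \<omega> = (\<chi> i. sphere_gradient \<eta> (fi i) (iter k \<omega> $ i))"
definition err where "err k \<omega> = est k \<omega> - grads k \<omega>"
definition mean where "mean k \<omega> = row_mean (iter k \<omega>)"
definition cons where "cons k \<omega> = consensus_error (iter k \<omega>)"
text \<open>The shifted index follows the scheme: iteration \<open>k\<close> first forms the tracker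
  \<open>Suc k\<close> from the current estimates and then moves the iterates with it.\<close>

definition dis where "dis k \<omega> = consensus_error (track (Suc k) \<omega>)"

text \<open>Without the newest noise, which is orthogonal to the past, the disagreement of the trackers
  is measurable with respect to the past.\<close>

definition hid where "hid k \<omega> = dis k \<omega> - V ** err k \<omega>"

lemma iter_tracking_iterate: "tracking_iterate W \<gamma> \<eta> \<phi> \<xi> v x0 k \<omega> = iter k \<omega>"
  by (simp add: tracking_iterate_def iter_def state_def)

lemma state_0: "iter 0 = x0" "track 0 \<omega> = 0" "prev 0 \<omega> = 0"
  by (auto simp: fun_eq_iff iter_def track_def prev_def state_def)

lemma state_Suc:
  "track (Suc k) \<omega> = W ** (track k \<omega> + est k \<omega> - prev k \<omega>)"
  "iter (Suc k) \<omega> = W ** (iter k \<omega> - \<gamma> *\<^sub>R track (Suc k) \<omega>)"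
  "prev (Suc k) \<omega> = est k \<omega>"
  by (simp_all add: iter_def track_def prev_def est_def estimate_def state_def Let_def split: prod.splits)

text \<open>\<open>W\<close> preserves the mean and the trackers start at 0, so the averaged
  increments \<open>est k - prev k\<close> telescope.\<close>

lemma row_mean_track: "row_mean (track (Suc k) \<omega>) = row_mean (est k \<omega>)"
proof -
  have "row_mean (track k \<omega>) = row_mean (prev k \<omega>)"
    by (induction k) (simp_all add: state_0 state_Suc row_mean_mixing[OF W] row_mean_simps)
  then show ?thesis by (simp add: state_Suc row_mean_mixing[OF W] row_mean_simps)
qed

text \<open>The means perform a plain stochastic gradient step with the averaged estimates. The
  network acts on them only through the points at which the estimates are taken.\<close>

lemma mean_Suc: "mean (Suc k) \<omega> = mean k \<omega> - \<gamma> *\<^sub>R row_mean (est k \<omega>)"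
  by (simp add: mean_def state_Suc(2) row_mean_mixing[OF W] row_mean_simps row_mean_track)

lemma cons_Suc: "cons (Suc k) \<omega> = V ** (cons k \<omega> - \<gamma> *\<^sub>R dis k \<omega>)"
  unfolding cons_def dis_def state_Suc(2)[of k] consensus_error_mixing[OF W] consensus_error_simps ..

lemma dis_0: "dis 0 \<omega> = V ** est 0 \<omega>"
  by (simp add: dis_def state_Suc state_0 consensus_error_mixing'[OF W])

lemma dis_Suc: "dis (Suc k) \<omega> = V ** (dis k \<omega> + (est (Suc k) \<omega> - est k \<omega>))"
proof -
  have "dis (Suc k) \<omega> = V ** (track (Suc k) \<omega>) + V ** (est (Suc k) \<omega> - est k \<omega>)"
    unfolding dis_def state_Suc(1)[of "Suc k"] consensus_error_mixing'[OF W] state_Suc(3)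
    by (simp add: matrix_mul_linear_simps)
  also have "V ** (track (Suc k) \<omega>) = V ** dis k \<omega>"
    by (simp add: dis_def consensus_error_mixing[OF W, symmetric] consensus_error_mixing'[OF W])
  finally show ?thesis by (simp add: matrix_mul_linear_simps)
qed

lemma hid_0: "hid 0 \<omega> = V ** grads 0 \<omega>"
  by (simp add: hid_def dis_0 err_def matrix_mul_linear_simps)

text \<open>The noise of iteration \<open>k\<close> enters twice: as the part
  \<open>V ** err k\<close> that was split off \<open>dis k\<close>, and as \<open>- err k\<close>
  through the difference of consecutive estimates. The newest noise \<open>err (Suc k)\<close>
  cancels.\<close>

lemma hid_Suc: "hid (Suc k) \<omega> = V ** (hid k \<omega> + (grads (Suc k) \<omega> - grads k \<omega>) + (V ** err k \<omega> - err k \<omega>))"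
  by (simp add: hid_def dis_Suc err_def matrix_mul_linear_simps algebra_simps)

text \<open>The sources that determine the iterates \<open>iter k\<close>; the estimates of
  iteration \<open>k\<close> use fresh sources outside of this set.\<close>

definition past :: "nat \<Rightarrow> 'm source set" where
  "past k = insert Initial {s. \<exists>i j. j < k \<and> (s = Sample i j \<or> s = Direction i j)}"

lemma past_simps:
  "past k \<subseteq> past (Suc k)" "past k \<subseteq> - fresh i k" "i \<noteq> j \<Longrightarrow> past k \<union> fresh j k \<subseteq> - fresh i k"
  "past k \<union> fresh i k \<subseteq> past (Suc k)" "Initial \<in> past k"
  by (auto simp: past_def less_Suc_eq)

lemma measurable_row: "F \<in> borel_measurable N \<Longrightarrow> (\<lambda>\<omega>. F \<omega> $ i) \<in> borel_measurable N"
  for F :: "'b \<Rightarrow> ('a::euclidean_space)^'m"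
  by (rule measurable_bounded_linear[OF bounded_linear_vec_nth])

lemma measurable_est_row:
  assumes "iter k \<in> borel_measurable (source_algebra (past k))"
  shows "(\<lambda>\<omega>. est k \<omega> $ i) \<in> borel_measurable (source_algebra (past k \<union> fresh i k))"
proof -
  have "(\<lambda>\<omega>. (iter k \<omega> $ i, (\<xi> i k \<omega>, v i k \<omega>))) \<in> source_algebra (past k \<union> fresh i k) \<rightarrow>\<^sub>M borel \<Otimes>\<^sub>M (borel \<Otimes>\<^sub>M borel)"
    by (intro measurable_Pair measurable_row measurable_source measurable_source_mono[OF assms]) auto
  from measurable_compose[OF this measurable_estimate[of i]] show ?thesis by (simp add: est_def)
qed

lemma measurable_est_aux:
  assumes "iter k \<in> borel_measurable (source_algebra (past k))"
  shows "est k \<in> borel_measurable (source_algebra (past (Suc k)))"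
proof -
  have "(\<lambda>\<omega>. \<chi> i. est k \<omega> $ i) \<in> borel_measurable (source_algebra (past (Suc k)))"
    using measurable_est_row[OF assms] past_simps(4) by (intro measurable_vec_lambda) (blast intro: measurable_source_mono)
  then show ?thesis by simp
qed

lemma measurable_state:
  "iter k \<in> borel_measurable (source_algebra (past k))"
  "track k \<in> borel_measurable (source_algebra (past k))"
  "prev k \<in> borel_measurable (source_algebra (past k))"
proof (induction k)
  case 0
  show "iter 0 \<in> borel_measurable (source_algebra (past 0))" unfolding state_0 by (intro measurable_source past_simps)
  show "track 0 \<in> borel_measurable (source_algebra (past 0))" "prev 0 \<in> borel_measurable (source_algebra (past 0))"
    by (auto simp: state_0 cong: measurable_cong)
next
  case (Suc k)
  let ?N = "source_algebra (past (Suc k))"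
  have mono: "F \<in> borel_measurable ?N" if "F \<in> borel_measurable (source_algebra (past k))" for F :: "'w \<Rightarrow> real^'n^'m"
    by (rule measurable_source_mono[OF that past_simps(1)])
  have e: "est k \<in> borel_measurable ?N" by (rule measurable_est_aux[OF Suc(1)])
  have "(\<lambda>\<omega>. W ** (track k \<omega> + est k \<omega> - prev k \<omega>)) \<in> borel_measurable ?N"
    using mono[OF Suc(2)] mono[OF Suc(3)] e by (intro measurable_bounded_linear[OF linear_matrix_mul]) measurable
  then show t: "track (Suc k) \<in> borel_measurable ?N" by (simp add: state_Suc(1)[symmetric])
  have "(\<lambda>\<omega>. W ** (iter k \<omega> - \<gamma> *\<^sub>R track (Suc k) \<omega>)) \<in> borel_measurable ?N"
    by (intro measurable_bounded_linear[OF linear_matrix_mul] borel_measurable_diff mono[OF Suc(1)]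
        measurable_bounded_linear[OF bounded_linear_scaleR_right] t)
  then show "iter (Suc k) \<in> borel_measurable ?N" by (simp add: state_Suc(2)[symmetric])
  show "prev (Suc k) \<in> borel_measurable ?N" using e by (simp add: state_Suc(3) cong: measurable_cong)
qed

lemmas measurable_est = measurable_est_aux[OF measurable_state(1)]

lemma measurable_grads: "grads k \<in> borel_measurable (source_algebra (past k))"
proof -
  have "(\<lambda>\<omega>. \<chi> i. sphere_gradient \<eta> (fi i) (iter k \<omega> $ i)) \<in> borel_measurable (source_algebra (past k))"
    by (intro measurable_vec_lambda measurable_compose[OF measurable_row[OF measurable_state(1)]]
        lipschitz_on_borel_measurable[OF lipschitz_gradient(1)])
  then show ?thesis by (simp add: grads_def[abs_def])
qed

lemma measurable_err: "err k \<in> borel_measurable (source_algebra (past (Suc k)))"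
  unfolding err_def[abs_def] using measurable_est[of k] measurable_source_mono[OF measurable_grads past_simps(1), of k] by measurable

lemma measurable_err_row: "(\<lambda>\<omega>. err k \<omega> $ i) \<in> borel_measurable (source_algebra (past k \<union> fresh i k))"
proof -
  have "(\<lambda>\<omega>. grads k \<omega> $ i) \<in> borel_measurable (source_algebra (past k \<union> fresh i k))"
    by (rule measurable_row, rule measurable_source_mono[OF measurable_grads]) auto
  with measurable_est_row[OF measurable_state(1), of k i] show ?thesis by (simp add: err_def)
qed

lemma measurable_hid: "hid k \<in> borel_measurable (source_algebra (past k))"
proof (induction k)
  case 0
  have "(\<lambda>\<omega>. V ** grads 0 \<omega>) \<in> borel_measurable (source_algebra (past 0))"
    by (rule measurable_bounded_linear[OF linear_matrix_mul measurable_grads])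
  then show ?case by (simp add: hid_0[symmetric])
next
  case (Suc k)
  let ?N = "source_algebra (past (Suc k))"
  have "(\<lambda>\<omega>. V ** (hid k \<omega> + (grads (Suc k) \<omega> - grads k \<omega>) + (V ** err k \<omega> - err k \<omega>))) \<in> borel_measurable ?N"
    by (intro measurable_bounded_linear[OF linear_matrix_mul] borel_measurable_add borel_measurable_diff
        measurable_grads measurable_err measurable_source_mono[OF Suc past_simps(1)]
        measurable_source_mono[OF measurable_grads past_simps(1)])
  then show ?case by (simp add: hid_Suc[symmetric])
qed

section \<open>Moments and orthogonality of the noise\<close>

lemma si_grads_row: "square_integrable M (\<lambda>\<omega>. grads k \<omega> $ i)"
  by (rule square_integrable_bounded[of _ L0])
     (auto simp: grads_def intro: gradient_bound measurable_row[OF measurable_source_M[OF measurable_grads], unfolded grads_def, simplified])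

lemma est_row:
  shows "square_integrable M (\<lambda>\<omega>. est k \<omega> $ i)" and "(\<integral>\<omega>. (norm (est k \<omega> $ i))\<^sup>2 \<partial>M) \<le> \<sigma>2"
    and "Z \<in> borel_measurable (rest i k) \<Longrightarrow> square_integrable M Z \<Longrightarrow> (\<integral>\<omega>. Z \<omega> \<bullet> (err k \<omega> $ i) \<partial>M) = 0"
proof -
  have X: "(\<lambda>\<omega>. iter k \<omega> $ i) \<in> borel_measurable (rest i k)"
    by (rule measurable_row, rule measurable_source_mono[OF measurable_state(1) past_simps(2)])
  show si: "square_integrable M (\<lambda>\<omega>. est k \<omega> $ i)" and "(\<integral>\<omega>. (norm (est k \<omega> $ i))\<^sup>2 \<partial>M) \<le> \<sigma>2"
    using estimate_at(1,2)[OF X] by (simp_all add: est_def)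
  assume Z: "Z \<in> borel_measurable (rest i k)" "square_integrable M Z"
  have "(\<integral>\<omega>. Z \<omega> \<bullet> (err k \<omega> $ i) \<partial>M) = (\<integral>\<omega>. Z \<omega> \<bullet> (est k \<omega> $ i) \<partial>M) - (\<integral>\<omega>. Z \<omega> \<bullet> (grads k \<omega> $ i) \<partial>M)"
    using integrable_inner[OF Z(2) si] integrable_inner[OF Z(2) si_grads_row] by (simp add: err_def inner_diff_right)
  also have "\<dots> = 0" using estimate_at(3)[OF X Z] by (simp add: est_def grads_def)
  finally show "(\<integral>\<omega>. Z \<omega> \<bullet> (err k \<omega> $ i) \<partial>M) = 0" .
qed

lemma si_err_row: "square_integrable M (\<lambda>\<omega>. err k \<omega> $ i)"
  using square_integrable_diff[OF est_row(1) si_grads_row] by (simp add: err_def)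

lemma si_grads: "square_integrable M (grads k)" by (rule square_integrable_vec[OF si_grads_row])
lemma si_est: "square_integrable M (est k)" by (rule square_integrable_vec[OF est_row(1)])
lemma si_err: "square_integrable M (err k)" by (rule square_integrable_vec[OF si_err_row])

text \<open>The gradients are determined by the past, so the cross term vanishes and the variance is
  at most the second moment.\<close>

lemma err_row_second_moment: "(\<integral>\<omega>. (norm (err k \<omega> $ i))\<^sup>2 \<partial>M) \<le> \<sigma>2"
proof -
  have g: "(\<lambda>\<omega>. grads k \<omega> $ i) \<in> borel_measurable (rest i k)"
    by (rule measurable_row, rule measurable_source_mono[OF measurable_grads past_simps(2)])
  have eq: "(norm (est k \<omega> $ i))\<^sup>2 = (norm (grads k \<omega> $ i))\<^sup>2 + 2 * ((grads k \<omega> $ i) \<bullet> (err k \<omega> $ i)) + (norm (err k \<omega> $ i))\<^sup>2" for \<omega>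
  proof -
    have "est k \<omega> $ i = grads k \<omega> $ i + err k \<omega> $ i" by (simp add: err_def)
    then show ?thesis unfolding dot_square_norm[symmetric] by (simp add: inner_add inner_commute)
  qed
  have "(\<integral>\<omega>. (norm (est k \<omega> $ i))\<^sup>2 \<partial>M) = (\<integral>\<omega>. (norm (grads k \<omega> $ i))\<^sup>2 \<partial>M)
      + 2 * (\<integral>\<omega>. (grads k \<omega> $ i) \<bullet> (err k \<omega> $ i) \<partial>M) + (\<integral>\<omega>. (norm (err k \<omega> $ i))\<^sup>2 \<partial>M)"
    unfolding eq using square_integrableD(2)[OF si_grads_row] square_integrableD(2)[OF si_err_row] integrable_inner[OF si_grads_row si_err_row]
    by simp
  moreover have "(\<integral>\<omega>. (grads k \<omega> $ i) \<bullet> (err k \<omega> $ i) \<partial>M) = 0" by (rule est_row(3)[OF g si_grads_row])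
  moreover have "0 \<le> (\<integral>\<omega>. (norm (grads k \<omega> $ i))\<^sup>2 \<partial>M)" by (intro Bochner_Integration.integral_nonneg) auto
  ultimately show ?thesis using est_row(2)[of k i] by linarith
qed

lemma err_second_moment: "(\<integral>\<omega>. (norm (err k \<omega>))\<^sup>2 \<partial>M) \<le> real CARD('m) * \<sigma>2"
proof -
  have "(\<integral>\<omega>. (norm (err k \<omega>))\<^sup>2 \<partial>M) = (\<Sum>i\<in>UNIV. \<integral>\<omega>. (norm (err k \<omega> $ i))\<^sup>2 \<partial>M)"
    unfolding norm_matrix_squared[of "err k _"] by (rule Bochner_Integration.integral_sum) (rule square_integrableD(2)[OF si_err_row])
  also have "\<dots> \<le> (\<Sum>i\<in>(UNIV::'m set). \<sigma>2)" by (intro sum_mono err_row_second_moment)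
  finally show ?thesis by simp
qed

text \<open>The noise of each agent is orthogonal to the past, hence so is every linear combination
  of the noises. The matrix \<open>A\<close> is general because both \<open>V\<close> and
  \<open>V ** (V - mat 1)\<close> occur.\<close>

lemma err_orthogonal:
  fixes A :: "real^'m^'m"
  assumes Z: "Z \<in> borel_measurable (source_algebra (past k))" and Z2: "square_integrable M Z"
  shows "(\<integral>\<omega>. Z \<omega> \<bullet> (A ** err k \<omega>) \<partial>M) = 0"
proof -
  have Zi: "square_integrable M (\<lambda>\<omega>. Z \<omega> $ i)" for i by (rule square_integrable_linear[OF bounded_linear_vec_nth Z2])
  have z: "(\<integral>\<omega>. (Z \<omega> $ i) \<bullet> (err k \<omega> $ j) \<partial>M) = 0" for i j
    by (rule est_row(3)[OF _ Zi], rule measurable_row, rule measurable_source_mono[OF Z past_simps(2)])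
  have "(\<integral>\<omega>. Z \<omega> \<bullet> (A ** err k \<omega>) \<partial>M) = (\<integral>\<omega>. (\<Sum>i\<in>UNIV. \<Sum>j\<in>UNIV. A $ i $ j * ((Z \<omega> $ i) \<bullet> (err k \<omega> $ j))) \<partial>M)"
    by (simp add: inner_vec_def[of "Z _"] matrix_mul_row inner_sum_right)
  also have "\<dots> = (\<Sum>i\<in>UNIV. \<Sum>j\<in>UNIV. \<integral>\<omega>. A $ i $ j * ((Z \<omega> $ i) \<bullet> (err k \<omega> $ j)) \<partial>M)"
    by (subst Bochner_Integration.integral_sum, (intro Bochner_Integration.integrable_sum integrable_mult_right integrable_inner Zi si_err_row))
       (intro sum.cong refl Bochner_Integration.integral_sum integrable_mult_right integrable_inner Zi si_err_row)
  also have "\<dots> = 0" by (simp add: z)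
  finally show ?thesis .
qed

lemma err_mean_orthogonal:
  assumes Z: "Z \<in> borel_measurable (source_algebra (past k))" and Z2: "square_integrable M Z"
  shows "(\<integral>\<omega>. Z \<omega> \<bullet> row_mean (err k \<omega>) \<partial>M) = 0"
proof -
  have z: "(\<integral>\<omega>. Z \<omega> \<bullet> (err k \<omega> $ j) \<partial>M) = 0" for j
    by (rule est_row(3)[OF _ Z2], rule measurable_source_mono[OF Z past_simps(2)])
  have "(\<integral>\<omega>. Z \<omega> \<bullet> row_mean (err k \<omega>) \<partial>M) = (\<integral>\<omega>. (1 / real CARD('m)) * (\<Sum>j\<in>UNIV. Z \<omega> \<bullet> (err k \<omega> $ j)) \<partial>M)"
    by (simp add: row_mean_def inner_sum_right)
  also have "\<dots> = (1 / real CARD('m)) * (\<Sum>j\<in>UNIV. \<integral>\<omega>. Z \<omega> \<bullet> (err k \<omega> $ j) \<partial>M)"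
    by (subst integral_mult_right_zero, subst Bochner_Integration.integral_sum) (auto intro: integrable_inner Z2 si_err_row)
  also have "\<dots> = 0" by (simp add: z)
  finally show ?thesis .
qed

text \<open>The noises of different agents are orthogonal, so averaging divides the variance by the
  number of agents.\<close>

lemma err_mean_second_moment: "(\<integral>\<omega>. (norm (row_mean (err k \<omega>)))\<^sup>2 \<partial>M) \<le> \<sigma>2 / real CARD('m)"
proof -
  have z: "(\<integral>\<omega>. (err k \<omega> $ i) \<bullet> (err k \<omega> $ j) \<partial>M) = (if i = j then (\<integral>\<omega>. (norm (err k \<omega> $ i))\<^sup>2 \<partial>M) else 0)" for i j
  proof (cases "i = j")
    case False
    then have "(\<lambda>\<omega>. err k \<omega> $ i) \<in> borel_measurable (rest j k)"
      by (intro measurable_source_mono[OF measurable_err_row past_simps(3)]) auto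
    from est_row(3)[OF this si_err_row] False show ?thesis by simp
  qed (simp add: dot_square_norm)
  have "(\<integral>\<omega>. (norm (row_mean (err k \<omega>)))\<^sup>2 \<partial>M) = (\<integral>\<omega>. (1 / real CARD('m))\<^sup>2 * (\<Sum>i\<in>UNIV. \<Sum>j\<in>UNIV. (err k \<omega> $ i) \<bullet> (err k \<omega> $ j)) \<partial>M)"
    unfolding dot_square_norm[symmetric]
    by (simp add: row_mean_def inner_sum_left inner_sum_right power2_eq_square sum_divide_distrib sum_distrib_left)
       (intro Bochner_Integration.integral_cong refl sum.swap)
  also have "\<dots> = (1 / real CARD('m))\<^sup>2 * (\<Sum>i\<in>UNIV. \<Sum>j\<in>UNIV. \<integral>\<omega>. (err k \<omega> $ i) \<bullet> (err k \<omega> $ j) \<partial>M)"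
    by (subst integral_mult_right_zero, subst Bochner_Integration.integral_sum,
        (intro Bochner_Integration.integrable_sum integrable_inner si_err_row))
       (intro arg_cong[where f="(*) _"] sum.cong refl Bochner_Integration.integral_sum integrable_inner si_err_row)
  also have "\<dots> = (1 / real CARD('m))\<^sup>2 * (\<Sum>i\<in>UNIV. \<integral>\<omega>. (norm (err k \<omega> $ i))\<^sup>2 \<partial>M)" by (simp add: z)
  also have "\<dots> \<le> (1 / real CARD('m))\<^sup>2 * (\<Sum>i\<in>(UNIV::'m set). \<sigma>2)"
    by (intro mult_left_mono sum_mono err_row_second_moment) auto
  also have "\<dots> = \<sigma>2 / real CARD('m)" by (simp add: power2_eq_square)
  finally show ?thesis .
qed

lemma si_hid: "square_integrable M (hid k)"
proof (induction k)
  case 0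
  show ?case using square_integrable_linear[OF linear_matrix_mul si_grads[of 0], of V] by (simp add: hid_0[symmetric])
next
  case (Suc k)
  have "square_integrable M (\<lambda>\<omega>. hid k \<omega> + (grads (Suc k) \<omega> - grads k \<omega>) + (V ** err k \<omega> - err k \<omega>))"
    by (intro square_integrable_add square_integrable_diff Suc si_grads si_err square_integrable_linear[OF linear_matrix_mul])
  from square_integrable_linear[OF linear_matrix_mul this, of V] show ?case by (simp add: hid_Suc[symmetric])
qed

lemma dis_eq: "dis k \<omega> = hid k \<omega> + V ** err k \<omega>" by (simp add: hid_def)

lemma si_dis: "square_integrable M (dis k)"
  using square_integrable_add[OF si_hid square_integrable_linear[OF linear_matrix_mul si_err], of k V k] by (simp add: dis_eq[symmetric])

lemma si_cons: "square_integrable M (cons k)"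
proof (induction k)
  case 0
  have "(\<lambda>\<omega>. consensus_error (x0 \<omega>)) \<in> borel_measurable M"
    by (rule measurable_bounded_linear[OF consensus_error_linear]) measurable
  then show ?case using integrable_cons by (simp add: square_integrable_def cons_def[abs_def] state_0)
next
  case (Suc k)
  have "square_integrable M (\<lambda>\<omega>. cons k \<omega> - \<gamma> *\<^sub>R dis k \<omega>)"
    by (intro square_integrable_diff Suc square_integrable_scaleR si_dis)
  from square_integrable_linear[OF linear_matrix_mul this, of V] show ?case by (simp add: cons_Suc[symmetric])
qed

lemma si_mean_grads: "square_integrable M (\<lambda>\<omega>. row_mean (grads k \<omega>))"
  by (rule square_integrable_linear[OF row_mean_linear si_grads])

lemma si_mean_err: "square_integrable M (\<lambda>\<omega>. row_mean (err k \<omega>))"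
  by (rule square_integrable_linear[OF row_mean_linear si_err])

lemma si_mean_est: "square_integrable M (\<lambda>\<omega>. row_mean (est k \<omega>))"
  by (rule square_integrable_linear[OF row_mean_linear si_est])

section \<open>One-step inequalities for the expected quantities\<close>

definition ec where "ec k = (\<integral>\<omega>. (norm (cons k \<omega>))\<^sup>2 \<partial>M)"
definition ea where "ea k = (\<integral>\<omega>. (norm (hid k \<omega>))\<^sup>2 \<partial>M)"
definition ed where "ed k = (\<integral>\<omega>. (norm (dis k \<omega>))\<^sup>2 \<partial>M)"
definition e\<delta> where "e\<delta> k = (\<integral>\<omega>. (norm (iter (Suc k) \<omega> - iter k \<omega>))\<^sup>2 \<partial>M)"
definition e\<beta> where "e\<beta> k = (\<integral>\<omega>. (norm (row_mean (grads k \<omega>)))\<^sup>2 \<partial>M)"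
definition es where "es k = (\<integral>\<omega>. (norm (sphere_gradient \<eta> f (mean k \<omega>)))\<^sup>2 \<partial>M)"
definition eF where "eF k = (\<integral>\<omega>. ball_smoothing \<eta> f (mean k \<omega>) \<partial>M)"

lemma moments_nonneg: "0 \<le> ec k" "0 \<le> ea k" "0 \<le> e\<beta> k" "0 \<le> es k"
  by (simp_all add: ec_def ea_def e\<beta>_def es_def)

lemma lam_facts: "0 \<le> lam" "lam\<^sup>2 < 1" "0 < 1 - lam\<^sup>2"
proof -
  show l: "0 \<le> lam" by (rule mixing_rate_nonneg)
  show "lam\<^sup>2 < 1" using l W_rate by (simp add: abs_square_less_1)
  then show "0 < 1 - lam\<^sup>2" by simp
qed

lemma V_le: "norm (V ** X) \<le> lam * norm X" for X :: "real^'n^'m"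
  unfolding mixing_rate_deviation by (rule norm_matrix_mul_le)

lemma V_le2: "(norm (V ** X))\<^sup>2 \<le> lam\<^sup>2 * (norm X)\<^sup>2" for X :: "real^'n^'m"
  using power_mono[OF V_le[of X], of 2] by (simp add: power_mult_distrib)

lemma ec_Suc: "ec (Suc k) \<le> (1 + lam\<^sup>2) / 2 * ec k + 2 * \<gamma>\<^sup>2 * lam\<^sup>2 / (1 - lam\<^sup>2) * ed k"
proof -
  note i = square_integrableD(2)[OF si_cons] square_integrableD(2)[OF si_dis]
  have "ec (Suc k) \<le> (\<integral>\<omega>. (1 + lam\<^sup>2) / 2 * (norm (cons k \<omega>))\<^sup>2 + 2 * \<gamma>\<^sup>2 * lam\<^sup>2 / (1 - lam\<^sup>2) * (norm (dis k \<omega>))\<^sup>2 \<partial>M)"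
    unfolding ec_def
  proof (rule integral_mono[OF i(1)])
    fix \<omega>
    have "(norm (cons (Suc k) \<omega>))\<^sup>2 \<le> (1 + lam\<^sup>2) / 2 * (norm (cons k \<omega>))\<^sup>2 + lam\<^sup>2 * (1 + lam\<^sup>2) / (1 - lam\<^sup>2) * (norm (- \<gamma> *\<^sub>R dis k \<omega>))\<^sup>2"
      using V_le[of "cons k \<omega> - \<gamma> *\<^sub>R dis k \<omega>"] lam_facts by (intro contraction_young) (auto simp: cons_Suc)
    also have "lam\<^sup>2 * (1 + lam\<^sup>2) / (1 - lam\<^sup>2) * (norm (- \<gamma> *\<^sub>R dis k \<omega>))\<^sup>2 \<le> lam\<^sup>2 * 2 / (1 - lam\<^sup>2) * (norm (- \<gamma> *\<^sub>R dis k \<omega>))\<^sup>2"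
      using lam_facts by (intro mult_right_mono divide_right_mono mult_left_mono) auto
    also have "\<dots> = 2 * \<gamma>\<^sup>2 * lam\<^sup>2 / (1 - lam\<^sup>2) * (norm (dis k \<omega>))\<^sup>2"
      by (simp add: power_mult_distrib)
    finally show "(norm (cons (Suc k) \<omega>))\<^sup>2 \<le> (1 + lam\<^sup>2) / 2 * (norm (cons k \<omega>))\<^sup>2 + 2 * \<gamma>\<^sup>2 * lam\<^sup>2 / (1 - lam\<^sup>2) * (norm (dis k \<omega>))\<^sup>2"
      by simp
  qed (use i in auto)
  also have "\<dots> = (1 + lam\<^sup>2) / 2 * ec k + 2 * \<gamma>\<^sup>2 * lam\<^sup>2 / (1 - lam\<^sup>2) * ed k"
    using i by (simp add: ec_def ed_def)
  finally show ?thesis .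
qed

lemma ea_0: "ea 0 \<le> lam\<^sup>2 * real CARD('m) * ((1 / real CARD('m)) * (\<integral>\<omega>. (norm (grads 0 \<omega>))\<^sup>2 \<partial>M))"
proof -
  have "ea 0 \<le> (\<integral>\<omega>. lam\<^sup>2 * (norm (grads 0 \<omega>))\<^sup>2 \<partial>M)"
    unfolding ea_def
  proof (rule integral_mono[OF square_integrableD(2)[OF si_hid]])
    show "(norm (hid 0 \<omega>))\<^sup>2 \<le> lam\<^sup>2 * (norm (grads 0 \<omega>))\<^sup>2" for \<omega> unfolding hid_0 by (rule V_le2)
  qed (use square_integrableD(2)[OF si_grads] in auto)
  then show ?thesis by simp
qed

text \<open>The newest noise is orthogonal to \<open>hid k\<close>, so the squares add without a
  Young factor.\<close>

lemma ed_le: "ed k \<le> ea k + lam\<^sup>2 * real CARD('m) * \<sigma>2"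
proof -
  have si: "square_integrable M (\<lambda>\<omega>. V ** err k \<omega>)" by (rule square_integrable_linear[OF linear_matrix_mul si_err])
  have eq: "(norm (dis k \<omega>))\<^sup>2 = (norm (hid k \<omega>))\<^sup>2 + 2 * (hid k \<omega> \<bullet> (V ** err k \<omega>)) + (norm (V ** err k \<omega>))\<^sup>2" for \<omega>
    unfolding dis_eq dot_square_norm[symmetric] by (simp add: inner_add inner_commute)
  have "ed k = ea k + 2 * (\<integral>\<omega>. hid k \<omega> \<bullet> (V ** err k \<omega>) \<partial>M) + (\<integral>\<omega>. (norm (V ** err k \<omega>))\<^sup>2 \<partial>M)"
    unfolding ed_def ea_def eq
    using square_integrableD(2)[OF si_hid] square_integrableD(2)[OF si] integrable_inner[OF si_hid si] by simp
  also have "(\<integral>\<omega>. hid k \<omega> \<bullet> (V ** err k \<omega>) \<partial>M) = 0" by (rule err_orthogonal[OF measurable_hid si_hid])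
  also have "(\<integral>\<omega>. (norm (V ** err k \<omega>))\<^sup>2 \<partial>M) \<le> (\<integral>\<omega>. lam\<^sup>2 * (norm (err k \<omega>))\<^sup>2 \<partial>M)"
    using square_integrableD(2)[OF si] square_integrableD(2)[OF si_err] V_le2 by (intro integral_mono) auto
  also have "\<dots> = lam\<^sup>2 * (\<integral>\<omega>. (norm (err k \<omega>))\<^sup>2 \<partial>M)" by simp
  also have "\<dots> \<le> lam\<^sup>2 * (real CARD('m) * \<sigma>2)" by (intro mult_left_mono err_second_moment) auto
  finally show ?thesis by simp
qed

lemma iter_diff: "iter (Suc k) \<omega> - iter k \<omega> = (cons (Suc k) \<omega> - cons k \<omega>) + (\<chi> i. - \<gamma> *\<^sub>R row_mean (est k \<omega>))"
proof -
  have "iter j \<omega> = cons j \<omega> + (\<chi> i. mean j \<omega>)" for j by (simp add: cons_def mean_def consensus_error_def)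
  then show ?thesis by (simp add: mean_Suc vec_eq_iff)
qed

lemma iter_diff_norm:
  "(norm (iter (Suc k) \<omega> - iter k \<omega>))\<^sup>2 = (norm (cons (Suc k) \<omega> - cons k \<omega>))\<^sup>2 + real CARD('m) * \<gamma>\<^sup>2 * (norm (row_mean (est k \<omega>)))\<^sup>2"
proof -
  have "(norm (iter (Suc k) \<omega> - iter k \<omega>))\<^sup>2
     = (norm (cons (Suc k) \<omega> - cons k \<omega>))\<^sup>2 + real CARD('m) * (norm (mean (Suc k) \<omega> - mean k \<omega>))\<^sup>2"
    unfolding norm_matrix_decomposition[of "iter (Suc k) \<omega> - iter k \<omega>"] by (simp add: cons_def mean_def consensus_error_simps row_mean_simps)
  then show ?thesis by (simp add: mean_Suc power_mult_distrib)
qed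

lemma mean_est_second_moment: "(\<integral>\<omega>. (norm (row_mean (est k \<omega>)))\<^sup>2 \<partial>M) \<le> e\<beta> k + \<sigma>2 / real CARD('m)"
proof -
  have eq: "(norm (row_mean (est k \<omega>)))\<^sup>2 = (norm (row_mean (grads k \<omega>)))\<^sup>2
      + 2 * (row_mean (grads k \<omega>) \<bullet> row_mean (err k \<omega>)) + (norm (row_mean (err k \<omega>)))\<^sup>2" for \<omega>
  proof -
    have "row_mean (est k \<omega>) = row_mean (grads k \<omega>) + row_mean (err k \<omega>)" by (simp add: err_def row_mean_simps)
    then show ?thesis unfolding dot_square_norm[symmetric] by (simp add: inner_add inner_commute)
  qed
  have "(\<integral>\<omega>. (norm (row_mean (est k \<omega>)))\<^sup>2 \<partial>M) = e\<beta> k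
      + 2 * (\<integral>\<omega>. row_mean (grads k \<omega>) \<bullet> row_mean (err k \<omega>) \<partial>M) + (\<integral>\<omega>. (norm (row_mean (err k \<omega>)))\<^sup>2 \<partial>M)"
    unfolding eq e\<beta>_def using square_integrableD(2)[OF si_mean_grads] square_integrableD(2)[OF si_mean_err]
      integrable_inner[OF si_mean_grads si_mean_err] by simp
  also have "(\<integral>\<omega>. row_mean (grads k \<omega>) \<bullet> row_mean (err k \<omega>) \<partial>M) = 0"
    by (rule err_mean_orthogonal[OF measurable_bounded_linear[OF row_mean_linear measurable_grads] si_mean_grads])
  finally show ?thesis using err_mean_second_moment[of k] by simp
qed

lemma si_iter_diff: "square_integrable M (\<lambda>\<omega>. iter (Suc k) \<omega> - iter k \<omega>)"
proof -
  have "square_integrable M (\<lambda>\<omega>. \<chi> i. - \<gamma> *\<^sub>R row_mean (est k \<omega>) :: real^'n^'m)"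
    by (rule square_integrable_vec) (use square_integrable_scaleR[OF si_mean_est, of "- \<gamma>" k] in simp)
  then show ?thesis unfolding iter_diff by (intro square_integrable_add square_integrable_diff si_cons)
qed

text \<open>By \<open>iter_diff_norm\<close> the movement splits orthogonally into the disagreement
  and the mean. The mean is counted once per agent, which cancels the denominator of its
  variance.\<close>

lemma e\<delta>_le: "e\<delta> k \<le> 2 * ec (Suc k) + 2 * ec k + real CARD('m) * \<gamma>\<^sup>2 * e\<beta> k + \<gamma>\<^sup>2 * \<sigma>2"
proof -
  note i = square_integrableD(2)[OF si_cons] square_integrableD(2)[OF si_mean_est]
  have "e\<delta> k \<le> (\<integral>\<omega>. 2 * (norm (cons (Suc k) \<omega>))\<^sup>2 + 2 * (norm (cons k \<omega>))\<^sup>2 + real CARD('m) * \<gamma>\<^sup>2 * (norm (row_mean (est k \<omega>)))\<^sup>2 \<partial>M)"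
    unfolding e\<delta>_def
  proof (rule integral_mono[OF square_integrableD(2)[OF si_iter_diff]])
    fix \<omega>
    have "(norm (cons (Suc k) \<omega> - cons k \<omega>))\<^sup>2 \<le> (norm (cons (Suc k) \<omega>) + norm (cons k \<omega>))\<^sup>2"
      by (intro power_mono norm_triangle_ineq4) auto
    also have "\<dots> \<le> 2 * (norm (cons (Suc k) \<omega>))\<^sup>2 + 2 * (norm (cons k \<omega>))\<^sup>2"
      using sum_squares_bound[of "norm (cons (Suc k) \<omega>)" "norm (cons k \<omega>)"] by (simp add: power2_sum)
    finally show "(norm (iter (Suc k) \<omega> - iter k \<omega>))\<^sup>2
        \<le> 2 * (norm (cons (Suc k) \<omega>))\<^sup>2 + 2 * (norm (cons k \<omega>))\<^sup>2 + real CARD('m) * \<gamma>\<^sup>2 * (norm (row_mean (est k \<omega>)))\<^sup>2"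
      unfolding iter_diff_norm by simp
  qed (use i in auto)
  also have "\<dots> = 2 * ec (Suc k) + 2 * ec k + real CARD('m) * \<gamma>\<^sup>2 * (\<integral>\<omega>. (norm (row_mean (est k \<omega>)))\<^sup>2 \<partial>M)"
    using i by (simp add: ec_def)
  also have "\<dots> \<le> 2 * ec (Suc k) + 2 * ec k + real CARD('m) * \<gamma>\<^sup>2 * (e\<beta> k + \<sigma>2 / real CARD('m))"
    by (intro add_left_mono mult_left_mono mean_est_second_moment) auto
  also have "\<dots> = 2 * ec (Suc k) + 2 * ec k + real CARD('m) * \<gamma>\<^sup>2 * e\<beta> k + \<gamma>\<^sup>2 * \<sigma>2"
    by (simp add: distrib_left)
  finally show ?thesis .
qed

lemma grads_diff_le: "(norm (grads (Suc k) \<omega> - grads k \<omega>))\<^sup>2 \<le> \<Lambda>\<^sup>2 * (norm (iter (Suc k) \<omega> - iter k \<omega>))\<^sup>2"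
proof -
  have "(norm (grads (Suc k) \<omega> - grads k \<omega>))\<^sup>2
     = (\<Sum>i\<in>UNIV. (norm (sphere_gradient \<eta> (fi i) (iter (Suc k) \<omega> $ i) - sphere_gradient \<eta> (fi i) (iter k \<omega> $ i)))\<^sup>2)"
    unfolding norm_matrix_squared[of "grads (Suc k) \<omega> - grads k \<omega>"] by (simp add: grads_def)
  also have "\<dots> \<le> (\<Sum>i\<in>UNIV. (\<Lambda> * norm (iter (Suc k) \<omega> $ i - iter k \<omega> $ i))\<^sup>2)"
    by (intro sum_mono power_mono lipschitz_on_normD[OF lipschitz_gradient(1)]) auto
  also have "\<dots> = \<Lambda>\<^sup>2 * (norm (iter (Suc k) \<omega> - iter k \<omega>))\<^sup>2"
    unfolding norm_matrix_squared[of "iter (Suc k) \<omega> - iter k \<omega>"] by (simp add: power_mult_distrib sum_distrib_left)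
  finally show ?thesis .
qed

text \<open>Young's inequality is spent on \<open>hid k + B\<close> only, because
  \<open>V ** hid k\<close> is orthogonal to the noise. The gradient change \<open>B\<close> depends
  on that noise through the new iterates, so its product with \<open>V ** N\<close> is estimated by
  squares. Thus \<open>V ** N\<close> counts twice, each time with \<open>4 * lam^2\<close>, which
  makes 8.\<close>

lemma ea_Suc: "ea (Suc k) \<le> (1 + lam\<^sup>2) / 2 * ea k + (2 * lam\<^sup>2 / (1 - lam\<^sup>2) * \<Lambda>\<^sup>2 * e\<delta> k + 8 * lam\<^sup>2 * real CARD('m) * \<sigma>2)"
proof -
  define B where "B \<omega> = grads (Suc k) \<omega> - grads k \<omega>" for \<omega>
  define N where "N \<omega> = V ** err k \<omega> - err k \<omega>" for \<omega>
  have siB: "square_integrable M B" unfolding B_def[abs_def] by (intro square_integrable_diff si_grads)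
  have siN: "square_integrable M N" unfolding N_def[abs_def]
    by (intro square_integrable_diff si_err square_integrable_linear[OF linear_matrix_mul])
  have siVh: "square_integrable M (\<lambda>\<omega>. V ** hid k \<omega>)" by (rule square_integrable_linear[OF linear_matrix_mul si_hid])
  have siVN: "square_integrable M (\<lambda>\<omega>. V ** N \<omega>)" by (rule square_integrable_linear[OF linear_matrix_mul siN])
  let ?q = "1 - lam\<^sup>2"
  have q: "0 < ?q" by (rule lam_facts)
  have VN: "(norm (V ** N \<omega>))\<^sup>2 \<le> 4 * lam\<^sup>2 * (norm (err k \<omega>))\<^sup>2" for \<omega>
  proof -
    have "norm (N \<omega>) \<le> norm (V ** err k \<omega>) + norm (err k \<omega>)" unfolding N_def by (rule norm_triangle_ineq4)
    also have "\<dots> \<le> 1 * norm (err k \<omega>) + norm (err k \<omega>)"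
      using W_rate by (intro add_right_mono order_trans[OF V_le] mult_right_mono) auto
    finally have "(norm (N \<omega>))\<^sup>2 \<le> (2 * norm (err k \<omega>))\<^sup>2" by (intro power_mono) auto
    then have "lam\<^sup>2 * (norm (N \<omega>))\<^sup>2 \<le> lam\<^sup>2 * (2 * norm (err k \<omega>))\<^sup>2" by (rule mult_left_mono) auto
    then show ?thesis using V_le2[of "N \<omega>"] by (simp add: power_mult_distrib)
  qed
  have pw: "(norm (hid (Suc k) \<omega>))\<^sup>2 \<le> (1 + lam\<^sup>2) / 2 * (norm (hid k \<omega>))\<^sup>2
      + 2 * lam\<^sup>2 / ?q * \<Lambda>\<^sup>2 * (norm (iter (Suc k) \<omega> - iter k \<omega>))\<^sup>2 + 8 * lam\<^sup>2 * (norm (err k \<omega>))\<^sup>2 + 2 * ((V ** hid k \<omega>) \<bullet> (V ** N \<omega>))" for \<omega>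
  proof -
    have h: "hid (Suc k) \<omega> = V ** (hid k \<omega> + B \<omega>) + V ** N \<omega>"
      by (simp add: hid_Suc B_def N_def matrix_mul_linear_simps)
    have "(norm (hid (Suc k) \<omega>))\<^sup>2 = (norm (V ** (hid k \<omega> + B \<omega>)))\<^sup>2 + 2 * ((V ** (hid k \<omega> + B \<omega>)) \<bullet> (V ** N \<omega>)) + (norm (V ** N \<omega>))\<^sup>2"
      unfolding h dot_square_norm[symmetric] by (simp add: inner_add inner_commute)
    also have "(V ** (hid k \<omega> + B \<omega>)) \<bullet> (V ** N \<omega>) = (V ** hid k \<omega>) \<bullet> (V ** N \<omega>) + (V ** B \<omega>) \<bullet> (V ** N \<omega>)"
      by (simp add: matrix_mul_linear_simps inner_add)
    finally have e1: "(norm (hid (Suc k) \<omega>))\<^sup>2 = (norm (V ** (hid k \<omega> + B \<omega>)))\<^sup>2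
       + 2 * ((V ** hid k \<omega>) \<bullet> (V ** N \<omega>)) + 2 * ((V ** B \<omega>) \<bullet> (V ** N \<omega>)) + (norm (V ** N \<omega>))\<^sup>2" by simp
    have "2 * ((V ** B \<omega>) \<bullet> (V ** N \<omega>)) \<le> 2 * norm (V ** B \<omega>) * norm (V ** N \<omega>)"
      using norm_cauchy_schwarz[of "V ** B \<omega>" "V ** N \<omega>"] by simp
    also have "\<dots> \<le> (norm (V ** B \<omega>))\<^sup>2 + (norm (V ** N \<omega>))\<^sup>2" by (rule sum_squares_bound)
    finally have e2: "2 * ((V ** B \<omega>) \<bullet> (V ** N \<omega>)) \<le> lam\<^sup>2 * (norm (B \<omega>))\<^sup>2 + (norm (V ** N \<omega>))\<^sup>2"
      using V_le2[of "B \<omega>"] by linarith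
    have e3: "(norm (V ** (hid k \<omega> + B \<omega>)))\<^sup>2 \<le> (1 + lam\<^sup>2) / 2 * (norm (hid k \<omega>))\<^sup>2 + lam\<^sup>2 * (1 + lam\<^sup>2) / ?q * (norm (B \<omega>))\<^sup>2"
      using V_le lam_facts by (intro contraction_young) auto
    \<comment> \<open>The extra square of \<open>B\<close> fits the coefficient exactly, as
      \<open>(1 + lam^2) + (1 - lam^2) = 2\<close>.\<close>
    have "lam\<^sup>2 * (1 + lam\<^sup>2) / ?q * (norm (B \<omega>))\<^sup>2 + lam\<^sup>2 * (norm (B \<omega>))\<^sup>2 = 2 * lam\<^sup>2 / ?q * (norm (B \<omega>))\<^sup>2"
      using q by (simp add: field_simps)
    also have "\<dots> \<le> 2 * lam\<^sup>2 / ?q * (\<Lambda>\<^sup>2 * (norm (iter (Suc k) \<omega> - iter k \<omega>))\<^sup>2)"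
      using q grads_diff_le unfolding B_def by (intro mult_left_mono) auto
    finally have e4: "lam\<^sup>2 * (1 + lam\<^sup>2) / ?q * (norm (B \<omega>))\<^sup>2 + lam\<^sup>2 * (norm (B \<omega>))\<^sup>2
        \<le> 2 * lam\<^sup>2 / ?q * \<Lambda>\<^sup>2 * (norm (iter (Suc k) \<omega> - iter k \<omega>))\<^sup>2" by (simp add: mult.assoc)
    show ?thesis using e1 e2 e3 e4 VN[of \<omega>] by linarith
  qed
  note i = square_integrableD(2)[OF si_hid] square_integrableD(2)[OF si_iter_diff] square_integrableD(2)[OF si_err] integrable_inner[OF siVh siVN]
  have "ea (Suc k) \<le> (\<integral>\<omega>. (1 + lam\<^sup>2) / 2 * (norm (hid k \<omega>))\<^sup>2
      + 2 * lam\<^sup>2 / ?q * \<Lambda>\<^sup>2 * (norm (iter (Suc k) \<omega> - iter k \<omega>))\<^sup>2 + 8 * lam\<^sup>2 * (norm (err k \<omega>))\<^sup>2 + 2 * ((V ** hid k \<omega>) \<bullet> (V ** N \<omega>)) \<partial>M)"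
    unfolding ea_def by (rule integral_mono[OF i(1) _ pw]) (intro Bochner_Integration.integrable_add integrable_mult_right i)
  also have "\<dots> = (1 + lam\<^sup>2) / 2 * ea k + 2 * lam\<^sup>2 / ?q * \<Lambda>\<^sup>2 * e\<delta> k + 8 * lam\<^sup>2 * (\<integral>\<omega>. (norm (err k \<omega>))\<^sup>2 \<partial>M)
      + 2 * (\<integral>\<omega>. (V ** hid k \<omega>) \<bullet> (V ** N \<omega>) \<partial>M)"
    unfolding ea_def e\<delta>_def
    by (subst Bochner_Integration.integral_add, (intro Bochner_Integration.integrable_add integrable_mult_right i)+,
        subst Bochner_Integration.integral_add, (intro Bochner_Integration.integrable_add integrable_mult_right i)+,
        subst Bochner_Integration.integral_add, (intro Bochner_Integration.integrable_add integrable_mult_right i)+)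
       (simp only: integral_mult_right_zero)
  also have "(\<integral>\<omega>. (V ** hid k \<omega>) \<bullet> (V ** N \<omega>) \<partial>M) = 0"
  proof -
    \<comment> \<open>Writes \<open>V ** N\<close> as one matrix applied to \<open>err k\<close>,
      the form that \<open>err_orthogonal\<close> takes.\<close>
    have "(V - mat 1) ** X = V ** X - X" for X :: "real^'n^'m"
    proof -
      have "(V - mat 1) ** X = V ** X - mat 1 ** X"
        by (simp add: vec_eq_iff matrix_matrix_mult_def left_diff_distrib sum_subtractf)
      then show ?thesis by (simp add: matrix_mul_lid)
    qed
    then have "V ** N \<omega> = (V ** (V - mat 1)) ** err k \<omega>" for \<omega>
      by (simp add: N_def matrix_mul_assoc[symmetric])
    then show ?thesis
      using err_orthogonal[OF measurable_bounded_linear[OF linear_matrix_mul measurable_hid] siVh, of "V ** (V - mat 1)"] by simp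
  qed
  also have "(1 + lam\<^sup>2) / 2 * ea k + 2 * lam\<^sup>2 / ?q * \<Lambda>\<^sup>2 * e\<delta> k + 8 * lam\<^sup>2 * (\<integral>\<omega>. (norm (err k \<omega>))\<^sup>2 \<partial>M) + 2 * 0
      \<le> (1 + lam\<^sup>2) / 2 * ea k + 2 * lam\<^sup>2 / ?q * \<Lambda>\<^sup>2 * e\<delta> k + 8 * lam\<^sup>2 * (real CARD('m) * \<sigma>2)"
    using mult_left_mono[OF err_second_moment[of k], of "8 * lam\<^sup>2"] by simp
  finally show ?thesis by simp
qed

lemma measurable_mean: "mean k \<in> borel_measurable (source_algebra (past k))"
  unfolding mean_def[abs_def] by (rule measurable_bounded_linear[OF row_mean_linear measurable_state(1)])

lemma measurable_mean_gradient: "(\<lambda>\<omega>. sphere_gradient \<eta> f (mean k \<omega>)) \<in> borel_measurable (source_algebra (past k))"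
  by (rule measurable_compose[OF measurable_mean lipschitz_on_borel_measurable[OF lipschitz_gradient(2)]])

lemma si_mean_gradient: "square_integrable M (\<lambda>\<omega>. sphere_gradient \<eta> f (mean k \<omega>))"
  by (rule square_integrable_bounded[OF measurable_source_M[OF measurable_mean_gradient] gradient_bound(2)])

text \<open>The initial value is integrable by assumption, and each increment is controlled by the
  Lipschitz constant and the square integrable estimates.\<close>

lemma integrable_objective: "integrable M (\<lambda>\<omega>. ball_smoothing \<eta> f (mean k \<omega>))"
proof (induction k)
  case 0
  then show ?case using integrable_gap by (simp add: mean_def state_0 ball_smoothing_agent_mean[OF lipschitz_fi])
next
  case (Suc k)
  let ?F = "ball_smoothing \<eta> f"
  have lip: "L0-lipschitz_on UNIV ?F" by (rule lipschitz_on_ball_smoothing(1)[OF lipschitz_f])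
  have "integrable M (\<lambda>\<omega>. ?F (mean (Suc k) \<omega>) - ?F (mean k \<omega>))"
  proof (rule Bochner_Integration.integrable_bound)
    show "integrable M (\<lambda>\<omega>. L0 * (\<gamma> * norm (row_mean (est k \<omega>))))"
      using square_integrable_integrable[OF si_mean_est[of k]] by auto
    show "(\<lambda>\<omega>. ?F (mean (Suc k) \<omega>) - ?F (mean k \<omega>)) \<in> borel_measurable M"
      by (intro borel_measurable_diff measurable_compose[OF measurable_source_M[OF measurable_mean] lipschitz_on_borel_measurable[OF lip]])
    show "AE \<omega> in M. norm (?F (mean (Suc k) \<omega>) - ?F (mean k \<omega>)) \<le> norm (L0 * (\<gamma> * norm (row_mean (est k \<omega>))))"
    proof (rule AE_I2)
      fix \<omega>
      show "norm (?F (mean (Suc k) \<omega>) - ?F (mean k \<omega>)) \<le> norm (L0 * (\<gamma> * norm (row_mean (est k \<omega>))))"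
        using lipschitz_on_normD[OF lip, of "mean (Suc k) \<omega>" "mean k \<omega>"] L0_pos \<gamma>_pos by (simp add: mean_Suc abs_mult)
    qed
  qed
  from Bochner_Integration.integrable_add[OF this Suc] show ?case by simp
qed

text \<open>The product of the gradient at the mean with the mean of the gradients is polarized: it
  yields both squares and loses the squared deviation, which the consensus error bounds. The
  remainder \<open>\<Lambda> * \<gamma>^2\<close> of \<open>smooth_expansion\<close> accounts for
  the factor \<open>1 - 2 * (\<gamma> * \<Lambda>)\<close> and for the variance term.\<close>

lemma eF_Suc:
  "eF (Suc k) \<le> eF k - \<gamma> / 2 * es k - \<gamma> / 2 * (1 - 2 * (\<gamma> * \<Lambda>)) * e\<beta> k + \<gamma> / 2 * (\<Lambda>\<^sup>2 / real CARD('m) * ec k) + \<gamma> * (\<gamma> * \<Lambda>) * (\<sigma>2 / real CARD('m))"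
proof -
  let ?F = "ball_smoothing \<eta> f" and ?G = "\<lambda>\<omega>. sphere_gradient \<eta> f (mean k \<omega>)"
  let ?b = "\<lambda>\<omega>. row_mean (grads k \<omega>)" and ?g = "\<lambda>\<omega>. row_mean (est k \<omega>)" and ?e = "\<lambda>\<omega>. row_mean (err k \<omega>)"
  have dev: "(norm (?G \<omega> - ?b \<omega>))\<^sup>2 \<le> \<Lambda>\<^sup>2 / real CARD('m) * (norm (cons k \<omega>))\<^sup>2" for \<omega>
  proof -
    define X where "X = (\<chi> i. sphere_gradient \<eta> (fi i) (mean k \<omega>) - sphere_gradient \<eta> (fi i) (iter k \<omega> $ i))"
    have "?G \<omega> - ?b \<omega> = row_mean X"
      unfolding sphere_gradient_agent_mean[OF lipschitz_fi] by (simp add: X_def row_mean_def grads_def sum_subtractf scaleR_diff_right)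
    then have "real CARD('m) * (norm (?G \<omega> - ?b \<omega>))\<^sup>2 \<le> (norm X)\<^sup>2" using norm_row_mean_le[of X] by simp
    also have "\<dots> \<le> (\<Sum>i\<in>UNIV. (\<Lambda> * norm (mean k \<omega> - iter k \<omega> $ i))\<^sup>2)"
      unfolding norm_matrix_squared[of X] unfolding X_def vec_lambda_beta
      by (intro sum_mono power_mono lipschitz_on_normD[OF lipschitz_gradient(1)]) auto
    also have "\<dots> = \<Lambda>\<^sup>2 * (norm (cons k \<omega>))\<^sup>2"
      unfolding norm_matrix_squared[of "cons k \<omega>"]
      by (simp add: cons_def consensus_error_def mean_def[symmetric] power_mult_distrib sum_distrib_left norm_minus_commute)
    finally show ?thesis by (simp add: field_simps)
  qed
  have pw: "?F (mean (Suc k) \<omega>) \<le> ?F (mean k \<omega>) - \<gamma> / 2 * (norm (?G \<omega>))\<^sup>2 - \<gamma> / 2 * (norm (?b \<omega>))\<^sup>2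
      + \<gamma> / 2 * (\<Lambda>\<^sup>2 / real CARD('m) * (norm (cons k \<omega>))\<^sup>2) - \<gamma> * (?G \<omega> \<bullet> ?e \<omega>) + \<Lambda> * \<gamma>\<^sup>2 * (norm (?g \<omega>))\<^sup>2" for \<omega>
  proof -
    have "\<bar>?F (mean (Suc k) \<omega>) - ?F (mean k \<omega>) - ?G \<omega> \<bullet> (mean (Suc k) \<omega> - mean k \<omega>)\<bar> \<le> \<Lambda> * (norm (mean (Suc k) \<omega> - mean k \<omega>))\<^sup>2"
      by (rule smooth_expansion[OF GDERIV_ball_smoothing[OF lipschitz_f \<eta>_pos] lipschitz_gradient(2)])
    then have 1: "?F (mean (Suc k) \<omega>) \<le> ?F (mean k \<omega>) - \<gamma> * (?G \<omega> \<bullet> ?g \<omega>) + \<Lambda> * \<gamma>\<^sup>2 * (norm (?g \<omega>))\<^sup>2"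
      by (simp add: mean_Suc power_mult_distrib abs_le_iff)
    have "?g \<omega> = ?b \<omega> + ?e \<omega>" by (simp add: err_def row_mean_simps)
    then have 2: "?G \<omega> \<bullet> ?g \<omega> = ?G \<omega> \<bullet> ?b \<omega> + ?G \<omega> \<bullet> ?e \<omega>" by (simp add: inner_add)
    have "2 * (?G \<omega> \<bullet> ?b \<omega>) = (norm (?G \<omega>))\<^sup>2 + (norm (?b \<omega>))\<^sup>2 - (norm (?G \<omega> - ?b \<omega>))\<^sup>2"
      unfolding dot_square_norm[symmetric] by (simp add: inner_diff inner_commute)
    then have "(norm (?G \<omega>))\<^sup>2 / 2 + (norm (?b \<omega>))\<^sup>2 / 2 - \<Lambda>\<^sup>2 / real CARD('m) * (norm (cons k \<omega>))\<^sup>2 / 2 \<le> ?G \<omega> \<bullet> ?b \<omega>"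
    proof -
      have "x / 2 + y / 2 - z / 2 \<le> w" if "2 * w = x + y - d" "d \<le> z" for x y z w d :: real
        using that by linarith
      from this[OF _ dev[of \<omega>]] \<open>2 * _ = _\<close> show ?thesis by blast
    qed
    from mult_left_mono[OF this, of \<gamma>] \<gamma>_pos
    have "\<gamma> / 2 * (norm (?G \<omega>))\<^sup>2 + \<gamma> / 2 * (norm (?b \<omega>))\<^sup>2 - \<gamma> / 2 * (\<Lambda>\<^sup>2 / real CARD('m) * (norm (cons k \<omega>))\<^sup>2) \<le> \<gamma> * (?G \<omega> \<bullet> ?b \<omega>)"
      by (simp add: distrib_left right_diff_distrib)
    moreover have "\<gamma> * (?G \<omega> \<bullet> ?g \<omega>) = \<gamma> * (?G \<omega> \<bullet> ?b \<omega>) + \<gamma> * (?G \<omega> \<bullet> ?e \<omega>)" unfolding 2 by (rule distrib_left)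
    ultimately show ?thesis using 1 by linarith
  qed
  note i = integrable_objective square_integrableD(2)[OF si_mean_gradient] square_integrableD(2)[OF si_mean_grads]
    square_integrableD(2)[OF si_cons] integrable_inner[OF si_mean_gradient si_mean_err] square_integrableD(2)[OF si_mean_est]
  have "eF (Suc k) \<le> (\<integral>\<omega>. ?F (mean k \<omega>) - \<gamma> / 2 * (norm (?G \<omega>))\<^sup>2 - \<gamma> / 2 * (norm (?b \<omega>))\<^sup>2
      + \<gamma> / 2 * (\<Lambda>\<^sup>2 / real CARD('m) * (norm (cons k \<omega>))\<^sup>2) - \<gamma> * (?G \<omega> \<bullet> ?e \<omega>) + \<Lambda> * \<gamma>\<^sup>2 * (norm (?g \<omega>))\<^sup>2 \<partial>M)"
    unfolding eF_def
    by (rule integral_mono[OF i(1) _ pw]) (intro Bochner_Integration.integrable_add Bochner_Integration.integrable_diff integrable_mult_right i)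
  also have "\<dots> = eF k - \<gamma> / 2 * es k - \<gamma> / 2 * e\<beta> k + \<gamma> / 2 * (\<Lambda>\<^sup>2 / real CARD('m) * ec k) - \<gamma> * (\<integral>\<omega>. ?G \<omega> \<bullet> ?e \<omega> \<partial>M)
      + \<Lambda> * \<gamma>\<^sup>2 * (\<integral>\<omega>. (norm (?g \<omega>))\<^sup>2 \<partial>M)"
    unfolding eF_def es_def e\<beta>_def ec_def
    by (subst Bochner_Integration.integral_add Bochner_Integration.integral_diff,
        (intro Bochner_Integration.integrable_add Bochner_Integration.integrable_diff integrable_mult_right i)+)+
       (simp only: integral_mult_right_zero)
  also have "(\<integral>\<omega>. ?G \<omega> \<bullet> ?e \<omega> \<partial>M) = 0" by (rule err_mean_orthogonal[OF measurable_mean_gradient si_mean_gradient])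
  also have "\<Lambda> * \<gamma>\<^sup>2 * (\<integral>\<omega>. (norm (?g \<omega>))\<^sup>2 \<partial>M) \<le> \<Lambda> * \<gamma>\<^sup>2 * (e\<beta> k + \<sigma>2 / real CARD('m))"
    using \<Lambda>_pos by (intro mult_left_mono mean_est_second_moment) auto
  finally show ?thesis by (simp add: algebra_simps power2_eq_square)
qed

end

section \<open>Stepsize and complexity\<close>

lemma stepsize_capD:
  assumes "0 \<le> l" "l < 1" "0 \<le> \<rho>" "\<rho> \<le> stepsize_cap l"
  shows "\<rho> \<le> 1 / 6" "16 * \<rho> * l\<^sup>2 \<le> (1 - l\<^sup>2)\<^sup>2"
proof -
  show "\<rho> \<le> 1 / 6" using assms(4) by (auto simp: stepsize_cap_def split: if_splits)
  show "16 * \<rho> * l\<^sup>2 \<le> (1 - l\<^sup>2)\<^sup>2"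
  proof (cases "l = 0")
    case False
    then have "\<rho> \<le> (1 - l\<^sup>2)\<^sup>2 / (16 * l\<^sup>2)" using assms(4) by (auto simp: stepsize_cap_def)
    then show ?thesis using False by (simp add: field_simps)
  qed simp
qed

definition threshold_factor :: "real \<Rightarrow> real" where
  "threshold_factor l = Max {6 * sqrt 3 * l\<^sup>2 / sqrt (1 - l\<^sup>2), 12 * l ^ 3 / (1 - l\<^sup>2), 16 * l\<^sup>2 / (1 - l\<^sup>2)\<^sup>2, 6, 6 * l / (1 - l\<^sup>2)}"

text \<open>The entries of the maximum are the reciprocals of those of the minimum in
  \<open>stepsize_cap\<close>. At \<open>l = 0\<close> all of them but the 6 vanish, in accordance
  with the infinite entries of the minimum.\<close>

lemma le_stepsize_cap:
  assumes l: "0 \<le> l" "l < 1" and \<rho>: "0 < \<rho>" "\<rho> * threshold_factor l \<le> 1"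
  shows "\<rho> \<le> stepsize_cap l"
proof -
  have q: "0 < 1 - l\<^sup>2" using l by (simp add: abs_square_less_1)
  have "x \<le> threshold_factor l" if "x \<in> {6 * sqrt 3 * l\<^sup>2 / sqrt (1 - l\<^sup>2), 12 * l ^ 3 / (1 - l\<^sup>2), 16 * l\<^sup>2 / (1 - l\<^sup>2)\<^sup>2, 6, 6 * l / (1 - l\<^sup>2)}" for x
    unfolding threshold_factor_def using that by (intro Max_ge) auto
  then have bound: "\<rho> * x \<le> 1" if "x \<in> {6 * sqrt 3 * l\<^sup>2 / sqrt (1 - l\<^sup>2), 12 * l ^ 3 / (1 - l\<^sup>2), 16 * l\<^sup>2 / (1 - l\<^sup>2)\<^sup>2, 6, 6 * l / (1 - l\<^sup>2)}" for x
    using that \<rho> by (meson less_imp_le mult_left_mono order_trans)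
  show ?thesis
  proof (cases "l = 0")
    case True
    then show ?thesis using bound[of 6] by (simp add: stepsize_cap_def)
  next
    case False
    have sq: "0 < sqrt (1 - l\<^sup>2)" using q by simp
    have "\<rho> \<le> sqrt (1 - l\<^sup>2) / (6 * sqrt 3 * l\<^sup>2)" using bound[of "6 * sqrt 3 * l\<^sup>2 / sqrt (1 - l\<^sup>2)"] sq False by (simp add: field_simps)
    moreover have "\<rho> \<le> (1 - l\<^sup>2) / (12 * l ^ 3)" using bound[of "12 * l ^ 3 / (1 - l\<^sup>2)"] q False l by (simp add: field_simps)
    moreover have "\<rho> \<le> (1 - l\<^sup>2)\<^sup>2 / (16 * l\<^sup>2)" using bound[of "16 * l\<^sup>2 / (1 - l\<^sup>2)\<^sup>2"] q False l by (simp add: field_simps)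
    moreover have "\<rho> \<le> 1 / 6" using bound[of 6] by simp
    moreover have "\<rho> \<le> (1 - l\<^sup>2) / (6 * l)" using bound[of "6 * l / (1 - l\<^sup>2)"] q False l by (simp add: field_simps)
    ultimately show ?thesis using False by (simp add: stepsize_cap_def)
  qed
qed

section \<open>Elimination of real powers\<close>

lemma powr_quarter:
  assumes "0 < (x::real)"
  obtains y where "0 < y" "x = y ^ 4" "sqrt x = y\<^sup>2" "x powr (1/2) = y\<^sup>2" "x powr (1/4) = y" "x powr (-1/4) = 1 / y" "x powr (3/2) = y ^ 6"
proof
  let ?y = "x powr (1/4)"
  show "0 < ?y" using assms by simp
  have p: "?y ^ k = x powr (real k / 4)" for k using assms by (simp add: powr_powr powr_realpow[symmetric])
  show "x = ?y ^ 4" using p[of 4] assms by simp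
  show h: "x powr (1/2) = ?y\<^sup>2" using p[of 2] by simp
  show "sqrt x = ?y\<^sup>2" using h assms by (simp add: powr_half_sqrt)
  show "x powr (-1/4) = 1 / ?y" using powr_minus_divide[of x "1/4"] by simp
  show "x powr (3/2) = ?y ^ 6" using p[of 6] by simp
qed simp

lemma powr_half:
  assumes "0 < (x::real)"
  obtains y where "0 < y" "x = y\<^sup>2" "x powr (1/2) = y" "sqrt x = y" "x powr (-1/2) = 1 / y" "x powr (3/2) = y ^ 3" "x powr (-1) = 1 / y\<^sup>2" "x powr (-2) = 1 / y ^ 4"
proof
  let ?y = "x powr (1/2)"
  show "0 < ?y" using assms by simp
  have p: "?y ^ k = x powr (real k / 2)" for k using assms by (simp add: powr_powr powr_realpow[symmetric])
  show x2: "x = ?y\<^sup>2" using p[of 2] assms by simp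
  show "sqrt x = ?y" using assms by (simp add: powr_half_sqrt)
  show "x powr (-1/2) = 1 / ?y" using powr_minus_divide[of x "1/2"] by simp
  show "x powr (3/2) = ?y ^ 3" using p[of 3] by simp
  show "x powr (-1) = 1 / ?y\<^sup>2" using p[of 2] powr_minus_divide[of x 1] by simp
  show "x powr (-2) = 1 / ?y ^ 4" using p[of 4] powr_minus_divide[of x 2] by simp
qed simp

lemma sqrt_2pi_le: "sqrt (2 * pi) \<le> 3"
  using pi_less_4 by (intro real_le_lsqrt) auto

text \<open>Keeps the numerical constant \<open>c\<close>, with its \<open>sqrt (2 * pi)\<close>,
  apart from the rational identity \<open>W * X = Q\<close>, which is then checked on its
  own.\<close>

lemma scaled_term_le:
  fixes c X b Q W :: real
  assumes "c * X \<le> b" "W * X = Q" "0 \<le> W"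
  shows "c * Q \<le> W * b"
  using mult_left_mono[OF assms(1,3)] by (simp add: assms(2)[symmetric] mult.left_commute)

text \<open>For the terms that decay like \<open>1 / sqrt K\<close>, where \<open>y\<close> is
  compared with the root \<open>\<kappa>\<close> of the number of iterations.\<close>

lemma dominated_ratio:
  fixes y \<kappa> c :: real
  assumes "0 \<le> y" "0 < \<kappa>" "0 < c" "c\<^sup>2 * y\<^sup>2 \<le> \<kappa>\<^sup>2"
  shows "y / \<kappa> \<le> 1 / c"
proof -
  have "(c * y)\<^sup>2 \<le> \<kappa>\<^sup>2" using assms by (simp add: power_mult_distrib)
  then have "c * y \<le> \<kappa>" by (rule power2_le_imp_le) (use assms in simp)
  then show ?thesis using assms by (simp add: field_simps)
qed

text \<open>The variables are roots of the parameters of the problem, in terms of which all terms are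
  rational: \<open>n = \<nu>\<^sup>4\<close>, \<open>\<eta> = e\<^sup>2\<close>, \<open>L\<^sub>0 = a\<^sup>2\<close>, \<open>\<epsilon> = w\<^sup>2\<close>, \<open>1 - \<lambda>\<^sup>2 = s\<^sup>2\<close>, \<open>1 + 3 \<lambda>\<^sup>2 = r\<^sup>2\<close>,
  \<open>m = \<mu>\<^sup>2\<close>, \<open>K = \<kappa>\<^sup>2\<close>.\<close>

lemma complexity_core:
  fixes \<nu> e a w s r \<mu> \<kappa> l \<Delta> c0 \<Gamma> \<omega> :: real
  assumes pos: "0 < \<nu>" "0 < e" "0 < a" "0 < w" "0 < s" "0 < r" "0 < \<mu>" "0 < \<kappa>"
    and nn: "0 \<le> l" "0 \<le> \<Delta>" "0 \<le> c0" "0 \<le> \<Gamma>" "0 \<le> \<omega>" and s1: "s \<le> 1"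
  defines "y1 \<equiv> \<nu> ^ 3 * a ^ 3 / (e * w\<^sup>2)" and "y2 \<equiv> \<nu> ^ 3 * a ^ 3 / (e * \<mu>\<^sup>2 * w\<^sup>2)"
    and "x3 \<equiv> a ^ 4 * \<nu> ^ 4 * c0 / (e ^ 4 * s\<^sup>2 * w\<^sup>2)"
    and "y4 \<equiv> l\<^sup>2 * a * \<nu> / (e * s ^ 3 * w)" and "y5 \<equiv> l\<^sup>2 / (a * \<nu> * e * s ^ 3 * w)"
    and "x6 \<equiv> l\<^sup>2 * a\<^sup>2 * \<nu>\<^sup>2 * (l\<^sup>2 + \<omega>) / (e\<^sup>2 * s ^ 6 * w\<^sup>2)"
    and "y7 \<equiv> l\<^sup>2 * r / (\<mu> * e\<^sup>2 * s ^ 4 * w)"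
    and "x8 \<equiv> l ^ 4 * a\<^sup>2 * \<nu>\<^sup>2 / (e\<^sup>2 * s ^ 6 * w\<^sup>2)"
    and "\<gamma> \<equiv> e / (\<nu> ^ 3 * \<kappa> * a ^ 3)"
  assumes K: "500000 * (1 + \<Delta>\<^sup>2 + sqrt \<Gamma>) * (y1\<^sup>2 + y2\<^sup>2 + x3 + y4 + y5 + x6 + y7 + x8) \<le> \<kappa>\<^sup>2"
  shows "2 * \<Delta> / (\<gamma> * \<kappa>\<^sup>2)
          + a ^ 4 * \<nu> ^ 4 / (e ^ 4 * \<kappa>\<^sup>2) * (1 + 13 / s\<^sup>2) * c0
          + 52 * \<gamma>\<^sup>2 * l ^ 4 * a ^ 4 * \<nu> ^ 4 / (e ^ 4 * s ^ 6 * \<kappa>\<^sup>2) * (\<Gamma> + 16 * sqrt (2 * pi) * a ^ 4 * \<nu> ^ 4)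
          + 832 * sqrt (2 * pi) * \<gamma>\<^sup>2 * l\<^sup>2 * a ^ 8 * \<nu> ^ 8 * (l\<^sup>2 + \<omega>) / (e ^ 4 * s ^ 6)
          + 32 * sqrt (2 * pi) * \<nu> ^ 6 * a ^ 6 * \<gamma> / (\<mu>\<^sup>2 * e\<^sup>2)
          + 2496 * sqrt (2 * pi) * l ^ 4 * \<gamma> ^ 4 * \<nu> ^ 12 * a ^ 12 * r\<^sup>2 / (\<mu>\<^sup>2 * e ^ 8 * s ^ 8)
          + 4992 * sqrt (2 * pi) * \<gamma>\<^sup>2 * l ^ 4 * a ^ 8 * \<nu> ^ 8 / (e ^ 4 * s ^ 6) \<le> w\<^sup>2"
proof -
  define C where "C = 500000 * (1 + \<Delta>\<^sup>2 + sqrt \<Gamma>)"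
  have sG: "0 \<le> sqrt \<Gamma>" using nn by simp
  have C1: "500000 \<le> C" and C\<Delta>: "500000 * \<Delta>\<^sup>2 \<le> C" and C\<Gamma>: "500000 * sqrt \<Gamma> \<le> C"
    using sG zero_le_power2[of \<Delta>] by (simp_all add: C_def)
  have p: "0 \<le> y1" "0 \<le> y2" "0 \<le> x3" "0 \<le> y4" "0 \<le> y5" "0 \<le> x6" "0 \<le> y7" "0 \<le> x8"
    unfolding y1_def y2_def x3_def y4_def y5_def x6_def y7_def x8_def using pos nn by (auto intro!: divide_nonneg_nonneg mult_nonneg_nonneg)
  have dom: "C * x \<le> \<kappa>\<^sup>2" if "x \<le> y1\<^sup>2 + y2\<^sup>2 + x3 + y4 + y5 + x6 + y7 + x8" for x
    using K mult_left_mono[OF that, of C] C1 unfolding C_def[symmetric] by linarith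
  have Cy: "C * y1\<^sup>2 \<le> \<kappa>\<^sup>2" "C * y2\<^sup>2 \<le> \<kappa>\<^sup>2" "C * x3 \<le> \<kappa>\<^sup>2" "C * y4 \<le> \<kappa>\<^sup>2" "C * y5 \<le> \<kappa>\<^sup>2" "C * x6 \<le> \<kappa>\<^sup>2" "C * y7 \<le> \<kappa>\<^sup>2" "C * x8 \<le> \<kappa>\<^sup>2"
    by (rule dom, use p in simp)+
  have lin: "x / \<kappa>\<^sup>2 \<le> 1 / 500000" if "0 \<le> x" "C * x \<le> \<kappa>\<^sup>2" for x
  proof -
    have "500000 * x \<le> C * x" using C1 that(1) by (rule mult_right_mono)
    then show ?thesis using that(2) pos by (simp add: field_simps)
  qed
  \<comment> \<open>For terms that enter the error as squares of \<open>y / \<kappa>^2\<close>;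
    squaring a number below 1/500000 only makes it smaller.\<close>
  have sq: "(y / \<kappa>\<^sup>2)\<^sup>2 \<le> 1 / 500000" if "0 \<le> y" "C * y \<le> \<kappa>\<^sup>2" for y
  proof -
    have 1: "0 \<le> y / \<kappa>\<^sup>2" "y / \<kappa>\<^sup>2 \<le> 1 / 500000" using lin[OF that] that(1) by auto
    have "(y / \<kappa>\<^sup>2)\<^sup>2 \<le> (1 / 500000)\<^sup>2" by (rule power_mono[OF 1(2,1)])
    also have "\<dots> \<le> 1 / 500000" by (simp add: power2_eq_square)
    finally show ?thesis .
  qed
  have w2: "0 < w\<^sup>2" using pos by simp
  have T1: "2 * \<Delta> / (\<gamma> * \<kappa>\<^sup>2) \<le> w\<^sup>2 * (2 / 700)"
  proof -
    \<comment> \<open>The square of 700 is 490000, just below 500000. The gap occurs squared in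
      \<open>C\<close>, because this term is compared with the root of the number of
      iterations.\<close>
    have "700\<^sup>2 * (\<Delta> * y1)\<^sup>2 \<le> (500000 * \<Delta>\<^sup>2) * y1\<^sup>2" by (simp add: power_mult_distrib mult_right_mono)
    also have "\<dots> \<le> C * y1\<^sup>2" using C\<Delta> by (rule mult_right_mono) auto
    finally have "700\<^sup>2 * (\<Delta> * y1)\<^sup>2 \<le> \<kappa>\<^sup>2" using Cy(1) by linarith
    then have "\<Delta> * y1 / \<kappa> \<le> 1 / 700" using p nn pos by (intro dominated_ratio) auto
    then have "w\<^sup>2 * (2 * (\<Delta> * y1 / \<kappa>)) \<le> w\<^sup>2 * (2 * (1 / 700))" using w2 by (intro mult_left_mono) auto
    moreover have "2 * \<Delta> / (\<gamma> * \<kappa>\<^sup>2) = w\<^sup>2 * (2 * (\<Delta> * y1 / \<kappa>))"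
      using pos by (simp add: \<gamma>_def y1_def field_simps power2_eq_square)
    ultimately show ?thesis by simp
  qed
  have T2: "a ^ 4 * \<nu> ^ 4 / (e ^ 4 * \<kappa>\<^sup>2) * (1 + 13 / s\<^sup>2) * c0 \<le> w\<^sup>2 * (14 / 500000)"
  proof -
    have "s\<^sup>2 \<le> 1" using s1 pos by (simp add: power_le_one)
    then have "1 \<le> 1 / s\<^sup>2" using pos by simp
    moreover have "14 / s\<^sup>2 = 1 / s\<^sup>2 + 13 / s\<^sup>2" by (simp add: add_divide_distrib[symmetric])
    ultimately have "1 + 13 / s\<^sup>2 \<le> 14 / s\<^sup>2" by linarith
    then have "a ^ 4 * \<nu> ^ 4 / (e ^ 4 * \<kappa>\<^sup>2) * (1 + 13 / s\<^sup>2) * c0 \<le> a ^ 4 * \<nu> ^ 4 / (e ^ 4 * \<kappa>\<^sup>2) * (14 / s\<^sup>2) * c0"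
      using pos nn by (intro mult_right_mono mult_left_mono) auto
    also have "\<dots> = w\<^sup>2 * (14 * (x3 / \<kappa>\<^sup>2))" using pos by (simp add: x3_def field_simps)
    also have "\<dots> \<le> w\<^sup>2 * (14 * (1 / 500000))" using lin[OF p(3) Cy(3)] w2 by (intro mult_left_mono) auto
    finally show ?thesis by simp
  qed
  have T3: "52 * \<gamma>\<^sup>2 * l ^ 4 * a ^ 4 * \<nu> ^ 4 / (e ^ 4 * s ^ 6 * \<kappa>\<^sup>2) * (\<Gamma> + 16 * sqrt (2 * pi) * a ^ 4 * \<nu> ^ 4)
      \<le> w\<^sup>2 * (52 * (1 / 500000)) + w\<^sup>2 * (832 * 3 * (1 / 500000))"
  proof -
    \<comment> \<open>The initial gradient is matched with \<open>y5\<close>, and \<open>C\<close>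
      contains \<open>sqrt \<Gamma>\<close> because the ratio is squared. The variance in the same
      term is matched with \<open>y4\<close>.\<close>
    have "\<Gamma> * (y5 / \<kappa>\<^sup>2)\<^sup>2 \<le> 1 / 500000"
    proof -
      have "500000 * sqrt \<Gamma> * y5 \<le> \<kappa>\<^sup>2" using Cy(5) mult_right_mono[OF C\<Gamma> p(5)] by linarith
      then have "sqrt \<Gamma> * (y5 / \<kappa>\<^sup>2) \<le> 1 / 500000" using pos by (simp add: field_simps)
      moreover have "0 \<le> sqrt \<Gamma> * (y5 / \<kappa>\<^sup>2)" using sG p(5) by simp
      ultimately have "(sqrt \<Gamma> * (y5 / \<kappa>\<^sup>2))\<^sup>2 \<le> (1 / 500000)\<^sup>2" by (intro power_mono)
      also have "\<dots> \<le> 1 / 500000" by (simp add: power2_eq_square)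
      finally show ?thesis unfolding power_mult_distrib real_sqrt_pow2[OF nn(4)] .
    qed
    then have 1: "52 * \<Gamma> * (y5 / \<kappa>\<^sup>2)\<^sup>2 \<le> 52 * (1 / 500000)" by simp
    have 2: "w\<^sup>2 * (y5 / \<kappa>\<^sup>2)\<^sup>2 = \<gamma>\<^sup>2 * l ^ 4 * a ^ 4 * \<nu> ^ 4 / (e ^ 4 * s ^ 6 * \<kappa>\<^sup>2)"
      using pos by (simp add: y5_def \<gamma>_def field_simps eval_nat_numeral)
    have 3: "832 * sqrt (2 * pi) * (y4 / \<kappa>\<^sup>2)\<^sup>2 \<le> 832 * 3 * (1 / 500000)"
      using sqrt_2pi_le sq[OF p(4) Cy(4)] by (intro mult_mono) auto
    have 4: "w\<^sup>2 * (y4 / \<kappa>\<^sup>2)\<^sup>2 = \<gamma>\<^sup>2 * l ^ 4 * a ^ 4 * \<nu> ^ 4 / (e ^ 4 * s ^ 6 * \<kappa>\<^sup>2) * (a ^ 4 * \<nu> ^ 4)"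
      using pos by (simp add: y4_def \<gamma>_def field_simps eval_nat_numeral)
    define Q where "Q = \<gamma>\<^sup>2 * l ^ 4 * a ^ 4 * \<nu> ^ 4 / (e ^ 4 * s ^ 6 * \<kappa>\<^sup>2)"
    have "52 * \<gamma>\<^sup>2 * l ^ 4 * a ^ 4 * \<nu> ^ 4 / (e ^ 4 * s ^ 6 * \<kappa>\<^sup>2) * (\<Gamma> + 16 * sqrt (2 * pi) * a ^ 4 * \<nu> ^ 4)
       = 52 * \<Gamma> * Q + 832 * sqrt (2 * pi) * (Q * (a ^ 4 * \<nu> ^ 4))"
    proof -
      have "52 * \<gamma>\<^sup>2 * l ^ 4 * a ^ 4 * \<nu> ^ 4 / (e ^ 4 * s ^ 6 * \<kappa>\<^sup>2) = 52 * Q" by (simp add: Q_def mult.assoc)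
      then show ?thesis by (simp only:) (simp add: algebra_simps)
    qed
    also have "\<dots> \<le> w\<^sup>2 * (52 * (1 / 500000)) + w\<^sup>2 * (832 * 3 * (1 / 500000))"
      using scaled_term_le[OF 1 2] scaled_term_le[OF 3 4] unfolding Q_def[symmetric] by (intro add_mono) auto
    finally show ?thesis .
  qed
  have T4: "832 * sqrt (2 * pi) * \<gamma>\<^sup>2 * l\<^sup>2 * a ^ 8 * \<nu> ^ 8 * (l\<^sup>2 + \<omega>) / (e ^ 4 * s ^ 6) \<le> w\<^sup>2 * (832 * 3 * (1 / 500000))"
  proof -
    have 1: "832 * sqrt (2 * pi) * (x6 / \<kappa>\<^sup>2) \<le> (832 * 3 * (1 / 500000))"
      using sqrt_2pi_le lin[OF p(6) Cy(6)] p(6) by (intro mult_mono) auto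
    have 2: "w\<^sup>2 * (x6 / \<kappa>\<^sup>2) = \<gamma>\<^sup>2 * l\<^sup>2 * a ^ 8 * \<nu> ^ 8 * (l\<^sup>2 + \<omega>) / (e ^ 4 * s ^ 6)"
      using pos by (simp add: x6_def \<gamma>_def field_simps eval_nat_numeral)
    from scaled_term_le[OF 1 2] w2 show ?thesis by (simp only: mult.assoc times_divide_eq_right)
  qed
  have T5: "32 * sqrt (2 * pi) * \<nu> ^ 6 * a ^ 6 * \<gamma> / (\<mu>\<^sup>2 * e\<^sup>2) \<le> w\<^sup>2 * (32 * 3 * (1 / 700))"
  proof -
    have 1: "32 * sqrt (2 * pi) * (y2 / \<kappa>) \<le> (32 * 3 * (1 / 700))"
    proof -
      have "700\<^sup>2 * y2\<^sup>2 \<le> C * y2\<^sup>2" using C1 by (intro mult_right_mono) auto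
      then have "y2 / \<kappa> \<le> 1 / 700" using p pos Cy(2) by (intro dominated_ratio) auto
      then show ?thesis using sqrt_2pi_le p pos by (intro mult_mono) auto
    qed
    have 2: "w\<^sup>2 * (y2 / \<kappa>) = \<nu> ^ 6 * a ^ 6 * \<gamma> / (\<mu>\<^sup>2 * e\<^sup>2)"
      using pos by (simp add: y2_def \<gamma>_def field_simps eval_nat_numeral)
    from scaled_term_le[OF 1 2] w2 show ?thesis by (simp only: mult.assoc times_divide_eq_right)
  qed
  have T6: "2496 * sqrt (2 * pi) * l ^ 4 * \<gamma> ^ 4 * \<nu> ^ 12 * a ^ 12 * r\<^sup>2 / (\<mu>\<^sup>2 * e ^ 8 * s ^ 8) \<le> w\<^sup>2 * (2496 * 3 * (1 / 500000))"
  proof -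
    have 1: "2496 * sqrt (2 * pi) * (y7 / \<kappa>\<^sup>2)\<^sup>2 \<le> (2496 * 3 * (1 / 500000))"
      using sqrt_2pi_le sq[OF p(7) Cy(7)] by (intro mult_mono) auto
    have 2: "w\<^sup>2 * (y7 / \<kappa>\<^sup>2)\<^sup>2 = l ^ 4 * \<gamma> ^ 4 * \<nu> ^ 12 * a ^ 12 * r\<^sup>2 / (\<mu>\<^sup>2 * e ^ 8 * s ^ 8)"
      using pos by (simp add: y7_def \<gamma>_def field_simps eval_nat_numeral)
    from scaled_term_le[OF 1 2] w2 show ?thesis by (simp only: mult.assoc times_divide_eq_right)
  qed
  have T7: "4992 * sqrt (2 * pi) * \<gamma>\<^sup>2 * l ^ 4 * a ^ 8 * \<nu> ^ 8 / (e ^ 4 * s ^ 6) \<le> w\<^sup>2 * (4992 * 3 * (1 / 500000))"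
  proof -
    have 1: "4992 * sqrt (2 * pi) * (x8 / \<kappa>\<^sup>2) \<le> (4992 * 3 * (1 / 500000))"
      using sqrt_2pi_le lin[OF p(8) Cy(8)] p(8) by (intro mult_mono) auto
    have 2: "w\<^sup>2 * (x8 / \<kappa>\<^sup>2) = \<gamma>\<^sup>2 * l ^ 4 * a ^ 8 * \<nu> ^ 8 / (e ^ 4 * s ^ 6)"
      using pos by (simp add: x8_def \<gamma>_def field_simps eval_nat_numeral)
    from scaled_term_le[OF 1 2] w2 show ?thesis by (simp only: mult.assoc times_divide_eq_right)
  qed
  \<comment> \<open>The shares of \<open>w^2\<close>, that is of \<epsilon>, add up to about
    0.2.\<close>
  show ?thesis using T1 T2 T3 T4 T5 T6 T7 w2 by linarith
qed

section \<open>Error bound and iteration complexity\<close>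

context zo_tracking
begin

definition grad0 where "grad0 = (1 / real CARD('m)) * (\<integral>\<omega>. (norm (grads 0 \<omega>))\<^sup>2 \<partial>M)"

text \<open>A lower bound of \<open>f\<close> is also one of its smoothing, so the infimum of the
  smoothing over the reals is a genuine one.\<close>

lemma INF_le_eF: "(INF x. ball_smoothing \<eta> f x) \<le> eF k"
proof -
  obtain b where b: "\<And>x. b \<le> f x" using lower_bounded by (auto simp: bdd_below_def)
  interpret U: prob_space "uniform_ball :: (real^'n) measure" by (rule prob_space_uniform_ball)
  have sb: "b \<le> ball_smoothing \<eta> f x" for x
  proof -
    have "(\<integral>u. b \<partial>(uniform_ball :: (real^'n) measure)) \<le> ball_smoothing \<eta> f x"
      unfolding ball_smoothing_def by (rule integral_mono) (use b lipschitz_on_ball_smoothing(3)[OF lipschitz_f] in auto)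
    then show ?thesis using U.prob_space by simp
  qed
  then have bb: "bdd_below (range (ball_smoothing \<eta> f))" by (auto simp: bdd_below_def)
  have "(\<integral>\<omega>. (INF x. ball_smoothing \<eta> f x) \<partial>M) \<le> eF k"
    unfolding eF_def by (rule integral_mono) (use integrable_objective cINF_lower[OF bb] in auto)
  then show ?thesis using prob_space by simp
qed

lemma average_gradient_bound:
  assumes step: "\<gamma> * \<Lambda> \<le> 1 / 6" "16 * (\<gamma> * \<Lambda>) * lam\<^sup>2 \<le> (1 - lam\<^sup>2)\<^sup>2" and K: "1 \<le> K" and w: "0 \<le> w"
  defines "q \<equiv> 1 - lam\<^sup>2" and "\<rho> \<equiv> \<gamma> * \<Lambda>"
  shows "(\<Sum>k<K. es k) / K \<le> 2 * (eF 0 - (INF x. ball_smoothing \<eta> f x)) / (\<gamma> * K) + \<Lambda>\<^sup>2 / K * (1 + 13 / q) * (ec 0 / real CARD('m))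
    + 52 * (\<rho>\<^sup>2 * lam ^ 4 / q ^ 3) / K * (grad0 + \<sigma>2)
    + 52 * (\<rho>\<^sup>2 * lam\<^sup>2 / q ^ 3) * \<sigma>2 * (lam\<^sup>2 + w) + 2 * \<rho> * (\<sigma>2 / real CARD('m))
    + 156 * (\<rho> ^ 4 * lam ^ 4 / q ^ 4) * (\<sigma>2 / real CARD('m)) * (1 + 3 * lam\<^sup>2) + 312 * (\<rho>\<^sup>2 * lam ^ 4 / q ^ 3) * \<sigma>2"
proof -
  have g0: "0 \<le> grad0" by (simp add: grad0_def)
  have m1: "1 \<le> real CARD('m)" using zero_less_card_finite[where 'a='m] by simp
  have a0: "ea 0 \<le> lam\<^sup>2 * real CARD('m) * grad0" using ea_0 by (simp add: grad0_def)
  have C: "\<Lambda>\<^sup>2 / real CARD('m) * (\<Sum>k<K. ec k) \<le> 8 / (3 * q) * (\<Lambda>\<^sup>2 * ec 0 / real CARD('m)) + 32 / 3 * (\<rho>\<^sup>2 * lam ^ 4 / q ^ 3) * grad0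
    + \<rho>\<^sup>2 / 12 * (\<Sum>k<K. e\<beta> k) + 64 / 3 * (\<rho> ^ 4 * lam ^ 4 / q ^ 4) * (K * \<sigma>2 / real CARD('m)) + 272 / 3 * (\<rho>\<^sup>2 * lam ^ 4 / q ^ 3) * (K * \<sigma>2)"
    unfolding q_def \<rho>_def
    by (rule consensus_sum_bound[where a=ea and d=ed and \<delta>=e\<delta>])
       (use moments_nonneg \<sigma>2_nonneg g0 m1 \<gamma>_pos \<Lambda>_pos lam_facts ec_Suc a0 ea_Suc ed_le e\<delta>_le step K in \<open>auto intro: less_imp_le\<close>)
  show ?thesis
    unfolding q_def \<rho>_def
    by (rule descent_sum_bound[where c=ec and \<beta>=e\<beta>])
       (use moments_nonneg \<sigma>2_nonneg g0 m1 \<gamma>_pos \<Lambda>_pos lam_facts eF_Suc INF_le_eF C[unfolded q_def \<rho>_def] step K w in \<open>auto intro: less_imp_le\<close>)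
qed

text \<open>The index is independent of everything that determines the gradient norms, so splitting
  by its value gives their average.\<close>

lemma expected_stationarity_le:
  assumes \<kappa>: "uniform_independent_index M \<xi> v x0 K \<kappa>" and K: "1 \<le> K"
  shows "expected_stationarity M \<eta> f (tracking_iterate W \<gamma> \<eta> \<phi> \<xi> v x0) \<kappa> \<le> ennreal ((\<Sum>k<K. es k) / K)"
proof -
  have \<kappa>m[measurable]: "\<kappa> \<in> M \<rightarrow>\<^sub>M count_space UNIV"
    and \<kappa>d: "distr M (count_space UNIV) \<kappa> = measure_pmf (pmf_of_set {..<K})"
    and \<kappa>i: "indep_set (events_of M (count_space UNIV) \<kappa>) (sigma_sets (space M) (\<Union>s. source_events M \<xi> v x0 s))"
    using \<kappa> by (auto simp: uniform_independent_index_def)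
  have K0: "{..<K} \<noteq> {}" using K by (metis lessThan_iff empty_iff less_le_trans zero_less_one)
  define h where "h k \<omega> = (norm (sphere_gradient \<eta> f (mean k \<omega>)))\<^sup>2" for k \<omega>
  have hU: "h k \<in> borel_measurable (source_algebra UNIV)" for k
    unfolding h_def[abs_def] using measurable_source_mono[OF measurable_mean_gradient[of k], of UNIV] by simp
  have hM[measurable]: "h k \<in> borel_measurable M" for k by (rule measurable_source_M[OF hU])
  have ih: "integrable M (h k)" for k unfolding h_def[abs_def] by (rule square_integrableD(2)[OF si_mean_gradient])
  have one: "(\<integral>\<^sup>+\<omega>. indicator {k} (\<kappa> \<omega>) * ennreal (h k \<omega>) \<partial>M) = ennreal (es k / K)" if k: "k < K" for k
  proof -
    let ?D = "distr M (count_space UNIV) \<kappa>" and ?H = "distr M borel (h k)"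
    interpret H: prob_space ?H by (rule prob_space_distr[OF hM])
    have d: "distr M (count_space UNIV \<Otimes>\<^sub>M borel) (\<lambda>\<omega>. (\<kappa> \<omega>, h k \<omega>)) = ?D \<Otimes>\<^sub>M ?H"
    proof (rule distr_pair_indep[OF \<kappa>m hM])
      fix A and B :: "real set" assume "A \<in> sets (count_space (UNIV :: nat set))" "B \<in> sets borel"
      then show "prob ((\<kappa> -` A \<inter> space M) \<inter> (h k -` B \<inter> space M)) = prob (\<kappa> -` A \<inter> space M) * prob (h k -` B \<inter> space M)"
        using measurable_sets[OF hU, of B k]
        by (intro indep_setD[OF \<kappa>i]) (auto simp: events_of_def sets_source_algebra)
    qed
    let ?\<psi> = "\<lambda>p :: nat \<times> real. indicator {k} (fst p) * ennreal (snd p)"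
    have m\<psi>: "?\<psi> \<in> borel_measurable (count_space UNIV \<Otimes>\<^sub>M borel)"
    proof (rule borel_measurable_times_ennreal)
      show "(\<lambda>p :: nat \<times> real. indicator {k} (fst p) :: ennreal) \<in> borel_measurable (count_space UNIV \<Otimes>\<^sub>M borel)"
        by (rule measurable_compose[OF measurable_fst]) simp
      show "(\<lambda>p :: nat \<times> real. ennreal (snd p)) \<in> borel_measurable (count_space UNIV \<Otimes>\<^sub>M borel)"
        by (rule measurable_compose[OF measurable_snd]) simp
    qed
    have "(\<integral>\<^sup>+\<omega>. indicator {k} (\<kappa> \<omega>) * ennreal (h k \<omega>) \<partial>M)
       = (\<integral>\<^sup>+p. ?\<psi> p \<partial>distr M (count_space UNIV \<Otimes>\<^sub>M borel) (\<lambda>\<omega>. (\<kappa> \<omega>, h k \<omega>)))"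
      using m\<psi> by (subst nn_integral_distr) auto
    also have "\<dots> = (\<integral>\<^sup>+x. \<integral>\<^sup>+y. ?\<psi> (x, y) \<partial>?H \<partial>?D)"
      unfolding d by (rule H.nn_integral_fst[symmetric]) (simp add: measurable_cong_sets[OF sets_pair_measure_cong[OF sets_distr sets_distr] refl] m\<psi>)
    also have "\<dots> = (\<integral>\<^sup>+x. indicator {k} x * (\<integral>\<^sup>+y. ennreal y \<partial>?H) \<partial>?D)"
      by (intro nn_integral_cong) (simp add: nn_integral_cmult)
    also have "\<dots> = emeasure ?D {k} * (\<integral>\<^sup>+y. ennreal y \<partial>?H)"
      by (subst nn_integral_multc) auto
    also have "(\<integral>\<^sup>+y. ennreal y \<partial>?H) = (\<integral>\<^sup>+\<omega>. ennreal (h k \<omega>) \<partial>M)"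
      by (subst nn_integral_distr) auto
    also have "\<dots> = ennreal (es k)"
      unfolding es_def h_def[symmetric] by (rule nn_integral_eq_integral[OF ih]) (simp add: h_def)
    also have "emeasure ?D {k} = ennreal (1 / K)"
      unfolding \<kappa>d using k K0 by (simp add: emeasure_pmf_single)
    also have "ennreal (1 / K) * ennreal (es k) = ennreal (es k / K)"
      using moments_nonneg(4)[of k] by (subst ennreal_mult[symmetric]) auto
    finally show ?thesis .
  qed
  \<comment> \<open>The law of the index bounds it almost surely, not everywhere.\<close>
  have AEK: "AE \<omega> in M. \<kappa> \<omega> < K"
  proof -
    have "AE x in distr M (count_space UNIV) \<kappa>. x < K"
      unfolding \<kappa>d using K0 by (auto simp: AE_measure_pmf_iff)
    then show ?thesis by (subst (asm) AE_distr_iff) auto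
  qed
  \<comment> \<open>\<open>nn_integral_mono\<close> applies to arbitrary functions, which settles
    the question of measurability of the distance in \<omega>.\<close>
  have "expected_stationarity M \<eta> f (tracking_iterate W \<gamma> \<eta> \<phi> \<xi> v x0) \<kappa> \<le> (\<integral>\<^sup>+\<omega>. ennreal (h (\<kappa> \<omega>) \<omega>) \<partial>M)"
    unfolding expected_stationarity_def iter_tracking_iterate mean_def[symmetric] h_def
    by (intro nn_integral_mono ennreal_leI power_mono infdist_clarke_gradient_eta_le[OF lipschitz_f \<eta>_pos] infdist_nonneg)
  also have "\<dots> = (\<integral>\<^sup>+\<omega>. (\<Sum>k<K. indicator {k} (\<kappa> \<omega>) * ennreal (h k \<omega>)) \<partial>M)"
  proof (rule nn_integral_cong_AE)
    show "AE \<omega> in M. ennreal (h (\<kappa> \<omega>) \<omega>) = (\<Sum>k<K. indicator {k} (\<kappa> \<omega>) * ennreal (h k \<omega>))"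
      using AEK
    proof eventually_elim
      case (elim \<omega>)
      have "(\<Sum>k<K. indicator {k} (\<kappa> \<omega>) * ennreal (h k \<omega>)) = (\<Sum>k<K. if k = \<kappa> \<omega> then ennreal (h k \<omega>) else 0)"
        by (intro sum.cong) (auto simp: indicator_def)
      also have "\<dots> = ennreal (h (\<kappa> \<omega>) \<omega>)" using elim by simp
      finally show ?case by simp
    qed
  qed
  also have "\<dots> = (\<Sum>k<K. \<integral>\<^sup>+\<omega>. indicator {k} (\<kappa> \<omega>) * ennreal (h k \<omega>) \<partial>M)"
  proof (rule nn_integral_sum, rule borel_measurable_times_ennreal)
    show "(\<lambda>\<omega>. indicator {k} (\<kappa> \<omega>) :: ennreal) \<in> borel_measurable M" for k
      by (rule measurable_compose[OF \<kappa>m]) simp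
    show "(\<lambda>\<omega>. ennreal (h k \<omega>)) \<in> borel_measurable M" for k
      by (rule measurable_compose[OF hM]) simp
  qed
  also have "\<dots> = (\<Sum>k<K. ennreal (es k / K))" by (intro sum.cong) (auto simp: one)
  also have "\<dots> = ennreal ((\<Sum>k<K. es k) / K)"
    using moments_nonneg(4) by (simp add: sum_ennreal sum_divide_distrib)
  finally show ?thesis .
qed

definition gap0 where "gap0 = eF 0 - (INF x. ball_smoothing \<eta> f x)"

lemma gap0_nonneg: "0 \<le> gap0"
  using INF_le_eF[of 0] by (simp add: gap0_def)

lemma expected_stationarity_bound:
  fixes K :: nat
  defines "n \<equiv> real CARD('n)" and "m \<equiv> real CARD('m)"
  assumes step: "\<gamma> \<le> stepsize_cap lam * (\<eta> / (sqrt n * L0))" and K: "1 \<le> K"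
    and \<kappa>: "uniform_independent_index M \<xi> v x0 K \<kappa>"
  shows "expected_stationarity M \<eta> f (tracking_iterate W \<gamma> \<eta> \<phi> \<xi> v x0) \<kappa> \<le> ennreal
         (2 * gap0 / (\<gamma> * real K)
          + L0\<^sup>2 * n / (\<eta>\<^sup>2 * real K) * (1 + 13 / (1 - lam\<^sup>2)) * (ec 0 / m)
          + 52 * \<gamma>\<^sup>2 * lam ^ 4 * L0\<^sup>2 * n / (\<eta>\<^sup>2 * (1 - lam\<^sup>2) ^ 3 * real K)
              * (grad0 + 16 * sqrt (2 * pi) * L0\<^sup>2 * n)
          + 832 * sqrt (2 * pi) * \<gamma>\<^sup>2 * lam\<^sup>2 * L0 ^ 4 * n\<^sup>2 * (lam\<^sup>2 + (norm W)\<^sup>2)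
              / (\<eta>\<^sup>2 * (1 - lam\<^sup>2) ^ 3)
          + 32 * sqrt (2 * pi) * n powr (3/2) * L0 ^ 3 * \<gamma> / (m * \<eta>)
          + 2496 * sqrt (2 * pi) * lam ^ 4 * \<gamma> ^ 4 * n ^ 3 * L0 ^ 6 * (1 + 3 * lam\<^sup>2)
              / (m * \<eta> ^ 4 * (1 - lam\<^sup>2) ^ 4)
          + 4992 * sqrt (2 * pi) * \<gamma>\<^sup>2 * lam ^ 4 * L0 ^ 4 * n\<^sup>2
              / (\<eta>\<^sup>2 * (1 - lam\<^sup>2) ^ 3))"
proof -
  have m: "0 < m" and n: "0 < n" by (simp_all add: m_def n_def)
  \<comment> \<open>With \<open>n = y^2\<close> all powers of \<open>n\<close> in the bound,
    \<open>n powr (3/2)\<close> included, become monomials in \<open>y\<close>.\<close>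
  obtain y where y: "0 < y" "n = y\<^sup>2" "sqrt n = y" "n powr (3/2) = y ^ 3" using powr_half[OF n] by metis
  define q p where "q = 1 - lam\<^sup>2" and "p = sqrt (2 * pi)"
  have q: "0 < q" using lam_facts by (simp add: q_def)
  have \<Lambda>: "\<Lambda> = L0 * y / \<eta>" and \<sigma>2: "\<sigma>2 = 16 * p * L0\<^sup>2 * y\<^sup>2"
    using y(2,3) by (simp_all add: \<Lambda>_def \<sigma>2_def p_def n_def)
  have "\<gamma> * \<Lambda> \<le> stepsize_cap lam * (\<eta> / (sqrt n * L0)) * \<Lambda>"
    using step \<Lambda>_pos by (intro mult_right_mono) auto
  also have "\<dots> = stepsize_cap lam" using L0_pos \<eta>_pos y by (simp add: \<Lambda> y(3))
  finally have cap: "\<gamma> * \<Lambda> \<le> stepsize_cap lam" .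
  have "0 \<le> \<gamma> * \<Lambda>" using \<gamma>_pos \<Lambda>_pos by simp
  note stepsize_capD[OF lam_facts(1) W_rate this cap]
  \<comment> \<open>The nonnegative parameter \<open>w\<close> becomes the squared Frobenius norm of
    \<open>W\<close>.\<close>
  from average_gradient_bound[OF this K zero_le_power2[of "norm W"]]
  have "(\<Sum>k<K. es k) / K \<le> 2 * gap0 / (\<gamma> * real K)
          + L0\<^sup>2 * n / (\<eta>\<^sup>2 * real K) * (1 + 13 / q) * (ec 0 / m)
          + 52 * \<gamma>\<^sup>2 * lam ^ 4 * L0\<^sup>2 * n / (\<eta>\<^sup>2 * q ^ 3 * real K)
              * (grad0 + 16 * p * L0\<^sup>2 * n)
          + 832 * p * \<gamma>\<^sup>2 * lam\<^sup>2 * L0 ^ 4 * n\<^sup>2 * (lam\<^sup>2 + (norm W)\<^sup>2)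
              / (\<eta>\<^sup>2 * q ^ 3)
          + 32 * p * n powr (3/2) * L0 ^ 3 * \<gamma> / (m * \<eta>)
          + 2496 * p * lam ^ 4 * \<gamma> ^ 4 * n ^ 3 * L0 ^ 6 * (1 + 3 * lam\<^sup>2)
              / (m * \<eta> ^ 4 * q ^ 4)
          + 4992 * p * \<gamma>\<^sup>2 * lam ^ 4 * L0 ^ 4 * n\<^sup>2
              / (\<eta>\<^sup>2 * q ^ 3)" (is "_ \<le> ?t1 + ?t2 + ?t3 + ?t4 + ?t5 + ?t6 + ?t7")
    unfolding gap0_def[symmetric] m_def[symmetric] q_def[symmetric]
  proof (elim order_trans[OF _ eq_refl])
    have 2: "\<Lambda>\<^sup>2 / K = L0\<^sup>2 * n / (\<eta>\<^sup>2 * real K)"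
      by (simp add: \<Lambda> y(2) power_mult_distrib power_divide)
    have 3: "52 * ((\<gamma> * \<Lambda>)\<^sup>2 * lam ^ 4 / q ^ 3) / K = 52 * \<gamma>\<^sup>2 * lam ^ 4 * L0\<^sup>2 * n / (\<eta>\<^sup>2 * q ^ 3 * real K)"
      by (simp add: \<Lambda> y(2) power_mult_distrib power_divide)
    have 4: "52 * ((\<gamma> * \<Lambda>)\<^sup>2 * lam\<^sup>2 / q ^ 3) * \<sigma>2 * (lam\<^sup>2 + (norm W)\<^sup>2) = ?t4"
      by (simp add: \<Lambda> \<sigma>2 y(2) power_mult_distrib power_divide eval_nat_numeral mult_ac)
    have 5: "2 * (\<gamma> * \<Lambda>) * (\<sigma>2 / m) = ?t5"
      by (simp add: \<Lambda> \<sigma>2 y(4) eval_nat_numeral mult_ac)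
    have 6: "156 * ((\<gamma> * \<Lambda>) ^ 4 * lam ^ 4 / q ^ 4) * (\<sigma>2 / m) * (1 + 3 * lam\<^sup>2) = ?t6"
      by (simp add: \<Lambda> \<sigma>2 y(2) power_mult_distrib power_divide eval_nat_numeral mult_ac)
    have 7: "312 * ((\<gamma> * \<Lambda>)\<^sup>2 * lam ^ 4 / q ^ 3) * \<sigma>2 = ?t7"
      by (simp add: \<Lambda> \<sigma>2 y(2) power_mult_distrib power_divide eval_nat_numeral mult_ac)
    show "2 * gap0 / (\<gamma> * K) + \<Lambda>\<^sup>2 / K * (1 + 13 / q) * (ec 0 / m)
      + 52 * ((\<gamma> * \<Lambda>)\<^sup>2 * lam ^ 4 / q ^ 3) / K * (grad0 + \<sigma>2)
      + 52 * ((\<gamma> * \<Lambda>)\<^sup>2 * lam\<^sup>2 / q ^ 3) * \<sigma>2 * (lam\<^sup>2 + (norm W)\<^sup>2) + 2 * (\<gamma> * \<Lambda>) * (\<sigma>2 / m)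
      + 156 * ((\<gamma> * \<Lambda>) ^ 4 * lam ^ 4 / q ^ 4) * (\<sigma>2 / m) * (1 + 3 * lam\<^sup>2) + 312 * ((\<gamma> * \<Lambda>)\<^sup>2 * lam ^ 4 / q ^ 3) * \<sigma>2
      = ?t1 + ?t2 + ?t3 + ?t4 + ?t5 + ?t6 + ?t7"
      unfolding 2 3 4 5 6 7 by (simp only: \<sigma>2 y(2))
  qed
  then show ?thesis
    unfolding q_def p_def by (rule order_trans[OF expected_stationarity_le[OF \<kappa> K] ennreal_leI])
qed

end

theorem corollary1:
  fixes M :: "'w measure"
    and P :: "'m::finite \<Rightarrow> (real^'d) measure"
    and h :: "'m \<Rightarrow> real^'n \<Rightarrow> real^'p \<Rightarrow> real^'d \<Rightarrow> real"
    and Ft :: "'m \<Rightarrow> real^'n \<Rightarrow> real^'p \<Rightarrow> real^'d \<Rightarrow> real^'p"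
    and F :: "'m \<Rightarrow> real^'n \<Rightarrow> real^'p \<Rightarrow> real^'p"
    and Z :: "'m \<Rightarrow> real^'n \<Rightarrow> (real^'p) set"
    and z :: "'m \<Rightarrow> real^'n \<Rightarrow> real^'p"
    and \<phi> :: "'m \<Rightarrow> real^'n \<Rightarrow> real^'d \<Rightarrow> real"
    and fi :: "'m \<Rightarrow> real^'n \<Rightarrow> real"
    and f f\<^sub>\<eta> :: "real^'n \<Rightarrow> real"
    and Lt0\<xi> L0\<xi> :: "'m \<Rightarrow> real^'d \<Rightarrow> real"
    and L0 \<mu>F LF \<eta> lam n m :: real
    and D :: "'m \<Rightarrow> real"
    and E :: "('m \<times> 'm) set"
    and W :: "real^'m^'m"
    and \<xi> :: "'m \<Rightarrow> nat \<Rightarrow> 'w \<Rightarrow> real^'d"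
    and v :: "'m \<Rightarrow> nat \<Rightarrow> 'w \<Rightarrow> real^'n"
    and x0 :: "'w \<Rightarrow> real^'n^'m"
    and \<kappa> :: "nat \<Rightarrow> 'w \<Rightarrow> nat"
    and gap\<^sub>0 cons\<^sub>0 grad\<^sub>0 :: real
    and stationarity :: "real \<Rightarrow> nat \<Rightarrow> ennreal"
  assumes n_def: "n = real CARD('n)"
    and m_def: "m = real CARD('m)"
    \<comment> \<open>the random vectors of the agents, by their distributions\<close>
    and prob_P: "\<And>i. prob_space (P i)"
    and sets_P: "\<And>i. sets (P i) = sets borel"
    \<comment> \<open>the lower-level problems and the implicit objectives\<close>
    and integrable_Ft: "\<And>i x y. integrable (P i) (Ft i x y)"
    and F_def: "\<And>i x y. F i x y = (\<integral>s. Ft i x y s \<partial>P i)"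
    and z_sol: "\<And>i x. solves_VI (Z i x) (F i x) (z i x)"
    and \<phi>_def: "\<And>i x s. \<phi> i x s = h i x (z i x) s"
    and integrable_\<phi>: "\<And>i x. integrable (P i) (\<phi> i x)"
    and fi_def: "\<And>i x. fi i x = (\<integral>s. \<phi> i x s \<partial>P i)"
    and f_def: "f = agent_mean fi"
    and \<eta>_pos: "0 < \<eta>"
    and f\<^sub>\<eta>_def: "f\<^sub>\<eta> = agent_mean (\<lambda>i. ball_smoothing \<eta> (fi i))"
    \<comment> \<open>network\<close>
    and graph: "undirected_connected E"
    and mixing: "mixing_matrix E W"
    and lam_def: "lam = mixing_rate W"
    and lam_less: "lam < 1"
    \<comment> \<open>lower-boundedness\<close>
    and lower_bounded: "bdd_below (range f)"
    \<comment> \<open>Lipschitz continuity\<close>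
    and h_Lipschitz: "\<And>i x s. (Lt0\<xi> i s)-lipschitz_on UNIV (\<lambda>y. h i x y s)"
    and integrable_Lt0\<xi>: "\<And>i. integrable (P i) (\<lambda>s. (Lt0\<xi> i s)\<^sup>2)"
    and \<phi>_Lipschitz: "\<And>i s. (L0\<xi> i s)-lipschitz_on UNIV (\<lambda>x. \<phi> i x s)"
    and integrable_L0\<xi>: "\<And>i. integrable (P i) (\<lambda>s. (L0\<xi> i s)\<^sup>2)"
    and L0_def: "L0 = Max (range (\<lambda>i. sqrt (\<integral>s. (L0\<xi> i s)\<^sup>2 \<partial>P i)))"
    and L0_pos: "0 < L0"
    \<comment> \<open>lower-level VI\<close>
    and F_monotone: "\<And>i x. strongly_monotone \<mu>F (F i x)"
    and F_Lipschitz: "\<And>i x. LF-lipschitz_on UNIV (F i x)"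
    and Z_set: "\<And>i x. Z i x \<noteq> {} \<and> closed (Z i x) \<and> convex (Z i x)"
    and Z_diameter: "\<And>i x y w. y \<in> Z i x \<Longrightarrow> w \<in> Z i x \<Longrightarrow> (norm (y - w))\<^sup>2 \<le> D i"
    \<comment> \<open>sampling\<close>
    and prob_M: "prob_space M"
    and sampling: "sampling M P \<xi> v x0"
    \<comment> \<open>the initial quantities, which are finite\<close>
    and integrable_gap: "integrable M (\<lambda>\<omega>. f\<^sub>\<eta> (row_mean (x0 \<omega>)))"
    and integrable_cons: "integrable M (\<lambda>\<omega>. (norm (consensus_error (x0 \<omega>)))\<^sup>2)"
    and gap\<^sub>0_def: "gap\<^sub>0 = (\<integral>\<omega>. f\<^sub>\<eta> (row_mean (x0 \<omega>)) \<partial>M) - (INF x. f\<^sub>\<eta> x)"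
    and cons\<^sub>0_def: "cons\<^sub>0 = (\<integral>\<omega>. 1 / m * (norm (consensus_error (x0 \<omega>)))\<^sup>2 \<partial>M)"
    and grad\<^sub>0_def:
      "grad\<^sub>0 = 1 / m * (\<integral>\<omega>. (norm (stacked_smoothed_gradient \<eta> fi (x0 \<omega>)))\<^sup>2 \<partial>M)"
    \<comment> \<open>the error of the scheme with stepsize \<open>\<gamma>\<close> at the random index for \<open>K\<close> iterations\<close>
    and stationarity_def: "\<And>\<gamma> K. stationarity \<gamma> K =
      expected_stationarity M \<eta> f (tracking_iterate W \<gamma> \<eta> \<phi> \<xi> v x0) (\<kappa> K)"
  shows
    "(\<forall>\<gamma> K. 0 < \<gamma> \<longrightarrow> \<gamma> \<le> stepsize_cap lam * (\<eta> / (sqrt n * L0)) \<longrightarrow> 1 \<le> K \<longrightarrow>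
        uniform_independent_index M \<xi> v x0 K (\<kappa> K) \<longrightarrow>
        stationarity \<gamma> K \<le> ennreal
         (2 * gap\<^sub>0 / (\<gamma> * real K)
          + L0\<^sup>2 * n / (\<eta>\<^sup>2 * real K) * (1 + 13 / (1 - lam\<^sup>2)) * cons\<^sub>0
          + 52 * \<gamma>\<^sup>2 * lam ^ 4 * L0\<^sup>2 * n / (\<eta>\<^sup>2 * (1 - lam\<^sup>2) ^ 3 * real K)
              * (grad\<^sub>0 + 16 * sqrt (2 * pi) * L0\<^sup>2 * n)
          + 832 * sqrt (2 * pi) * \<gamma>\<^sup>2 * lam\<^sup>2 * L0 ^ 4 * n\<^sup>2 * (lam\<^sup>2 + (norm W)\<^sup>2)
              / (\<eta>\<^sup>2 * (1 - lam\<^sup>2) ^ 3)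
          + 32 * sqrt (2 * pi) * n powr (3/2) * L0 ^ 3 * \<gamma> / (m * \<eta>)
          + 2496 * sqrt (2 * pi) * lam ^ 4 * \<gamma> ^ 4 * n ^ 3 * L0 ^ 6 * (1 + 3 * lam\<^sup>2)
              / (m * \<eta> ^ 4 * (1 - lam\<^sup>2) ^ 4)
          + 4992 * sqrt (2 * pi) * \<gamma>\<^sup>2 * lam ^ 4 * L0 ^ 4 * n\<^sup>2
              / (\<eta>\<^sup>2 * (1 - lam\<^sup>2) ^ 3)))
     \<and>
     ((\<forall>K\<ge>1. uniform_independent_index M \<xi> v x0 K (\<kappa> K)) \<longrightarrow>
      (\<forall>\<epsilon>>0. let T = iteration_threshold n \<eta> L0 lam;
                err = (\<lambda>K. stationarity (complexity_stepsize n \<eta> L0 K) K) in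
        (\<exists>N. guarantees_accuracy T err \<epsilon> N) \<and>
        real (iterations_needed T err \<epsilon>) \<le> complexity_constant gap\<^sub>0 grad\<^sub>0 *
         (n powr (3/2) * L0 ^ 3 / \<eta> * \<epsilon> powr (-2)
          + L0 ^ 3 * n powr (3/2) / (\<eta> * m\<^sup>2) * \<epsilon> powr (-2)
          + L0\<^sup>2 * n * cons\<^sub>0 / (\<eta>\<^sup>2 * (1 - lam\<^sup>2)) * \<epsilon> powr (-1)
          + lam\<^sup>2 * L0 powr (1/2) * n powr (1/4) / (\<eta> powr (1/2) * (1 - lam\<^sup>2) powr (3/2))
              * \<epsilon> powr (-1/2)
          + lam\<^sup>2 * L0 powr (-1/2) * n powr (-1/4) / (\<eta> powr (1/2) * (1 - lam\<^sup>2) powr (3/2))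
              * \<epsilon> powr (-1/2)
          + lam\<^sup>2 * L0 * n powr (1/2) * (lam\<^sup>2 + (norm W)\<^sup>2) / (\<eta> * (1 - lam\<^sup>2) ^ 3)
              * \<epsilon> powr (-1)
          + lam\<^sup>2 * (1 + 3 * lam\<^sup>2) powr (1/2) / (sqrt m * \<eta> * (1 - lam\<^sup>2)\<^sup>2)
              * \<epsilon> powr (-1/2)
          + lam ^ 4 * L0 * n powr (1/2) / (\<eta> * (1 - lam\<^sup>2) ^ 3) * \<epsilon> powr (-1))))"
proof -
  define B where "B \<gamma> K = 2 * gap\<^sub>0 / (\<gamma> * real K)
          + L0\<^sup>2 * n / (\<eta>\<^sup>2 * real K) * (1 + 13 / (1 - lam\<^sup>2)) * cons\<^sub>0
          + 52 * \<gamma>\<^sup>2 * lam ^ 4 * L0\<^sup>2 * n / (\<eta>\<^sup>2 * (1 - lam\<^sup>2) ^ 3 * real K)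
              * (grad\<^sub>0 + 16 * sqrt (2 * pi) * L0\<^sup>2 * n)
          + 832 * sqrt (2 * pi) * \<gamma>\<^sup>2 * lam\<^sup>2 * L0 ^ 4 * n\<^sup>2 * (lam\<^sup>2 + (norm W)\<^sup>2)
              / (\<eta>\<^sup>2 * (1 - lam\<^sup>2) ^ 3)
          + 32 * sqrt (2 * pi) * n powr (3/2) * L0 ^ 3 * \<gamma> / (m * \<eta>)
          + 2496 * sqrt (2 * pi) * lam ^ 4 * \<gamma> ^ 4 * n ^ 3 * L0 ^ 6 * (1 + 3 * lam\<^sup>2)
              / (m * \<eta> ^ 4 * (1 - lam\<^sup>2) ^ 4)
          + 4992 * sqrt (2 * pi) * \<gamma>\<^sup>2 * lam ^ 4 * L0 ^ 4 * n\<^sup>2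
              / (\<eta>\<^sup>2 * (1 - lam\<^sup>2) ^ 3)" for \<gamma> and K :: nat
  have lam0: "0 \<le> lam" unfolding lam_def by (rule mixing_rate_nonneg)
  have q: "0 < 1 - lam\<^sup>2" using lam0 lam_less by (simp add: abs_square_less_1)
  have n: "0 < n" and m: "0 < m" by (simp_all add: n_def m_def)
  have L0_bound: "(\<integral>s. (L0\<xi> i s)\<^sup>2 \<partial>P i) \<le> L0\<^sup>2" for i
  proof -
    have "sqrt (\<integral>s. (L0\<xi> i s)\<^sup>2 \<partial>P i) \<le> L0" unfolding L0_def by (rule Max_ge) auto
    then have "(sqrt (\<integral>s. (L0\<xi> i s)\<^sup>2 \<partial>P i))\<^sup>2 \<le> L0\<^sup>2" by (intro power_mono) auto
    then show ?thesis by simp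
  qed
  have W: "doubly_stochastic W" using mixing by (simp add: mixing_matrix_def doubly_stochastic_def)
  have scheme: "zo_tracking M P \<phi> fi L0\<xi> L0 \<eta> \<gamma> W \<xi> v x0" if "0 < \<gamma>" for \<gamma>
    by (rule zo_tracking.intro[OF prob_M prob_P sets_P integrable_\<phi> fi_def \<phi>_Lipschitz integrable_L0\<xi> L0_bound
        L0_pos \<eta>_pos that sampling W lam_less[unfolded lam_def] integrable_cons
        integrable_gap[unfolded f\<^sub>\<eta>_def] lower_bounded[unfolded f_def]])
  \<comment> \<open>The constants of the locale carry the stepsize as a parameter, but at iteration
    0 no step has been taken, so their initial values agree for all \<gamma>.\<close>
  have initial: "gap\<^sub>0 = zo_tracking.gap0 M \<phi> fi \<eta> \<gamma> W \<xi> v x0"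
      "cons\<^sub>0 = zo_tracking.ec M \<phi> \<eta> \<gamma> W \<xi> v x0 0 / m"
      "grad\<^sub>0 = zo_tracking.grad0 M \<phi> fi \<eta> \<gamma> W \<xi> v x0" if "0 < \<gamma>" for \<gamma>
  proof -
    interpret zo_tracking M P \<phi> fi L0\<xi> L0 \<eta> \<gamma> W \<xi> v x0 by (rule scheme[OF that])
    have "f\<^sub>\<eta> = ball_smoothing \<eta> (agent_mean fi)"
      unfolding f\<^sub>\<eta>_def by (intro ext ball_smoothing_agent_mean[OF lipschitz_fi, symmetric])
    then show "gap\<^sub>0 = gap0" by (simp add: gap\<^sub>0_def gap0_def eF_def mean_def state_0)
    show "cons\<^sub>0 = ec 0 / m" by (simp add: cons\<^sub>0_def ec_def cons_def state_0)
    show "grad\<^sub>0 = grad0"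
      by (simp add: grad\<^sub>0_def grad0_def m_def stacked_smoothed_gradient_def grads_def state_0
          gradient_ball_smoothing[OF lipschitz_fi \<eta>_pos])
  qed
  have bound: "stationarity \<gamma> K \<le> ennreal (B \<gamma> K)"
    if "0 < \<gamma>" "\<gamma> \<le> stepsize_cap lam * (\<eta> / (sqrt n * L0))" "1 \<le> K"
      "uniform_independent_index M \<xi> v x0 K (\<kappa> K)" for \<gamma> K
    using zo_tracking.expected_stationarity_bound[OF scheme[OF that(1)], of K "\<kappa> K"] that(2-4)
    unfolding stationarity_def f_def B_def lam_def n_def m_def initial[OF that(1)] by simp
  \<comment> \<open>Any positive stepsize may serve here, since the initial gap is the same for all
    of them.\<close>
  have gap: "0 \<le> gap\<^sub>0" using zo_tracking.gap0_nonneg[OF scheme, of 1] initial(1)[of 1] by simp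
  have cons: "0 \<le> cons\<^sub>0" unfolding cons\<^sub>0_def using m by (intro Bochner_Integration.integral_nonneg) auto
  have grad: "0 \<le> grad\<^sub>0" unfolding grad\<^sub>0_def using m by simp
  define S where "S \<epsilon> = n powr (3/2) * L0 ^ 3 / \<eta> * \<epsilon> powr (-2)
          + L0 ^ 3 * n powr (3/2) / (\<eta> * m\<^sup>2) * \<epsilon> powr (-2)
          + L0\<^sup>2 * n * cons\<^sub>0 / (\<eta>\<^sup>2 * (1 - lam\<^sup>2)) * \<epsilon> powr (-1)
          + lam\<^sup>2 * L0 powr (1/2) * n powr (1/4) / (\<eta> powr (1/2) * (1 - lam\<^sup>2) powr (3/2))
              * \<epsilon> powr (-1/2)
          + lam\<^sup>2 * L0 powr (-1/2) * n powr (-1/4) / (\<eta> powr (1/2) * (1 - lam\<^sup>2) powr (3/2))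
              * \<epsilon> powr (-1/2)
          + lam\<^sup>2 * L0 * n powr (1/2) * (lam\<^sup>2 + (norm W)\<^sup>2) / (\<eta> * (1 - lam\<^sup>2) ^ 3)
              * \<epsilon> powr (-1)
          + lam\<^sup>2 * (1 + 3 * lam\<^sup>2) powr (1/2) / (sqrt m * \<eta> * (1 - lam\<^sup>2)\<^sup>2)
              * \<epsilon> powr (-1/2)
          + lam ^ 4 * L0 * n powr (1/2) / (\<eta> * (1 - lam\<^sup>2) ^ 3) * \<epsilon> powr (-1)" for \<epsilon> :: real
  \<comment> \<open>Half of \<open>complexity_constant\<close>; the other half is spent on rounding
    in \<open>complexity\<close>.\<close>
  define c where "c = 500000 * (1 + gap\<^sub>0\<^sup>2 + sqrt grad\<^sub>0)"
  define T where "T = iteration_threshold n \<eta> L0 lam"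
  define err where "err K = stationarity (complexity_stepsize n \<eta> L0 K) K" for K
  have S0: "0 \<le> S \<epsilon>" for \<epsilon>
    unfolding S_def using n m q cons L0_pos \<eta>_pos by (intro add_nonneg_nonneg mult_nonneg_nonneg divide_nonneg_nonneg) auto
  have c0: "0 \<le> c" using grad by (simp add: c_def)
  have T1: "1 \<le> T" by (simp add: T_def iteration_threshold_def)
  have accurate: "err K \<le> ennreal \<epsilon>"
    if idx: "\<forall>K\<ge>1. uniform_independent_index M \<xi> v x0 K (\<kappa> K)" and \<epsilon>: "0 < \<epsilon>"
      and KT: "T \<le> real K" and KS: "c * S \<epsilon> \<le> real K" for \<epsilon> K
  proof -
    have K1: "1 \<le> K" and K0: "0 < real K" using KT T1 by linarith+
    have r0: "0 < 1 + 3 * lam\<^sup>2" by (simp add: add_pos_nonneg)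
    obtain \<nu> where \<nu>: "0 < \<nu>" "n = \<nu> ^ 4" "sqrt n = \<nu>\<^sup>2" "n powr (1/2) = \<nu>\<^sup>2" "n powr (1/4) = \<nu>"
      "n powr (-1/4) = 1 / \<nu>" "n powr (3/2) = \<nu> ^ 6" by (rule powr_quarter[OF n])
    obtain e where e: "0 < e" "\<eta> = e\<^sup>2" "\<eta> powr (1/2) = e" by (rule powr_half[OF \<eta>_pos])
    obtain a where a: "0 < a" "L0 = a\<^sup>2" "L0 powr (1/2) = a" "L0 powr (-1/2) = 1 / a" "L0 powr (3/2) = a ^ 3"
      by (rule powr_half[OF L0_pos])
    obtain w where w: "0 < w" "\<epsilon> = w\<^sup>2" "\<epsilon> powr (-1/2) = 1 / w" "\<epsilon> powr (-1) = 1 / w\<^sup>2" "\<epsilon> powr (-2) = 1 / w ^ 4"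
      by (rule powr_half[OF \<epsilon>])
    obtain s where s: "0 < s" "1 - lam\<^sup>2 = s\<^sup>2" "(1 - lam\<^sup>2) powr (3/2) = s ^ 3" by (rule powr_half[OF q])
    obtain r where r: "0 < r" "1 + 3 * lam\<^sup>2 = r\<^sup>2" "(1 + 3 * lam\<^sup>2) powr (1/2) = r" by (rule powr_half[OF r0])
    obtain \<mu> where \<mu>: "0 < \<mu>" "m = \<mu>\<^sup>2" "sqrt m = \<mu>" by (rule powr_half[OF m])
    obtain k where k: "0 < k" "real K = k\<^sup>2" by (rule powr_half[OF K0])
    have "sqrt (\<nu> ^ 6 * k\<^sup>2) = \<nu> ^ 3 * k"
      using \<nu> k by (intro real_sqrt_unique) (auto simp: power_mult_distrib)
    then have step: "complexity_stepsize n \<eta> L0 K = e / (\<nu> ^ 3 * k * a ^ 3)"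
      by (simp add: complexity_stepsize_def \<nu>(7) e(3) a(5) k(2))
    define \<gamma> where "\<gamma> = e / (\<nu> ^ 3 * k * a ^ 3)"
    have \<gamma>0: "0 < \<gamma>" using e \<nu> k a by (simp add: \<gamma>_def)
    have "s\<^sup>2 \<le> 1" using s(2)[symmetric] by simp
    then have s1: "s \<le> 1" using s(1) by (simp add: power_le_one_iff)
    \<comment> \<open>The square root of the threshold condition. Since
      \<open>1 / (\<nu> * k * a * e)\<close> equals \<open>\<gamma>\<close> times
      \<open>L0 * sqrt n / \<eta>\<close>, this is the stepsize condition of the error
      bound.\<close>
    have tf: "threshold_factor lam \<le> \<nu> * k * a * e"
    proof (rule power2_le_imp_le)
      have "(threshold_factor lam)\<^sup>2 * (1 / (e\<^sup>2 * a\<^sup>2 * \<nu>\<^sup>2)) \<le> k\<^sup>2"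
        using KT unfolding T_def iteration_threshold_def threshold_factor_def[symmetric] \<nu>(4) k(2) e(2) a(2) by simp
      then show "(threshold_factor lam)\<^sup>2 \<le> (\<nu> * k * a * e)\<^sup>2"
        using e \<nu> k a by (simp add: field_simps power_mult_distrib)
    qed (use e \<nu> k a in simp)
    then have "1 / (\<nu> * k * a * e) * threshold_factor lam \<le> 1" using e \<nu> k a by (simp add: field_simps)
    then have "1 / (\<nu> * k * a * e) \<le> stepsize_cap lam" using e \<nu> k a by (intro le_stepsize_cap lam0 lam_less) auto
    then have "1 / (\<nu> * k * a * e) * (e\<^sup>2 / (\<nu>\<^sup>2 * a\<^sup>2)) \<le> stepsize_cap lam * (e\<^sup>2 / (\<nu>\<^sup>2 * a\<^sup>2))"
      by (rule mult_right_mono) simp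
    moreover have "1 / (\<nu> * k * a * e) * (e\<^sup>2 / (\<nu>\<^sup>2 * a\<^sup>2)) = \<gamma>"
      using e \<nu> k a by (simp add: \<gamma>_def field_simps eval_nat_numeral)
    ultimately have cap: "\<gamma> \<le> stepsize_cap lam * (\<eta> / (sqrt n * L0))"
      by (simp add: \<nu>(3) e(2)[symmetric] a(2)[symmetric])
    have "S \<epsilon> = (\<nu> ^ 3 * a ^ 3 / (e * w\<^sup>2))\<^sup>2 + (\<nu> ^ 3 * a ^ 3 / (e * \<mu>\<^sup>2 * w\<^sup>2))\<^sup>2
        + a ^ 4 * \<nu> ^ 4 * cons\<^sub>0 / (e ^ 4 * s\<^sup>2 * w\<^sup>2) + lam\<^sup>2 * a * \<nu> / (e * s ^ 3 * w)
        + lam\<^sup>2 / (a * \<nu> * e * s ^ 3 * w) + lam\<^sup>2 * a\<^sup>2 * \<nu>\<^sup>2 * (lam\<^sup>2 + (norm W)\<^sup>2) / (e\<^sup>2 * s ^ 6 * w\<^sup>2)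
        + lam\<^sup>2 * r / (\<mu> * e\<^sup>2 * s ^ 4 * w) + lam ^ 4 * a\<^sup>2 * \<nu>\<^sup>2 / (e\<^sup>2 * s ^ 6 * w\<^sup>2)"
      unfolding S_def \<nu>(4-7) e(3) a(3,4) w(3-5) s(3) r(3) \<mu>(3)
      unfolding \<nu>(2) e(2) a(2) s(2) \<mu>(2)
      by (simp add: power_mult_distrib power_divide mult_ac)
    then have Kc: "500000 * (1 + gap\<^sub>0\<^sup>2 + sqrt grad\<^sub>0) * ((\<nu> ^ 3 * a ^ 3 / (e * w\<^sup>2))\<^sup>2 + (\<nu> ^ 3 * a ^ 3 / (e * \<mu>\<^sup>2 * w\<^sup>2))\<^sup>2
        + a ^ 4 * \<nu> ^ 4 * cons\<^sub>0 / (e ^ 4 * s\<^sup>2 * w\<^sup>2) + lam\<^sup>2 * a * \<nu> / (e * s ^ 3 * w)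
        + lam\<^sup>2 / (a * \<nu> * e * s ^ 3 * w) + lam\<^sup>2 * a\<^sup>2 * \<nu>\<^sup>2 * (lam\<^sup>2 + (norm W)\<^sup>2) / (e\<^sup>2 * s ^ 6 * w\<^sup>2)
        + lam\<^sup>2 * r / (\<mu> * e\<^sup>2 * s ^ 4 * w) + lam ^ 4 * a\<^sup>2 * \<nu>\<^sup>2 / (e\<^sup>2 * s ^ 6 * w\<^sup>2)) \<le> k\<^sup>2"
      using KS unfolding c_def k(2) by simp
    have "B \<gamma> K \<le> w\<^sup>2"
      using complexity_core[OF \<nu>(1) e(1) a(1) w(1) s(1) r(1) \<mu>(1) k(1) lam0 gap cons grad zero_le_power2[of "norm W"] s1 Kc]
      unfolding \<gamma>_def[symmetric] B_def \<nu>(7)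
      unfolding \<nu>(2) e(2) a(2) s(2) \<mu>(2) r(2) k(2)
      by simp
    then show ?thesis
      using bound[OF \<gamma>0 cap K1] idx K1 unfolding err_def step \<gamma>_def[symmetric] w(2)
      by (blast intro: order_trans ennreal_leI)
  qed
  have complexity: "(\<exists>N. guarantees_accuracy T err \<epsilon> N) \<and> real (iterations_needed T err \<epsilon>) \<le> complexity_constant gap\<^sub>0 grad\<^sub>0 * S \<epsilon>"
    if idx: "\<forall>K\<ge>1. uniform_independent_index M \<xi> v x0 K (\<kappa> K)" and \<epsilon>: "0 < \<epsilon>" for \<epsilon>
  proof -
    \<comment> \<open>Runs shorter than the threshold \<open>T \<ge> 1\<close> do not count, so
      \<open>N = 0\<close> serves if the bound is at most 1. Above 1, rounding up at most doubles
      the bound. Rounding up a small positive bound would give 1, which its double need not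
      reach.\<close>
    define N where "N = (if c * S \<epsilon> \<le> 1 then 0 else nat \<lceil>c * S \<epsilon>\<rceil>)"
    have "c * S \<epsilon> \<le> real K" if "N \<le> K" "T \<le> real K" for K
      using that T1 by (auto simp: N_def split: if_splits)
    then have N: "guarantees_accuracy T err \<epsilon> N"
      unfolding guarantees_accuracy_def using accurate[OF idx \<epsilon>] by blast
    then have "iterations_needed T err \<epsilon> \<le> N" unfolding iterations_needed_def by (rule Least_le)
    moreover have "real N \<le> 2 * (c * S \<epsilon>)" using mult_nonneg_nonneg[OF c0 S0[of \<epsilon>]] by (simp add: N_def) linarith
    moreover have "2 * (c * S \<epsilon>) = complexity_constant gap\<^sub>0 grad\<^sub>0 * S \<epsilon>" by (simp add: complexity_constant_def c_def)
    ultimately show ?thesis using N by (auto intro: order_trans)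
  qed
  show ?thesis
    unfolding Let_def T_def[symmetric] err_def[abs_def, symmetric] S_def[symmetric] B_def[symmetric]
    using bound complexity by blast
qed

end
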